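(* Let $m\ge1$, let $\alpha_1<\cdots<\alpha_m$ and $\beta_1,\ldots,\beta_m$ be real numbers, and let $\mathcal{A}$ be the parabolic Airy process. Then $$\mathbb{P}\left(\bigcap_{i=1}^m\left\{\mathcal{A}(\alpha_i)\le\beta_i\right\}\right)=\det(\mathrm{I}+\mathbf{K}),$$ where $\mathbf{K}$ is the kernel on $\{1,\ldots,m\}\times\Gamma_{\mathrm{L}}$ and $\det(\mathrm{I}+\mathbf{K})$ the Fredholm series defined in the context.
   Context: Parabolic Airy process: $\mathcal{A}(\alpha)=\mathcal{A}_2(\alpha)-\alpha^2$, $\alpha\in\mathbb{R}$, with $\mathcal{A}_2$ the Airy$_2$ process; its finite-dimensional distributions, for $\alpha_1<\cdots<\alpha_m$, are $$\mathbb{P}\left(\bigcap_{i=1}^m\{\mathcal{A}(\alpha_i)\le\beta_i\}\right)=\det\left(\mathrm{I}-\chi^{1/2}K_{\mathrm{Ai}}^{\mathrm{ext}}\chi^{1/2}\right)_{L^2(\{\alpha_1,\ldots,\alpha_m\}\times\mathbb{R})},$$ where $\chi(\alpha_i,x)=1$ if $x>\beta_i+\alpha_i^2$ and $0$ otherwise, and $K_{\mathrm{Ai}}^{\mathrm{ext}}(\alpha_i,x;\alpha_j,y)=\int_0^\infty e^{-z(\alpha_i-\alpha_j)}\mathrm{Ai}(x+z)\mathrm{Ai}(y+z)\,\mathrm{d}z$ if $\alpha_i\ge\alpha_j$, $=-\int_{-\infty}^0 e^{-z(\alpha_i-\alpha_j)}\mathrm{Ai}(x+z)\mathrm{Ai}(y+z)\,\mathrm{d}z$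 if $\alpha_i<\alpha_j$ ($\mathrm{Ai}$ is the Airy function). Functions: $f_i(w)=e^{-\frac13w^3+\alpha_iw^2+\beta_iw}$ for $1\le i\le m$; $F_1=f_1$ and $F_i(w)=f_i(w)/f_{i-1}(w)=e^{(\alpha_i-\alpha_{i-1})w^2+(\beta_i-\beta_{i-1})w}$ for $2\le i\le m$. Kernel: for $i,j\in\{1,\ldots,m\}$ and $z,u$ in the open left half plane, $$\mathbf{K}(1,z;j,u)=\int\frac{\mathrm{d}v}{2\pi\mathrm{i}}\frac{f_1(z)}{f_1(v)}\frac{1}{(z-v)(v-u)},$$ and for $2\le i\le m$, $$\mathbf{K}(i,z;j,u)=\int\frac{\mathrm{d}v}{2\pi\mathrm{i}}\prod_{\ell=2}^i\int\frac{\mathrm{d}u_\ell}{2\pi\mathrm{i}}\ \frac{f_1(z)}{f_i(v)}\cdot\frac{\prod_{\ell=2}^iF_\ell(u_\ell)}{(z-u_2)\cdot\prod_{\ell=2}^{i-1}(u_\ell-u_{\ell+1})\cdot(u_i-v)(v-u)}.$$ The $v$-contour is any contour in the right half plane going from $\infty e^{-\pi\mathrm{i}/5}$ to $\infty e^{\pi\mathrm{i}/5}$. Each $u_\ell$-contour lies in the left half plane, passes between $-\infty$ and $z$ (that is, to the left of $z$), and goes from $\infty e^{-2\pi\mathrm{i}/3}$ to $\infty e^{2\pi\mathrm{i}/3}$; the contours of $u_2,\ldots,u_i$ are disjoint and ordered from right to left ($u_2$ rightmost, $u_i$ leftmost). Fredholm determinant: let $\Gamma_{\mathrm{L}}=\{-1+re^{\pm2\pi\mathrm{i}/3}:r\ge0\}$,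 oriented from $\infty e^{-2\pi\mathrm{i}/3}$ to $\infty e^{2\pi\mathrm{i}/3}$, and define $$\det(\mathrm{I}+\mathbf{K})=\sum_{k=0}^\infty\frac1{k!}\sum_{1\le\ell_1,\ldots,\ell_k\le m}\int_{\Gamma_{\mathrm{L}}}\cdots\int_{\Gamma_{\mathrm{L}}}\det\left[\mathbf{K}(\ell_i,u_i;\ell_j,u_j)\right]_{i,j=1}^k\frac{\mathrm{d}u_1}{2\pi\mathrm{i}}\cdots\frac{\mathrm{d}u_k}{2\pi\mathrm{i}},$$ an absolutely convergent series whose $k=0$ term is $1$. *)

theory Defs
  imports
    "HOL-Probability.Probability"
    "HOL-Complex_Analysis.Complex_Analysis"
    "Jordan_Normal_Form.Determinant"
begin

text \<open>
  A contour is a map on the whole real line. The gauge integral over \<^term>\<open>UNIV\<close> makes this the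
  unbounded analogue of the library's contour integral (cf. \<open>contour_integral_integral\<close>). It includes
  improper integrals, so no growth condition on the speed of the parametrization is needed.
\<close>

definition line_integral :: "(real \<Rightarrow> complex) \<Rightarrow> (complex \<Rightarrow> complex) \<Rightarrow> complex" where
  "line_integral \<gamma> g = integral UNIV (\<lambda>t. g (\<gamma> t) * vector_derivative \<gamma> (at t))"

text \<open>The contour goes from \<open>\<infinity> e\<^sup>-\<^sup>i\<^sup>\<theta>\<close> to \<open>\<infinity> e\<^sup>i\<^sup>\<theta>\<close>.\<close>

definition unbounded_contour :: "real \<Rightarrow> (real \<Rightarrow> complex) \<Rightarrow> bool" where
  "unbounded_contour \<theta> \<gamma> \<longleftrightarrow>
     (\<forall>a b. \<gamma> piecewise_C1_differentiable_on {a..b}) \<and>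
     filterlim \<gamma> at_infinity at_top \<and> ((\<lambda>t. sgn (\<gamma> t)) \<longlongrightarrow> cis \<theta>) at_top \<and>
     filterlim \<gamma> at_infinity at_bot \<and> ((\<lambda>t. sgn (\<gamma> t)) \<longlongrightarrow> cis (- \<theta>)) at_bot"

text \<open>\<open>{c + r e\<^sup>\<plusminus>\<^sup>i\<^sup>\<theta> : r \<ge> 0}\<close>, oriented from \<open>\<infinity> e\<^sup>-\<^sup>i\<^sup>\<theta>\<close> to \<open>\<infinity> e\<^sup>i\<^sup>\<theta>\<close>.\<close>

definition wedge :: "complex \<Rightarrow> real \<Rightarrow> real \<Rightarrow> complex" where
  "wedge c \<theta> t = c + of_real \<bar>t\<bar> * cis (sgn t * \<theta>)"

definition Gamma_L :: "real \<Rightarrow> complex" where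
  "Gamma_L = wedge (-1) (2 * pi / 3)"

text \<open>
  For a contour in the open left half plane: the component of the complement that contains the
  closed right half plane, i.e. the points that the contour passes on the left.
\<close>

definition right_side :: "(real \<Rightarrow> complex) \<Rightarrow> complex set" where
  "right_side \<gamma> = connected_component_set (- range \<gamma>) 0"

text \<open>
  The determinant of \<open>I + K\<close> with respect to the (complex) density \<open>\<rho>\<close> on each copy of the real line.
  Contour variables enter through a parametrization \<open>\<gamma>\<close>, with \<open>\<rho> = \<gamma>' / (2\<pi>i)\<close>.
\<close>

definition fredholm_integrand ::
  "(real \<Rightarrow> complex) \<Rightarrow> (nat \<Rightarrow> real \<Rightarrow> nat \<Rightarrow> real \<Rightarrow> complex) \<Rightarrow> nat \<Rightarrow> (nat \<Rightarrow> nat) \<Rightarrow> (nat \<Rightarrow> real) \<Rightarrow> complex"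
  where
  "fredholm_integrand \<rho> K k l t =
     Determinant.det (mat k k (\<lambda>(i, j). K (l i) (t i) (l j) (t j))) * (\<Prod>i<k. \<rho> (t i))"

definition fredholm_term ::
  "nat \<Rightarrow> (real \<Rightarrow> complex) \<Rightarrow> (nat \<Rightarrow> real \<Rightarrow> nat \<Rightarrow> real \<Rightarrow> complex) \<Rightarrow> nat \<Rightarrow> complex" where
  "fredholm_term m \<rho> K k =
     1 / fact k * (\<Sum>l\<in>{..<k} \<rightarrow>\<^sub>E {1..m}. \<integral>t. fredholm_integrand \<rho> K k l t \<partial>(\<Pi>\<^sub>M i\<in>{..<k}. lborel))"

definition fredholm_det ::
  "nat \<Rightarrow> (real \<Rightarrow> complex) \<Rightarrow> (nat \<Rightarrow> real \<Rightarrow> nat \<Rightarrow> real \<Rightarrow> complex) \<Rightarrow> complex" where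
  "fredholm_det m \<rho> K = (\<Sum>k. fredholm_term m \<rho> K k)"

definition fredholm_abs_convergent ::
  "nat \<Rightarrow> (real \<Rightarrow> complex) \<Rightarrow> (nat \<Rightarrow> real \<Rightarrow> nat \<Rightarrow> real \<Rightarrow> complex) \<Rightarrow> bool" where
  "fredholm_abs_convergent m \<rho> K \<longleftrightarrow>
     (\<forall>k. \<forall>l\<in>{..<k} \<rightarrow>\<^sub>E {1..m}. integrable (\<Pi>\<^sub>M i\<in>{..<k}. lborel) (fredholm_integrand \<rho> K k l)) \<and>
     summable (\<lambda>k. norm (fredholm_term m \<rho> K k))"

text \<open>\<open>Ai(x) = (2\<pi>i)\<^sup>-\<^sup>1 \<integral> exp(w\<^sup>3/3 - x w) dw\<close>, from \<open>\<infinity> e\<^sup>-\<^sup>\<pi>\<^sup>i\<^sup>/\<^sup>3\<close> to \<open>\<infinity> e\<^sup>\<pi>\<^sup>i\<^sup>/\<^sup>3\<close>; real for real \<open>x\<close>.\<close>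

definition Ai :: "complex \<Rightarrow> complex" where
  "Ai x = line_integral (wedge 0 (pi / 3)) (\<lambda>w. exp (w ^ 3 / 3 - x * w)) / (2 * pi * \<i>)"

definition K_Ai_ext :: "real \<Rightarrow> real \<Rightarrow> real \<Rightarrow> real \<Rightarrow> complex" where
  "K_Ai_ext a x b y =
     (if a \<ge> b
      then (LBINT z:{0::real..}. exp (- z * (a - b)) * Ai (x + z) * Ai (y + z))
      else - (LBINT z:{..0::real}. exp (- z * (a - b)) * Ai (x + z) * Ai (y + z)))"

definition chi :: "(nat \<Rightarrow> real) \<Rightarrow> (nat \<Rightarrow> real) \<Rightarrow> nat \<Rightarrow> real \<Rightarrow> real" where
  "chi \<alpha> \<beta> i x = (if x > \<beta> i + (\<alpha> i)\<^sup>2 then 1 else 0)"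

text \<open>
  The point \<open>(\<alpha>\<^sub>i, x)\<close> of \<open>{\<alpha>\<^sub>1,\<dots>,\<alpha>\<^sub>m} \<times> \<real>\<close> is represented by \<open>(i, x)\<close>, and the determinant of
  \<open>I - \<chi>\<^sup>1\<^sup>/\<^sup>2 K \<chi>\<^sup>1\<^sup>/\<^sup>2\<close> is its Fredholm expansion.
\<close>

definition parabolic_airy_process :: "'a measure \<Rightarrow> (real \<Rightarrow> 'a \<Rightarrow> real) \<Rightarrow> bool" where
  "parabolic_airy_process M A \<longleftrightarrow>
     prob_space M \<and> (\<forall>a. A a \<in> borel_measurable M) \<and>
     (\<forall>m \<alpha> \<beta>. m \<ge> 1 \<longrightarrow> strict_mono_on {1..m} \<alpha> \<longrightarrow>
        complex_of_real (measure M (\<Inter>i\<in>{1..m}. {\<omega> \<in> space M. A (\<alpha> i) \<omega> \<le> \<beta> i})) =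
        fredholm_det m (\<lambda>_. 1)
          (\<lambda>i x j y. - (sqrt (chi \<alpha> \<beta> i x) * K_Ai_ext (\<alpha> i) x (\<alpha> j) y * sqrt (chi \<alpha> \<beta> j y))))"

definition f_fun :: "(nat \<Rightarrow> real) \<Rightarrow> (nat \<Rightarrow> real) \<Rightarrow> nat \<Rightarrow> complex \<Rightarrow> complex" where
  "f_fun \<alpha> \<beta> i w = exp (- (1 / 3) * w ^ 3 + \<alpha> i * w\<^sup>2 + \<beta> i * w)"

definition F_fun :: "(nat \<Rightarrow> real) \<Rightarrow> (nat \<Rightarrow> real) \<Rightarrow> nat \<Rightarrow> complex \<Rightarrow> complex" where
  "F_fun \<alpha> \<beta> i w = (if i = 1 then f_fun \<alpha> \<beta> 1 w else f_fun \<alpha> \<beta> i w / f_fun \<alpha> \<beta> (i - 1) w)"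

definition v_contour :: "(real \<Rightarrow> complex) \<Rightarrow> bool" where
  "v_contour \<gamma> \<longleftrightarrow> unbounded_contour (pi / 5) \<gamma> \<and> (\<forall>t. Re (\<gamma> t) > 0)"

text \<open>
  \<open>U l\<close> is the contour of \<open>u\<^sub>l\<close> for \<open>2 \<le> l \<le> i\<close>. The last condition includes disjointness, since
  \<^term>\<open>right_side \<gamma>\<close> does not meet \<^term>\<open>range \<gamma>\<close>.
\<close>

definition u_contours :: "nat \<Rightarrow> complex \<Rightarrow> (nat \<Rightarrow> real \<Rightarrow> complex) \<Rightarrow> bool" where
  "u_contours i z U \<longleftrightarrow>
     (\<forall>l\<in>{2..i}. unbounded_contour (2 * pi / 3) (U l) \<and> (\<forall>t. Re (U l t) < 0) \<and> z \<in> right_side (U l)) \<and>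
     (\<forall>l\<in>{2..i}. \<forall>l'\<in>{2..i}. l < l' \<longrightarrow> range (U l) \<subseteq> right_side (U l'))"

text \<open>
  \<open>\<Prod>\<^sub>l (\<integral> du\<^sub>l / 2\<pi>i) g(u)\<close>, with \<open>l\<close> running through the list (the first one outermost) and
  \<open>us\<close> holding the values of the variables not integrated over.
\<close>

fun iterated_integral ::
  "(nat \<Rightarrow> real \<Rightarrow> complex) \<Rightarrow> nat list \<Rightarrow> ((nat \<Rightarrow> complex) \<Rightarrow> complex) \<Rightarrow> (nat \<Rightarrow> complex) \<Rightarrow> complex" where
  "iterated_integral U [] g us = g us"
| "iterated_integral U (l # ls) g us =
     line_integral (U l) (\<lambda>w. iterated_integral U ls g (us(l := w))) / (2 * pi * \<i>)"

text \<open>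
  The contours are explicit arguments, and may be chosen anew for each entry of the kernel: the
  \<open>u\<close>-contours have to depend on \<open>z\<close>. The \<open>v\<close>-integral is the outermost one.
\<close>

definition kernel_K ::
  "(nat \<Rightarrow> real) \<Rightarrow> (nat \<Rightarrow> real) \<Rightarrow>
   (nat \<Rightarrow> complex \<Rightarrow> nat \<Rightarrow> complex \<Rightarrow> real \<Rightarrow> complex) \<Rightarrow>
   (nat \<Rightarrow> complex \<Rightarrow> nat \<Rightarrow> complex \<Rightarrow> nat \<Rightarrow> real \<Rightarrow> complex) \<Rightarrow>
   nat \<Rightarrow> complex \<Rightarrow> nat \<Rightarrow> complex \<Rightarrow> complex" where
  "kernel_K \<alpha> \<beta> V U i z j u =
     (if i = 1
      then line_integral (V i z j u) (\<lambda>v. f_fun \<alpha> \<beta> 1 z / f_fun \<alpha> \<beta> 1 v * (1 / ((z - v) * (v - u)))) / (2 * pi * \<i>)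
      else line_integral (V i z j u) (\<lambda>v. iterated_integral (U i z j u) [2..<i + 1] (\<lambda>us.
             f_fun \<alpha> \<beta> 1 z / f_fun \<alpha> \<beta> i v *
             ((\<Prod>l\<in>{2..i}. F_fun \<alpha> \<beta> l (us l)) /
              ((z - us 2) * (\<Prod>l\<in>{2..i - 1}. us l - us (l + 1)) * (us i - v) * (v - u))))
           (\<lambda>_. 0)) / (2 * pi * \<i>))"

definition Gamma_L_density :: "real \<Rightarrow> complex" where
  "Gamma_L_density t = vector_derivative Gamma_L (at t) / (2 * pi * \<i>)"

end

theory Submission
  imports Defs "Jordan_Normal_Form.Schur_Decomposition" "HOL-Real_Asymp.Real_Asymp"
begin

text \<open>
  Both determinants are reduced to that of one kernel on the half line, using only the two identities
  \<open>det (I + R E) = det (I + E R)\<close> and \<open>det ((I + K) (I + N)) = det (I + K)\<close> for strictly triangular \<open>N\<close>.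

  On the Airy side, \<open>\<integral>\<^sub>\<real>\<close> of a product of two Airy functions is a heat kernel, so the extended kernel is the
  product of two half-line factors minus the heat kernels between increasing levels. Splitting the heat flow
  at the thresholds \<open>\<beta>\<^sub>i\<close> exhibits \<open>I - K\<^sub>A\<^sub>i\<close> as \<open>(I - C) (I + N)\<close>, where \<open>N\<close> consists of the truncated heat
  kernels and \<open>C\<close> again factors through the half line.

  On the contour side, \<open>1 / (u\<^sub>i - v)\<close> is a Laplace transform, and each \<open>u\<close>-integral with its Gaussian \<open>F\<^sub>l\<close> acts on
  Laplace transforms as the heat flow followed by the cut-off at \<open>\<beta>\<^sub>l\<^sub>-\<^sub>1\<close>. With
  \<open>1 / (v - u) = \<integral>\<^sub>s\<^sub>>\<^sub>0 exp (s (u - v))\<close> the \<open>v\<close>-integral becomes an Airy function, the kernel factors through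
  the half line, and integrating over \<open>\<Gamma>\<^sub>L\<close> gives the same kernel there.
\<close>

section \<open>Fredholm series\<close>

text \<open>The Fredholm series is a sum of integrals of determinants, so both determinant
  identities are proved on the series, without operators. Hadamard's bound makes every series
  converge whose kernel is bounded by an integrable function of the first variable. A plain heat
  kernel has no such bound, as it is constant along the diagonal; the extended Airy kernel carries
  factors exp(\<alpha>_i x) that tilt it, and since \<alpha> increases, the tilted kernel decays.
  The identity for R E holds term by term. The one for triangular N mixes the orders, so it is a
  statement about the sums, and its partial sums leave a remainder that the same bound sends to 0.
  On the contour side the obstacle is that the contours are arbitrary and their integrals may be
  improper, so integrals cannot be exchanged on them. Each is therefore compared, through a
  primitive, with a vertical line, where the integrands have Gaussian bounds. The u-contours depend
  on z, but the comparison uses only that the pole lies to their right.\<close>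

lemma det_map_cnj:
  assumes A: "A \<in> carrier_mat n n"
  shows "Determinant.det (mat n n (\<lambda>(i, j). cnj (A $$ (j, i)))) = cnj (Determinant.det A)"
proof -
  have "Determinant.det (mat n n (\<lambda>(i, j). cnj (A $$ (j, i)))) =
      (\<Sum>p\<in>{p. p permutes {0..<n}}. signof p * (\<Prod>i = 0..<n. cnj (A $$ (p i, i))))"
    by (subst det_def'[of _ n]) (auto intro!: sum.cong prod.cong dest: permutes_in_image)
  also have "\<dots> = cnj (\<Sum>p\<in>{p. p permutes {0..<n}}. signof p * (\<Prod>i = 0..<n. A $$ (p i, i)))"
    by (simp add: sign_def)
  also have "(\<Sum>p\<in>{p. p permutes {0..<n}}. signof p * (\<Prod>i = 0..<n. A $$ (p i, i))) = Determinant.det A"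
    using mat_det_left_def[OF A] A by simp
  finally show ?thesis .
qed

lemma trace_similar:
  fixes A B :: "complex mat"
  assumes sim: "similar_mat A B" and A: "A \<in> carrier_mat n n"
  shows "(\<Sum>i<n. A $$ (i, i)) = (\<Sum>i<n. B $$ (i, i))"
proof -
  from sim obtain P Q where wit: "similar_mat_wit A B P Q" by (auto simp: similar_mat_def)
  note w = similar_mat_witD2[OF A wit]
  have trc: "(\<Sum>i<n. (X * Y) $$ (i, i)) = (\<Sum>i<n. (Y * X) $$ (i, i))"
    if "X \<in> carrier_mat n n" "Y \<in> carrier_mat n n" for X Y :: "complex mat"
  proof -
    have "(\<Sum>i<n. (X * Y) $$ (i, i)) = (\<Sum>i<n. \<Sum>k<n. X $$ (i, k) * Y $$ (k, i))"
      using that by (intro sum.cong) (auto simp: scalar_prod_def atLeast0LessThan)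
    also have "\<dots> = (\<Sum>k<n. \<Sum>i<n. Y $$ (k, i) * X $$ (i, k))"
      by (subst sum.swap) (simp add: mult.commute)
    also have "\<dots> = (\<Sum>k<n. (Y * X) $$ (k, k))"
      using that by (intro sum.cong) (auto simp: scalar_prod_def atLeast0LessThan)
    finally show ?thesis .
  qed
  have "A = P * (B * Q)" using w by (metis assoc_mult_mat)
  hence "(\<Sum>i<n. A $$ (i, i)) = (\<Sum>i<n. (P * (B * Q)) $$ (i, i))" by simp
  also have "\<dots> = (\<Sum>i<n. ((B * Q) * P) $$ (i, i))"
    using w by (intro trc) auto
  also have "(B * Q) * P = B * (Q * P)" using w by (intro assoc_mult_mat) auto
  also have "\<dots> = B" using w by simp
  finally show ?thesis .
qed

text \<open>Hadamard's bound, by the arithmetic-geometric mean inequality for the eigenvalues of \<open>A A\<^sup>*\<close>.\<close>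

lemma norm_det_le:
  fixes A :: "complex mat"
  assumes A: "A \<in> carrier_mat n n" and bd: "\<And>i j. i < n \<Longrightarrow> j < n \<Longrightarrow> norm (A $$ (i, j)) \<le> 1"
  shows "norm (Determinant.det A) \<le> sqrt (real n ^ n)"
proof (cases "n = 0")
  case True
  then show ?thesis using A by simp
next
  case False
  have sq: "complex_of_real ((norm z)\<^sup>2) = cnj z * z" for z
    by (metis complex_norm_square mult.commute)
  have sq': "complex_of_real ((norm z)\<^sup>2) = z * cnj z" for z
    by (metis complex_norm_square)
  define H where "H = mat n n (\<lambda>(i, j). cnj (A $$ (j, i)))"
  define G where "G = A * H"
  have H: "H \<in> carrier_mat n n" and G: "G \<in> carrier_mat n n"
    using A by (auto simp: H_def G_def)
  have Gij: "G $$ (i, j) = (\<Sum>k<n. A $$ (i, k) * cnj (A $$ (j, k)))" if "i < n" "j < n" for i j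
    using A that by (simp add: G_def H_def scalar_prod_def atLeast0LessThan)
  obtain es where "char_poly G = (\<Prod>a\<leftarrow>es. [:- a, 1:])"
    using char_poly_factorized[OF G] by blast
  then obtain B where B: "B \<in> carrier_mat n n" "upper_triangular B" "similar_mat G B"
    using schur_decomposition_exists[OF G] by blast
  \<comment> \<open>An eigenvalue of the product of \<open>A\<close> and its adjoint is a Rayleigh
    quotient: \<open>N\<close> is the squared length of the eigenvector, \<open>S\<close> that of
    its image under the adjoint, and the eigenvalue is their ratio \<open>S / N\<close>.\<close>
  have eig: "\<exists>r\<ge>0. B $$ (i, i) = complex_of_real r" if i: "i < n" for i
  proof -
    let ?b = "B $$ (i, i)"
    have "?b \<in> set (diag_mat B)" using B i by (auto simp: diag_mat_def)
    hence "poly (char_poly B) ?b = 0"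
      using char_poly_upper_triangular[OF B(1,2)] by (simp add: poly_prod_list prod_list_zero_iff)
    hence "eigenvalue G ?b"
      using eigenvalue_root_char_poly[OF G] char_poly_similar[OF B(3)] by simp
    then obtain v where v: "v \<in> carrier_vec n" "v \<noteq> 0\<^sub>v n" "G *\<^sub>v v = ?b \<cdot>\<^sub>v v"
      using G by (auto simp: eigenvalue_def eigenvector_def)
    define N where "N = (\<Sum>i<n. (norm (vec_index v i))\<^sup>2)"
    define S where "S = (\<Sum>k<n. (norm (\<Sum>j<n. cnj (A $$ (j, k)) * vec_index v j))\<^sup>2)"
    obtain l where l: "l < n" "vec_index v l \<noteq> 0"
      using v(1,2) by (metis carrier_vecD eq_vecI index_zero_vec)
    have "0 < (norm (vec_index v l))\<^sup>2" using l by simp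
    also have "\<dots> \<le> N" unfolding N_def using l by (intro member_le_sum) auto
    finally have Npos: "N > 0" .
    have "?b * of_real N = (\<Sum>i<n. cnj (vec_index v i) * (?b * vec_index v i))"
      unfolding N_def of_real_sum sq sum_distrib_left by (simp add: mult_ac)
    also have "\<dots> = (\<Sum>i<n. cnj (vec_index v i) * vec_index (G *\<^sub>v v) i)"
      using v by (intro sum.cong) auto
    also have "\<dots> = (\<Sum>i<n. cnj (vec_index v i) * (\<Sum>j<n. G $$ (i, j) * vec_index v j))"
      using v(1) G by (intro sum.cong) (auto simp: scalar_prod_def atLeast0LessThan)
    also have "\<dots> = (\<Sum>i<n. \<Sum>j<n. \<Sum>k<n. cnj (vec_index v i) * A $$ (i, k) * (cnj (A $$ (j, k)) * vec_index v j))"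
      by (intro sum.cong refl) (simp add: Gij sum_distrib_left sum_distrib_right mult_ac)
    also have "\<dots> = (\<Sum>k<n. \<Sum>i<n. \<Sum>j<n. cnj (vec_index v i) * A $$ (i, k) * (cnj (A $$ (j, k)) * vec_index v j))"
      by (subst (2) sum.swap, subst sum.swap) (rule refl)
    also have "\<dots> = (\<Sum>k<n. cnj (\<Sum>i<n. cnj (A $$ (i, k)) * vec_index v i) * (\<Sum>j<n. cnj (A $$ (j, k)) * vec_index v j))"
      unfolding cnj_sum sum_product by (intro sum.cong refl) (simp add: mult_ac)
    also have "\<dots> = of_real S"
      unfolding S_def of_real_sum sq ..
    finally have "?b * of_real N = of_real S" .
    hence "?b = of_real (S / N)" using Npos by (simp add: field_simps)
    moreover have "S / N \<ge> 0" using Npos by (simp add: S_def sum_nonneg)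
    ultimately show ?thesis by blast
  qed
  then obtain r where r: "\<And>i. i < n \<Longrightarrow> r i \<ge> 0" "\<And>i. i < n \<Longrightarrow> B $$ (i, i) = complex_of_real (r i)"
    by metis
  have "Determinant.det G = (\<Prod>i<n. B $$ (i, i))"
    using det_similar[OF B(3)] det_upper_triangular[OF B(2,1)] B(1)
    by (simp add: diag_mat_def prod.list_conv_set_nth atLeast0LessThan)
  also have "\<dots> = of_real (\<Prod>i<n. r i)" using r by simp
  finally have detG: "Determinant.det G = of_real (\<Prod>i<n. r i)" .
  have "Determinant.det G = Determinant.det A * cnj (Determinant.det A)"
    using det_mult[OF A H] det_map_cnj[OF A] by (simp add: G_def H_def)
  hence dd: "(norm (Determinant.det A))\<^sup>2 = (\<Prod>i<n. r i)"
    using detG by (metis complex_norm_square of_real_eq_iff)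
  \<comment> \<open>The trace is the sum of the squared moduli of all entries of \<open>A\<close>,
    hence at most n^2, and the mean of the eigenvalues is at most n. Their product, which is the
    squared modulus of the determinant, is then at most n^n.\<close>
  have "complex_of_real (\<Sum>i<n. r i) = (\<Sum>i<n. G $$ (i, i))"
    using trace_similar[OF B(3) G] r by simp
  also have "\<dots> = of_real (\<Sum>i<n. \<Sum>k<n. (norm (A $$ (i, k)))\<^sup>2)"
    unfolding of_real_sum sq' by (simp add: Gij)
  finally have "(\<Sum>i<n. r i) = (\<Sum>i<n. \<Sum>k<n. (norm (A $$ (i, k)))\<^sup>2)"
    by (simp only: of_real_eq_iff)
  also have "\<dots> \<le> (\<Sum>i<n. \<Sum>k<n. 1)"
    using bd by (intro sum_mono) (auto simp: abs_square_le_1 power_le_one)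
  finally have tr: "(\<Sum>i<n. r i) \<le> real n * real n" by simp
  have "(\<Prod>i<n. r i) powr (1 / n) \<le> (\<Sum>i<n. r i / n)"
    using arith_geom_mean[of "{..<n}" r] r False by (simp add: lessThan_empty_iff)
  also have "\<dots> = (\<Sum>i<n. r i) / n" by (simp add: sum_divide_distrib)
  also have "\<dots> \<le> n" using tr False by (simp add: field_simps)
  finally have "((\<Prod>i<n. r i) powr (1 / n)) ^ n \<le> real n ^ n"
    by (intro power_mono) auto
  moreover have "((\<Prod>i<n. r i) powr (1 / n)) ^ n = (\<Prod>i<n. r i)"
  proof (cases "(\<Prod>i<n. r i) = 0")
    case True
    then show ?thesis unfolding True using False by (simp add: zero_power)
  next
    case nz: False
    have "(\<Prod>i<n. r i) \<ge> 0" using r(1) by (intro prod_nonneg) auto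
    hence pos: "(\<Prod>i<n. r i) > 0" using nz by linarith
    have "((\<Prod>i<n. r i) powr (1 / n)) ^ n = ((\<Prod>i<n. r i) powr (1 / n)) powr real n"
      using nz by (subst powr_realpow) (simp_all only: powr_gt_zero not_False_eq_True)
    also have "\<dots> = (\<Prod>i<n. r i)" unfolding powr_powr using False pos by simp
    finally show ?thesis .
  qed
  ultimately have "(norm (Determinant.det A))\<^sup>2 \<le> real n ^ n" using dd by simp
  then show ?thesis by (simp add: real_le_rsqrt)
qed

section \<open>Determinants indexed by functions\<close>

definition dt :: "nat \<Rightarrow> (nat \<Rightarrow> nat \<Rightarrow> complex) \<Rightarrow> complex" where
  "dt k f = Determinant.det (mat k k (\<lambda>(i, j). f i j))"

lemma dt_rows: "dt k f = (\<Sum>p | p permutes {..<k}. signof p * (\<Prod>i<k. f i (p i)))"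
  unfolding dt_def
  by (subst det_def'[of _ k]) (auto simp: atLeast0LessThan intro!: sum.cong prod.cong dest: permutes_in_image)

lemma dt_cols: "dt k f = (\<Sum>p | p permutes {..<k}. signof p * (\<Prod>i<k. f (p i) i))"
  unfolding dt_def
  by (subst mat_det_left_def[of _ k]) (auto simp: atLeast0LessThan intro!: sum.cong prod.cong dest: permutes_in_image)

lemma dt_cong: "(\<And>i j. i < k \<Longrightarrow> j < k \<Longrightarrow> f i j = g i j) \<Longrightarrow> dt k f = dt k g"
  unfolding dt_def by (intro arg_cong[where f = Determinant.det] eq_matI) auto

lemma dt_scale_rows: "dt k (\<lambda>i j. c i * f i j) = (\<Prod>i<k. c i) * dt k f"
  unfolding dt_rows prod.distrib sum_distrib_left by (simp only: mult.left_commute)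

lemma dt_scale_cols: "dt k (\<lambda>i j. f i j * c j) = dt k f * (\<Prod>i<k. c i)"
  unfolding dt_cols prod.distrib sum_distrib_right by (simp only: mult.assoc)

lemma dt_transpose: "dt k (\<lambda>i j. f j i) = dt k f"
  by (subst dt_rows, subst dt_cols) (rule refl)

text \<open>Rows and columns contribute the same sign, and its square is 1. This is what allows
  integration variables to be relabelled under the integral of a determinant.\<close>

lemma dt_permute:
  assumes p: "p permutes {..<k}"
  shows "dt k (\<lambda>i j. f (p i) (p j)) = dt k f"
proof -
  have rows: "dt k (\<lambda>i j. g (p i) j) = signof p * dt k g" for g
  proof -
    have "dt k (\<lambda>i j. g (p i) j) = Determinant.det (mat k k (\<lambda>(i, j). mat k k (\<lambda>(i, j). g i j) $$ (p i, j)))"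
      unfolding dt_def using permutes_in_image[OF p]
      by (intro arg_cong[where f = Determinant.det] eq_matI) (simp_all add: lessThan_iff)
    also have "\<dots> = signof p * dt k g"
      unfolding dt_def using p by (intro det_permute_rows) (auto simp: atLeast0LessThan)
    finally show ?thesis .
  qed
  have "dt k (\<lambda>i j. f (p i) (p j)) = signof p * dt k (\<lambda>i j. f i (p j))"
    by (rule rows)
  also have "dt k (\<lambda>i j. f i (p j)) = dt k (\<lambda>i j. f j (p i))"
    by (rule dt_transpose[symmetric])
  also have "\<dots> = signof p * dt k (\<lambda>i j. f j i)"
    by (rule rows)
  also have "dt k (\<lambda>i j. f j i) = dt k f" by (rule dt_transpose)
  finally show ?thesis by (auto simp: sign_def)
qed

lemma dt_add_columns:
  "dt k (\<lambda>i j. f i j + g i j) = (\<Sum>S\<in>Pow {..<k}. dt k (\<lambda>i j. if j \<in> S then f i j else g i j))"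
proof -
  have "(\<Prod>i<k. f (p i) i + g (p i) i) = (\<Sum>S\<in>Pow {..<k}. \<Prod>i<k. if i \<in> S then f (p i) i else g (p i) i)" for p
  proof -
    have "(\<Prod>i<k. f (p i) i + g (p i) i) = (\<Sum>S\<in>Pow {..<k}. (\<Prod>i\<in>S. f (p i) i) * (\<Prod>i\<in>{..<k} - S. g (p i) i))"
      by (rule prod_add) simp
    also have "\<dots> = (\<Sum>S\<in>Pow {..<k}. \<Prod>i<k. if i \<in> S then f (p i) i else g (p i) i)"
      by (intro sum.cong refl, subst prod.If_cases) (auto intro!: arg_cong2[where f = "(*)"] prod.cong)
    finally show ?thesis .
  qed
  then show ?thesis
    unfolding dt_cols by (simp add: sum_distrib_left) (rule sum.swap)
qed

text \<open>The increasing enumeration of the indices other than \<open>i\<close>, by which a minor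
  is again a \<open>dt\<close>.\<close>

definition skip :: "nat \<Rightarrow> nat \<Rightarrow> nat" where
  "skip i a = (if a < i then a else Suc a)"

lemma dt_laplace:
  assumes c: "c < k"
  shows "dt k f = (\<Sum>i<k. f i c * ((-1) ^ (i + c) * dt (k - 1) (\<lambda>a b. f (skip i a) (skip c b))))"
  unfolding dt_def using c
  by (subst laplace_expansion_column[of _ k c])
     (auto simp: cofactor_def mat_delete_def skip_def intro!: sum.cong arg_cong[where f = Determinant.det] eq_matI)

lemma dt_zero_col: "j < k \<Longrightarrow> (\<And>i. i < k \<Longrightarrow> f i j = 0) \<Longrightarrow> dt k f = 0"
  by (subst dt_laplace[of j]) auto

text \<open>Dividing each row by its bound reduces this to Hadamard's inequality for entries of
  modulus at most 1; a row with bound 0 makes the determinant vanish. Bounds per row are enough,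
  which is why kernels will be dominated in their first variable only.\<close>

lemma norm_dt_le:
  assumes bd: "\<And>i j. i < k \<Longrightarrow> j < k \<Longrightarrow> norm (f i j) \<le> a i" and a: "\<And>i. i < k \<Longrightarrow> a i \<ge> 0"
  shows "norm (dt k f) \<le> sqrt (real k ^ k) * (\<Prod>i<k. a i)"
proof (cases "\<exists>i<k. a i = 0")
  case True
  then obtain i where i: "i < k" "a i = 0" by blast
  have "dt k f = dt k (\<lambda>i j. f j i)" by (rule dt_transpose[symmetric])
  also have "\<dots> = 0" using i bd by (intro dt_zero_col[of i]) force+
  finally show ?thesis using prod_nonneg[of "{..<k}" a] a by simp
next
  case False
  have "dt k f = dt k (\<lambda>i j. of_real (a i) * (f i j / of_real (a i)))"
    using False by (intro dt_cong) auto
  also have "\<dots> = (\<Prod>i<k. of_real (a i)) * dt k (\<lambda>i j. f i j / of_real (a i))"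
    by (rule dt_scale_rows)
  finally have "norm (dt k f) = (\<Prod>i<k. a i) * norm (dt k (\<lambda>i j. f i j / of_real (a i)))"
    using prod_nonneg[of "{..<k}" a] a by (simp add: norm_mult flip: of_real_prod)
  also have "\<dots> \<le> (\<Prod>i<k. a i) * sqrt (real k ^ k)"
  proof (intro mult_left_mono prod_nonneg)
    show "norm (dt k (\<lambda>i j. f i j / of_real (a i))) \<le> sqrt (real k ^ k)"
      unfolding dt_def
    proof (rule norm_det_le)
      fix i j assume ij: "i < k" "j < k"
      have "a i > 0" using a[OF ij(1)] False ij by force
      then show "norm (mat k k (\<lambda>(i, j). f i j / of_real (a i)) $$ (i, j)) \<le> 1"
        using bd[OF ij] ij by (simp add: norm_divide)
    qed auto
  qed (use a in auto)
  finally show ?thesis by (simp add: mult.commute)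
qed

text \<open>One term of the exponential series gives k^k \<le> e^k k!, so the terms are at most (C
  e)^k / sqrt (k!), and the ratio test applies. Replacing e^k by its square in between makes the
  square root exact.\<close>

lemma summable_hadamard: "summable (\<lambda>k. sqrt (real k ^ k) * C ^ k / fact k)"
proof -
  have "summable (\<lambda>k. (\<bar>C\<bar> * exp 1) ^ k / sqrt (fact k))"
  proof (rule summable_ratio_test[of "1/2" "nat \<lceil>(2 * (\<bar>C\<bar> * exp 1))\<^sup>2\<rceil>"])
    fix n assume n: "n \<ge> nat \<lceil>(2 * (\<bar>C\<bar> * exp 1))\<^sup>2\<rceil>"
    let ?D = "\<bar>C\<bar> * exp 1 :: real"
    have "(2 * ?D)\<^sup>2 \<le> real n" using n by linarith
    hence "2 * ?D \<le> sqrt (real n + 1)" by (intro real_le_rsqrt) linarith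
    hence "?D / sqrt (real n + 1) \<le> 1 / 2" by (simp add: divide_le_eq add_pos_nonneg mult.commute)
    hence "?D / sqrt (real n + 1) * (?D ^ n / sqrt (fact n)) \<le> 1 / 2 * (?D ^ n / sqrt (fact n))"
      by (intro mult_right_mono) auto
    moreover have "?D ^ Suc n / sqrt (fact (Suc n)) = ?D / sqrt (real n + 1) * (?D ^ n / sqrt (fact n))"
      by (simp add: real_sqrt_mult add.commute)
    moreover have "norm (?D ^ j / sqrt (fact j)) = ?D ^ j / sqrt (fact j)" for j
      by simp
    ultimately show "norm (?D ^ Suc n / sqrt (fact (Suc n))) \<le> 1 / 2 * norm (?D ^ n / sqrt (fact n))"
      by metis
  qed simp
  moreover have "norm (sqrt (real k ^ k) * C ^ k / fact k) \<le> (\<bar>C\<bar> * exp 1) ^ k / sqrt (fact k)" for k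
  proof -
    have "real k ^ k / fact k \<le> exp (real k)"
    proof -
      have "(\<Sum>n\<in>{k}. real k ^ n /\<^sub>R fact n) \<le> (\<Sum>n. real k ^ n /\<^sub>R fact n)"
        by (rule sum_le_suminf[OF summable_exp_generic]) auto
      also have "\<dots> = exp (real k)" by (simp add: exp_def)
      finally have "(\<Sum>n\<in>{k}. real k ^ n /\<^sub>R fact n) \<le> exp (real k)" .
      then show ?thesis by (simp add: field_simps)
    qed
    hence "real k ^ k \<le> exp 1 ^ k * fact k" using exp_of_nat_mult[of k "1::real"] by (simp add: divide_le_eq)
    also have "\<dots> \<le> (exp 1 ^ k)\<^sup>2 * fact k"
      by (intro mult_right_mono self_le_power) auto
    finally have "sqrt (real k ^ k) \<le> sqrt ((exp 1 ^ k)\<^sup>2 * fact k)" by (rule real_sqrt_le_mono)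
    also have "\<dots> = exp 1 ^ k * sqrt (fact k)" by (simp add: real_sqrt_mult)
    finally have "sqrt (real k ^ k) * \<bar>C\<bar> ^ k / fact k \<le> (exp 1 ^ k * sqrt (fact k)) * \<bar>C\<bar> ^ k / fact k"
      by (intro divide_right_mono mult_right_mono) auto
    also have "\<dots> = (\<bar>C\<bar> * exp 1) ^ k * (sqrt (fact k) / fact k)" by (simp add: power_mult_distrib)
    also have "sqrt (fact k) / fact k = 1 / sqrt (fact k :: real)"
      using real_sqrt_mult_self[of "fact k"] by (simp add: field_simps)
    finally show ?thesis by (simp add: abs_mult power_abs)
  qed
  ultimately show ?thesis by (rule summable_comparison_test'[where N = 0])
qed

section \<open>Terms of the Fredholm series\<close>

definition fterm :: "'a measure \<Rightarrow> ('a \<Rightarrow> 'a \<Rightarrow> complex) \<Rightarrow> nat \<Rightarrow> complex" where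
  "fterm M K k = 1 / fact k * (\<integral>x. dt k (\<lambda>i j. K (x i) (x j)) \<partial>(\<Pi>\<^sub>M i\<in>{..<k}. M))"

text \<open>With the row bound of \<open>norm_dt_le\<close>, the determinant of order
  \<open>k\<close> is bounded by a constant times the product of the \<open>w (x i)\<close>, whose
  integral is the \<open>k\<close>-th power of the integral of \<open>w\<close>. All convergence
  statements about Fredholm series rest on this.\<close>

definition dominated :: "'a measure \<Rightarrow> ('a \<Rightarrow> real) \<Rightarrow> ('a \<Rightarrow> 'a \<Rightarrow> complex) \<Rightarrow> bool" where
  "dominated M w K \<longleftrightarrow> integrable M w \<and> (\<forall>x\<in>space M. 0 \<le> w x) \<and>
     (\<lambda>(x, y). K x y) \<in> borel_measurable (M \<Otimes>\<^sub>M M) \<and>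
     (\<forall>x\<in>space M. \<forall>y\<in>space M. norm (K x y) \<le> w x)"

lemma integrable_pair_mult:
  fixes f :: "'a \<Rightarrow> real" and g :: "'b \<Rightarrow> real"
  assumes "sigma_finite_measure M" "sigma_finite_measure N" and f: "integrable M f" and g: "integrable N g"
  shows "integrable (M \<Otimes>\<^sub>M N) (\<lambda>(x, y). f x * g y)"
proof -
  interpret M: sigma_finite_measure M by fact
  interpret N: sigma_finite_measure N by fact
  interpret pair_sigma_finite M N ..
  have [measurable]: "f \<in> borel_measurable M" "g \<in> borel_measurable N" using f g by auto
  show ?thesis
  proof (rule Fubini_integrable)
    show "(\<lambda>(x, y). f x * g y) \<in> borel_measurable (M \<Otimes>\<^sub>M N)" by measurable
    have "(\<lambda>x. \<integral>y. norm (case (x, y) of (x, y) \<Rightarrow> f x * g y) \<partial>N) = (\<lambda>x. \<bar>f x\<bar> * (\<integral>y. \<bar>g y\<bar> \<partial>N))"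
      by (simp add: abs_mult)
    then show "integrable M (\<lambda>x. \<integral>y. norm (case (x, y) of (x, y) \<Rightarrow> f x * g y) \<partial>N)"
      using f by simp
    show "AE x in M. integrable N (\<lambda>y. case (x, y) of (x, y) \<Rightarrow> f x * g y)" using g by simp
  qed
qed

text \<open>A product measure is determined by its values on boxes, and on a box the substitution
  only reorders the factors.\<close>

lemma PiM_reindex_permute:
  assumes "sigma_finite_measure M" and p: "p permutes I" and I: "finite I"
  shows "distr (\<Pi>\<^sub>M i\<in>I. M) (\<Pi>\<^sub>M i\<in>I. M) (\<lambda>x. \<lambda>i\<in>I. x (p i)) = (\<Pi>\<^sub>M i\<in>I. M)"
proof -
  interpret product_sigma_finite "\<lambda>_. M"
    using assms(1) by (simp add: product_sigma_finite_def)
  have pI: "p i \<in> I" if "i \<in> I" for i using permutes_in_image[OF p] that by simp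
  have m: "(\<lambda>x. \<lambda>i\<in>I. x (p i)) \<in> measurable (\<Pi>\<^sub>M i\<in>I. M) (\<Pi>\<^sub>M i\<in>I. M)"
    by (rule measurable_restrict) (use pI in auto)
  show ?thesis
  proof (rule PiM_eqI)
    fix A :: "'b \<Rightarrow> 'a set" assume A: "\<And>i. i \<in> I \<Longrightarrow> A i \<in> sets M"
    let ?q = "inv_into UNIV p"
    have q: "?q i \<in> I" if "i \<in> I" for i
      using permutes_in_image[OF permutes_inv[OF p]] that by simp
    have "(\<lambda>x. \<lambda>i\<in>I. x (p i)) -` Pi\<^sub>E I A \<inter> space (\<Pi>\<^sub>M i\<in>I. M) = Pi\<^sub>E I (\<lambda>i. A (?q i))"
      (is "?L = ?R")
    proof (rule Set.set_eqI, rule iffI)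
      fix x assume x: "x \<in> ?L"
      have "x i \<in> A (?q i)" if i: "i \<in> I" for i
      proof -
        have "(\<lambda>i\<in>I. x (p i)) (?q i) \<in> A (?q i)" using x q[OF i] by (intro PiE_mem[of _ I A]) auto
        then show ?thesis using q[OF i] permutes_inverses(1)[OF p] by simp
      qed
      then show "x \<in> ?R" using x by (auto simp: space_PiM PiE_def)
    next
      fix x assume x: "x \<in> ?R"
      have "x (p i) \<in> A i" if i: "i \<in> I" for i
        using PiE_mem[OF x pI[OF i]] permutes_inverses(2)[OF p] by simp
      moreover have "x \<in> space (\<Pi>\<^sub>M i\<in>I. M)"
        using x A[OF q] sets.sets_into_space by (fastforce simp: space_PiM PiE_def Pi_def)
      ultimately show "x \<in> ?L" by auto
    qed
    moreover have "(\<Prod>i\<in>I. emeasure M (A (?q i))) = (\<Prod>i\<in>I. emeasure M (A i))"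
      using prod.permute[OF permutes_inv[OF p], of "\<lambda>i. emeasure M (A i)"] by (simp add: comp_def)
    ultimately show "emeasure (distr (\<Pi>\<^sub>M i\<in>I. M) (\<Pi>\<^sub>M i\<in>I. M) (\<lambda>x. \<lambda>i\<in>I. x (p i))) (Pi\<^sub>E I A) =
        (\<Prod>i\<in>I. emeasure M (A i))"
      using m A I q by (subst emeasure_distr) (auto simp: emeasure_PiM intro!: sets_PiM_I_finite)
  qed (use I in auto)
qed

context
  fixes M :: "'a measure"
  assumes sf: "sigma_finite_measure M"
begin

interpretation product_sigma_finite "\<lambda>_::nat. M"
  using sf by (simp add: product_sigma_finite_def)

lemma dt_borel_measurable [measurable (raw)]:
  assumes "\<And>i j. i < k \<Longrightarrow> j < k \<Longrightarrow> F i j \<in> borel_measurable N"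
  shows "(\<lambda>x. dt k (\<lambda>i j. F i j x)) \<in> borel_measurable N"
  unfolding dt_rows
  by (intro borel_measurable_sum borel_measurable_times borel_measurable_const borel_measurable_prod assms)
     (use permutes_in_image in \<open>fastforce+\<close>)

lemma integral_prod_w:
  fixes w :: "'a \<Rightarrow> real"
  assumes "integrable M w"
  shows "integrable (\<Pi>\<^sub>M i\<in>{..<k}. M) (\<lambda>x. \<Prod>i<k. w (x i))"
    and "(\<integral>x. (\<Prod>i<k. w (x i)) \<partial>(\<Pi>\<^sub>M i\<in>{..<k::nat}. M)) = integral\<^sup>L M w ^ k"
  using product_integrable_prod[of "{..<k}" "\<lambda>_. w"] product_integral_prod[of "{..<k}" "\<lambda>_. w"] assms by auto

lemma dt_integrable:
  assumes meas: "\<And>i j. i < k \<Longrightarrow> j < k \<Longrightarrow> F i j \<in> borel_measurable (\<Pi>\<^sub>M i\<in>{..<k}. M)"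
    and bd: "\<And>i j x. i < k \<Longrightarrow> j < k \<Longrightarrow> x \<in> space (\<Pi>\<^sub>M i\<in>{..<k}. M) \<Longrightarrow> norm (F i j x) \<le> w (x i)"
    and w: "integrable M w" "\<And>x. x \<in> space M \<Longrightarrow> 0 \<le> w x"
  shows "integrable (\<Pi>\<^sub>M i\<in>{..<k}. M) (\<lambda>x. dt k (\<lambda>i j. F i j x))"
    and "norm (\<integral>x. dt k (\<lambda>i j. F i j x) \<partial>(\<Pi>\<^sub>M i\<in>{..<k}. M)) \<le> sqrt (real k ^ k) * integral\<^sup>L M w ^ k"
proof -
  have b: "norm (dt k (\<lambda>i j. F i j x)) \<le> sqrt (real k ^ k) * (\<Prod>i<k. w (x i))"
    if "x \<in> space (\<Pi>\<^sub>M i\<in>{..<k}. M)" for x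
    using that by (intro norm_dt_le bd w(2)) (auto simp: space_PiM)
  have I: "integrable (\<Pi>\<^sub>M i\<in>{..<k}. M) (\<lambda>x. sqrt (real k ^ k) * (\<Prod>i<k. w (x i)))"
    using integral_prod_w(1)[OF w(1)] by simp
  show int: "integrable (\<Pi>\<^sub>M i\<in>{..<k}. M) (\<lambda>x. dt k (\<lambda>i j. F i j x))"
    by (rule Bochner_Integration.integrable_bound[OF I])
       (use meas b in \<open>auto intro!: dt_borel_measurable AE_I2 intro: order_trans[OF _ abs_ge_self]\<close>)
  have "norm (\<integral>x. dt k (\<lambda>i j. F i j x) \<partial>(\<Pi>\<^sub>M i\<in>{..<k}. M)) \<le>
      (\<integral>x. sqrt (real k ^ k) * (\<Prod>i<k. w (x i)) \<partial>(\<Pi>\<^sub>M i\<in>{..<k}. M))"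
    using int I b
    by (intro order_trans[OF Bochner_Integration.integral_norm_bound Bochner_Integration.integral_mono]) auto
  also have "\<dots> = sqrt (real k ^ k) * integral\<^sup>L M w ^ k"
    using integral_prod_w(2)[OF w(1)] by simp
  finally show "norm (\<integral>x. dt k (\<lambda>i j. F i j x) \<partial>(\<Pi>\<^sub>M i\<in>{..<k}. M)) \<le> sqrt (real k ^ k) * integral\<^sup>L M w ^ k" .
qed

lemma kernel_entry_measurable:
  assumes "(\<lambda>(x, y). K x y) \<in> borel_measurable (M \<Otimes>\<^sub>M M)" "i < k" "j < k"
  shows "(\<lambda>x. K (x i) (x j)) \<in> borel_measurable (\<Pi>\<^sub>M i\<in>{..<k}. M)"
proof -
  have "(\<lambda>x. (x i, x j)) \<in> measurable (\<Pi>\<^sub>M i\<in>{..<k}. M) (M \<Otimes>\<^sub>M M)"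
    using assms(2,3) by (intro measurable_Pair measurable_component_singleton) auto
  from measurable_compose[OF this assms(1)] show ?thesis by simp
qed

lemma fterm_dominated:
  assumes K: "dominated M w K"
  shows "integrable (\<Pi>\<^sub>M i\<in>{..<k}. M) (\<lambda>x. dt k (\<lambda>i j. K (x i) (x j)))"
    and "norm (fterm M K k) \<le> sqrt (real k ^ k) * integral\<^sup>L M w ^ k / fact k"
proof -
  note K' = K[unfolded dominated_def]
  have m: "i < k \<Longrightarrow> j < k \<Longrightarrow> (\<lambda>x. K (x i) (x j)) \<in> borel_measurable (\<Pi>\<^sub>M i\<in>{..<k}. M)" for i j
    using K' by (intro kernel_entry_measurable) auto
  have b: "i < k \<Longrightarrow> j < k \<Longrightarrow> x \<in> space (\<Pi>\<^sub>M i\<in>{..<k}. M) \<Longrightarrow> norm (K (x i) (x j)) \<le> w (x i)" for i j x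
    using K' by (auto simp: space_PiM)
  have w: "integrable M w" "\<And>x. x \<in> space M \<Longrightarrow> 0 \<le> w x" using K' by auto
  note D = dt_integrable[of k "\<lambda>i j x. K (x i) (x j)" w, OF m b w]
  show "integrable (\<Pi>\<^sub>M i\<in>{..<k}. M) (\<lambda>x. dt k (\<lambda>i j. K (x i) (x j)))"
    by (rule D(1))
  show "norm (fterm M K k) \<le> sqrt (real k ^ k) * integral\<^sup>L M w ^ k / fact k"
  proof -
    have "norm (fterm M K k) = norm (\<integral>x. dt k (\<lambda>i j. K (x i) (x j)) \<partial>(\<Pi>\<^sub>M i\<in>{..<k}. M)) / fact k"
      unfolding fterm_def norm_mult by (simp add: norm_divide)
    also have "\<dots> \<le> sqrt (real k ^ k) * integral\<^sup>L M w ^ k / fact k"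
      by (intro divide_right_mono D(2) fact_ge_zero)
    finally show ?thesis .
  qed
qed

lemma fterm_summable:
  assumes "dominated M w K"
  shows "summable (\<lambda>k. norm (fterm M K k))"
  by (rule summable_comparison_test'[where N = 0, OF summable_hadamard[of "integral\<^sup>L M w"]])
     (use fterm_dominated(2)[OF assms] in auto)

lemma PiM_integral_permute:
  fixes F :: "(nat \<Rightarrow> 'a) \<Rightarrow> complex"
  assumes p: "p permutes {..<k}" and F: "F \<in> borel_measurable (\<Pi>\<^sub>M i\<in>{..<k}. M)"
  shows "(\<integral>x. F (\<lambda>i\<in>{..<k}. x (p i)) \<partial>(\<Pi>\<^sub>M i\<in>{..<k}. M)) = integral\<^sup>L (\<Pi>\<^sub>M i\<in>{..<k}. M) F"
proof -
  have pI: "p i \<in> {..<k}" if "i \<in> {..<k}" for i using permutes_in_image[OF p] that by simp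
  have m: "(\<lambda>x. \<lambda>i\<in>{..<k}. x (p i)) \<in> measurable (\<Pi>\<^sub>M i\<in>{..<k}. M) (\<Pi>\<^sub>M i\<in>{..<k}. M)"
    by (rule measurable_restrict) (use pI in auto)
  have "integral\<^sup>L (\<Pi>\<^sub>M i\<in>{..<k}. M) F =
      integral\<^sup>L (distr (\<Pi>\<^sub>M i\<in>{..<k}. M) (\<Pi>\<^sub>M i\<in>{..<k}. M) (\<lambda>x. \<lambda>i\<in>{..<k}. x (p i))) F"
    using PiM_reindex_permute[OF sf p] by simp
  also have "\<dots> = (\<integral>x. F (\<lambda>i\<in>{..<k}. x (p i)) \<partial>(\<Pi>\<^sub>M i\<in>{..<k}. M))"
    by (rule integral_distr[OF m F])
  finally show ?thesis ..
qed

text \<open>Row \<open>i\<close> depends on the variable \<open>s i\<close> alone. Each product in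
  the Leibniz expansion by rows therefore has one factor per variable, and its integral is a product
  of one-dimensional integrals.\<close>

lemma dt_integral_rows:
  assumes "\<And>i j. i < k \<Longrightarrow> j < k \<Longrightarrow> integrable M (g i j)"
  shows "dt k (\<lambda>i j. \<integral>s. g i j s \<partial>M) = (\<integral>s. dt k (\<lambda>i j. g i j (s i)) \<partial>(\<Pi>\<^sub>M i\<in>{..<k}. M))"
    and "integrable (\<Pi>\<^sub>M i\<in>{..<k}. M) (\<lambda>s. dt k (\<lambda>i j. g i j (s i)))"
proof -
  have pI: "p permutes {..<k} \<Longrightarrow> i < k \<Longrightarrow> p i < k" for p i
    using permutes_in_image[of p "{..<k}" i] by simp
  have P: "integrable (\<Pi>\<^sub>M i\<in>{..<k}. M) (\<lambda>s. \<Prod>i<k. g i (p i) (s i))"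
     "(\<integral>s. (\<Prod>i<k. g i (p i) (s i)) \<partial>(\<Pi>\<^sub>M i\<in>{..<k}. M)) = (\<Prod>i<k. \<integral>s. g i (p i) s \<partial>M)"
    if p: "p permutes {..<k}" for p
    using product_integrable_prod[of "{..<k}" "\<lambda>i. g i (p i)"]
      product_integral_prod[of "{..<k}" "\<lambda>i. g i (p i)"] pI[OF p] assms by auto
  show "integrable (\<Pi>\<^sub>M i\<in>{..<k}. M) (\<lambda>s. dt k (\<lambda>i j. g i j (s i)))"
    unfolding dt_rows using P(1)
    by (intro Bochner_Integration.integrable_sum integrable_mult_right) auto
  show "dt k (\<lambda>i j. \<integral>s. g i j s \<partial>M) = (\<integral>s. dt k (\<lambda>i j. g i j (s i)) \<partial>(\<Pi>\<^sub>M i\<in>{..<k}. M))"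
    unfolding dt_rows using P
    by (subst Bochner_Integration.integral_sum) (auto intro!: sum.cong integrable_mult_right)
qed

lemma dt_integral_cols:
  assumes "\<And>i j. i < k \<Longrightarrow> j < k \<Longrightarrow> integrable M (g i j)"
  shows "dt k (\<lambda>i j. \<integral>s. g i j s \<partial>M) = (\<integral>s. dt k (\<lambda>i j. g i j (s j)) \<partial>(\<Pi>\<^sub>M i\<in>{..<k}. M))"
proof -
  have "dt k (\<lambda>i j. \<integral>s. g i j s \<partial>M) = dt k (\<lambda>i j. \<integral>s. g j i s \<partial>M)"
    by (rule dt_transpose[symmetric])
  also have "\<dots> = (\<integral>s. dt k (\<lambda>i j. g j i (s i)) \<partial>(\<Pi>\<^sub>M i\<in>{..<k}. M))"
    using assms by (intro dt_integral_rows) auto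
  also have "\<dots> = (\<integral>s. dt k (\<lambda>i j. g i j (s j)) \<partial>(\<Pi>\<^sub>M i\<in>{..<k}. M))"
    by (subst dt_transpose) (rule refl)
  finally show ?thesis .
qed

end

text \<open>Expanding one determinant by rows and the other by columns produces the same integrand.\<close>

lemma fterm_commute:
  fixes R :: "'a \<Rightarrow> 'b \<Rightarrow> complex" and E :: "'b \<Rightarrow> 'a \<Rightarrow> complex" and w :: "'a \<Rightarrow> real" and r :: "'b \<Rightarrow> real"
  assumes sfM: "sigma_finite_measure M" and sfN: "sigma_finite_measure N"
    and Rm: "(\<lambda>(x, s). R x s) \<in> borel_measurable (M \<Otimes>\<^sub>M N)"
    and Em: "(\<lambda>(s, x). E s x) \<in> borel_measurable (N \<Otimes>\<^sub>M M)"
    and Rb: "\<And>x s. x \<in> space M \<Longrightarrow> s \<in> space N \<Longrightarrow> norm (R x s) \<le> w x * r s"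
    and Eb: "\<And>s x. s \<in> space N \<Longrightarrow> x \<in> space M \<Longrightarrow> norm (E s x) \<le> C"
    and w: "integrable M w" "\<And>x. x \<in> space M \<Longrightarrow> 0 \<le> w x"
    and r: "integrable N r" "\<And>s. s \<in> space N \<Longrightarrow> 0 \<le> r s"
  shows "fterm M (\<lambda>x y. \<integral>s. R x s * E s y \<partial>N) k = fterm N (\<lambda>s s'. \<integral>x. E s x * R x s' \<partial>M) k"
proof -
  interpret M: product_sigma_finite "\<lambda>_::nat. M" using sfM by (simp add: product_sigma_finite_def)
  interpret N: product_sigma_finite "\<lambda>_::nat. N" using sfN by (simp add: product_sigma_finite_def)
  define PM where "PM = (\<Pi>\<^sub>M i\<in>{..<k}. M)"
  define PN where "PN = (\<Pi>\<^sub>M i\<in>{..<k}. N)"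
  have sPM: "sigma_finite_measure PM" and sPN: "sigma_finite_measure PN"
    unfolding PM_def PN_def by (rule M.sigma_finite N.sigma_finite, simp)+
  interpret PM: sigma_finite_measure PM by (rule sPM)
  interpret PN: sigma_finite_measure PN by (rule sPN)
  interpret P: pair_sigma_finite PM PN ..
  define H where "H x s = (\<Prod>i<k. R (x i) (s i)) * dt k (\<lambda>i j. E (s i) (x j))" for x s
  have RE: "integrable N (\<lambda>s. R x s * E s y)" if "x \<in> space M" "y \<in> space M" for x y
  proof (rule Bochner_Integration.integrable_bound)
    show "integrable N (\<lambda>s. w x * r s * C)" using r by simp
    show "(\<lambda>s. R x s * E s y) \<in> borel_measurable N"
      using measurable_compose[OF _ Rm, of "\<lambda>s. (x, s)" N] measurable_compose[OF _ Em, of "\<lambda>s. (s, y)" N] that by simp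
    have "norm (R x s * E s y) \<le> w x * r s * C" if s: "s \<in> space N" for s
      unfolding norm_mult using that \<open>x \<in> space M\<close> \<open>y \<in> space M\<close> w r
      by (intro mult_mono Rb Eb mult_nonneg_nonneg) auto
    then show "AE s in N. norm (R x s * E s y) \<le> norm (w x * r s * C)"
      by (intro AE_I2) (smt (verit) real_norm_def)
  qed
  have ER: "integrable M (\<lambda>x. E s x * R x s')" if "s \<in> space N" "s' \<in> space N" for s s'
  proof (rule Bochner_Integration.integrable_bound)
    show "integrable M (\<lambda>x. C * (w x * r s'))" using w by simp
    show "(\<lambda>x. E s x * R x s') \<in> borel_measurable M"
      using measurable_compose[OF _ Rm, of "\<lambda>x. (x, s')" M] measurable_compose[OF _ Em, of "\<lambda>x. (s, x)" M] that by simp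
    have "norm (E s x * R x s') \<le> C * (w x * r s')" if x: "x \<in> space M" for x
      unfolding norm_mult using that \<open>s \<in> space N\<close> \<open>s' \<in> space N\<close> w r Eb[OF \<open>s \<in> space N\<close> x]
      by (intro mult_mono Rb Eb mult_nonneg_nonneg) (auto intro: order_trans[OF norm_ge_zero])
    then show "AE x in M. norm (E s x * R x s') \<le> norm (C * (w x * r s'))"
      by (intro AE_I2) (smt (verit) real_norm_def)
  qed
  have L: "dt k (\<lambda>i j. \<integral>s. R (x i) s * E s (x j) \<partial>N) = (\<integral>s. H x s \<partial>PN)" if x: "x \<in> space PM" for x
  proof -
    have xi: "x i \<in> space M" if "i < k" for i using x that by (auto simp: PM_def space_PiM)
    have "dt k (\<lambda>i j. \<integral>s. R (x i) s * E s (x j) \<partial>N) = (\<integral>s. dt k (\<lambda>i j. R (x i) (s i) * E (s i) (x j)) \<partial>PN)"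
      unfolding PN_def by (rule dt_integral_rows[OF sfN]) (intro RE xi)
    then show ?thesis by (simp add: H_def dt_scale_rows)
  qed
  have U: "dt k (\<lambda>i j. \<integral>x. E (s i) x * R x (s j) \<partial>M) = (\<integral>x. H x s \<partial>PM)" if s: "s \<in> space PN" for s
  proof -
    have si: "s i \<in> space N" if "i < k" for i using s that by (auto simp: PN_def space_PiM)
    have "dt k (\<lambda>i j. \<integral>x. E (s i) x * R x (s j) \<partial>M) = (\<integral>x. dt k (\<lambda>i j. E (s i) (x j) * R (x j) (s j)) \<partial>PM)"
      unfolding PM_def by (rule dt_integral_cols[OF sfM]) (intro ER si)
    then show ?thesis by (simp add: H_def dt_scale_cols mult.commute)
  qed
  have int: "integrable (PM \<Otimes>\<^sub>M PN) (\<lambda>(x, s). H x s)"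
  proof (rule Bochner_Integration.integrable_bound)
    show "integrable (PM \<Otimes>\<^sub>M PN) (\<lambda>(x, s). (\<Prod>i<k. w (x i)) * ((\<Prod>i<k. r (s i)) * (sqrt (real k ^ k) * C ^ k)))"
      unfolding PM_def PN_def
      by (intro integrable_pair_mult M.sigma_finite N.sigma_finite integrable_mult_left
          integral_prod_w[OF sfM] integral_prod_w[OF sfN] w r) auto
    have cM: "(\<lambda>x. x i) \<in> measurable PM M" "(\<lambda>x. x i) \<in> measurable PN N" if "i < k" for i
      unfolding PM_def PN_def using that by (auto intro!: measurable_component_singleton)
    have "(\<lambda>p. (fst p i, snd p j)) \<in> measurable (PM \<Otimes>\<^sub>M PN) (M \<Otimes>\<^sub>M N)" if "i < k" "j < k" for i j
      by (intro measurable_Pair measurable_compose[OF measurable_fst cM(1)] measurable_compose[OF measurable_snd cM(2)] that)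
    from measurable_compose[OF this Rm]
    have m1: "(\<lambda>p. R (fst p i) (snd p j)) \<in> borel_measurable (PM \<Otimes>\<^sub>M PN)" if "i < k" "j < k" for i j
      using that by simp
    have "(\<lambda>p. (snd p i, fst p j)) \<in> measurable (PM \<Otimes>\<^sub>M PN) (N \<Otimes>\<^sub>M M)" if "i < k" "j < k" for i j
      by (intro measurable_Pair measurable_compose[OF measurable_fst cM(1)] measurable_compose[OF measurable_snd cM(2)] that)
    from measurable_compose[OF this Em]
    have m2: "(\<lambda>p. E (snd p i) (fst p j)) \<in> borel_measurable (PM \<Otimes>\<^sub>M PN)" if "i < k" "j < k" for i j
      using that by simp
    show "(\<lambda>(x, s). H x s) \<in> borel_measurable (PM \<Otimes>\<^sub>M PN)"
      unfolding H_def case_prod_beta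
      by (intro borel_measurable_times borel_measurable_prod dt_borel_measurable[OF sfM]) (use m1 m2 in auto)
    have "norm (H x s) \<le> (\<Prod>i<k. w (x i)) * ((\<Prod>i<k. r (s i)) * (sqrt (real k ^ k) * C ^ k))"
      if x: "x \<in> space PM" and s: "s \<in> space PN" for x s
    proof -
      have xi: "x i \<in> space M" "s i \<in> space N" if "i < k" for i
        using x s that by (auto simp: PM_def PN_def space_PiM)
      \<comment> \<open>The sign of \<open>C\<close> can be read off only at points of the two
        spaces, and a point of the product space supplies such points when \<open>k\<close> is
        positive. For \<open>k = 0\<close> the power of \<open>C\<close> is 1.\<close>
      have C: "0 \<le> C" if "0 < k" using Eb[of "s 0" "x 0"] xi that norm_ge_zero order_trans by blast
      have "norm (dt k (\<lambda>i j. E (s i) (x j))) \<le> sqrt (real k ^ k) * (\<Prod>i<k. C)"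
        using C xi by (intro norm_dt_le Eb) auto
      moreover have "norm (\<Prod>i<k. R (x i) (s i)) \<le> (\<Prod>i<k. w (x i) * r (s i))"
        unfolding prod_norm[symmetric] using xi by (intro prod_mono) (auto intro: Rb)
      ultimately have "norm (H x s) \<le> (\<Prod>i<k. w (x i) * r (s i)) * (sqrt (real k ^ k) * (\<Prod>i<k. C))"
        unfolding H_def norm_mult by (intro mult_mono) (auto intro!: prod_nonneg mult_nonneg_nonneg w r xi)
      then show ?thesis by (simp add: prod.distrib mult_ac)
    qed
    then show "AE p in PM \<Otimes>\<^sub>M PN. norm (case p of (x, s) \<Rightarrow> H x s) \<le>
        norm (case p of (x, s) \<Rightarrow> (\<Prod>i<k. w (x i)) * ((\<Prod>i<k. r (s i)) * (sqrt (real k ^ k) * C ^ k)))"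
      by (intro AE_I2) (auto simp: space_pair_measure simp del: norm_mult intro: order_trans[OF _ abs_ge_self])
  qed
  have "fterm M (\<lambda>x y. \<integral>s. R x s * E s y \<partial>N) k = 1 / fact k * (\<integral>x. (\<integral>s. H x s \<partial>PN) \<partial>PM)"
    unfolding fterm_def PM_def[symmetric] by (simp add: L cong: Bochner_Integration.integral_cong)
  also have "(\<integral>x. (\<integral>s. H x s \<partial>PN) \<partial>PM) = (\<integral>s. (\<integral>x. H x s \<partial>PM) \<partial>PN)"
    by (rule P.Fubini_integral[OF int, symmetric])
  also have "1 / fact k * \<dots> = fterm N (\<lambda>s s'. \<integral>x. E s x * R x s' \<partial>M) k"
    unfolding fterm_def PN_def[symmetric] by (simp add: U cong: Bochner_Integration.integral_cong)
  finally show ?thesis .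
qed

lemma skip_0: "skip 0 = Suc"
  by (auto simp: skip_def)

text \<open>Used to bring the columns of a given set to the front, so that an integral depends only
  on the number of these columns.\<close>

lemma ex_permutes_initial:
  assumes S: "S \<subseteq> {..<k}" and s: "card S = s"
  shows "\<exists>p. p permutes {..<k} \<and> (\<forall>j<k. p j \<in> S \<longleftrightarrow> j < s)"
proof -
  have fS: "finite S" using S finite_subset by blast
  have sk: "s \<le> k" using card_mono[OF _ S] s by simp
  obtain f where f: "bij_betw f {..<s} S"
    using finite_same_card_bij[of "{..<s}" S] fS s by auto
  have "card {s..<k} = card ({..<k} - S)" using S fS s by (simp add: card_Diff_subset)
  then obtain g where g: "bij_betw g {s..<k} ({..<k} - S)"
    using finite_same_card_bij[of "{s..<k}" "{..<k} - S"] by auto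
  define p where "p j = (if j < s then f j else if j < k then g j else j)" for j
  have pf: "bij_betw p {..<s} S" using f by (rule bij_betw_cong[THEN iffD1, rotated]) (simp add: p_def)
  have pg: "bij_betw p {s..<k} ({..<k} - S)" using g by (rule bij_betw_cong[THEN iffD1, rotated]) (simp add: p_def)
  have "bij_betw p ({..<s} \<union> {s..<k}) (S \<union> ({..<k} - S))"
    using pf pg by (rule bij_betw_combine) auto
  moreover have "{..<s} \<union> {s..<k} = {..<k}" "S \<union> ({..<k} - S) = {..<k}" using sk S by auto
  ultimately have "bij_betw p {..<k} {..<k}" by simp
  hence "p permutes {..<k}" by (rule bij_imp_permutes) (use sk in \<open>auto simp: p_def\<close>)
  moreover have "p j \<in> S \<longleftrightarrow> j < s" if "j < k" for j
    using bij_betwE[OF pf] bij_betwE[OF pg] that by (cases "j < s") force+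
  ultimately show ?thesis by blast
qed

section \<open>Multiplication by a strictly triangular kernel\<close>

definition kmult :: "'a measure \<Rightarrow> ('a \<Rightarrow> 'a \<Rightarrow> complex) \<Rightarrow> ('a \<Rightarrow> 'a \<Rightarrow> complex) \<Rightarrow> 'a \<Rightarrow> 'a \<Rightarrow> complex" where
  "kmult M K N x y = (\<integral>z. K x z * N z y \<partial>M)"

lemma dominated_mono: "dominated M w K \<Longrightarrow> integrable M w' \<Longrightarrow> (\<And>x. x \<in> space M \<Longrightarrow> w x \<le> w' x) \<Longrightarrow> dominated M w' K"
  unfolding dominated_def by (meson order_trans)

lemma dominated_add:
  "dominated M w K \<Longrightarrow> dominated M w' K' \<Longrightarrow> dominated M (\<lambda>x. w x + w' x) (\<lambda>x y. K x y + K' x y)"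
  unfolding dominated_def
  by (auto simp: case_prod_beta intro!: borel_measurable_add order_trans[OF norm_triangle_ineq] add_mono)

lemma kmult_measurable:
  assumes "sigma_finite_measure M" "(\<lambda>(x, y). K x y) \<in> borel_measurable (M \<Otimes>\<^sub>M M)"
    "(\<lambda>(x, y). N x y) \<in> borel_measurable (M \<Otimes>\<^sub>M M)"
  shows "(\<lambda>(x, y). kmult M K N x y) \<in> borel_measurable (M \<Otimes>\<^sub>M M)"
proof -
  interpret sigma_finite_measure M by fact
  have "(\<lambda>p. (fst (fst p), snd p)) \<in> measurable ((M \<Otimes>\<^sub>M M) \<Otimes>\<^sub>M M) (M \<Otimes>\<^sub>M M)" by measurable
  from measurable_compose[OF this assms(2)]
  have 1: "(\<lambda>p. K (fst (fst p)) (snd p)) \<in> borel_measurable ((M \<Otimes>\<^sub>M M) \<Otimes>\<^sub>M M)" by simp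
  have "(\<lambda>p. (snd p, snd (fst p))) \<in> measurable ((M \<Otimes>\<^sub>M M) \<Otimes>\<^sub>M M) (M \<Otimes>\<^sub>M M)" by measurable
  from measurable_compose[OF this assms(3)]
  have 2: "(\<lambda>p. N (snd p) (snd (fst p))) \<in> borel_measurable ((M \<Otimes>\<^sub>M M) \<Otimes>\<^sub>M M)" by simp
  have "(\<lambda>q. \<integral>z. K (fst q) z * N z (snd q) \<partial>M) \<in> borel_measurable (M \<Otimes>\<^sub>M M)"
    by (rule borel_measurable_lebesgue_integral) (use 1 2 in \<open>simp add: case_prod_beta\<close>)
  then show ?thesis by (simp add: kmult_def case_prod_beta)
qed

lemma kernel_sections:
  assumes "(\<lambda>(x, y). K x y) \<in> borel_measurable (M \<Otimes>\<^sub>M N)"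
  shows "x \<in> space M \<Longrightarrow> (\<lambda>y. K x y) \<in> borel_measurable N"
    and "y \<in> space N \<Longrightarrow> (\<lambda>x. K x y) \<in> borel_measurable M"
  using measurable_compose[OF _ assms, of "\<lambda>y. (x, y)" N] measurable_compose[OF _ assms, of "\<lambda>x. (x, y)" M] by auto

lemma kmult_integrable:
  assumes K: "dominated M w K" and N: "dominated M v N" and x: "x \<in> space M" and y: "y \<in> space M"
  shows "integrable M (\<lambda>z. K x z * N z y)" "norm (kmult M K N x y) \<le> w x * integral\<^sup>L M v"
proof -
  note D = K[unfolded dominated_def] N[unfolded dominated_def]
  have I: "integrable M (\<lambda>z. w x * v z)" using D by simp
  have b: "norm (K x z * N z y) \<le> w x * v z" if "z \<in> space M" for z
    unfolding norm_mult using D x y that by (intro mult_mono) auto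
  show int: "integrable M (\<lambda>z. K x z * N z y)"
  proof (rule Bochner_Integration.integrable_bound[OF I])
    show "(\<lambda>z. K x z * N z y) \<in> borel_measurable M"
      using D x y kernel_sections[of K M M] kernel_sections[of N M M] by auto
    show "AE z in M. norm (K x z * N z y) \<le> norm (w x * v z)"
      using b by (intro AE_I2) (auto intro: order_trans[OF _ abs_ge_self])
  qed
  have "norm (kmult M K N x y) \<le> (\<integral>z. w x * v z \<partial>M)"
    unfolding kmult_def using int I b
    by (intro order_trans[OF Bochner_Integration.integral_norm_bound Bochner_Integration.integral_mono]) auto
  then show "norm (kmult M K N x y) \<le> w x * integral\<^sup>L M v" by simp
qed

lemma dominated_kmult:
  assumes sf: "sigma_finite_measure M" and K: "dominated M w K" and N: "dominated M v N"
  shows "dominated M (\<lambda>x. w x * integral\<^sup>L M v) (kmult M K N)"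
proof -
  have "0 \<le> integral\<^sup>L M v" using N by (intro Bochner_Integration.integral_nonneg) (auto simp: dominated_def)
  then show ?thesis
    using kmult_integrable(2)[OF K N] kmult_measurable[OF sf] K N by (auto simp: dominated_def)
qed

text \<open>
  \<open>det ((I + K)(I + N)) = det (I + K)\<close> if \<open>N\<close> maps one set of coordinates to a disjoint one. With
  \<open>P = N + K N\<close>, expand the columns of \<open>K + P\<close>; the integral \<open>a s k\<close> of the determinants with \<open>s\<close> columns
  from \<open>P\<close> and \<open>k - s\<close> columns from \<open>K\<close> satisfies \<open>a s k = c s k - (k - s) c s (k - 1)\<close>, because expanding
  a column \<open>N(\<cdot>, x\<^sub>0)\<close> and integrating out the row variable turns \<open>K\<close> into \<open>K N\<close>. Hence the series telescope.
\<close>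

context
  fixes M :: "'a measure" and K N :: "'a \<Rightarrow> 'a \<Rightarrow> complex" and w :: "'a \<Rightarrow> real" and E1 E2 :: "'a set"
  assumes sf: "sigma_finite_measure M"
    and K: "dominated M w K" and N: "dominated M w N"
    and disj: "E1 \<inter> E2 = {}"
    and supp: "\<And>x y. N x y \<noteq> 0 \<Longrightarrow> x \<in> E1 \<and> y \<in> E2"
begin

interpretation product_sigma_finite "\<lambda>_::nat. M"
  using sf by (simp add: product_sigma_finite_def)

private abbreviation "KN \<equiv> kmult M K N"
private abbreviation "P \<equiv> (\<lambda>x y. N x y + KN x y)"
private abbreviation "PI k \<equiv> (\<Pi>\<^sub>M i\<in>{..<k::nat}. M)"

private definition v :: "'a \<Rightarrow> real" where "v x = w x + w x * integral\<^sup>L M w"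

private lemma v: "integrable M v" "\<And>x. x \<in> space M \<Longrightarrow> 0 \<le> v x"
  and dK: "dominated M v K" and dN: "dominated M v N" and dKN: "dominated M v KN" and dP: "dominated M v P"
proof -
  have W: "0 \<le> integral\<^sup>L M w" using K by (intro Bochner_Integration.integral_nonneg) (auto simp: dominated_def)
  show v1: "integrable M v" using K by (auto simp: v_def[abs_def] dominated_def)
  have w0: "0 \<le> w x" if "x \<in> space M" for x using K that by (auto simp: dominated_def)
  show "0 \<le> v x" if "x \<in> space M" for x using w0[OF that] W by (simp add: v_def)
  show "dominated M v K" "dominated M v N"
    using dominated_mono[OF K v1] dominated_mono[OF N v1] w0 W by (simp_all add: v_def)
  show "dominated M v KN"
    using dominated_mono[OF dominated_kmult[OF sf K N] v1] w0 W by (simp add: v_def)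
  show "dominated M v P"
    using dominated_add[OF N dominated_kmult[OF sf K N]] by (simp add: v_def[abs_def])
qed

private lemma P_zero: "y \<notin> E2 \<Longrightarrow> P x y = 0"
proof -
  assume "y \<notin> E2"
  hence "N z y = 0" for z using supp by blast
  then show "P x y = 0" by (simp add: kmult_def)
qed

private lemma meas:
  assumes "dominated M v H" "i < k" "j < k"
  shows "(\<lambda>x. H (x i) (x j)) \<in> borel_measurable (PI k)"
  using assms by (intro kernel_entry_measurable[OF sf]) (auto simp: dominated_def)

private lemma bnd:
  assumes "dominated M v H" "i < k" "j < k" "x \<in> space (PI k)"
  shows "norm (H (x i) (x j)) \<le> v (x i)"
  using assms by (auto simp: dominated_def space_PiM)

private definition am :: "nat \<Rightarrow> nat \<Rightarrow> (nat \<Rightarrow> 'a) \<Rightarrow> complex" where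
  "am s k x = dt k (\<lambda>i j. if j < s then P (x i) (x j) else K (x i) (x j))"

private definition cm :: "nat \<Rightarrow> nat \<Rightarrow> (nat \<Rightarrow> 'a) \<Rightarrow> complex" where
  "cm s k x = dt k (\<lambda>i j. if j = 0 then KN (x i) (x j) else if j < s then P (x i) (x j) else K (x i) (x j))"

text \<open>Column 0 of \<open>am\<close> is a sum of a column from \<open>KN\<close> and a column
  from \<open>N\<close>. The second is split further into single entries, one for each row
  \<open>l\<close>, because integrating out \<open>x l\<close> has a different effect for different
  \<open>l\<close>.\<close>

private definition tm :: "nat \<Rightarrow> nat \<Rightarrow> nat \<Rightarrow> (nat \<Rightarrow> 'a) \<Rightarrow> complex" where
  "tm l s k x = dt k (\<lambda>i j. if j = 0 then (if i = l then N (x i) (x j) else 0)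
     else if j < s then P (x i) (x j) else K (x i) (x j))"

private lemma int_am: "integrable (PI k) (am s k)"
  and bd_am: "norm (integral\<^sup>L (PI k) (am s k)) \<le> sqrt (real k ^ k) * integral\<^sup>L M v ^ k"
proof -
  have m: "(\<lambda>x. if j < s then P (x i) (x j) else K (x i) (x j)) \<in> borel_measurable (PI k)"
    if "i < k" "j < k" for i j using meas[OF dP that] meas[OF dK that] by (cases "j < s") auto
  have b: "norm (if j < s then P (x i) (x j) else K (x i) (x j)) \<le> v (x i)"
    if "i < k" "j < k" "x \<in> space (PI k)" for i j x using bnd[OF dP that] bnd[OF dK that] by simp
  note I = dt_integrable[OF sf, of k "\<lambda>i j x. if j < s then P (x i) (x j) else K (x i) (x j)" v, OF m b v]
  show "integrable (PI k) (am s k)"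
    unfolding am_def[abs_def] by (rule I(1); assumption)
  show "norm (integral\<^sup>L (PI k) (am s k)) \<le> sqrt (real k ^ k) * integral\<^sup>L M v ^ k"
    unfolding am_def[abs_def] by (rule I(2); assumption)
qed

private lemma int_cm: "integrable (PI k) (cm s k)"
  and bd_cm: "norm (integral\<^sup>L (PI k) (cm s k)) \<le> sqrt (real k ^ k) * integral\<^sup>L M v ^ k"
proof -
  have m: "(\<lambda>x. if j = 0 then KN (x i) (x j) else if j < s then P (x i) (x j) else K (x i) (x j))
      \<in> borel_measurable (PI k)"
    if "i < k" "j < k" for i j using meas[OF dP that] meas[OF dK that] meas[OF dKN that]
    by (cases "j = 0"; cases "j < s") auto
  have b: "norm (if j = 0 then KN (x i) (x j) else if j < s then P (x i) (x j) else K (x i) (x j)) \<le> v (x i)"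
    if "i < k" "j < k" "x \<in> space (PI k)" for i j x
    using bnd[OF dP that] bnd[OF dK that] bnd[OF dKN that] by (cases "j = 0"; cases "j < s") simp_all
  note I = dt_integrable[OF sf, of k
      "\<lambda>i j x. if j = 0 then KN (x i) (x j) else if j < s then P (x i) (x j) else K (x i) (x j)" v, OF m b v]
  show "integrable (PI k) (cm s k)"
    unfolding cm_def[abs_def] by (rule I(1); assumption)
  show "norm (integral\<^sup>L (PI k) (cm s k)) \<le> sqrt (real k ^ k) * integral\<^sup>L M v ^ k"
    unfolding cm_def[abs_def] by (rule I(2); assumption)
qed

private lemma int_tm: "integrable (PI k) (tm l s k)"
proof -
  have m: "(\<lambda>x. if j = 0 then (if i = l then N (x i) (x j) else 0)
     else if j < s then P (x i) (x j) else K (x i) (x j)) \<in> borel_measurable (PI k)"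
    if "i < k" "j < k" for i j using meas[OF dP that] meas[OF dK that] meas[OF dN that]
    by (cases "j = 0"; cases "j < s"; cases "i = l") auto
  have b: "norm (if j = 0 then (if i = l then N (x i) (x j) else 0)
     else if j < s then P (x i) (x j) else K (x i) (x j)) \<le> v (x i)"
    if "i < k" "j < k" "x \<in> space (PI k)" for i j x
  proof -
    have "0 \<le> v (x i)" using that v(2) by (auto simp: space_PiM)
    then show ?thesis using bnd[OF dP that] bnd[OF dK that] bnd[OF dN that]
      by (cases "j = 0"; cases "j < s"; cases "i = l") simp_all
  qed
  show ?thesis
    unfolding tm_def[abs_def]
    by (rule dt_integrable(1)[OF sf, of k "\<lambda>i j x. if j = 0 then (if i = l then N (x i) (x j) else 0)
     else if j < s then P (x i) (x j) else K (x i) (x j)" v, OF m b v])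
qed

text \<open>A relabelling of the variables moves the columns in \<open>S\<close> to the front. It
  preserves the product measure, and it permutes rows and columns of the determinant
  simultaneously.\<close>

private lemma symmetrize:
  assumes S: "S \<subseteq> {..<k}"
  shows "integrable (PI k) (\<lambda>x. dt k (\<lambda>i j. if j \<in> S then P (x i) (x j) else K (x i) (x j)))"
    and "(\<integral>x. dt k (\<lambda>i j. if j \<in> S then P (x i) (x j) else K (x i) (x j)) \<partial>PI k) = integral\<^sup>L (PI k) (am (card S) k)"
proof -
  let ?F = "\<lambda>x. dt k (\<lambda>i j. if j \<in> S then P (x i) (x j) else K (x i) (x j))"
  have m: "(\<lambda>x. if j \<in> S then P (x i) (x j) else K (x i) (x j)) \<in> borel_measurable (PI k)"
    if "i < k" "j < k" for i j using meas[OF dP that] meas[OF dK that] by (cases "j \<in> S") auto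
  have b: "norm (if j \<in> S then P (x i) (x j) else K (x i) (x j)) \<le> v (x i)"
    if "i < k" "j < k" "x \<in> space (PI k)" for i j x using bnd[OF dP that] bnd[OF dK that] by simp
  show int: "integrable (PI k) ?F"
    by (rule dt_integrable(1)[OF sf, of k "\<lambda>i j x. if j \<in> S then P (x i) (x j) else K (x i) (x j)" v, OF m b v])
  obtain p where p: "p permutes {..<k}" "\<And>j. j < k \<Longrightarrow> p j \<in> S \<longleftrightarrow> j < card S"
    using ex_permutes_initial[OF S refl] by blast
  have pk: "p i < k" if "i < k" for i using permutes_in_image[OF p(1), of i] that by simp
  have "integral\<^sup>L (PI k) (am (card S) k) = (\<integral>x. am (card S) k (\<lambda>i\<in>{..<k}. x (p i)) \<partial>PI k)"
    using int_am by (intro PiM_integral_permute[OF sf p(1), symmetric]) auto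
  also have "\<dots> = integral\<^sup>L (PI k) ?F"
  proof (rule Bochner_Integration.integral_cong[OF refl])
    fix x
    have "am (card S) k (\<lambda>i\<in>{..<k}. x (p i)) =
        dt k (\<lambda>i j. if p j \<in> S then P (x (p i)) (x (p j)) else K (x (p i)) (x (p j)))"
      unfolding am_def by (intro dt_cong) (simp add: p(2))
    also have "\<dots> = ?F x" by (rule dt_permute[OF p(1)])
    finally show "am (card S) k (\<lambda>i\<in>{..<k}. x (p i)) = ?F x" .
  qed
  finally show "(\<integral>x. ?F x \<partial>PI k) = integral\<^sup>L (PI k) (am (card S) k)" by simp
qed

text \<open>The column sets are grouped by their size. The number of sets of size \<open>s\<close>,
  divided by \<open>k!\<close>, is the coefficient 1 / (s! (k - s)!), and the empty set gives the
  term of \<open>K\<close>.\<close>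

private lemma fterm_add:
  "fterm M (\<lambda>x y. K x y + P x y) k =
     fterm M K k + (\<Sum>s=1..k. integral\<^sup>L (PI k) (am s k) / (fact s * fact (k - s)))"
proof -
  have "dt k (\<lambda>i j. K (x i) (x j) + P (x i) (x j)) =
      (\<Sum>S\<in>Pow {..<k}. dt k (\<lambda>i j. if j \<in> S then P (x i) (x j) else K (x i) (x j)))" for x
    using dt_add_columns[of k "\<lambda>i j. P (x i) (x j)" "\<lambda>i j. K (x i) (x j)"] by (simp add: add.commute)
  hence "(\<integral>x. dt k (\<lambda>i j. K (x i) (x j) + P (x i) (x j)) \<partial>PI k) =
      (\<Sum>S\<in>Pow {..<k}. integral\<^sup>L (PI k) (am (card S) k))"
    using symmetrize by (simp add: Bochner_Integration.integral_sum)
  also have "\<dots> = (\<Sum>s\<in>{0..k}. \<Sum>S\<in>{S\<in>Pow {..<k}. card S = s}. integral\<^sup>L (PI k) (am (card S) k))"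
  proof (rule sum.group[symmetric])
    show "card ` Pow {..<k} \<subseteq> {0..k}" using card_mono[of "{..<k}"] by fastforce
  qed auto
  also have "\<dots> = (\<Sum>s\<in>{0..k}. of_nat (k choose s) * integral\<^sup>L (PI k) (am s k))"
  proof (rule sum.cong[OF refl])
    fix s
    have "card {S. S \<subseteq> {..<k} \<and> card S = s} = k choose s" using n_subsets[of "{..<k}" s] by simp
    then show "(\<Sum>S\<in>{S\<in>Pow {..<k}. card S = s}. integral\<^sup>L (PI k) (am (card S) k)) =
        of_nat (k choose s) * integral\<^sup>L (PI k) (am s k)" by simp
  qed
  finally have "fterm M (\<lambda>x y. K x y + P x y) k =
      (\<Sum>s\<in>{0..k}. of_nat (k choose s) / fact k * integral\<^sup>L (PI k) (am s k))"
    by (simp add: fterm_def sum_divide_distrib)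
  also have "\<dots> = (\<Sum>s\<in>{0..k}. integral\<^sup>L (PI k) (am s k) / (fact s * fact (k - s)))"
    by (intro sum.cong refl) (simp add: binomial_fact)
  also have "\<dots> = integral\<^sup>L (PI k) (am 0 k) / fact k + (\<Sum>s=1..k. integral\<^sup>L (PI k) (am s k) / (fact s * fact (k - s)))"
    by (subst sum.atLeast_Suc_atMost) auto
  also have "integral\<^sup>L (PI k) (am 0 k) / fact k = fterm M K k"
    by (simp add: fterm_def am_def[abs_def])
  finally show ?thesis .
qed

private lemma am_split:
  assumes s: "1 \<le> s" "s \<le> k"
  shows "am s k x = cm s k x + (\<Sum>l<k. tm l s k x)"
proof -
  let ?c = "\<lambda>i. (-1) ^ (i + 0) * dt (k - 1) (\<lambda>a b. if Suc b < s then P (x (skip i a)) (x (Suc b)) else K (x (skip i a)) (x (Suc b)))"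
  have k: "0 < k" using s by simp
  have "am s k x = (\<Sum>i<k. P (x i) (x 0) * ?c i)"
    unfolding am_def by (subst dt_laplace[OF k], unfold skip_0) (use s in simp)
  moreover have "cm s k x = (\<Sum>i<k. KN (x i) (x 0) * ?c i)"
    unfolding cm_def by (subst dt_laplace[OF k], unfold skip_0) (use s in simp)
  moreover have "tm l s k x = N (x l) (x 0) * ?c l" if l: "l < k" for l
  proof -
    have "tm l s k x = (\<Sum>i<k. (if i = l then N (x i) (x 0) else 0) * ?c i)"
      unfolding tm_def by (subst dt_laplace[OF k], unfold skip_0) (use s in simp)
    also have "\<dots> = (\<Sum>i<k. if i = l then N (x i) (x 0) * ?c i else 0)"
      by (intro sum.cong) auto
    also have "\<dots> = N (x l) (x 0) * ?c l" using l by (subst sum.delta) auto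
    finally show ?thesis .
  qed
  ultimately show ?thesis by (simp add: distrib_right sum.distrib)
qed

text \<open>For \<open>l = 0\<close> the only entry of column 0 is \<open>N (x 0) (x 0)\<close>,
  which vanishes because \<open>E1\<close> and \<open>E2\<close> are disjoint. For other
  \<open>l\<close>, a nonzero entry puts \<open>x l\<close> into \<open>E1\<close>, hence outside
  \<open>E2\<close>; then column \<open>l\<close>, which still comes from \<open>P\<close>, is
  zero.\<close>

private lemma tm_zero:
  assumes "1 \<le> s" "l < s" "s \<le> k"
  shows "tm l s k x = 0"
proof (cases "l = 0 \<or> N (x l) (x 0) = 0")
  case True
  moreover have "N (x 0) (x 0) = 0" using supp[of "x 0" "x 0"] disj by auto
  ultimately have "N (x l) (x 0) = 0" by auto
  then show ?thesis unfolding tm_def using assms by (intro dt_zero_col[of 0]) auto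
next
  case False
  hence "x l \<notin> E2" using supp[of "x l" "x 0"] disj by auto
  then show ?thesis unfolding tm_def using assms False P_zero by (intro dt_zero_col[of l]) auto
qed

text \<open>The indices \<open>l\<close> and \<open>k - 1\<close> both belong to columns from
  \<open>K\<close> and both differ from 0, so exchanging the two variables changes nothing but the
  row in which the entry of \<open>N\<close> stands.\<close>

private lemma tm_swap:
  assumes "1 \<le> s" "s \<le> l" "l < k"
  shows "integral\<^sup>L (PI k) (tm l s k) = integral\<^sup>L (PI k) (tm (k - 1) s k)"
proof -
  let ?p = "Transposition.transpose l (k - 1)"
  have p: "?p permutes {..<k}" using assms by (intro permutes_swap_id) auto
  have pk: "?p i < k" if "i < k" for i using permutes_in_image[OF p, of i] that by simp
  have "integral\<^sup>L (PI k) (tm (k - 1) s k) = (\<integral>x. tm (k - 1) s k (\<lambda>i\<in>{..<k}. x (?p i)) \<partial>PI k)"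
    using int_tm by (intro PiM_integral_permute[OF sf p, symmetric]) auto
  also have "\<dots> = integral\<^sup>L (PI k) (tm l s k)"
  proof (rule Bochner_Integration.integral_cong[OF refl])
    fix x
    let ?f = "\<lambda>i j. if j = 0 then (if i = l then N (x i) (x j) else 0)
       else if j < s then P (x i) (x j) else K (x i) (x j)"
    have p0: "?p 0 = 0" using assms by (simp add: Transposition.transpose_def)
    have pz: "?p j = 0 \<longleftrightarrow> j = 0" for j using assms by (auto simp: Transposition.transpose_def split: if_splits)
    have pl: "?p i = l \<longleftrightarrow> i = k - 1" for i by (auto simp: Transposition.transpose_def split: if_splits)
    have ps: "?p j < s \<longleftrightarrow> j < s" for j using assms by (auto simp: Transposition.transpose_def split: if_splits)
    have "tm (k - 1) s k (\<lambda>i\<in>{..<k}. x (?p i)) = dt k (\<lambda>i j. ?f (?p i) (?p j))"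
      unfolding tm_def pz pl ps by (intro dt_cong) auto
    also have "\<dots> = tm l s k x" unfolding tm_def by (rule dt_permute[OF p])
    finally show "tm (k - 1) s k (\<lambda>i\<in>{..<k}. x (?p i)) = tm l s k x" .
  qed
  finally show ?thesis by simp
qed

text \<open>Expanding along column 0 leaves the entry \<open>N (x n) (x 0)\<close> and a minor
  without row \<open>n\<close>. In this minor \<open>x n\<close> occurs only in the last column, as
  \<open>K (x a) (x n)\<close>; expanding along that column and integrating over \<open>x n\<close>
  composes the two kernels to \<open>KN (x a) (x 0)\<close>. The result is the expansion of
  \<open>cm\<close> of one order less.\<close>

private lemma tm_last:
  assumes s: "1 \<le> s" "s \<le> n"
  shows "integral\<^sup>L (PI (Suc n)) (tm n s (Suc n)) = - integral\<^sup>L (PI n) (cm s n)"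
proof -
  define G where "G x a b = (if Suc b < s then P (x a) (x (Suc b)) else K (x a) (x (Suc b)))" for x a b
  define D where "D x a = dt (n - 1) (\<lambda>a' b'. G x (skip a a') b')" for x :: "nat \<Rightarrow> 'a" and a
  have n: "0 < n" using s by simp
  have tmx: "tm n s (Suc n) x = - (\<Sum>a<n. N (x n) (x 0) * K (x a) (x n) * ((-1) ^ a * D x a))" for x
  proof -
    have "tm n s (Suc n) x = (\<Sum>i<Suc n. (if i = n then N (x i) (x 0) else 0) *
        ((-1) ^ i * dt n (\<lambda>a b. G x (skip i a) b)))"
      unfolding tm_def by (subst dt_laplace[of 0], simp, unfold skip_0 G_def) (use s in simp)
    also have "\<dots> = N (x n) (x 0) * ((-1) ^ n * dt n (\<lambda>a b. G x (skip n a) b))"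
      by simp
    also have "dt n (\<lambda>a b. G x (skip n a) b) = dt n (\<lambda>a b. G x a b)"
      by (intro dt_cong) (simp add: skip_def)
    also have "\<dots> = (\<Sum>a<n. G x a (n - 1) * ((-1) ^ (a + (n - 1)) * dt (n - 1) (\<lambda>a' b'. G x (skip a a') (skip (n - 1) b'))))"
      using n by (intro dt_laplace) auto
    also have "\<dots> = (\<Sum>a<n. K (x a) (x n) * ((-1) ^ (a + (n - 1)) * D x a))"
      unfolding D_def using s by (intro sum.cong refl arg_cong2[where f = "(*)"] dt_cong) (auto simp: G_def skip_def)
    also have "N (x n) (x 0) * ((-1) ^ n * \<dots>) = - (\<Sum>a<n. N (x n) (x 0) * K (x a) (x n) * ((-1) ^ a * D x a))"
    proof -
      \<comment> \<open>The exponents add up to \<open>a\<close> plus the odd number 2 n - 1. This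
        is the origin of the minus sign that makes the series telescope.\<close>
      have e: "(-1) ^ n * (-1) ^ (a + (n - 1)) = - ((-1 :: complex) ^ a)" for a
      proof -
        have "(-1) ^ n * (-1) ^ (a + (n - 1)) = (-1 :: complex) ^ a * (-1) ^ (n + (n - 1))"
          by (simp only: power_add mult_ac)
        also have "(-1 :: complex) ^ (n + (n - 1)) = -1" using n by (intro neg_one_odd_power) auto
        finally show ?thesis by simp
      qed
      have "N (x n) (x 0) * ((-1) ^ n * (K (x a) (x n) * ((-1) ^ (a + (n - 1)) * D x a))) =
          - (N (x n) (x 0) * K (x a) (x n) * ((-1) ^ a * D x a))" for a
      proof -
        have "N (x n) (x 0) * ((-1) ^ n * (K (x a) (x n) * ((-1) ^ (a + (n - 1)) * D x a))) =
            N (x n) (x 0) * K (x a) (x n) * D x a * ((-1) ^ n * (-1) ^ (a + (n - 1)))" by (simp only: mult_ac)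
        then show ?thesis unfolding e by (simp add: mult_ac)
      qed
      then show ?thesis by (simp only: sum_distrib_left sum_negf)
    qed
    finally show ?thesis .
  qed
  have cmx: "cm s n x = (\<Sum>a<n. KN (x a) (x 0) * ((-1) ^ a * D x a))" for x
    unfolding cm_def D_def by (subst dt_laplace[OF n], unfold skip_0 G_def) (use s in simp)
  have Dupd: "D (x(n := y)) a = D x a" if "a < n" for x y a
    unfolding D_def using that by (intro dt_cong) (auto simp: G_def skip_def)
  have "integral\<^sup>L (PI (Suc n)) (tm n s (Suc n)) = (\<integral>x. (\<integral>y. tm n s (Suc n) (x(n := y)) \<partial>M) \<partial>PI n)"
    unfolding lessThan_Suc by (rule product_integral_insert) (use int_tm[of "Suc n"] in \<open>auto simp: lessThan_Suc\<close>)
  also have "\<dots> = (\<integral>x. - cm s n x \<partial>PI n)"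
  proof (rule Bochner_Integration.integral_cong[OF refl])
    fix x assume x: "x \<in> space (PI n)"
    hence xm: "x a \<in> space M" if "a < n" for a using that by (auto simp: space_PiM)
    have int: "integrable M (\<lambda>y. K (x a) y * N y (x 0))" if "a < n" for a
      by (rule kmult_integrable[OF dK dN xm[OF that] xm[OF n]])
    have "(\<integral>y. tm n s (Suc n) (x(n := y)) \<partial>M) =
        (\<integral>y. - (\<Sum>a<n. (K (x a) y * N y (x 0)) * ((-1) ^ a * D x a)) \<partial>M)"
      unfolding tmx using n Dupd by (intro Bochner_Integration.integral_cong refl arg_cong[where f = uminus] sum.cong) (auto simp: mult_ac)
    also have "\<dots> = - (\<Sum>a<n. (\<integral>y. K (x a) y * N y (x 0) \<partial>M) * ((-1) ^ a * D x a))"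
      using int by (subst Bochner_Integration.integral_minus, subst Bochner_Integration.integral_sum) auto
    also have "\<dots> = - cm s n x" unfolding cmx by (simp add: kmult_def)
    finally show "(\<integral>y. tm n s (Suc n) (x(n := y)) \<partial>M) = - cm s n x" .
  qed
  finally show ?thesis by simp
qed

private lemma am_telescope:
  assumes s: "1 \<le> s" "s \<le> Suc n"
  shows "integral\<^sup>L (PI (Suc n)) (am s (Suc n)) =
    integral\<^sup>L (PI (Suc n)) (cm s (Suc n)) - of_nat (Suc n - s) * integral\<^sup>L (PI n) (cm s n)"
proof -
  have "integral\<^sup>L (PI (Suc n)) (am s (Suc n)) = (\<integral>x. cm s (Suc n) x + (\<Sum>l<Suc n. tm l s (Suc n) x) \<partial>PI (Suc n))"
    using s by (intro Bochner_Integration.integral_cong refl am_split) auto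
  also have "\<dots> = integral\<^sup>L (PI (Suc n)) (cm s (Suc n)) + (\<Sum>l<Suc n. integral\<^sup>L (PI (Suc n)) (tm l s (Suc n)))"
    by (subst Bochner_Integration.integral_add, rule int_cm, rule Bochner_Integration.integrable_sum, rule int_tm)
       (subst Bochner_Integration.integral_sum, rule int_tm, rule refl)
  also have "(\<Sum>l<Suc n. integral\<^sup>L (PI (Suc n)) (tm l s (Suc n))) =
      (\<Sum>l<Suc n. if l < s then 0 else - integral\<^sup>L (PI n) (cm s n))"
  proof (rule sum.cong[OF refl])
    fix l assume l: "l \<in> {..<Suc n}"
    show "integral\<^sup>L (PI (Suc n)) (tm l s (Suc n)) = (if l < s then 0 else - integral\<^sup>L (PI n) (cm s n))"
    proof (cases "l < s")
      case True
      have "tm l s (Suc n) = (\<lambda>_. 0)" by (rule ext) (rule tm_zero[OF s(1) True s(2)])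
      then show ?thesis using True by simp
    next
      case False
      then show ?thesis using tm_swap[of s l "Suc n"] tm_last[of s n] s l by simp
    qed
  qed
  also have "\<dots> = (\<Sum>l\<in>{s..<Suc n}. - integral\<^sup>L (PI n) (cm s n))"
    by (intro sum.mono_neutral_cong_right) auto
  also have "\<dots> = - (of_nat (Suc n - s) * integral\<^sup>L (PI n) (cm s n))" by simp
  finally show ?thesis by simp
qed

text \<open>In \<open>am_telescope\<close> the factor n + 1 - s cancels one factor of (n + 1 - s)!,
  so the subtracted part at order n + 1 is exactly the remainder left at order \<open>n\<close>.
  Only the last remainder survives.\<close>

private lemma partial_sums:
  "(\<Sum>k\<le>n. fterm M (\<lambda>x y. K x y + P x y) k - fterm M K k) =
     (\<Sum>s=1..n. integral\<^sup>L (PI n) (cm s n) / (fact s * fact (n - s)))"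
proof (induction n)
  case 0
  show ?case by (simp add: fterm_add)
next
  case (Suc n)
  have "(\<Sum>k\<le>Suc n. fterm M (\<lambda>x y. K x y + P x y) k - fterm M K k) =
      (\<Sum>s=1..n. integral\<^sup>L (PI n) (cm s n) / (fact s * fact (n - s))) +
      (\<Sum>s=1..Suc n. integral\<^sup>L (PI (Suc n)) (am s (Suc n)) / (fact s * fact (Suc n - s)))"
    unfolding sum.atMost_Suc Suc.IH by (subst fterm_add) (simp only: add_diff_cancel_left')
  also have "(\<Sum>s=1..Suc n. integral\<^sup>L (PI (Suc n)) (am s (Suc n)) / (fact s * fact (Suc n - s))) =
      (\<Sum>s=1..Suc n. integral\<^sup>L (PI (Suc n)) (cm s (Suc n)) / (fact s * fact (Suc n - s)) -
         of_nat (Suc n - s) * integral\<^sup>L (PI n) (cm s n) / (fact s * fact (Suc n - s)))"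
  proof (rule sum.cong[OF refl])
    fix s assume "s \<in> {1..Suc n}"
    hence "1 \<le> s" "s \<le> Suc n" by auto
    then show "integral\<^sup>L (PI (Suc n)) (am s (Suc n)) / (fact s * fact (Suc n - s)) =
        integral\<^sup>L (PI (Suc n)) (cm s (Suc n)) / (fact s * fact (Suc n - s)) -
         of_nat (Suc n - s) * integral\<^sup>L (PI n) (cm s n) / (fact s * fact (Suc n - s))"
      by (subst am_telescope) (simp_all only: diff_divide_distrib)
  qed
  also have "\<dots> = (\<Sum>s=1..Suc n. integral\<^sup>L (PI (Suc n)) (cm s (Suc n)) / (fact s * fact (Suc n - s))) -
      (\<Sum>s=1..Suc n. of_nat (Suc n - s) * integral\<^sup>L (PI n) (cm s n) / (fact s * fact (Suc n - s)))"
    by (rule sum_subtractf)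
  also have "(\<Sum>s=1..Suc n. of_nat (Suc n - s) * integral\<^sup>L (PI n) (cm s n) / (fact s * fact (Suc n - s))) =
      (\<Sum>s=1..n. integral\<^sup>L (PI n) (cm s n) / (fact s * fact (n - s)))"
  proof (rule sum.mono_neutral_cong_right)
    show "\<forall>i\<in>{1..Suc n} - {1..n}. of_nat (Suc n - i) * integral\<^sup>L (PI n) (cm i n) / (fact i * fact (Suc n - i)) = 0"
      by (auto simp: le_Suc_eq)
    fix s assume "s \<in> {1..n}"
    hence "Suc n - s = Suc (n - s)" by auto
    then show "of_nat (Suc n - s) * integral\<^sup>L (PI n) (cm s n) / (fact s * fact (Suc n - s)) =
        integral\<^sup>L (PI n) (cm s n) / (fact s * fact (n - s))"
      by (simp add: fact_Suc del: of_nat_Suc)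
  qed auto
  finally have step: "(\<Sum>k\<le>Suc n. fterm M (\<lambda>x y. K x y + P x y) k - fterm M K k) =
      (\<Sum>s=1..n. integral\<^sup>L (PI n) (cm s n) / (fact s * fact (n - s))) +
      ((\<Sum>s=1..Suc n. integral\<^sup>L (PI (Suc n)) (cm s (Suc n)) / (fact s * fact (Suc n - s))) -
       (\<Sum>s=1..n. integral\<^sup>L (PI n) (cm s n) / (fact s * fact (n - s))))" .
  have "a + (b - a) = b" for a b :: complex by simp
  then show ?case unfolding step .
qed

text \<open>The binomial coefficients in the remainder sum to 2^n, so it is at most a term of the
  series in \<open>summable_hadamard\<close> and tends to 0.\<close>

lemma fredholm_mult_triangular:
  "(\<Sum>k. fterm M (\<lambda>x y. K x y + (N x y + kmult M K N x y)) k) = (\<Sum>k. fterm M K k)"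
proof -
  let ?V = "integral\<^sup>L M v"
  have "dominated M (\<lambda>x. v x + v x) (\<lambda>x y. K x y + P x y)" by (rule dominated_add[OF dK dP])
  from fterm_summable[OF sf this] have s1: "summable (fterm M (\<lambda>x y. K x y + P x y))"
    by (rule summable_norm_cancel)
  have s2: "summable (fterm M K)"
    using fterm_summable[OF sf dK] by (rule summable_norm_cancel)
  let ?e = "\<lambda>n. \<Sum>s=1..n. integral\<^sup>L (PI n) (cm s n) / (fact s * fact (n - s))"
  have b: "norm (?e n) \<le> sqrt (real n ^ n) * (2 * ?V) ^ n / fact n" for n
  proof -
    have V0: "0 \<le> ?V" using v by (intro Bochner_Integration.integral_nonneg) auto
    have "norm (?e n) \<le> (\<Sum>s=1..n. sqrt (real n ^ n) * ?V ^ n / (fact s * fact (n - s)))"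
      using bd_cm by (intro sum_norm_le) (simp add: norm_divide norm_mult divide_right_mono)
    also have "\<dots> \<le> (\<Sum>s=0..n. sqrt (real n ^ n) * ?V ^ n / (fact s * fact (n - s)))"
      using V0 by (intro sum_mono2) auto
    also have "\<dots> = (\<Sum>s\<le>n. sqrt (real n ^ n) * ?V ^ n / fact n * (n choose s))"
      unfolding atLeast0AtMost by (intro sum.cong refl) (simp add: binomial_fact)
    also have "\<dots> = sqrt (real n ^ n) * ?V ^ n / fact n * real (\<Sum>s\<le>n. n choose s)"
      by (simp add: sum_distrib_left)
    also have "(\<Sum>s\<le>n. n choose s) = 2 ^ n" by (rule choose_row_sum)
    finally show ?thesis by (simp add: power_mult_distrib mult_ac)
  qed
  have "(\<lambda>n. sqrt (real n ^ n) * (2 * ?V) ^ n / fact n) \<longlonglongrightarrow> 0"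
    by (rule summable_LIMSEQ_zero[OF summable_hadamard])
  hence "?e \<longlonglongrightarrow> 0"
    by (rule Lim_null_comparison[OF always_eventually[OF allI[OF b]]])
  moreover have "(\<lambda>n. \<Sum>k\<le>n. fterm M (\<lambda>x y. K x y + P x y) k - fterm M K k) \<longlonglongrightarrow>
      (\<Sum>k. fterm M (\<lambda>x y. K x y + P x y) k - fterm M K k)"
    using summable_diff[OF s1 s2] by (rule summable_LIMSEQ')
  ultimately have "(\<Sum>k. fterm M (\<lambda>x y. K x y + P x y) k - fterm M K k) = 0"
    unfolding partial_sums by (rule LIMSEQ_unique[rotated])
  then show ?thesis using suminf_diff[OF s1 s2] by simp
qed
end

text \<open>\<open>N\<close> is removed one target level at a time. The columns of level
  \<open>d\<close> form the kernel \<open>H d\<close>, which maps the levels below \<open>d\<close>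
  to level \<open>d\<close>, so the version for two disjoint sets applies. \<open>G d\<close>
  collects the columns of level at least \<open>d\<close> that are still present: \<open>L 0\<close>
  is the full product, and beyond level \<open>m\<close> only \<open>K\<close> is left.\<close>

lemma fredholm_strictly_triangular:
  fixes ty :: "'a \<Rightarrow> nat"
  assumes sf: "sigma_finite_measure M" and K: "dominated M w K" and N: "dominated M w N"
    and ty [measurable]: "ty \<in> measurable M (count_space UNIV)"
    and tri: "\<And>x y. N x y \<noteq> 0 \<Longrightarrow> ty x < ty y" and bd: "\<And>y. ty y \<le> m"
  shows "(\<Sum>k. fterm M (\<lambda>x y. K x y + (N x y + kmult M K N x y)) k) = (\<Sum>k. fterm M K k)"
proof -
  define G where "G d x y = (if d \<le> ty y then N x y else 0)" for d x y
  define H where "H d x y = (if ty y = d then N x y else 0)" for d x y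
  define L where "L d x y = K x y + (G d x y + kmult M K (G d) x y)" for d x y
  have w: "integrable M w" "\<And>x. x \<in> space M \<Longrightarrow> 0 \<le> w x" using K by (auto simp: dominated_def)
  have Nm [measurable]: "(\<lambda>p. N (fst p) (snd p)) \<in> borel_measurable (M \<Otimes>\<^sub>M M)"
    using N unfolding dominated_def case_prod_beta' by blast
  have dG: "dominated M w (G d)" for d
    using N unfolding dominated_def G_def case_prod_beta by auto
  have dH: "dominated M w (H d)" for d
    using N unfolding dominated_def H_def case_prod_beta by auto
  define v where "v x = w x + (w x + w x * integral\<^sup>L M w)" for x
  have W: "0 \<le> integral\<^sup>L M w" using w by (intro Bochner_Integration.integral_nonneg) auto
  have dL: "dominated M v (L d)" for d
    unfolding L_def v_def by (intro dominated_add K dG dominated_kmult[OF sf])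
  have dHv: "dominated M v (H d)" for d
    using dL[of d] w W by (intro dominated_mono[OF dH]) (auto simp: dominated_def v_def)
  have step: "(\<Sum>k. fterm M (L d) k) = (\<Sum>k. fterm M (L (Suc d)) k)" for d
  proof -
    have GS: "G (Suc d) z y = 0" if "ty y = d" for z y using that by (simp add: G_def)
    \<comment> \<open>In front of \<open>H d\<close> the kernel \<open>L (Suc d)\<close> acts like
      \<open>K\<close>: the intermediate point has level below \<open>d\<close>, where every column
      of \<open>G (Suc d)\<close> vanishes. Hence adding the columns of level \<open>d\<close> is
      multiplication of I + \<open>L (Suc d)\<close> by I + \<open>H d\<close>.\<close>
    have L_eq: "L (Suc d) x z * H d z y = K x z * H d z y" for x z y
    proof (cases "H d z y = 0")
      case False
      hence "N z y \<noteq> 0" "ty y = d" by (auto simp: H_def split: if_splits)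
      hence "ty z < d" using tri by blast
      hence "G (Suc d) z' z = 0" for z' by (simp add: G_def)
      then show ?thesis by (simp add: L_def kmult_def)
    qed simp
    have "L d x y = L (Suc d) x y + (H d x y + kmult M (L (Suc d)) (H d) x y)" for x y
    proof (cases "ty y = d")
      case True
      have "kmult M (L (Suc d)) (H d) x y = kmult M K (H d) x y" by (simp only: kmult_def L_eq)
      moreover have "L (Suc d) x y = K x y" using GS[OF True] by (simp add: L_def kmult_def)
      moreover have "G d z y = H d z y" for z using True by (simp add: G_def H_def)
      ultimately show ?thesis by (simp add: L_def kmult_def)
    next
      case False
      hence "H d z y = 0" "G d z y = G (Suc d) z y" for z by (auto simp: H_def G_def)
      then show ?thesis by (simp add: L_def kmult_def)
    qed
    hence "L d = (\<lambda>x y. L (Suc d) x y + (H d x y + kmult M (L (Suc d)) (H d) x y))" by blast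
    moreover have "(\<Sum>k. fterm M (\<lambda>x y. L (Suc d) x y + (H d x y + kmult M (L (Suc d)) (H d) x y)) k) =
        (\<Sum>k. fterm M (L (Suc d)) k)"
    proof (rule fredholm_mult_triangular[OF sf dL dHv, where ?E1.0 = "{x. ty x < d}" and ?E2.0 = "{x. ty x = d}"])
      fix x y assume "H d x y \<noteq> 0"
      hence "N x y \<noteq> 0" "ty y = d" by (auto simp: H_def split: if_splits)
      then show "x \<in> {x. ty x < d} \<and> y \<in> {x. ty x = d}" using tri by blast
    qed auto
    ultimately show ?thesis by simp
  qed
  have "(\<Sum>k. fterm M (L 0) k) = (\<Sum>k. fterm M (L d) k)" for d
  proof (induction d)
    case (Suc d)
    then show ?case using step[of d] by simp
  qed simp
  from this[of "Suc m"] have "(\<Sum>k. fterm M (L 0) k) = (\<Sum>k. fterm M (L (Suc m)) k)" .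
  moreover have "L (Suc m) = K"
  proof (intro ext)
    fix x y
    have "G (Suc m) z y = 0" for z using bd[of y] by (simp add: G_def)
    then show "L (Suc m) x y = K x y" by (simp add: L_def kmult_def)
  qed
  moreover have "L 0 = (\<lambda>x y. K x y + (N x y + kmult M K N x y))"
    by (intro ext) (simp add: L_def G_def[abs_def])
  ultimately show ?thesis by simp
qed

lemma fterm_conjugate:
  assumes c: "\<And>x. c x \<noteq> 0"
  shows "fterm M (\<lambda>x y. c x * K x y / c y) k = fterm M K k"
proof -
  have "dt k (\<lambda>i j. c (x i) * K (x i) (x j) / c (x j)) = dt k (\<lambda>i j. K (x i) (x j))" for x
  proof -
    have "dt k (\<lambda>i j. c (x i) * K (x i) (x j) / c (x j)) = dt k (\<lambda>i j. c (x i) * (K (x i) (x j) * inverse (c (x j))))"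
      by (simp add: field_simps)
    also have "\<dots> = (\<Prod>i<k. c (x i)) * (dt k (\<lambda>i j. K (x i) (x j)) * (\<Prod>i<k. inverse (c (x i))))"
      unfolding dt_scale_rows[where c = "\<lambda>i. c (x i)"] dt_scale_cols[where c = "\<lambda>j. inverse (c (x j))"] ..
    also have "\<dots> = dt k (\<lambda>i j. K (x i) (x j)) * (\<Prod>i<k. c (x i) * inverse (c (x i)))"
      by (simp add: prod.distrib)
    also have "\<dots> = dt k (\<lambda>i j. K (x i) (x j))" using c by simp
    finally show ?thesis .
  qed
  then show ?thesis by (simp add: fterm_def)
qed

lemma fterm_distr:
  assumes sf: "sigma_finite_measure M" and S: "S \<in> measurable M M" and d: "distr M M S = M"
    and K: "(\<lambda>(x, y). K x y) \<in> borel_measurable (M \<Otimes>\<^sub>M M)"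
  shows "fterm M (\<lambda>x y. K (S x) (S y)) k = fterm M K k"
proof -
  interpret product_sigma_finite "\<lambda>_::nat. M"
    using sf by (simp add: product_sigma_finite_def)
  let ?P = "\<Pi>\<^sub>M i\<in>{..<k}. M" and ?T = "\<lambda>x. \<lambda>i\<in>{..<k}. S (x i)"
  have T: "?T \<in> measurable ?P ?P"
    by (intro measurable_restrict measurable_compose[OF _ S] measurable_component_singleton)
  have "distr ?P ?P ?T = ?P"
  proof (rule PiM_eqI)
    fix A assume A: "\<And>i. i \<in> {..<k} \<Longrightarrow> A i \<in> sets M"
    have pre: "?T -` Pi\<^sub>E {..<k} A \<inter> space ?P = Pi\<^sub>E {..<k} (\<lambda>i. S -` A i \<inter> space M)"
      by (auto simp: space_PiM PiE_def Pi_def extensional_def)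
    have sets: "S -` A i \<inter> space M \<in> sets M" if "i \<in> {..<k}" for i
      by (rule measurable_sets[OF S A[OF that]])
    have em: "emeasure M (S -` A i \<inter> space M) = emeasure M (A i)" if "i \<in> {..<k}" for i
      using emeasure_distr[OF S A[OF that]] by (simp add: d)
    have "emeasure (distr ?P ?P ?T) (Pi\<^sub>E {..<k} A) = emeasure ?P (?T -` Pi\<^sub>E {..<k} A \<inter> space ?P)"
      by (intro emeasure_distr[OF T] sets_PiM_I_finite A) auto
    also have "\<dots> = (\<Prod>i\<in>{..<k}. emeasure M (S -` A i \<inter> space M))"
      unfolding pre by (rule emeasure_PiM) (use sets in auto)
    also have "\<dots> = (\<Prod>i\<in>{..<k}. emeasure M (A i))"
      by (rule prod.cong[OF refl em])
    finally show "emeasure (distr ?P ?P ?T) (Pi\<^sub>E {..<k} A) = (\<Prod>i\<in>{..<k}. emeasure M (A i))" .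
  qed auto
  moreover have "(\<lambda>x. dt k (\<lambda>i j. K (x i) (x j))) \<in> borel_measurable ?P"
    by (intro dt_borel_measurable[OF sf] kernel_entry_measurable[OF sf K])
  ultimately have "(\<integral>x. dt k (\<lambda>i j. K (x i) (x j)) \<partial>?P) = (\<integral>x. dt k (\<lambda>i j. K (?T x i) (?T x j)) \<partial>?P)"
    using integral_distr[OF T, of "\<lambda>x. dt k (\<lambda>i j. K (x i) (x j))"] by simp
  also have "\<dots> = (\<integral>x. dt k (\<lambda>i j. K (S (x i)) (S (x j))) \<partial>?P)"
    by (intro Bochner_Integration.integral_cong refl dt_cong) simp
  finally show ?thesis by (simp add: fterm_def)
qed

section \<open>Several copies of the real line as one measure space\<close>

definition levels :: "nat \<Rightarrow> (nat \<times> real) measure" where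
  "levels m = count_space {1..m} \<Otimes>\<^sub>M lborel"

lemma sigma_finite_levels: "sigma_finite_measure (levels m)"
proof -
  interpret c: finite_measure "count_space {1..m}" by (rule finite_measure_count_space) simp
  interpret pair_sigma_finite "count_space {1..m}" "lborel :: real measure" ..
  show ?thesis unfolding levels_def by unfold_locales
qed

lemma space_levels: "space (levels m) = {1..m} \<times> UNIV"
  by (simp add: levels_def space_pair_measure)

lemma levels_section:
  assumes "X \<in> sets (levels m)"
  shows "Pair i -` X \<in> sets lborel"
  using assms unfolding levels_def by (rule sets_Pair1)

lemma emeasure_levels:
  assumes "X \<in> sets (levels m)"
  shows "emeasure (levels m) X = (\<Sum>i=1..m. emeasure lborel (Pair i -` X))"
proof -
  have "emeasure (levels m) X = (\<integral>\<^sup>+i. emeasure lborel (Pair i -` X) \<partial>count_space {1..m})"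
    using assms unfolding levels_def by (intro lborel.emeasure_pair_measure_alt)
  then show ?thesis by (simp add: nn_integral_count_space_finite)
qed

lemma integral_levels:
  fixes f :: "nat \<times> real \<Rightarrow> 'b :: {banach, second_countable_topology}"
  assumes f: "integrable (levels m) f"
  shows "integral\<^sup>L (levels m) f = (\<Sum>i=1..m. \<integral>x. f (i, x) \<partial>lborel)"
    and "\<And>i. i \<in> {1..m} \<Longrightarrow> integrable lborel (\<lambda>x. f (i, x))"
proof -
  interpret c: finite_measure "count_space {1..m}" by (rule finite_measure_count_space) simp
  interpret P: pair_sigma_finite "count_space {1..m}" "lborel :: real measure" ..
  note f' = f[unfolded levels_def]
  have "integral\<^sup>L (levels m) f = (\<integral>i. (\<integral>x. f (i, x) \<partial>lborel) \<partial>count_space {1..m})"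
    unfolding levels_def by (rule P.integral_fst'[OF f', symmetric])
  also have "\<dots> = (\<Sum>i=1..m. \<integral>x. f (i, x) \<partial>lborel)"
    by (rule lebesgue_integral_count_space_finite) simp
  finally show "integral\<^sup>L (levels m) f = (\<Sum>i=1..m. \<integral>x. f (i, x) \<partial>lborel)" .
  show "integrable lborel (\<lambda>x. f (i, x))" if "i \<in> {1..m}" for i
    using P.AE_integrable_fst'[OF f'] that by (auto simp: AE_count_space)
qed

lemma integrable_levels:
  fixes f :: "nat \<times> real \<Rightarrow> 'b :: {banach, second_countable_topology}"
  assumes m: "f \<in> borel_measurable (levels m)" and "\<And>i. i \<in> {1..m} \<Longrightarrow> integrable lborel (\<lambda>x. f (i, x))"
  shows "integrable (levels m) f"
proof -
  interpret c: finite_measure "count_space {1..m}" by (rule finite_measure_count_space) simp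
  interpret P: pair_sigma_finite "count_space {1..m}" "lborel :: real measure" ..
  show ?thesis unfolding levels_def
  proof (rule P.Fubini_integrable)
    show "f \<in> borel_measurable (count_space {1..m} \<Otimes>\<^sub>M lborel)" using m by (simp add: levels_def)
    show "integrable (count_space {1..m}) (\<lambda>x. \<integral>y. norm (f (x, y)) \<partial>lborel)"
      by (rule integrable_count_space) simp
    show "AE x in count_space {1..m}. integrable lborel (\<lambda>y. f (x, y))"
      using assms(2) by (simp add: AE_count_space)
  qed
qed

lemma levels_measurable:
  assumes "\<And>i. i \<in> {1..m} \<Longrightarrow> (\<lambda>x. f (i, x)) \<in> measurable borel N"
  shows "f \<in> measurable (levels m) N"
proof -
  have "(\<lambda>p. (\<lambda>i p. f (i, snd p)) (fst p) p) \<in> measurable (levels m) N"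
  proof (rule measurable_compose_countable'[where I = "{1..m}"])
    show "fst \<in> measurable (levels m) (count_space {1..m})" by (simp add: levels_def)
    show "(\<lambda>p. f (i, snd p)) \<in> measurable (levels m) N" if "i \<in> {1..m}" for i
      unfolding levels_def by (rule measurable_compose[OF measurable_snd]) (use assms[OF that] in simp)
  qed simp
  then show ?thesis by simp
qed

lemma levels_shift:
  fixes a :: "nat \<Rightarrow> real"
  shows "(\<lambda>(i, x). (i, x + a i)) \<in> measurable (levels m) (levels m)"
    and "distr (levels m) (levels m) (\<lambda>(i, x). (i, x + a i)) = levels m"
proof -
  let ?S = "\<lambda>(i :: nat, x :: real). (i, x + a i)"
  show S: "?S \<in> measurable (levels m) (levels m)"
  proof (rule levels_measurable)
    fix i assume "i \<in> {1..m}"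
    then show "(\<lambda>x. ?S (i, x)) \<in> measurable borel (levels m)"
      unfolding levels_def by simp measurable
  qed
  show "distr (levels m) (levels m) ?S = levels m"
  proof (rule measure_eqI)
    fix X assume "X \<in> sets (distr (levels m) (levels m) ?S)"
    hence X: "X \<in> sets (levels m)" by simp
    have sec: "Pair i -` X \<in> sets borel" for i
      using levels_section[OF X] by simp
    have "emeasure (distr (levels m) (levels m) ?S) X = emeasure (levels m) (?S -` X \<inter> space (levels m))"
      by (rule emeasure_distr[OF S X])
    also have "\<dots> = (\<Sum>i=1..m. emeasure lborel (Pair i -` (?S -` X \<inter> space (levels m))))"
      by (rule emeasure_levels[OF measurable_sets[OF S X]])
    also have "\<dots> = (\<Sum>i=1..m. emeasure lborel (Pair i -` X))"
    proof (rule sum.cong[OF refl])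
      fix i assume i: "i \<in> {1..m}"
      have "emeasure lborel (Pair i -` X) = emeasure (distr lborel borel ((+) (a i))) (Pair i -` X)"
        by (simp add: lborel_distr_plus)
      also have "\<dots> = emeasure lborel ((+) (a i) -` (Pair i -` X))"
        using sec by (subst emeasure_distr) auto
      also have "(+) (a i) -` (Pair i -` X) = Pair i -` (?S -` X \<inter> space (levels m))"
        using i by (auto simp: space_levels add.commute)
      finally show "emeasure lborel (Pair i -` (?S -` X \<inter> space (levels m))) = emeasure lborel (Pair i -` X)" ..
    qed
    also have "\<dots> = emeasure (levels m) X" by (rule emeasure_levels[OF X, symmetric])
    finally show "emeasure (distr (levels m) (levels m) ?S) X = emeasure (levels m) X" .
  qed simp
qed

text \<open>A power of the sum of \<open>m\<close> Lebesgue measures is the sum, over all tuples of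
  levels, of products of Lebesgue measures. On boxes this is the expansion of a product of
  sums.\<close>

lemma PiM_levels:
  fixes k m :: nat
  defines "C \<equiv> count_space ({..<k} \<rightarrow>\<^sub>E {1..m})" and "B \<equiv> (\<Pi>\<^sub>M i\<in>{..<k}. (lborel :: real measure))"
    and "T \<equiv> \<lambda>(l, t). \<lambda>i\<in>{..<k}. (l i, t i)"
  shows "T \<in> measurable (C \<Otimes>\<^sub>M B) (\<Pi>\<^sub>M i\<in>{..<k}. levels m)"
    and "distr (C \<Otimes>\<^sub>M B) (\<Pi>\<^sub>M i\<in>{..<k}. levels m) T = (\<Pi>\<^sub>M i\<in>{..<k}. levels m)"
proof -
  let ?P = "\<Pi>\<^sub>M i\<in>{..<k}. levels m"
  interpret L: product_sigma_finite "\<lambda>_::nat. levels m"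
    using sigma_finite_levels by (simp add: product_sigma_finite_def)
  interpret b: product_sigma_finite "\<lambda>_::nat. lborel :: real measure"
    by (simp add: product_sigma_finite_def lborel.sigma_finite_measure_axioms)
  interpret B: sigma_finite_measure B unfolding B_def by (rule b.sigma_finite) simp
  have fin: "finite ({..<k} \<rightarrow>\<^sub>E {1..m})" by (intro finite_PiE) auto
  show T: "T \<in> measurable (C \<Otimes>\<^sub>M B) ?P"
    unfolding T_def case_prod_beta
  proof (rule measurable_restrict)
    fix i assume i: "i \<in> {..<k}"
    have "(\<lambda>p. fst p i) \<in> measurable (C \<Otimes>\<^sub>M B) (count_space {1..m})"
      by (rule measurable_compose[OF measurable_fst]) (use i in \<open>auto simp: C_def\<close>)
    moreover have "(\<lambda>p. snd p i) \<in> measurable (C \<Otimes>\<^sub>M B) lborel"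
      unfolding B_def by (rule measurable_compose[OF measurable_snd]) (use i in auto)
    ultimately show "(\<lambda>p. (fst p i, snd p i)) \<in> measurable (C \<Otimes>\<^sub>M B) (levels m)"
      unfolding levels_def by (rule measurable_Pair)
  qed
  show "distr (C \<Otimes>\<^sub>M B) ?P T = ?P"
  proof (rule L.PiM_eqI)
    fix A assume A: "\<And>i. i \<in> {..<k} \<Longrightarrow> A i \<in> sets (levels m)"
    have sec: "Pair j -` A i \<in> sets lborel" if "i < k" for i j
      using levels_section[OF A] that by simp
    have PA: "Pi\<^sub>E {..<k} A \<in> sets ?P" using A by (intro sets_PiM_I_finite) auto
    have "emeasure (distr (C \<Otimes>\<^sub>M B) ?P T) (Pi\<^sub>E {..<k} A) = emeasure (C \<Otimes>\<^sub>M B) (T -` Pi\<^sub>E {..<k} A \<inter> space (C \<Otimes>\<^sub>M B))"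
      by (rule emeasure_distr[OF T PA])
    also have "\<dots> = (\<integral>\<^sup>+l. emeasure B (Pair l -` (T -` Pi\<^sub>E {..<k} A \<inter> space (C \<Otimes>\<^sub>M B))) \<partial>C)"
      by (rule B.emeasure_pair_measure_alt[OF measurable_sets[OF T PA]])
    also have "\<dots> = (\<Sum>l\<in>{..<k} \<rightarrow>\<^sub>E {1..m}. emeasure B (Pair l -` (T -` Pi\<^sub>E {..<k} A \<inter> space (C \<Otimes>\<^sub>M B))))"
      unfolding C_def by (rule nn_integral_count_space_finite[OF fin])
    also have "\<dots> = (\<Sum>l\<in>{..<k} \<rightarrow>\<^sub>E {1..m}. \<Prod>i<k. emeasure lborel (Pair (l i) -` A i))"
    proof (rule sum.cong[OF refl])
      fix l assume l: "l \<in> {..<k} \<rightarrow>\<^sub>E {1..m}"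
      have pre: "Pair l -` (T -` Pi\<^sub>E {..<k} A \<inter> space (C \<Otimes>\<^sub>M B)) = Pi\<^sub>E {..<k} (\<lambda>i. Pair (l i) -` A i)"
        using l by (auto simp: T_def C_def B_def space_pair_measure space_PiM PiE_def Pi_def extensional_def)
      show "emeasure B (Pair l -` (T -` Pi\<^sub>E {..<k} A \<inter> space (C \<Otimes>\<^sub>M B))) = (\<Prod>i<k. emeasure lborel (Pair (l i) -` A i))"
        unfolding pre unfolding B_def by (rule b.emeasure_PiM) (use sec in auto)
    qed
    also have "\<dots> = (\<Prod>i<k. \<Sum>j=1..m. emeasure lborel (Pair j -` A i))"
      by (rule prod_sum_PiE[symmetric]) auto
    also have "\<dots> = (\<Prod>i<k. emeasure (levels m) (A i))"
      by (intro prod.cong refl emeasure_levels[symmetric] A) auto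
    finally show "emeasure (distr (C \<Otimes>\<^sub>M B) ?P T) (Pi\<^sub>E {..<k} A) = (\<Prod>i<k. emeasure (levels m) (A i))" .
  qed auto
qed

text \<open>Putting the density into the second argument multiplies the columns of each determinant
  by it. The sum over levels and the integrals over positions in \<open>fredholm_term\<close> then
  become one integral over \<open>levels m\<close>.\<close>

definition level_kernel ::
  "(real \<Rightarrow> complex) \<Rightarrow> (nat \<Rightarrow> real \<Rightarrow> nat \<Rightarrow> real \<Rightarrow> complex) \<Rightarrow> nat \<times> real \<Rightarrow> nat \<times> real \<Rightarrow> complex" where
  "level_kernel \<rho> K p q = K (fst p) (snd p) (fst q) (snd q) * \<rho> (snd q)"

lemma fredholm_term_levels:
  assumes K: "dominated (levels m) w (level_kernel \<rho> K)"
  shows "fredholm_term m \<rho> K k = fterm (levels m) (level_kernel \<rho> K) k"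
    and "\<And>l. l \<in> {..<k} \<rightarrow>\<^sub>E {1..m} \<Longrightarrow> integrable (\<Pi>\<^sub>M i\<in>{..<k}. lborel) (fredholm_integrand \<rho> K k l)"
proof -
  define C where "C = count_space ({..<k} \<rightarrow>\<^sub>E {1..m})"
  define B where "B = (\<Pi>\<^sub>M i\<in>{..<k}. (lborel :: real measure))"
  define T where "T = (\<lambda>(l :: nat \<Rightarrow> nat, t :: nat \<Rightarrow> real). \<lambda>i\<in>{..<k}. (l i, t i))"
  let ?P = "\<Pi>\<^sub>M i\<in>{..<k}. levels m"
  let ?F = "\<lambda>x. dt k (\<lambda>i j. level_kernel \<rho> K (x i) (x j))"
  interpret b: product_sigma_finite "\<lambda>_::nat. lborel :: real measure"
    by (simp add: product_sigma_finite_def lborel.sigma_finite_measure_axioms)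
  interpret B: sigma_finite_measure B unfolding B_def by (rule b.sigma_finite) simp
  have fin: "finite ({..<k} \<rightarrow>\<^sub>E {1..m})" by (intro finite_PiE) auto
  interpret C: finite_measure C unfolding C_def by (rule finite_measure_count_space[OF fin])
  interpret CB: pair_sigma_finite C B ..
  have T: "T \<in> measurable (C \<Otimes>\<^sub>M B) ?P" and dT: "distr (C \<Otimes>\<^sub>M B) ?P T = ?P"
    using PiM_levels[of k m] by (simp_all add: C_def B_def T_def)
  have FT: "?F (T (l, t)) = fredholm_integrand \<rho> K k l t" for l t
  proof -
    have "?F (T (l, t)) = dt k (\<lambda>i j. K (l i) (t i) (l j) (t j) * \<rho> (t j))"
      by (intro dt_cong) (simp add: T_def level_kernel_def)
    also have "\<dots> = dt k (\<lambda>i j. K (l i) (t i) (l j) (t j)) * (\<Prod>i<k. \<rho> (t i))"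
      by (rule dt_scale_cols)
    finally show ?thesis by (simp add: dt_def fredholm_integrand_def)
  qed
  have int: "integrable ?P ?F" by (rule fterm_dominated(1)[OF sigma_finite_levels K])
  have intT: "integrable (C \<Otimes>\<^sub>M B) (\<lambda>p. ?F (T p))"
    by (rule integrable_distr[OF T]) (unfold dT, rule int)
  show intl: "integrable (\<Pi>\<^sub>M i\<in>{..<k}. lborel) (fredholm_integrand \<rho> K k l)" if "l \<in> {..<k} \<rightarrow>\<^sub>E {1..m}" for l
  proof -
    have "AE l in C. integrable B (\<lambda>t. ?F (T (l, t)))" by (rule CB.AE_integrable_fst'[OF intT])
    hence "integrable B (\<lambda>t. ?F (T (l, t)))"
      unfolding C_def AE_count_space using that by (rule bspec)
    then show ?thesis unfolding FT B_def .
  qed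
  have "integral\<^sup>L ?P ?F = (\<integral>p. ?F (T p) \<partial>(C \<Otimes>\<^sub>M B))"
    using integral_distr[OF T, of ?F] borel_measurable_integrable[OF int] unfolding dT by (simp only:)
  also have "\<dots> = (\<integral>l. (\<integral>t. ?F (T (l, t)) \<partial>B) \<partial>C)"
    by (rule CB.integral_fst'[OF intT, symmetric])
  also have "\<dots> = (\<Sum>l\<in>{..<k} \<rightarrow>\<^sub>E {1..m}. \<integral>t. fredholm_integrand \<rho> K k l t \<partial>B)"
    unfolding C_def FT by (subst lebesgue_integral_count_space_finite[OF fin]) (rule refl)
  finally show "fredholm_term m \<rho> K k = fterm (levels m) (level_kernel \<rho> K) k"
    by (simp add: fredholm_term_def fterm_def B_def)
qed

section \<open>The heat kernel\<close>

text \<open>Variance 2 t makes this the kernel of exp(t D^2), with D the derivative. Its Laplace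
  transform is exp(t w^2), the quadratic factor of \<open>F_fun\<close> when \<open>t\<close> is the
  difference of consecutive values of \<open>\<alpha>\<close>.\<close>

definition heat :: "real \<Rightarrow> real \<Rightarrow> real" where
  "heat t = normal_density 0 (sqrt (2 * t))"

lemma heat_eq: "t > 0 \<Longrightarrow> heat t y = exp (- y\<^sup>2 / (4 * t)) / sqrt (4 * pi * t)"
  by (simp add: heat_def normal_density_def mult.assoc)

lemma heat_nonneg: "0 \<le> heat t y"
  by (simp add: heat_def)

lemma heat_measurable [measurable]: "heat t \<in> borel_measurable borel"
  by (simp add: heat_def)

lemma heat_minus: "heat t (- y) = heat t y"
  by (simp add: heat_def normal_density_def)

lemma heat_conv:
  assumes s: "s > 0" and t: "t > 0"
  shows "has_bochner_integral lborel (\<lambda>y. heat s (x - y) * heat t (y - z)) (heat (s + t) (x - z))"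
proof (rule has_bochner_integral_nn_integral)
  show "(\<lambda>y. heat s (x - y) * heat t (y - z)) \<in> borel_measurable lborel" by measurable
  show "AE y in lborel. 0 \<le> heat s (x - y) * heat t (y - z)" by (simp add: heat_nonneg)
  show "0 \<le> heat (s + t) (x - z)" by (rule heat_nonneg)
  have "(\<integral>\<^sup>+y. ennreal (heat s (x - y) * heat t (y - z)) \<partial>lborel) =
      (\<integral>\<^sup>+y. ennreal (heat s ((x - z) - y) * heat t y) \<partial>lborel)"
    by (subst nn_integral_real_affine[where c = 1 and t = z]) (auto simp: algebra_simps)
  also have "\<dots> = heat (s + t) (x - z)"
    using fun_cong[OF conv_normal_density_zero_mean[of "sqrt (2 * s)" "sqrt (2 * t)"], of "x - z"] s t
    by (simp add: heat_def algebra_simps)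
  finally show "(\<integral>\<^sup>+y. ennreal (heat s (x - y) * heat t (y - z)) \<partial>lborel) = ennreal (heat (s + t) (x - z))" .
qed

text \<open>Completing the square turns the real part of \<open>w\<close> into a shift of the normal
  density. The imaginary part is then an argument of the characteristic function of the standard
  normal distribution.\<close>

lemma heat_laplace_0:
  fixes w :: complex
  assumes t: "t > 0"
  shows "has_bochner_integral lborel (\<lambda>y. of_real (heat t y) * exp (w * of_real y)) (exp (of_real t * w\<^sup>2))"
proof -
  define \<sigma> where "\<sigma> = sqrt (2 * t)"
  have \<sigma>: "\<sigma> > 0" "\<sigma>\<^sup>2 = 2 * t" using t by (auto simp: \<sigma>_def)
  define p q where "p = Re w" and "q = Im w"
  have w: "w = of_real p + \<i> * of_real q" by (simp add: p_def q_def complex_eq)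
  have key: "heat t y * exp (p * y) = exp (t * p\<^sup>2) * normal_density (2 * t * p) \<sigma> y" for y
  proof -
    have "- y\<^sup>2 / (4 * t) + p * y = t * p\<^sup>2 + - (y - 2 * t * p)\<^sup>2 / (4 * t)"
      using t by (simp add: field_simps power2_eq_square)
    then show ?thesis using \<sigma> t
      by (simp add: heat_eq normal_density_def mult_ac flip: exp_add)
  qed
  have eq: "of_real (heat t y) * exp (w * of_real y) =
      of_real (exp (t * p\<^sup>2)) * (of_real (normal_density (2 * t * p) \<sigma> y) * exp (\<i> * of_real (q * y)))" for y
  proof -
    have "exp (w * of_real y) = of_real (exp (p * y)) * exp (\<i> * of_real (q * y))"
      by (simp add: w exp_add[symmetric] algebra_simps flip: exp_of_real)
    hence "of_real (heat t y) * exp (w * of_real y) = of_real (heat t y * exp (p * y)) * exp (\<i> * of_real (q * y))"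
      by simp
    then show ?thesis unfolding key by simp
  qed
  let ?f = "\<lambda>y. of_real (normal_density (2 * t * p) \<sigma> y) * exp (\<i> * of_real (q * y)) :: complex"
  have nd: "normal_density (2 * t * p) \<sigma> (2 * t * p + \<sigma> * x) = std_normal_density x / \<sigma>" for x
    using \<sigma>(1) by (simp add: normal_density_def real_sqrt_mult power_mult_distrib)
  have int: "integrable lborel ?f"
    by (rule Bochner_Integration.integrable_bound[OF integrable_normal_density[OF \<sigma>(1), of "2 * t * p"]])
       (auto simp: norm_mult)
  have "integral\<^sup>L lborel ?f = \<sigma> *\<^sub>R (\<integral>x. ?f (2 * t * p + \<sigma> * x) \<partial>lborel)"
    using \<sigma>(1) lborel_integral_real_affine[of \<sigma> ?f "2 * t * p"] by simp
  also have "(\<lambda>x. ?f (2 * t * p + \<sigma> * x)) =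
      (\<lambda>x. (exp (\<i> * of_real (q * (2 * t * p))) / of_real \<sigma>) * (of_real (std_normal_density x) * exp (\<i> * of_real (q * \<sigma> * x))))"
  proof (rule ext)
    fix x
    have "exp (\<i> * of_real (q * (2 * t * p + \<sigma> * x))) = exp (\<i> * of_real (q * (2 * t * p))) * exp (\<i> * of_real (q * \<sigma> * x))"
      by (simp add: algebra_simps flip: exp_add)
    then show "?f (2 * t * p + \<sigma> * x) = (exp (\<i> * of_real (q * (2 * t * p))) / of_real \<sigma>) * (of_real (std_normal_density x) * exp (\<i> * of_real (q * \<sigma> * x)))"
      unfolding nd by simp
  qed
  also have "(\<integral>x. (exp (\<i> * of_real (q * (2 * t * p))) / of_real \<sigma>) * (of_real (std_normal_density x) * exp (\<i> * of_real (q * \<sigma> * x))) \<partial>lborel) =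
      (exp (\<i> * of_real (q * (2 * t * p))) / of_real \<sigma>) * char std_normal_distribution (q * \<sigma>)"
    by (subst integral_mult_right_zero) (simp add: char_def integral_density scaleR_conv_of_real)
  also have "char std_normal_distribution (q * \<sigma>) = of_real (exp (- t * q\<^sup>2))"
    unfolding char_std_normal_distribution using \<sigma> by (simp add: power_mult_distrib)
  finally have I: "integral\<^sup>L lborel ?f = exp (\<i> * of_real (q * (2 * t * p))) * of_real (exp (- t * q\<^sup>2))"
    using \<sigma>(1) by (simp add: scaleR_conv_of_real)
  have "of_real (exp (t * p\<^sup>2)) * integral\<^sup>L lborel ?f = exp (of_real t * w\<^sup>2)"
    unfolding I w by (simp add: power2_eq_square algebra_simps flip: exp_of_real exp_add)
  then show ?thesis
    unfolding eq has_bochner_integral_iff using int by (simp add: integral_mult_right_zero)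
qed

lemma heat_laplace:
  fixes w :: complex
  assumes t: "t > 0"
  shows "has_bochner_integral lborel (\<lambda>x. of_real (heat t (x - y)) * exp (w * of_real x)) (exp (of_real t * w\<^sup>2 + w * of_real y))"
proof -
  have "has_bochner_integral lborel (\<lambda>x. of_real (heat t (- y + 1 * x)) * exp (w * of_real (- y + 1 * x))) (exp (of_real t * w\<^sup>2))"
    using lborel_has_bochner_integral_real_affine_iff[of 1 "\<lambda>x. of_real (heat t x) * exp (w * of_real x)" _ "- y"] heat_laplace_0[OF t, of w]
    by simp
  from has_bochner_integral_mult_right[OF this, of "exp (w * of_real y)"]
  have "has_bochner_integral lborel (\<lambda>x. exp (w * of_real y) * (of_real (heat t (x - y)) * exp (w * of_real (x - y)))) (exp (w * of_real y) * exp (of_real t * w\<^sup>2))"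
    by simp
  moreover have eq: "exp (w * of_real y) * (of_real (heat t (x - y)) * exp (w * of_real (x - y))) = of_real (heat t (x - y)) * exp (w * of_real x)" for x
  proof -
    have "exp (w * of_real x) = exp (w * of_real y) * exp (w * of_real (x - y))"
      by (simp add: algebra_simps flip: exp_add)
    then show ?thesis by simp
  qed
  ultimately show ?thesis unfolding eq by (simp add: exp_add mult.commute)
qed

lemma heat_laplace_real:
  assumes t: "t > 0"
  shows "has_bochner_integral lborel (\<lambda>x. heat t (x - y) * exp (p * x)) (exp (t * p\<^sup>2 + p * y))"
proof -
  from heat_laplace[OF t, of y "of_real p"]
  have "has_bochner_integral lborel (\<lambda>x. complex_of_real (heat t (x - y) * exp (p * x))) (of_real (exp (t * p\<^sup>2 + p * y)))"
    by (simp flip: exp_of_real)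
  then show ?thesis
    by (simp only: has_bochner_integral_iff complex_of_real_integrable_eq integral_complex_of_real of_real_eq_iff)
qed

text \<open>Inverts the Laplace transform of the heat kernel on the line of real part
  \<open>c\<close>. As a function of \<open>q\<close>, the integrand is a constant times the heat
  kernel at time \<open>1 / (4 * t)\<close> times an exponential, so \<open>heat_laplace_0\<close>
  computes the integral.\<close>

lemma heat_contour:
  assumes t: "t > 0"
  shows "has_bochner_integral lborel (\<lambda>q. exp (of_real t * (Complex c q)\<^sup>2 + of_real y * Complex c q)) (of_real (2 * pi * heat t y))"
proof -
  let ?s = "1 / (4 * t)" and ?w = "\<i> * of_real (2 * t * c + y)"
  have s: "?s > 0" using t by simp
  define a where "a = sqrt (pi / t) * exp (t * c\<^sup>2 + y * c)"
  have a0: "sqrt (pi / t) * heat ?s q = exp (- t * q\<^sup>2)" for q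
  proof -
    have "sqrt (4 * pi * ?s) = sqrt (pi / t)" using t by (simp add: field_simps)
    then show ?thesis unfolding heat_eq[OF s] using t pi_gt_zero by simp
  qed
  have eq: "exp (of_real t * (Complex c q)\<^sup>2 + of_real y * Complex c q) = of_real a * (of_real (heat ?s q) * exp (?w * of_real q))" for q
  proof -
    have "of_real a * (of_real (heat ?s q) * exp (?w * of_real q)) =
        of_real (exp (t * c\<^sup>2 + y * c) * (sqrt (pi / t) * heat ?s q)) * exp (?w * of_real q)"
      by (simp add: a_def)
    also have "\<dots> = of_real (exp (t * c\<^sup>2 + y * c) * exp (- t * q\<^sup>2)) * exp (?w * of_real q)"
      by (simp only: a0)
    also have "\<dots> = exp (of_real (t * c\<^sup>2 + y * c - t * q\<^sup>2) + ?w * of_real q)"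
      by (simp only: exp_add exp_of_real exp_diff exp_minus of_real_mult) (simp add: exp_add exp_diff exp_minus field_simps flip: exp_of_real)
    also have "of_real (t * c\<^sup>2 + y * c - t * q\<^sup>2) + ?w * of_real q = of_real t * (Complex c q)\<^sup>2 + of_real y * Complex c q"
      by (simp add: complex_eq_iff power2_eq_square algebra_simps)
    finally show ?thesis ..
  qed
  have "of_real a * exp (of_real ?s * ?w\<^sup>2) = of_real (2 * pi * heat t y)"
  proof -
    have "of_real ?s * ?w\<^sup>2 = of_real (- (2 * t * c + y)\<^sup>2 / (4 * t))"
      by (simp add: power_mult_distrib)
    also have "- (2 * t * c + y)\<^sup>2 / (4 * t) = - (t * c\<^sup>2 + y * c) - y\<^sup>2 / (4 * t)"
      using t by (simp add: field_simps power2_eq_square)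
    finally have "of_real a * exp (of_real ?s * ?w\<^sup>2) =
        of_real (a * exp (- (t * c\<^sup>2 + y * c) - y\<^sup>2 / (4 * t)))" by (simp only: exp_of_real of_real_mult)
    also have "a * exp (- (t * c\<^sup>2 + y * c) - y\<^sup>2 / (4 * t)) = sqrt (pi / t) * exp (- y\<^sup>2 / (4 * t))"
      by (simp add: a_def flip: exp_add)
    also have "sqrt (pi / t) = 2 * pi / sqrt (4 * pi * t)"
    proof -
      have "sqrt (pi / t) * sqrt (4 * pi * t) = sqrt ((2 * pi)\<^sup>2)"
        using t by (simp add: power2_eq_square flip: real_sqrt_mult)
      also have "\<dots> = 2 * pi" by (simp only: real_sqrt_abs) simp
      finally show ?thesis using t by (subst nonzero_eq_divide_eq) simp_all
    qed
    finally show ?thesis using t by (simp add: heat_eq)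
  qed
  then show ?thesis
    unfolding eq using has_bochner_integral_mult_right[OF heat_laplace_0[OF s, of ?w], of "of_real a"] by simp
qed

section \<open>Integrals over unbounded contours\<close>

lemma integrable_exp_abs: "integrable lborel (\<lambda>q::real. exp (- \<bar>q\<bar>))"
proof -
  let ?g = "\<lambda>x::real. indicator {0..} x *\<^sub>R exp (- 1 * x)"
  have "(\<lambda>x::real. exp (- 1 * x)) absolutely_integrable_on {0..}"
    by (intro nonnegative_absolutely_integrable_1 integrable_on_exp_minus_to_infinity) auto
  hence g: "integrable lborel ?g"
    unfolding set_integrable_def by (subst (asm) integrable_completion) auto
  have g': "integrable lborel (\<lambda>x. ?g (0 + - 1 * x))"
    by (rule lborel_integrable_real_affine[OF g]) simp
  show ?thesis
    by (rule Bochner_Integration.integrable_bound[OF Bochner_Integration.integrable_add[OF g g']])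
       (auto simp: indicator_def)
qed

lemma integrable_exp_decay:
  fixes h :: "real \<Rightarrow> complex"
  assumes h: "continuous_on UNIV h" and b: "\<And>q. \<bar>q\<bar> \<ge> q1 \<Longrightarrow> norm (h q) \<le> C * exp (- \<bar>q\<bar>)"
  shows "integrable lborel h"
proof -
  have "compact (h ` {-q1..q1})" by (intro compact_continuous_image continuous_on_subset[OF h]) auto
  then obtain B where B: "\<And>q. q \<in> {-q1..q1} \<Longrightarrow> norm (h q) \<le> B"
    using compact_imp_bounded bounded_iff by (metis imageI)
  let ?D = "\<bar>C\<bar> + \<bar>B\<bar> * exp \<bar>q1\<bar>"
  have "norm (h q) \<le> ?D * exp (- \<bar>q\<bar>)" for q
  proof (cases "\<bar>q\<bar> \<ge> q1")
    case True
    have "norm (h q) \<le> C * exp (- \<bar>q\<bar>)" by (rule b[OF True])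
    also have "\<dots> \<le> ?D * exp (- \<bar>q\<bar>)"
      by (rule mult_right_mono[OF order_trans[OF abs_ge_self]]) simp_all
    finally show ?thesis .
  next
    case False
    hence "q \<in> {-q1..q1}" and q: "\<bar>q\<bar> \<le> \<bar>q1\<bar>" by auto
    hence "norm (h q) \<le> \<bar>B\<bar> * 1" using B by fastforce
    also have "\<dots> \<le> \<bar>B\<bar> * (exp \<bar>q1\<bar> * exp (- \<bar>q\<bar>))"
      using q by (intro mult_left_mono) (auto simp flip: exp_add)
    also have "\<dots> \<le> ?D * exp (- \<bar>q\<bar>)" by (simp add: distrib_right)
    finally show ?thesis .
  qed
  hence bd: "norm (h q) \<le> norm (?D * exp (- \<bar>q\<bar>))" for q
    unfolding real_norm_def by (rule order_trans[OF _ abs_ge_self])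
  have "integrable lborel (\<lambda>q::real. ?D * exp (- \<bar>q\<bar>))" using integrable_exp_abs by simp
  moreover have "h \<in> borel_measurable lborel" using borel_measurable_continuous_onI[OF h] by simp
  ultimately show ?thesis
    by (rule Bochner_Integration.integrable_bound) (use bd in blast)
qed

text \<open>The gauge integral over the line contains improper integrals, so convergence of the
  primitive at both ends is enough. The identity is asked only for intervals around [-T, T], because
  in the presence of a pole the primitive describes just the tails of the contour.\<close>

lemma has_integral_UNIV_limit:
  fixes h :: "real \<Rightarrow> complex"
  assumes I: "\<And>a b. a \<le> - T \<Longrightarrow> T \<le> b \<Longrightarrow> (h has_integral Q b - Q a) {a..b}"
    and L: "(Q \<longlongrightarrow> L) at_top" and L': "(Q \<longlongrightarrow> L') at_bot"
  shows "(h has_integral L - L') UNIV"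
  unfolding has_integral_alt'
proof (intro conjI allI impI)
  fix a b :: real
  have "h integrable_on {min a (- T)..max b T}" using I[of "min a (- T)" "max b T"] by auto
  hence "h integrable_on {a..b}" by (rule integrable_on_subinterval) auto
  then show "(\<lambda>x. if x \<in> UNIV then h x else 0) integrable_on cbox a b" by (simp add: cbox_interval)
next
  fix e :: real assume e: "0 < e"
  have "\<forall>\<^sub>F t in at_top. dist (Q t) L < e / 2" using L e by (intro tendstoD) auto
  then obtain b0 where b0: "\<And>t. t \<ge> b0 \<Longrightarrow> dist (Q t) L < e / 2" by (auto simp: eventually_at_top_linorder)
  have "\<forall>\<^sub>F t in at_bot. dist (Q t) L' < e / 2" using L' e by (intro tendstoD) auto
  then obtain a0 where a0: "\<And>t. t \<le> a0 \<Longrightarrow> dist (Q t) L' < e / 2" by (auto simp: eventually_at_bot_linorder)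
  define B where "B = \<bar>T\<bar> + \<bar>a0\<bar> + \<bar>b0\<bar> + 1"
  show "\<exists>B>0. \<forall>a b. ball 0 B \<subseteq> cbox a b \<longrightarrow> norm (integral (cbox a b) (\<lambda>x. if x \<in> UNIV then h x else 0) - (L - L')) < e"
  proof (intro exI[of _ "B + 1"] conjI allI impI)
    show "B + 1 > 0" by (simp add: B_def)
    fix a b :: real assume ab: "ball 0 (B + 1) \<subseteq> cbox a b"
    have B0: "B \<ge> 0" by (simp add: B_def)
    have "B \<in> cbox a b" "- B \<in> cbox a b" using ab B0 by (auto simp: subset_iff dist_real_def)
    hence "a \<le> - B" "B \<le> b" by (simp_all add: cbox_interval)
    hence a: "a \<le> - T" "a \<le> a0" and b: "T \<le> b" "b0 \<le> b" unfolding B_def by linarith+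
    have "integral {a..b} h = Q b - Q a" using I[OF a(1) b(1)] by (rule integral_unique)
    moreover have "(Q b - Q a) - (L - L') = (Q b - L) - (Q a - L')" by (simp add: algebra_simps)
    ultimately have "norm (integral {a..b} h - (L - L')) = norm ((Q b - L) - (Q a - L'))" by (simp only:)
    also have "\<dots> \<le> dist (Q b) L + dist (Q a) L'" unfolding dist_norm by (rule norm_triangle_ineq4)
    also have "\<dots> < e" using a0[OF a(2)] b0[OF b(2)] by linarith
    finally show "norm (integral (cbox a b) (\<lambda>x. if x \<in> UNIV then h x else 0) - (L - L')) < e"
      by (simp add: cbox_interval)
  qed
qed

lemma contour_primitive_integral:
  fixes P f :: "complex \<Rightarrow> complex"
  assumes "a \<le> b" and D: "open D" and P: "\<And>w. w \<in> D \<Longrightarrow> (P has_field_derivative f w) (at w)"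
    and \<gamma>: "\<gamma> piecewise_C1_differentiable_on {a..b}" and r: "\<And>t. t \<in> {a..b} \<Longrightarrow> \<gamma> t \<in> D"
  shows "((\<lambda>t. f (\<gamma> t) * vector_derivative \<gamma> (at t)) has_integral P (\<gamma> b) - P (\<gamma> a)) {a..b}"
  unfolding has_integral_localized_vector_derivative[symmetric]
  by (rule contour_integral_primitive_lemma[OF \<open>a \<le> b\<close>, where S = D])
     (use P r in \<open>auto intro: has_field_derivative_at_within piecewise_C1_imp_differentiable[OF \<gamma>]\<close>)

lemma vderiv_vertical: "(Complex c has_vector_derivative \<i>) (at q)"
proof -
  have "((\<lambda>q. of_real c + of_real q * \<i>) has_vector_derivative \<i>) (at q)"
    by (auto intro!: derivative_eq_intros)
  moreover have "(\<lambda>q. of_real c + of_real q * \<i>) = Complex c" by (auto simp: complex_eq_iff)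
  ultimately show ?thesis by simp
qed

lemma vertical_C1: "Complex c piecewise_C1_differentiable_on {a..b}"
  by (intro C1_differentiable_imp_piecewise)
     (auto simp: C1_differentiable_on_def intro!: exI[of _ "\<lambda>_. \<i>"] vderiv_vertical continuous_intros)

text \<open>The integral of f(w) dw / (2 pi i) along the upward line of real part \<open>c\<close>,
  where dw is i dq.\<close>

definition vline :: "real \<Rightarrow> (complex \<Rightarrow> complex) \<Rightarrow> complex" where
  "vline c f = (\<integral>q. f (Complex c q) \<partial>lborel) / (2 * pi)"

text \<open>Absolute integrability on the line makes the primitive converge at both ends. The two
  limits are kept apart because another contour is compared with the line at each end
  separately.\<close>

lemma primitive_vertical_limits:
  fixes P f :: "complex \<Rightarrow> complex"
  assumes D: "open D" and P: "\<And>w. w \<in> D \<Longrightarrow> (P has_field_derivative f w) (at w)"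
    and c: "\<And>q. Complex c q \<in> D" and int: "integrable lborel (\<lambda>q. f (Complex c q))"
  shows "\<exists>L L'. ((\<lambda>y. P (Complex c y)) \<longlongrightarrow> L) at_top \<and> ((\<lambda>y. P (Complex c y)) \<longlongrightarrow> L') at_bot \<and>
    L - L' = \<i> * (\<integral>q. f (Complex c q) \<partial>lborel)"
proof -
  let ?h = "\<lambda>q. f (Complex c q)"
  have FT: "\<i> * (LBINT q:{a..b}. ?h q) = P (Complex c b) - P (Complex c a)" if "a \<le> b" for a b
  proof -
    have "((\<lambda>t. f (Complex c t) * vector_derivative (Complex c) (at t)) has_integral P (Complex c b) - P (Complex c a)) {a..b}"
      using that D P vertical_C1 c by (intro contour_primitive_integral)
    hence 1: "((\<lambda>t. ?h t * \<i>) has_integral P (Complex c b) - P (Complex c a)) {a..b}"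
      by (simp add: vector_derivative_at[OF vderiv_vertical])
    have "set_integrable lborel {a..b} ?h"
      using int unfolding set_integrable_def by (intro integrable_mult_indicator) auto
    hence "(?h has_integral (LBINT q:{a..b}. ?h q)) {a..b}"
      by (metis set_borel_integral_eq_integral(1,2) has_integral_integral)
    hence "((\<lambda>t. ?h t * \<i>) has_integral (LBINT q:{a..b}. ?h q) * \<i>) {a..b}" by (rule has_integral_mult_left)
    from has_integral_unique[OF this 1] show ?thesis by (simp add: mult.commute)
  qed
  have si: "set_integrable lborel A ?h" if "A \<in> sets lborel" for A
    using int that unfolding set_integrable_def by (intro integrable_mult_indicator) auto
  have top: "((\<lambda>b. LBINT q:{0..b}. ?h q) \<longlongrightarrow> (LBINT q:{0..}. ?h q)) at_top"
    by (intro tendsto_set_lebesgue_integral_at_top si) auto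
  have bot: "((\<lambda>a. LBINT q:{a..0}. ?h q) \<longlongrightarrow> (LBINT q:{..0}. ?h q)) at_bot"
    by (intro tendsto_set_lebesgue_integral_at_bot si) auto
  have "((\<lambda>y. P (Complex c 0) + \<i> * (LBINT q:{0..y}. ?h q)) \<longlongrightarrow> P (Complex c 0) + \<i> * (LBINT q:{0..}. ?h q)) at_top"
    by (intro tendsto_intros top)
  moreover have "\<forall>\<^sub>F y in at_top. P (Complex c 0) + \<i> * (LBINT q:{0..y}. ?h q) = P (Complex c y)"
    using eventually_ge_at_top[of 0] by eventually_elim (simp add: FT)
  ultimately have 1: "((\<lambda>y. P (Complex c y)) \<longlongrightarrow> P (Complex c 0) + \<i> * (LBINT q:{0..}. ?h q)) at_top"
    by (rule Lim_transform_eventually)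
  have "((\<lambda>y. P (Complex c 0) - \<i> * (LBINT q:{y..0}. ?h q)) \<longlongrightarrow> P (Complex c 0) - \<i> * (LBINT q:{..0}. ?h q)) at_bot"
    by (intro tendsto_intros bot)
  moreover have "\<forall>\<^sub>F y in at_bot. P (Complex c 0) - \<i> * (LBINT q:{y..0}. ?h q) = P (Complex c y)"
    using eventually_le_at_bot[of 0] by eventually_elim (simp add: FT)
  ultimately have 2: "((\<lambda>y. P (Complex c y)) \<longlongrightarrow> P (Complex c 0) - \<i> * (LBINT q:{..0}. ?h q)) at_bot"
    by (rule Lim_transform_eventually)
  have "(LBINT q:{..0} \<union> {0<..}. ?h q) = (LBINT q:{..0}. ?h q) + (LBINT q:{0<..}. ?h q)"
    by (intro set_integral_Un si) auto
  moreover have "(LBINT q:{0<..}. ?h q) = (LBINT q:{0..}. ?h q)"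
  proof (rule set_integral_null_delta[OF int])
    have "sym_diff {0<..} {0..} = {0::real}" by auto
    moreover have "{0::real} \<in> null_sets lborel" by (rule null_setsI) simp_all
    ultimately show "sym_diff {0<..} {0::real..} \<in> null_sets lborel" by (simp only:)
  qed auto
  moreover have "{..0} \<union> {0<..} = (UNIV :: real set)" by auto
  ultimately have "(\<integral>q. ?h q \<partial>lborel) = (LBINT q:{..0}. ?h q) + (LBINT q:{0..}. ?h q)"
    by (simp add: set_lebesgue_integral_def)
  then show ?thesis using 1 2 by (intro exI conjI) (assumption | simp add: algebra_simps)+
qed

text \<open>
  The integral along a contour \<open>\<gamma>\<close> equals that along a vertical line as soon as both have the same
  primitive near infinity, and the tails of \<open>\<gamma>\<close> can be pushed horizontally to the line through a region
  where the integrand decays.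
\<close>

lemma line_integral_vertical:
  fixes P f :: "complex \<Rightarrow> complex"
  assumes D: "open D" and P: "\<And>w. w \<in> D \<Longrightarrow> (P has_field_derivative f w) (at w)"
    and c: "\<And>q. Complex c q \<in> D" and int: "integrable lborel (\<lambda>q. f (Complex c q))"
    and bd: "\<And>w. y0 \<le> \<bar>Im w\<bar> \<Longrightarrow> \<bar>Re w\<bar> \<le> \<kappa> * \<bar>Im w\<bar> \<Longrightarrow> 0 \<le> \<sigma> * (Re w - c) \<Longrightarrow>
        w \<in> D \<and> norm (f w) \<le> C * exp (- \<bar>Im w\<bar>)"
    and \<kappa>: "\<kappa> > 0"
    and top: "filterlim (\<lambda>t. Im (\<gamma> t)) at_top at_top"
      "\<forall>\<^sub>F t in at_top. \<bar>Re (\<gamma> t)\<bar> \<le> \<kappa> * \<bar>Im (\<gamma> t)\<bar> \<and> 0 \<le> \<sigma> * (Re (\<gamma> t) - c)"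
    and bot: "filterlim (\<lambda>t. Im (\<gamma> t)) at_bot at_bot"
      "\<forall>\<^sub>F t in at_bot. \<bar>Re (\<gamma> t)\<bar> \<le> \<kappa> * \<bar>Im (\<gamma> t)\<bar> \<and> 0 \<le> \<sigma> * (Re (\<gamma> t) - c)"
    and core: "\<And>a b. a \<le> - T \<Longrightarrow> T \<le> b \<Longrightarrow>
        ((\<lambda>t. f (\<gamma> t) * vector_derivative \<gamma> (at t)) has_integral P (\<gamma> b) - P (\<gamma> a)) {a..b}"
  shows "line_integral \<gamma> f = 2 * pi * \<i> * vline c f"
proof -
  obtain L L' where L: "((\<lambda>y. P (Complex c y)) \<longlongrightarrow> L) at_top" "((\<lambda>y. P (Complex c y)) \<longlongrightarrow> L') at_bot"
    "L - L' = \<i> * (\<integral>q. f (Complex c q) \<partial>lborel)"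
    using primitive_vertical_limits[OF D P c int] by blast
  \<comment> \<open>The horizontal segment from \<open>w\<close> to the line keeps the imaginary
    part, stays in the sector and on the same side of the line, so \<open>bd\<close> applies along
    it. Its length is at most 2 \<kappa> |Im w|, and the exponential decay beats this
    factor.\<close>
  have close: "norm (P w - P (Complex c (Im w))) \<le> \<bar>C\<bar> * exp (- \<bar>Im w\<bar>) * (2 * \<kappa> * \<bar>Im w\<bar>)"
    if w: "y0 \<le> \<bar>Im w\<bar>" "\<bar>Re w\<bar> \<le> \<kappa> * \<bar>Im w\<bar>" "0 \<le> \<sigma> * (Re w - c)" "\<bar>c\<bar> \<le> \<kappa> * \<bar>Im w\<bar>" for w
  proof -
    let ?S = "closed_segment w (Complex c (Im w))"
    have seg: "u \<in> D \<and> norm (f u) \<le> \<bar>C\<bar> * exp (- \<bar>Im w\<bar>)" if "u \<in> ?S" for u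
    proof -
      from that obtain s where s: "0 \<le> s" "s \<le> 1" "u = (1 - s) *\<^sub>R w + s *\<^sub>R Complex c (Im w)"
        by (auto simp: closed_segment_def)
      have im: "Im u = Im w" unfolding s(3) by (simp add: algebra_simps)
      have re: "Re u = (1 - s) * Re w + s * c" using s by simp
      have "\<bar>Re u\<bar> \<le> (1 - s) * \<bar>Re w\<bar> + s * \<bar>c\<bar>"
        unfolding re using s by (intro order_trans[OF abs_triangle_ineq]) (simp add: abs_mult)
      also have "\<dots> \<le> (1 - s) * (\<kappa> * \<bar>Im w\<bar>) + s * (\<kappa> * \<bar>Im w\<bar>)"
        using s w by (intro add_mono mult_left_mono) auto
      finally have 1: "\<bar>Re u\<bar> \<le> \<kappa> * \<bar>Im u\<bar>" by (simp add: im algebra_simps)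
      have "Re u - c = (1 - s) * (Re w - c)" unfolding re by (simp add: algebra_simps)
      hence e: "\<sigma> * (Re u - c) = (1 - s) * (\<sigma> * (Re w - c))" by (simp only: mult.left_commute)
      have 2: "0 \<le> \<sigma> * (Re u - c)" unfolding e by (rule mult_nonneg_nonneg[OF _ w(3)]) (use s(2) in simp)
      have "u \<in> D \<and> norm (f u) \<le> C * exp (- \<bar>Im u\<bar>)" using bd[OF _ 1 2] w(1) im by simp
      moreover have "C * exp (- \<bar>Im u\<bar>) \<le> \<bar>C\<bar> * exp (- \<bar>Im u\<bar>)" by (intro mult_right_mono) auto
      ultimately show ?thesis unfolding im by (blast intro: order_trans)
    qed
    have "norm (P w - P (Complex c (Im w))) \<le> \<bar>C\<bar> * exp (- \<bar>Im w\<bar>) * norm (w - Complex c (Im w))"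
      by (rule field_differentiable_bound[where S = ?S and f' = f])
         (use seg P in \<open>auto intro: has_field_derivative_at_within\<close>)
    also have "norm (w - Complex c (Im w)) \<le> 2 * \<kappa> * \<bar>Im w\<bar>"
    proof -
      have "w - Complex c (Im w) = of_real (Re w - c)" by (simp add: complex_eq_iff)
      hence "norm (w - Complex c (Im w)) = \<bar>Re w - c\<bar>" by (simp only: norm_of_real)
      then show ?thesis using w by linarith
    qed
    finally show ?thesis by (simp add: mult_left_mono)
  qed
  have dec: "((\<lambda>y. \<bar>C\<bar> * exp (- \<bar>y\<bar>) * (2 * \<kappa> * \<bar>y\<bar>)) \<longlongrightarrow> 0) at_top"
    "((\<lambda>y. \<bar>C\<bar> * exp (- \<bar>y\<bar>) * (2 * \<kappa> * \<bar>y\<bar>)) \<longlongrightarrow> 0) at_bot"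
  proof -
    have "((\<lambda>y. \<bar>C\<bar> * 2 * \<kappa> * (exp (- y) * y)) \<longlongrightarrow> \<bar>C\<bar> * 2 * \<kappa> * 0) at_top"
      by (intro tendsto_mult tendsto_const) real_asymp
    moreover have "\<forall>\<^sub>F y in at_top. \<bar>C\<bar> * 2 * \<kappa> * (exp (- y) * y) = \<bar>C\<bar> * exp (- \<bar>y\<bar>) * (2 * \<kappa> * \<bar>y\<bar>)"
      using eventually_ge_at_top[of 0] by eventually_elim simp
    ultimately show "((\<lambda>y. \<bar>C\<bar> * exp (- \<bar>y\<bar>) * (2 * \<kappa> * \<bar>y\<bar>)) \<longlongrightarrow> 0) at_top"
      by (simp add: Lim_transform_eventually)
    then show "((\<lambda>y. \<bar>C\<bar> * exp (- \<bar>y\<bar>) * (2 * \<kappa> * \<bar>y\<bar>)) \<longlongrightarrow> 0) at_bot"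
      by (simp add: filterlim_at_bot_mirror)
  qed
  have 1: "((\<lambda>t. P (\<gamma> t)) \<longlongrightarrow> L) at_top"
  proof -
    have "((\<lambda>t. P (\<gamma> t) - P (Complex c (Im (\<gamma> t)))) \<longlongrightarrow> 0) at_top"
    proof (rule Lim_null_comparison)
      have "\<forall>\<^sub>F t in at_top. Im (\<gamma> t) \<ge> max y0 (\<bar>c\<bar> / \<kappa>)" using top(1) unfolding filterlim_at_top by blast
      with top(2) show "\<forall>\<^sub>F t in at_top. norm (P (\<gamma> t) - P (Complex c (Im (\<gamma> t)))) \<le> \<bar>C\<bar> * exp (- \<bar>Im (\<gamma> t)\<bar>) * (2 * \<kappa> * \<bar>Im (\<gamma> t)\<bar>)"
      proof eventually_elim
        case (elim t)
        have "\<bar>c\<bar> \<le> \<kappa> * Im (\<gamma> t)" using elim \<kappa> by (simp add: pos_divide_le_eq mult.commute)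
        moreover have "\<kappa> * Im (\<gamma> t) \<le> \<kappa> * \<bar>Im (\<gamma> t)\<bar>" using \<kappa> by (intro mult_left_mono) auto
        ultimately show ?case using elim by (intro close) auto
      qed
      show "((\<lambda>t. \<bar>C\<bar> * exp (- \<bar>Im (\<gamma> t)\<bar>) * (2 * \<kappa> * \<bar>Im (\<gamma> t)\<bar>)) \<longlongrightarrow> 0) at_top"
        by (rule filterlim_compose[OF dec(1) top(1)])
    qed
    from tendsto_add[OF this filterlim_compose[OF L(1) top(1)]] show ?thesis by simp
  qed
  have 2: "((\<lambda>t. P (\<gamma> t)) \<longlongrightarrow> L') at_bot"
  proof -
    have "((\<lambda>t. P (\<gamma> t) - P (Complex c (Im (\<gamma> t)))) \<longlongrightarrow> 0) at_bot"
    proof (rule Lim_null_comparison)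
      have "\<forall>\<^sub>F t in at_bot. Im (\<gamma> t) \<le> - max y0 (\<bar>c\<bar> / \<kappa>)" using bot(1) unfolding filterlim_at_bot by blast
      with bot(2) show "\<forall>\<^sub>F t in at_bot. norm (P (\<gamma> t) - P (Complex c (Im (\<gamma> t)))) \<le> \<bar>C\<bar> * exp (- \<bar>Im (\<gamma> t)\<bar>) * (2 * \<kappa> * \<bar>Im (\<gamma> t)\<bar>)"
      proof eventually_elim
        case (elim t)
        have "\<bar>c\<bar> / \<kappa> \<le> \<bar>Im (\<gamma> t)\<bar>" "y0 \<le> \<bar>Im (\<gamma> t)\<bar>" using elim by linarith+
        then show ?case using elim \<kappa> by (intro close) (auto simp: pos_divide_le_eq mult.commute)
      qed
      show "((\<lambda>t. \<bar>C\<bar> * exp (- \<bar>Im (\<gamma> t)\<bar>) * (2 * \<kappa> * \<bar>Im (\<gamma> t)\<bar>)) \<longlongrightarrow> 0) at_bot"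
        by (rule filterlim_compose[OF dec(2) bot(1)])
    qed
    from tendsto_add[OF this filterlim_compose[OF L(2) bot(1)]] show ?thesis by simp
  qed
  have "((\<lambda>t. f (\<gamma> t) * vector_derivative \<gamma> (at t)) has_integral L - L') UNIV"
    by (rule has_integral_UNIV_limit[where T = T and Q = "\<lambda>t. P (\<gamma> t)", OF core 1 2])
  hence "line_integral \<gamma> f = L - L'" unfolding line_integral_def by (rule integral_unique)
  then show ?thesis by (simp add: L(3) vline_def)
qed

text \<open>Rescales a finite piece of an unbounded contour to a path on [0, 1], for which winding
  numbers and Cauchy's formula are available, and carries the value of the integral back.\<close>

lemma contour_affine:
  fixes \<gamma> :: "real \<Rightarrow> complex"
  assumes ab: "a < b" and \<gamma>: "\<gamma> piecewise_C1_differentiable_on {a..b}"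
  defines "p \<equiv> \<gamma> \<circ> (\<lambda>x. (b - a) *\<^sub>R x + a)"
  shows "valid_path p" "path_image p = \<gamma> ` {a..b}" "pathstart p = \<gamma> a" "pathfinish p = \<gamma> b"
    and "(f has_contour_integral i) p \<Longrightarrow> ((\<lambda>t. f (\<gamma> t) * vector_derivative \<gamma> (at t)) has_integral i) {a..b}"
proof -
  have im: "(\<lambda>x. (b - a) * x + a) ` {0..1} = {a..b}"
    using ab image_affinity_atLeastAtMost[of "b - a" a 0 1] by simp
  show vp: "valid_path p" unfolding valid_path_def p_def
    by (rule piecewise_C1_differentiable_affine) (use im \<gamma> in simp)
  show "path_image p = \<gamma> ` {a..b}" unfolding path_image_def p_def image_comp[symmetric] using im by simp
  show "pathstart p = \<gamma> a" "pathfinish p = \<gamma> b" by (simp_all add: p_def pathstart_def pathfinish_def)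
  assume "(f has_contour_integral i) p"
  hence I: "((\<lambda>s. f (p s) * vector_derivative p (at s)) has_integral i) (cbox 0 1)"
    by (simp add: has_contour_integral cbox_interval)
  define M where "M = b - a"
  have M: "M > 0" using ab by (simp add: M_def)
  have "(0 - - a / M) /\<^sub>R (1 / M) = a" "(1 - - a / M) /\<^sub>R (1 / M) = b"
    using M by (simp_all add: field_simps) (simp add: M_def algebra_simps)
  moreover have "(1 / M) *\<^sub>R t + - a / M = (t - a) / M" for t
    by (simp add: diff_divide_distrib)
  ultimately have 1: "((\<lambda>t. f (p ((t - a) / M)) * vector_derivative p (at ((t - a) / M))) has_integral M *\<^sub>R i) {a..b}"
    using has_integral_affinity'[OF I, of "1 / M" "- a / M"] M by (simp only: cbox_interval) simp
  obtain S where S: "finite S" "\<gamma> C1_differentiable_on ({a..b} - S)"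
    using \<gamma> by (auto simp: piecewise_C1_differentiable_on_def)
  then obtain D where D: "\<And>t. t \<in> {a..b} - S \<Longrightarrow> (\<gamma> has_vector_derivative D t) (at t)"
    unfolding C1_differentiable_on_def by blast
  have "((\<lambda>t. M *\<^sub>R (f (\<gamma> t) * vector_derivative \<gamma> (at t))) has_integral M *\<^sub>R i) {a..b}"
  proof (rule has_integral_spike_finite[OF S(1) _ 1])
    fix t assume t: "t \<in> {a..b} - S"
    have "((\<lambda>x. M *\<^sub>R x + a) has_vector_derivative M) (at ((t - a) / M))"
      by (auto intro!: derivative_eq_intros)
    moreover have "(\<gamma> has_vector_derivative D t) (at (M *\<^sub>R ((t - a) / M) + a))" using D[OF t] M by simp
    ultimately have "(p has_vector_derivative M *\<^sub>R D t) (at ((t - a) / M))"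
      unfolding p_def M_def[symmetric] by (rule vector_diff_chain_at)
    hence "vector_derivative p (at ((t - a) / M)) = M *\<^sub>R D t" by (rule vector_derivative_at)
    moreover have "vector_derivative \<gamma> (at t) = D t" using D[OF t] by (rule vector_derivative_at)
    moreover have "p ((t - a) / M) = \<gamma> t" using M by (simp add: p_def M_def[symmetric])
    ultimately show "M *\<^sub>R (f (\<gamma> t) * vector_derivative \<gamma> (at t)) = f (p ((t - a) / M)) * vector_derivative p (at ((t - a) / M))"
      by simp
  qed
  from has_integral_cmul[OF this, of "1 / M"] M
  show "((\<lambda>t. f (\<gamma> t) * vector_derivative \<gamma> (at t)) has_integral i) {a..b}" by simp
qed

text \<open>A limit of \<open>sgn\<close> fixes only the asymptotic direction \<open>e\<close>, but
  together with growth of the modulus this places the tail inside any sector that contains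
  \<open>e\<close> in its interior and, since \<open>e\<close> is not vertical, on one side of every
  vertical line.\<close>

lemma ray_tail:
  fixes \<gamma> :: "real \<Rightarrow> complex"
  assumes inf: "filterlim \<gamma> at_infinity F" and dir: "((\<lambda>t. sgn (\<gamma> t)) \<longlongrightarrow> e) F"
  shows "Im e > 0 \<Longrightarrow> filterlim (\<lambda>t. Im (\<gamma> t)) at_top F"
    and "Im e < 0 \<Longrightarrow> filterlim (\<lambda>t. Im (\<gamma> t)) at_bot F"
    and "\<bar>Re e\<bar> < \<kappa> * \<bar>Im e\<bar> \<Longrightarrow> 0 < \<sigma> * Re e \<Longrightarrow>
      \<forall>\<^sub>F t in F. \<bar>Re (\<gamma> t)\<bar> \<le> \<kappa> * \<bar>Im (\<gamma> t)\<bar> \<and> 0 \<le> \<sigma> * (Re (\<gamma> t) - c)"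
proof -
  have N: "filterlim (\<lambda>t. norm (\<gamma> t)) at_top F" using inf by (rule filterlim_at_infinity_imp_norm_at_top)
  have Re: "Re (\<gamma> t) = Re (sgn (\<gamma> t)) * norm (\<gamma> t)" and Im: "Im (\<gamma> t) = Im (sgn (\<gamma> t)) * norm (\<gamma> t)" for t
    by (cases "\<gamma> t = 0"; simp add: sgn_div_norm)+
  have Rl: "((\<lambda>t. Re (sgn (\<gamma> t))) \<longlongrightarrow> Re e) F" and Il: "((\<lambda>t. Im (sgn (\<gamma> t))) \<longlongrightarrow> Im e) F"
    by (intro tendsto_intros dir)+
  show "filterlim (\<lambda>t. Im (\<gamma> t)) at_top F" if "Im e > 0"
    unfolding Im by (rule filterlim_tendsto_pos_mult_at_top[OF Il that N])
  show "filterlim (\<lambda>t. Im (\<gamma> t)) at_bot F" if "Im e < 0"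
    unfolding Im by (rule filterlim_tendsto_neg_mult_at_bot[OF Il that N])
  assume r: "\<bar>Re e\<bar> < \<kappa> * \<bar>Im e\<bar>" and s: "0 < \<sigma> * Re e"
  have "((\<lambda>t. \<kappa> * \<bar>Im (sgn (\<gamma> t))\<bar> - \<bar>Re (sgn (\<gamma> t))\<bar>) \<longlongrightarrow> \<kappa> * \<bar>Im e\<bar> - \<bar>Re e\<bar>) F"
    by (intro tendsto_intros Rl Il)
  hence 1: "\<forall>\<^sub>F t in F. 0 < \<kappa> * \<bar>Im (sgn (\<gamma> t))\<bar> - \<bar>Re (sgn (\<gamma> t))\<bar>"
    using r by (intro order_tendstoD(1)) auto
  have "filterlim (\<lambda>t. (\<sigma> * Re (sgn (\<gamma> t))) * norm (\<gamma> t)) at_top F"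
    by (rule filterlim_tendsto_pos_mult_at_top[OF _ s N]) (intro tendsto_intros Rl)
  hence 2: "\<forall>\<^sub>F t in F. \<sigma> * c \<le> (\<sigma> * Re (sgn (\<gamma> t))) * norm (\<gamma> t)"
    unfolding filterlim_at_top by blast
  from 1 2 show "\<forall>\<^sub>F t in F. \<bar>Re (\<gamma> t)\<bar> \<le> \<kappa> * \<bar>Im (\<gamma> t)\<bar> \<and> 0 \<le> \<sigma> * (Re (\<gamma> t) - c)"
  proof eventually_elim
    case (elim t)
    have "\<bar>Re (sgn (\<gamma> t))\<bar> * norm (\<gamma> t) \<le> (\<kappa> * \<bar>Im (sgn (\<gamma> t))\<bar>) * norm (\<gamma> t)"
      using elim by (intro mult_right_mono) auto
    hence "\<bar>Re (\<gamma> t)\<bar> \<le> \<kappa> * \<bar>Im (\<gamma> t)\<bar>" unfolding Re Im by (simp only: abs_mult abs_norm_cancel mult.assoc)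
    moreover have "0 \<le> \<sigma> * (Re (\<gamma> t) - c)" unfolding Re using elim by (simp only: right_diff_distrib mult.assoc diff_ge_0_iff_ge)
    ultimately show ?case ..
  qed
qed

lemma unbounded_contour_tails:
  assumes \<gamma>: "unbounded_contour \<theta> \<gamma>" and \<theta>: "0 < sin \<theta>" "\<bar>cos \<theta>\<bar> < \<kappa> * sin \<theta>" "0 < \<sigma> * cos \<theta>"
  shows "filterlim (\<lambda>t. Im (\<gamma> t)) at_top at_top"
    and "\<forall>\<^sub>F t in at_top. \<bar>Re (\<gamma> t)\<bar> \<le> \<kappa> * \<bar>Im (\<gamma> t)\<bar> \<and> 0 \<le> \<sigma> * (Re (\<gamma> t) - c)"
    and "filterlim (\<lambda>t. Im (\<gamma> t)) at_bot at_bot"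
    and "\<forall>\<^sub>F t in at_bot. \<bar>Re (\<gamma> t)\<bar> \<le> \<kappa> * \<bar>Im (\<gamma> t)\<bar> \<and> 0 \<le> \<sigma> * (Re (\<gamma> t) - c)"
proof -
  note U = \<gamma>[unfolded unbounded_contour_def]
  have t: "filterlim \<gamma> at_infinity at_top" "((\<lambda>t. sgn (\<gamma> t)) \<longlongrightarrow> cis \<theta>) at_top"
    and b: "filterlim \<gamma> at_infinity at_bot" "((\<lambda>t. sgn (\<gamma> t)) \<longlongrightarrow> cis (- \<theta>)) at_bot" using U by auto
  show "filterlim (\<lambda>t. Im (\<gamma> t)) at_top at_top" using ray_tail(1)[OF t] \<theta> by simp
  show "filterlim (\<lambda>t. Im (\<gamma> t)) at_bot at_bot" using ray_tail(2)[OF b] \<theta> by simp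
  show "\<forall>\<^sub>F t in at_top. \<bar>Re (\<gamma> t)\<bar> \<le> \<kappa> * \<bar>Im (\<gamma> t)\<bar> \<and> 0 \<le> \<sigma> * (Re (\<gamma> t) - c)"
    by (rule ray_tail(3)[OF t]) (use \<theta> in auto)
  show "\<forall>\<^sub>F t in at_bot. \<bar>Re (\<gamma> t)\<bar> \<le> \<kappa> * \<bar>Im (\<gamma> t)\<bar> \<and> 0 \<le> \<sigma> * (Re (\<gamma> t) - c)"
    by (rule ray_tail(3)[OF b]) (use \<theta> in auto)
qed

lemma integrable_vertical:
  fixes f :: "complex \<Rightarrow> complex"
  assumes "continuous_on D f" and c: "\<And>q. Complex c q \<in> D"
    and bd: "\<And>w. y0 \<le> \<bar>Im w\<bar> \<Longrightarrow> \<bar>Re w\<bar> \<le> \<kappa> * \<bar>Im w\<bar> \<Longrightarrow> 0 \<le> \<sigma> * (Re w - c) \<Longrightarrow>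
        norm (f w) \<le> C * exp (- \<bar>Im w\<bar>)" and \<kappa>: "\<kappa> > 0"
  shows "integrable lborel (\<lambda>q. f (Complex c q))"
proof (rule integrable_exp_decay)
  have "continuous_on UNIV (Complex c)"
    using vderiv_vertical by (intro continuous_at_imp_continuous_on) (auto intro: has_vector_derivative_continuous)
  then show "continuous_on UNIV (\<lambda>q. f (Complex c q))"
    by (rule continuous_on_compose2[OF assms(1)]) (use c in auto)
  fix q assume "max y0 (\<bar>c\<bar> / \<kappa>) \<le> \<bar>q\<bar>"
  then show "norm (f (Complex c q)) \<le> C * exp (- \<bar>q\<bar>)"
    using bd[of "Complex c q"] \<kappa> by (auto simp: pos_divide_le_eq mult.commute)
qed

text \<open>On a convex domain the integrand has a global primitive, so the shape of the contour
  inside the domain does not influence the integral. The number \<open>\<sigma>\<close> records the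
  side of the vertical line to which the contour turns.\<close>

lemma line_integral_shift:
  fixes f :: "complex \<Rightarrow> complex"
  assumes D: "open D" "convex D" and f: "f holomorphic_on D" and c: "\<And>q. Complex c q \<in> D"
    and bd: "\<And>w. y0 \<le> \<bar>Im w\<bar> \<Longrightarrow> \<bar>Re w\<bar> \<le> \<kappa> * \<bar>Im w\<bar> \<Longrightarrow> 0 \<le> \<sigma> * (Re w - c) \<Longrightarrow>
        w \<in> D \<and> norm (f w) \<le> C * exp (- \<bar>Im w\<bar>)"
    and \<gamma>: "unbounded_contour \<theta> \<gamma>" and \<theta>: "0 < sin \<theta>" "\<bar>cos \<theta>\<bar> < \<kappa> * sin \<theta>" "0 < \<sigma> * cos \<theta>"
    and r: "\<And>t. \<gamma> t \<in> D"
  shows "line_integral \<gamma> f = 2 * pi * \<i> * vline c f"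
proof -
  have \<kappa>: "\<kappa> > 0" using \<theta> by (smt (verit) mult_nonpos_nonneg)
  obtain P where P: "\<And>w. w \<in> D \<Longrightarrow> (P has_field_derivative f w) (at w within D)"
    using holomorphic_convex_primitive'[OF D(2,1) f] by blast
  hence P': "(P has_field_derivative f w) (at w)" if "w \<in> D" for w
    using that at_within_open[OF that D(1)] by metis
  have int: "integrable lborel (\<lambda>q. f (Complex c q))"
    using holomorphic_on_imp_continuous_on[OF f] c bd \<kappa>
    by (intro integrable_vertical[where ?y0.0 = y0 and \<kappa> = \<kappa> and \<sigma> = \<sigma> and C = C]) auto
  note T = unbounded_contour_tails[OF \<gamma> \<theta>]
  have core: "((\<lambda>t. f (\<gamma> t) * vector_derivative \<gamma> (at t)) has_integral P (\<gamma> b) - P (\<gamma> a)) {a..b}"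
    if "a \<le> - 0" "0 \<le> b" for a b
    using that P' r \<gamma> D by (intro contour_primitive_integral) (auto simp: unbounded_contour_def)
  show ?thesis
    by (rule line_integral_vertical[OF D(1) P' c int bd \<kappa> T(1,2,3,4) core])
qed

lemma unbounded_contour_continuous:
  assumes "unbounded_contour \<theta> \<gamma>"
  shows "continuous_on UNIV \<gamma>"
proof (rule continuous_at_imp_continuous_on, rule ballI)
  fix t :: real
  have "continuous_on {t - 1..t + 1} \<gamma>"
    using assms by (auto simp: unbounded_contour_def piecewise_C1_differentiable_on_def)
  then show "isCont \<gamma> t" by (rule continuous_on_interior) auto
qed

text \<open>Near any given point only a compact piece of the contour is met. Closedness makes the
  complement open, so that a point of \<open>right_side\<close> can be joined to 0 by a path that
  avoids the contour.\<close>

lemma unbounded_contour_closed: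
  assumes \<gamma>: "unbounded_contour \<theta> \<gamma>"
  shows "closed (range \<gamma>)"
proof -
  have "x \<in> range \<gamma>" if x: "x \<in> closure (range \<gamma>)" for x
  proof -
    have "filterlim (\<lambda>t. norm (\<gamma> t)) at_top at_top" "filterlim (\<lambda>t. norm (\<gamma> t)) at_top at_bot"
      using \<gamma> by (auto simp: unbounded_contour_def intro: filterlim_at_infinity_imp_norm_at_top)
    hence "\<forall>\<^sub>F t in at_top. norm x + 1 \<le> norm (\<gamma> t)" "\<forall>\<^sub>F t in at_bot. norm x + 1 \<le> norm (\<gamma> t)"
      unfolding filterlim_at_top by blast+
    then obtain b a where b: "\<And>t. t \<ge> b \<Longrightarrow> norm x + 1 \<le> norm (\<gamma> t)" and a: "\<And>t. t \<le> a \<Longrightarrow> norm x + 1 \<le> norm (\<gamma> t)"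
      by (auto simp: eventually_at_top_linorder eventually_at_bot_linorder)
    have "range \<gamma> \<subseteq> \<gamma> ` {a..b} \<union> - ball 0 (norm x + 1)"
    proof
      fix w assume "w \<in> range \<gamma>"
      then obtain t where "w = \<gamma> t" by blast
      then show "w \<in> \<gamma> ` {a..b} \<union> - ball 0 (norm x + 1)" using a[of t] b[of t] by (cases "t \<in> {a..b}") auto
    qed
    moreover have "closed (\<gamma> ` {a..b} \<union> - ball 0 (norm x + 1))"
      using unbounded_contour_continuous[OF \<gamma>]
      by (intro closed_Un compact_imp_closed compact_continuous_image closed_Compl open_ball) (auto intro: continuous_on_subset)
    ultimately have "closure (range \<gamma>) \<subseteq> \<gamma> ` {a..b} \<union> - ball 0 (norm x + 1)"
      by (rule closure_minimal)
    then show ?thesis using x by auto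
  qed
  then show ?thesis using closure_subset_eq by blast
qed

text \<open>
  A pole \<open>z\<close> to the right of \<open>\<gamma>\<close> does not contribute: a long piece of \<open>\<gamma>\<close>, closed up by a segment far to
  the left, has winding number \<open>0\<close> around \<open>0\<close>, hence around \<open>z\<close>.
\<close>

lemma line_integral_pole:
  fixes g :: "complex \<Rightarrow> complex"
  assumes g: "g holomorphic_on {w. Re w < 0}" and \<gamma>: "unbounded_contour \<theta> \<gamma>"
    and \<theta>: "0 < sin \<theta>" "\<bar>cos \<theta>\<bar> < \<kappa> * sin \<theta>" "cos \<theta> < 0"
    and neg: "\<And>t. Re (\<gamma> t) < 0" and z: "z \<in> right_side \<gamma>" "Re z < 0" and c: "c < Re z"
    and bd: "\<And>w. y0 \<le> \<bar>Im w\<bar> \<Longrightarrow> \<bar>Re w\<bar> \<le> \<kappa> * \<bar>Im w\<bar> \<Longrightarrow> Re w \<le> c \<Longrightarrow>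
        norm (g w) \<le> C * exp (- \<bar>Im w\<bar>)"
  shows "line_integral \<gamma> (\<lambda>w. g w / (z - w)) = 2 * pi * \<i> * vline c (\<lambda>w. g w / (z - w))"
proof -
  let ?f = "\<lambda>w. g w / (z - w)" and ?D = "{w. Re w < Re z}"
  have \<kappa>: "\<kappa> > 0" using \<theta> by (smt (verit) mult_nonpos_nonneg)
  have \<sigma>: "0 < (-1) * cos \<theta>" using \<theta> by simp
  have D: "open ?D" "convex ?D" by (simp_all add: open_halfspace_Re_lt convex_halfspace_Re_lt)
  have f: "?f holomorphic_on ?D" using z(2)
    by (intro holomorphic_intros holomorphic_on_subset[OF g]) auto
  obtain P where P: "\<And>w. w \<in> ?D \<Longrightarrow> (P has_field_derivative ?f w) (at w within ?D)"
    using holomorphic_convex_primitive'[OF D(2,1) f] by blast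
  hence P': "(P has_field_derivative ?f w) (at w)" if "w \<in> ?D" for w
    using that at_within_open[OF that D(1)] by metis
  have bd': "w \<in> ?D \<and> norm (?f w) \<le> (\<bar>C\<bar> / (Re z - c)) * exp (- \<bar>Im w\<bar>)"
    if "y0 \<le> \<bar>Im w\<bar>" "\<bar>Re w\<bar> \<le> \<kappa> * \<bar>Im w\<bar>" "0 \<le> (-1) * (Re w - c)" for w
  proof -
    have "norm (g w) \<le> \<bar>C\<bar> * exp (- \<bar>Im w\<bar>)"
      using bd[OF that(1,2)] that(3) by (smt (verit) exp_gt_zero mult_right_mono)
    moreover have "Re z - c \<le> norm (z - w)" using that(3) complex_Re_le_cmod[of "z - w"] by simp
    ultimately have "norm (g w) / norm (z - w) \<le> (\<bar>C\<bar> * exp (- \<bar>Im w\<bar>)) / (Re z - c)"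
      using c by (intro frac_le) auto
    then show ?thesis using that(3) c by (simp add: norm_divide)
  qed
  have int: "integrable lborel (\<lambda>q. ?f (Complex c q))"
    using holomorphic_on_imp_continuous_on[OF f] c bd' \<kappa>
    by (intro integrable_vertical[where ?y0.0 = y0 and \<kappa> = \<kappa> and \<sigma> = "-1" and C = "\<bar>C\<bar> / (Re z - c)" and D = ?D]) auto
  have op: "open (- range \<gamma>)" using unbounded_contour_closed[OF \<gamma>] by (simp add: open_Compl)
  have zc: "connected_component (- range \<gamma>) 0 z" using z(1) by (simp add: right_side_def)
  hence znr: "z \<notin> range \<gamma>" using connected_component_in by blast
  have "path_component (- range \<gamma>) 0 z" using zc open_path_connected_component[OF op] by metis
  then obtain h where h: "path h" "path_image h \<subseteq> - range \<gamma>" "pathstart h = 0" "pathfinish h = z"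
    by (auto simp: path_component_def)
  have "bounded (path_image h)" using h(1) by (rule bounded_path_image)
  then obtain R where R: "\<And>w. w \<in> path_image h \<Longrightarrow> norm w \<le> R" by (auto simp: bounded_iff)
  \<comment> \<open>Points of real part at most \<open>d\<close> lie to the left of the whole path
    \<open>h\<close> from 0 to \<open>z\<close>, so closing the contour there does not meet
    \<open>h\<close>, and to the left of \<open>z\<close>, where \<open>P\<close> is a
    primitive.\<close>
  define d where "d = min (- R - 1) (Re z - 1)"
  note T = unbounded_contour_tails[OF \<gamma> \<theta>(1,2) \<sigma>]
  obtain b0 a0 where b0: "\<And>t. t \<ge> b0 \<Longrightarrow> Re (\<gamma> t) \<le> d" and a0: "\<And>t. t \<le> a0 \<Longrightarrow> Re (\<gamma> t) \<le> d"
    using T(2)[of d] T(4)[of d] by (auto simp: eventually_at_top_linorder eventually_at_bot_linorder)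
  define T0 where "T0 = max 1 (max b0 (- a0))"
  have core: "((\<lambda>t. ?f (\<gamma> t) * vector_derivative \<gamma> (at t)) has_integral P (\<gamma> b) - P (\<gamma> a)) {a..b}"
    if ab: "a \<le> - T0" "T0 \<le> b" for a b
  proof -
    have "1 \<le> T0" by (simp add: T0_def)
    hence lt: "a < b" using ab by linarith
    have da: "Re (\<gamma> a) \<le> d" and db: "Re (\<gamma> b) \<le> d" using a0[of a] b0[of b] ab by (auto simp: T0_def)
    have \<gamma>ab: "\<gamma> piecewise_C1_differentiable_on {a..b}" using \<gamma> by (simp add: unbounded_contour_def)
    define p where "p = \<gamma> \<circ> (\<lambda>x. (b - a) *\<^sub>R x + a)"
    note p = contour_affine[OF lt \<gamma>ab, folded p_def]
    let ?l = "linepath (\<gamma> b) (\<gamma> a)"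
    have li: "Re w \<le> d" if "w \<in> path_image ?l" for w
    proof -
      have "closed_segment (\<gamma> b) (\<gamma> a) \<subseteq> {w. Re w \<le> d}"
        using da db by (intro closed_segment_subset) (auto simp: convex_halfspace_Re_le)
      then show ?thesis using that by auto
    qed
    have dz: "d < Re z" "d < - R" by (auto simp: d_def)
    have vp: "valid_path (p +++ ?l)" using p by (intro valid_path_join) auto
    have pi: "path_image (p +++ ?l) = \<gamma> ` {a..b} \<union> path_image ?l" using p by (simp add: path_image_join)
    have pi_neg: "path_image (p +++ ?l) \<subseteq> {w. Re w < 0}" using neg li dz z(2) by (fastforce simp: pi)
    have pi_h: "path_image h \<inter> path_image (p +++ ?l) = {}"
    proof -
      have "w \<notin> path_image ?l" if "w \<in> path_image h" for w
      proof
        assume "w \<in> path_image ?l"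
        from li[OF this] R[OF that] dz abs_Re_le_cmod[of w] show False by linarith
      qed
      then show ?thesis using h(2) by (auto simp: pi)
    qed
    have cl: "pathfinish (p +++ ?l) = pathstart (p +++ ?l)" using p by simp
    have zh: "z \<in> path_image h" "0 \<in> path_image h" using h(3,4) pathfinish_in_path_image pathstart_in_path_image by metis+
    have "winding_number (p +++ ?l) z = winding_number (p +++ ?l) 0"
      using vp cl zh h(1) pi_h by (intro winding_number_eq[where S = "path_image h"]) (auto simp: valid_path_imp_path connected_path_image)
    also have "\<dots> = 0"
      using vp cl pi_neg by (intro winding_number_zero_outside[where s = "{w. Re w < 0}"]) (auto simp: valid_path_imp_path convex_halfspace_Re_lt)
    finally have wn: "winding_number (p +++ ?l) z = 0" .
    have "path_image (p +++ ?l) \<subseteq> {w. Re w < 0} - {z}" using pi_neg pi_h zh(1) by auto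
    hence "((\<lambda>w. g w / (w - z)) has_contour_integral (2 * pi * \<i> * winding_number (p +++ ?l) z * g z)) (p +++ ?l)"
      using vp cl z(2) by (intro Cauchy_integral_formula_convex_simple[OF convex_halfspace_Re_lt g])
         (auto simp: interior_open open_halfspace_Re_lt)
    hence "((\<lambda>w. g w / (w - z)) has_contour_integral 0) (p +++ ?l)" by (simp add: wn)
    from has_contour_integral_neg[OF this] have loop: "(?f has_contour_integral 0) (p +++ ?l)"
      by (simp add: minus_divide_right)
    have "(?f has_contour_integral (P (pathfinish ?l) - P (pathstart ?l))) ?l"
      by (rule contour_integral_primitive[OF P]) (use li dz in \<open>auto simp del: path_image_linepath dest!: li\<close>)
    hence l: "(?f has_contour_integral (P (\<gamma> a) - P (\<gamma> b))) ?l" by simp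
    have "?f contour_integrable_on p"
      using contour_integrable_joinD1[of ?f p ?l] loop p(1) by (auto simp: contour_integrable_on_def)
    then obtain I where I: "(?f has_contour_integral I) p" by (auto simp: contour_integrable_on_def)
    have "(?f has_contour_integral (I + (P (\<gamma> a) - P (\<gamma> b)))) (p +++ ?l)"
      using I l p(1) by (intro has_contour_integral_join) auto
    hence "I + (P (\<gamma> a) - P (\<gamma> b)) = 0" using loop has_contour_integral_unique by blast
    hence "I = P (\<gamma> b) - P (\<gamma> a)" by (simp add: algebra_simps)
    with p(5)[OF I] show ?thesis by simp
  qed
  show ?thesis
    by (rule line_integral_vertical[OF D(1) P' _ int bd' \<kappa> T(1,2,3,4) core]) (use c in auto)
qed

section \<open>The Airy function\<close>

lemma wedge_right: "t > 0 \<Longrightarrow> wedge c \<theta> t = c + of_real t * cis \<theta>"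
  and wedge_left: "t < 0 \<Longrightarrow> wedge c \<theta> t = c - of_real t * cis (- \<theta>)"
  and wedge_0: "wedge c \<theta> 0 = c"
  by (simp_all add: wedge_def)

lemma wedge_vector_derivative:
  "t > 0 \<Longrightarrow> (wedge c \<theta> has_vector_derivative cis \<theta>) (at t)"
  "t < 0 \<Longrightarrow> (wedge c \<theta> has_vector_derivative - cis (- \<theta>)) (at t)"
proof -
  assume t: "t > 0"
  have "((\<lambda>t. c + of_real t * cis \<theta>) has_vector_derivative cis \<theta>) (at t)"
    by (auto intro!: derivative_eq_intros)
  then show "(wedge c \<theta> has_vector_derivative cis \<theta>) (at t)"
    by (rule has_vector_derivative_transform_within_open[of _ _ _ "{0<..}"]) (use t in \<open>auto simp: wedge_right\<close>)
next
  assume t: "t < 0"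
  have "((\<lambda>t. c - of_real t * cis (- \<theta>)) has_vector_derivative - cis (- \<theta>)) (at t)"
    by (auto intro!: derivative_eq_intros)
  then show "(wedge c \<theta> has_vector_derivative - cis (- \<theta>)) (at t)"
    by (rule has_vector_derivative_transform_within_open[of _ _ _ "{..<0}"]) (use t in \<open>auto simp: wedge_left\<close>)
qed

lemma wedge_continuous: "continuous_on S (wedge c \<theta>)"
proof -
  have "continuous_on ({..0} \<union> {0..}) (\<lambda>t::real. if t \<le> 0 then c - of_real t * cis (- \<theta>) else c + of_real t * cis \<theta>)"
    by (intro continuous_on_cases continuous_intros) auto
  moreover have "(\<lambda>t::real. if t \<le> 0 then c - of_real t * cis (- \<theta>) else c + of_real t * cis \<theta>) = wedge c \<theta>"
    by (intro ext) (auto simp: wedge_def sgn_real_def)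
  moreover have "{..0} \<union> {0..} = (UNIV :: real set)" by auto
  ultimately show ?thesis using continuous_on_subset by (metis subset_UNIV)
qed

lemma wedge_C1: "wedge c \<theta> piecewise_C1_differentiable_on {a..b}"
proof -
  have "wedge c \<theta> C1_differentiable_on ({a..b} - {0})"
    unfolding C1_differentiable_on_def
  proof (intro exI[of _ "\<lambda>t. if t < 0 then - cis (- \<theta>) else cis \<theta>"] conjI ballI)
    fix t assume "t \<in> {a..b} - {0}"
    then show "(wedge c \<theta> has_vector_derivative (if t < 0 then - cis (- \<theta>) else cis \<theta>)) (at t)"
      using wedge_vector_derivative[of t c \<theta>] by (cases "t < 0") auto
  next
    have "continuous_on ({..<0} \<union> {0<..}) (\<lambda>t::real. if t < 0 then - cis (- \<theta>) else cis \<theta>)"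
      by (rule continuous_on_open_Un)
         (auto intro: continuous_on_eq[OF continuous_on_const[of _ "- cis (- \<theta>)"]] continuous_on_eq[OF continuous_on_const[of _ "cis \<theta>"]])
    then show "continuous_on ({a..b} - {0}) (\<lambda>t. if t < 0 then - cis (- \<theta>) else cis \<theta>)"
      by (rule continuous_on_subset) auto
  qed
  then show ?thesis unfolding piecewise_C1_differentiable_on_def using wedge_continuous by blast
qed

lemma sgn_affine_ray:
  fixes c e :: complex
  assumes "norm e = 1"
  shows "filterlim (\<lambda>t::real. c + of_real t * e) at_infinity at_top"
    and "((\<lambda>t::real. sgn (c + of_real t * e)) \<longlongrightarrow> e) at_top"
proof -
  show inf: "filterlim (\<lambda>t::real. c + of_real t * e) at_infinity at_top"
  proof (rule filterlim_norm_at_top_imp_at_infinity, rule filterlim_at_top_mono)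
    show "filterlim (\<lambda>t::real. t - norm c) at_top at_top" by real_asymp
    have ge: "t - norm c \<le> norm (c + of_real t * e)" if "t \<ge> 0" for t :: real
      using norm_triangle_ineq4[of "c + of_real t * e" c] assms that by (simp add: norm_mult)
    then show "\<forall>\<^sub>F t::real in at_top. t - norm c \<le> norm (c + of_real t * e)"
      by (rule eventually_mono[OF eventually_ge_at_top[of 0]]) (use ge in auto)
  qed
  have "((\<lambda>t::real. of_real (1 / t) * c + e) \<longlongrightarrow> of_real 0 * c + e) at_top"
    by (intro tendsto_intros) real_asymp
  hence "((\<lambda>t::real. sgn (of_real (1 / t) * c + e)) \<longlongrightarrow> sgn e) at_top"
    using assms by (intro tendsto_sgn) auto
  moreover have "sgn e = e" using assms by (simp add: sgn_div_norm)
  moreover have "\<forall>\<^sub>F t::real in at_top. sgn (of_real (1 / t) * c + e) = sgn (c + of_real t * e)"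
    using eventually_gt_at_top[of 0]
  proof eventually_elim
    case (elim t)
    have "c + of_real t * e = of_real t * (of_real (1 / t) * c + e)" using elim by (simp add: algebra_simps)
    moreover have "sgn (complex_of_real t) = 1" using elim by (simp add: sgn_div_norm scaleR_conv_of_real)
    ultimately show ?case by (simp only: sgn_mult mult_1)
  qed
  ultimately show "((\<lambda>t::real. sgn (c + of_real t * e)) \<longlongrightarrow> e) at_top"
    by (auto intro: Lim_transform_eventually)
qed

lemma wedge_unbounded_contour: "unbounded_contour \<theta> (wedge c \<theta>)"
proof -
  have t: "\<forall>\<^sub>F t in at_top. c + of_real t * cis \<theta> = wedge c \<theta> t"
    using eventually_gt_at_top[of 0] by eventually_elim (simp add: wedge_right)
  have b: "\<forall>\<^sub>F t in at_top. c + of_real t * cis (- \<theta>) = wedge c \<theta> (- t)"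
    using eventually_gt_at_top[of 0] by eventually_elim (simp add: wedge_left)
  have "filterlim (wedge c \<theta>) at_infinity at_top" "filterlim (\<lambda>t. wedge c \<theta> (- t)) at_infinity at_top"
    using sgn_affine_ray(1)[of "cis \<theta>" c] sgn_affine_ray(1)[of "cis (- \<theta>)" c] t b
    by (auto elim: filterlim_mono_eventually[OF _ order_refl order_refl])
  moreover have "((\<lambda>t. sgn (wedge c \<theta> t)) \<longlongrightarrow> cis \<theta>) at_top"
    by (rule Lim_transform_eventually[OF sgn_affine_ray(2)[of "cis \<theta>" c]]) (use t in \<open>auto elim: eventually_mono\<close>)
  moreover have "((\<lambda>t. sgn (wedge c \<theta> (- t))) \<longlongrightarrow> cis (- \<theta>)) at_top"
    by (rule Lim_transform_eventually[OF sgn_affine_ray(2)[of "cis (- \<theta>)" c]]) (use b in \<open>auto elim: eventually_mono\<close>)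
  ultimately show ?thesis
    unfolding unbounded_contour_def by (auto simp: filterlim_at_bot_mirror wedge_C1)
qed

text \<open>With a = \<alpha>_i and y = \<beta>_i this is 1 / f_i; with - \<alpha>_i in place of a
  and - w in place of w it is f_i itself. For a = 0 it is the integrand of the Airy
  function.\<close>

definition cub :: "real \<Rightarrow> real \<Rightarrow> complex \<Rightarrow> complex" where
  "cub a y w = exp (w ^ 3 / 3 - of_real a * w\<^sup>2 - of_real y * w)"

lemma Re_cub: "Re (w ^ 3 / 3 - of_real a * w\<^sup>2 - of_real y * w) =
    Re w ^ 3 / 3 - Re w * (Im w)\<^sup>2 - a * ((Re w)\<^sup>2 - (Im w)\<^sup>2) - y * Re w"
  by (simp add: power3_eq_cube power2_eq_square field_simps)

lemma norm_cub_vertical: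
  "norm (cub a y (Complex c q)) = exp (c ^ 3 / 3 - a * c\<^sup>2 - y * c) * exp (- (c - a) * q\<^sup>2)"
  unfolding cub_def norm_exp_eq_Re Re_cub by (simp add: algebra_simps flip: exp_add)

lemma cub_holomorphic [holomorphic_intros]: "f holomorphic_on S \<Longrightarrow> (\<lambda>w. cub a y (f w)) holomorphic_on S"
  unfolding cub_def by (intro holomorphic_intros) auto

text \<open>The decay comes from - Re w (Im w)^2. The slope 3/2 lies between the cotangents of pi/5
  (about 1.38) and of pi/6 (about 1.73), where the decay of exp(w^3/3) ends, so the sector admits
  the contours of angle pi/3 and pi/5. Of the coefficient 1 the cube uses 3/4, the quadratic term
  1/8, the linear term 1/16, and 1/16 is left for |Im w|; the constants 26 and 16 are made for these
  shares.\<close>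

lemma cub_sector_bound:
  assumes c: "c > 0" "26 * \<bar>a\<bar> \<le> c" and w: "c \<le> Re w" "\<bar>Re w\<bar> \<le> 3 / 2 * \<bar>Im w\<bar>"
    and q: "16 / c + 16 * \<bar>y\<bar> + 1 \<le> \<bar>Im w\<bar>"
  shows "norm (cub a y w) \<le> exp (- \<bar>Im w\<bar>)"
proof -
  define p Q where "p = Re w" and "Q = \<bar>Im w\<bar>"
  have p: "p \<ge> c" "p > 0" "p \<le> 3 / 2 * Q" using w c by (auto simp: p_def Q_def)
  have "16 / c > 0" using c by simp
  hence Q1: "Q \<ge> 1" "Q \<ge> 16 / c" "Q \<ge> 16 * \<bar>y\<bar>" using q unfolding Q_def by linarith+
  have pp: "p\<^sup>2 \<le> 9 / 4 * Q\<^sup>2" using power_mono[OF p(3), of 2] p(2) by (simp add: power_mult_distrib power2_eq_square)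
  have "p ^ 3 / 3 = p * p\<^sup>2 / 3" by (simp add: power3_eq_cube power2_eq_square)
  also have "\<dots> \<le> p * (9 / 4 * Q\<^sup>2) / 3" using pp p(2) by (intro divide_right_mono mult_left_mono) auto
  finally have 1: "p ^ 3 / 3 \<le> 3 / 4 * (p * Q\<^sup>2)" by simp
  have "- a * (p\<^sup>2 - Q\<^sup>2) \<le> \<bar>a\<bar> * (p\<^sup>2 + Q\<^sup>2)"
  proof -
    have "- a * (p\<^sup>2 - Q\<^sup>2) \<le> \<bar>a\<bar> * \<bar>p\<^sup>2 - Q\<^sup>2\<bar>" by (metis abs_ge_self abs_minus_cancel abs_mult)
    also have "\<dots> \<le> \<bar>a\<bar> * (p\<^sup>2 + Q\<^sup>2)" by (intro mult_left_mono) (auto simp: abs_le_iff add_increasing add_increasing2)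
    finally show ?thesis .
  qed
  also have "\<dots> \<le> \<bar>a\<bar> * (13 / 4 * Q\<^sup>2)" using pp by (intro mult_left_mono) auto
  also have "\<dots> \<le> p / 26 * (13 / 4 * Q\<^sup>2)" using c p by (intro mult_right_mono) auto
  finally have 2: "- a * (p\<^sup>2 - Q\<^sup>2) \<le> 1 / 8 * (p * Q\<^sup>2)" by simp
  have QQ: "Q \<le> Q\<^sup>2" using Q1(1) by (simp add: power2_eq_square)
  have "16 * \<bar>y\<bar> \<le> Q\<^sup>2" using Q1(3) QQ by linarith
  hence "p * \<bar>y\<bar> \<le> p * (Q\<^sup>2 / 16)" using p(2) by (intro mult_left_mono) auto
  moreover have "- y * p \<le> p * \<bar>y\<bar>" using p(2) by (metis abs_ge_self abs_minus_cancel mult.commute mult_left_mono less_imp_le)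
  ultimately have 3: "- y * p \<le> 1 / 16 * (p * Q\<^sup>2)" by simp
  have "16 \<le> c * Q" using Q1(2) c by (simp add: field_simps)
  also have "\<dots> \<le> p * Q" using p Q1 by (intro mult_right_mono) auto
  finally have "16 * Q \<le> p * Q * Q" using Q1 by (intro mult_right_mono) auto
  hence 4: "Q \<le> 1 / 16 * (p * Q\<^sup>2)" by (simp add: power2_eq_square)
  have im2: "(Im w)\<^sup>2 = Q\<^sup>2" by (simp add: Q_def)
  have "Re w ^ 3 / 3 - Re w * (Im w)\<^sup>2 - a * ((Re w)\<^sup>2 - (Im w)\<^sup>2) - y * Re w \<le> - Q"
    unfolding im2 p_def[symmetric] using 1 2 3 4 by simp
  then show ?thesis unfolding cub_def norm_exp_eq_Re Re_cub by (simp add: Q_def)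
qed

lemma integrable_gauss:
  fixes s :: real
  assumes s: "s > 0"
  shows "integrable lborel (\<lambda>q. exp (- s * q\<^sup>2))"
proof -
  have "(\<lambda>q. exp (- s * q\<^sup>2)) = (\<lambda>q. sqrt (pi / s) * heat (1 / (4 * s)) q)"
    using s by (intro ext) (simp add: heat_eq)
  moreover have "integrable lborel (heat (1 / (4 * s)))"
    unfolding heat_def using s by (intro integrable_normal_density) simp
  ultimately show ?thesis by (simp only: integrable_mult_right)
qed

lemma cub_integrable: "c > a \<Longrightarrow> integrable lborel (\<lambda>q. cub a y (Complex c q))"
proof (rule Bochner_Integration.integrable_bound)
  assume "c > a"
  then show "integrable lborel (\<lambda>q. exp (c ^ 3 / 3 - a * c\<^sup>2 - y * c) * exp (- (c - a) * q\<^sup>2))"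
    using integrable_gauss[of "c - a"] by simp
  have "continuous_on UNIV (\<lambda>q. cub a y (of_real c + \<i> * of_real q))" unfolding cub_def by (intro continuous_intros) auto
  then show "(\<lambda>q. cub a y (Complex c q)) \<in> borel_measurable lborel"
    unfolding Complex_eq by (simp add: borel_measurable_continuous_onI)
qed (simp add: norm_cub_vertical)

text \<open>On a vertical line in the right half plane the modulus of the integrand is Gaussian, so
  the Airy function becomes an absolutely convergent integral to which Fubini applies.\<close>

lemma Ai_vline:
  assumes c: "c > 0"
  shows "Ai (of_real x) = vline c (cub 0 x)"
proof -
  have "line_integral (wedge 0 (pi / 3)) (cub 0 x) = 2 * pi * \<i> * vline c (cub 0 x)"
  proof (rule line_integral_shift)
    show "cub 0 x holomorphic_on UNIV" using cub_holomorphic[OF holomorphic_on_id, of 0 x] by (simp add: id_def)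
    show "unbounded_contour (pi / 3) (wedge 0 (pi / 3))" by (rule wedge_unbounded_contour)
    fix w assume "16 / c + 16 * \<bar>x\<bar> + 1 \<le> \<bar>Im w\<bar>" "\<bar>Re w\<bar> \<le> (3 / 2) * \<bar>Im w\<bar>" "0 \<le> 1 * (Re w - c)"
    then show "w \<in> UNIV \<and> norm (cub 0 x w) \<le> 1 * exp (- \<bar>Im w\<bar>)"
      using cub_sector_bound[of c 0 w x] c by simp
  next
    have s3: "sqrt 3 > 1" by simp
    show "\<bar>cos (pi / 3)\<bar> < 3 / 2 * sin (pi / 3)" unfolding cos_60 sin_60 using s3 by linarith
  qed (auto simp: cos_60 sin_60)
  moreover have "cub 0 x = (\<lambda>w. exp (w ^ 3 / 3 - of_real x * w))" by (simp add: cub_def[abs_def])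
  ultimately show ?thesis by (simp add: Ai_def)
qed

text \<open>
  The prefactor is what remains when \<open>w\<^sup>3/3 - a w\<^sup>2 - y w\<close> is turned into the exponent of \<open>Ai\<close> by completing
  the cube.
\<close>

definition af :: "real \<Rightarrow> real \<Rightarrow> complex" where
  "af a y = of_real (exp (- (a * y + 2 * a ^ 3 / 3))) * Ai (of_real (y + a\<^sup>2))"

lemma af_vline:
  assumes c: "c > a"
  shows "af a y = vline c (cub a y)"
proof -
  have "of_real (exp (- (a * y + 2 * a ^ 3 / 3))) * cub 0 (y + a\<^sup>2) (Complex (c - a) q) = cub a y (Complex c q)" for q
  proof -
    let ?w = "Complex c q"
    have w: "Complex (c - a) q = ?w - of_real a" by (simp add: complex_eq_iff)
    have "of_real (- (a * y + 2 * a ^ 3 / 3)) + ((?w - of_real a) ^ 3 / 3 - of_real 0 * (?w - of_real a)\<^sup>2 - of_real (y + a\<^sup>2) * (?w - of_real a)) =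
       ?w ^ 3 / 3 - of_real a * ?w\<^sup>2 - of_real y * ?w"
      by (simp add: power3_eq_cube power2_eq_square field_simps)
    then show ?thesis unfolding w cub_def exp_of_real[symmetric] exp_add[symmetric] by simp
  qed
  moreover have "af a y = (\<integral>q. of_real (exp (- (a * y + 2 * a ^ 3 / 3))) * cub 0 (y + a\<^sup>2) (Complex (c - a) q) \<partial>lborel) / (2 * pi)"
    unfolding af_def using c by (subst Ai_vline[of "c - a"]) (simp_all add: vline_def)
  ultimately show ?thesis by (simp add: vline_def)
qed

definition af_const :: "real \<Rightarrow> real \<Rightarrow> real" where
  "af_const a c = exp (c ^ 3 / 3 - a * c\<^sup>2) * (\<integral>q. exp (- (c - a) * q\<^sup>2) \<partial>lborel) / (2 * pi)"

lemma af_const_nonneg: "0 \<le> af_const a c"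
  unfolding af_const_def by (intro divide_nonneg_pos mult_nonneg_nonneg Bochner_Integration.integral_nonneg) auto

text \<open>The absolute value is taken under the integral on the line of real part
  \<open>c\<close>. Any \<open>c\<close> above \<open>a\<close> is allowed, and choosing different
  rates for the two ends of the real line will give integrability of products.\<close>

lemma norm_af_le:
  assumes c: "c > a"
  shows "norm (af a y) \<le> af_const a c * exp (- c * y)"
proof -
  have "norm (af a y) = norm (\<integral>q. cub a y (Complex c q) \<partial>lborel) / (2 * pi)"
    unfolding af_vline[OF c] vline_def by (simp add: norm_divide)
  also have "\<dots> \<le> (\<integral>q. norm (cub a y (Complex c q)) \<partial>lborel) / (2 * pi)"
    by (intro divide_right_mono Bochner_Integration.integral_norm_bound) auto
  also have "(\<integral>q. norm (cub a y (Complex c q)) \<partial>lborel) = exp (c ^ 3 / 3 - a * c\<^sup>2 - y * c) * (\<integral>q. exp (- (c - a) * q\<^sup>2) \<partial>lborel)"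
    unfolding norm_cub_vertical by simp
  also have "exp (c ^ 3 / 3 - a * c\<^sup>2 - y * c) = exp (c ^ 3 / 3 - a * c\<^sup>2) * exp (- c * y)"
    by (simp add: mult.commute flip: exp_add)
  finally show ?thesis by (simp add: af_const_def mult_ac)
qed

lemma af_measurable [measurable]: "af a \<in> borel_measurable borel"
proof -
  have "(\<lambda>y. \<integral>q. cub a y (Complex (\<bar>a\<bar> + 1) q) \<partial>lborel) \<in> borel_measurable borel"
  proof (rule lborel.borel_measurable_lebesgue_integral)
    have "continuous_on UNIV (\<lambda>p. cub a (fst p) (of_real (\<bar>a\<bar> + 1) + \<i> * of_real (snd p)))"
      unfolding cub_def by (intro continuous_intros) auto
    from borel_measurable_continuous_onI[OF this]
    show "(\<lambda>(y, q). cub a y (Complex (\<bar>a\<bar> + 1) q)) \<in> borel_measurable (borel \<Otimes>\<^sub>M lborel)"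
      unfolding Complex_eq case_prod_beta' measurable_cong_sets[OF sets_pair_measure_cong[OF refl sets_lborel] refl] borel_prod .
  qed
  then have "(\<lambda>y. vline (\<bar>a\<bar> + 1) (cub a y)) \<in> borel_measurable borel" unfolding vline_def by simp
  moreover have "af a = (\<lambda>y. vline (\<bar>a\<bar> + 1) (cub a y))"
    by (intro ext af_vline) (simp add: abs_if)
  ultimately show ?thesis by simp
qed

text \<open>The reflection of z to - z carries a vertical line in the left half plane to one on the
  right. In this way the factor f_1(z), integrated over \<Gamma>_L, becomes an Airy
  function.\<close>

lemma Gamma_L_integral:
  "line_integral Gamma_L (\<lambda>z. cub a y (- z)) = 2 * pi * \<i> * af a y"
proof -
  define c where "c = 26 * \<bar>a\<bar> + 1"
  have c: "c > 0" "26 * \<bar>a\<bar> \<le> c" "c > a" by (auto simp: c_def)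
  have "line_integral Gamma_L (\<lambda>z. cub a y (- z)) = 2 * pi * \<i> * vline (- c) (\<lambda>z. cub a y (- z))"
    unfolding Gamma_L_def
  proof (rule line_integral_shift)
    show "(\<lambda>z. cub a y (- z)) holomorphic_on UNIV" by (intro holomorphic_intros)
    show "unbounded_contour (2 * pi / 3) (wedge (- 1) (2 * pi / 3))" by (rule wedge_unbounded_contour)
    fix w assume "16 / c + 16 * \<bar>y\<bar> + 1 \<le> \<bar>Im w\<bar>" "\<bar>Re w\<bar> \<le> (3 / 2) * \<bar>Im w\<bar>" "0 \<le> (-1) * (Re w - - c)"
    then show "w \<in> UNIV \<and> norm (cub a y (- w)) \<le> 1 * exp (- \<bar>Im w\<bar>)"
      using cub_sector_bound[of c a "- w" y] c by simp
  next
    have s3: "sqrt 3 > 1" by simp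
    show "\<bar>cos (2 * pi / 3)\<bar> < 3 / 2 * sin (2 * pi / 3)" unfolding cos_120 sin_120 using s3 by linarith
  qed (auto simp: cos_120 sin_120)
  also have "vline (- c) (\<lambda>z. cub a y (- z)) = vline c (cub a y)"
  proof -
    have "- Complex (- c) q = Complex c (- q)" for q by (simp add: complex_eq_iff)
    hence "(\<integral>q. cub a y (- Complex (- c) q) \<partial>lborel) = (\<integral>q. cub a y (Complex c (0 + (-1) * q)) \<partial>lborel)" by simp
    also have "\<dots> = (\<integral>q. cub a y (Complex c q) \<partial>lborel)"
      using lborel_integral_real_affine[of "-1" "\<lambda>q. cub a y (Complex c q)" 0] by simp
    finally show ?thesis by (simp add: vline_def)
  qed
  finally show ?thesis using af_vline[OF c(3)] by simp
qed

text \<open>The form in which integrals are exchanged below: a pointwise majorant whose inner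
  integral is known, typically a Gaussian or a tilted heat kernel, and whose outer integral is
  finite.\<close>

lemma fubini_dominated:
  fixes f :: "'a \<Rightarrow> 'b \<Rightarrow> complex" and g :: "'a \<Rightarrow> 'b \<Rightarrow> real"
  assumes sM: "sigma_finite_measure M" and sN: "sigma_finite_measure N"
    and f: "(\<lambda>(x, y). f x y) \<in> borel_measurable (M \<Otimes>\<^sub>M N)"
    and g: "\<And>x. x \<in> space M \<Longrightarrow> has_bochner_integral N (g x) (G x)"
    and bd: "\<And>x y. x \<in> space M \<Longrightarrow> y \<in> space N \<Longrightarrow> norm (f x y) \<le> g x y"
    and G: "integrable M G"
  shows "integrable (M \<Otimes>\<^sub>M N) (\<lambda>(x, y). f x y)"
    and "(\<integral>x. (\<integral>y. f x y \<partial>N) \<partial>M) = (\<integral>y. (\<integral>x. f x y \<partial>M) \<partial>N)"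
    and "integrable M (\<lambda>x. \<integral>y. f x y \<partial>N)"
    and "integrable N (\<lambda>y. \<integral>x. f x y \<partial>M)"
proof -
  interpret M: sigma_finite_measure M by fact
  interpret N: sigma_finite_measure N by fact
  interpret P: pair_sigma_finite M N ..
  have fx: "integrable N (f x)" if x: "x \<in> space M" for x
  proof (rule Bochner_Integration.integrable_bound)
    show "integrable N (g x)" using g[OF x] by (simp add: has_bochner_integral_iff)
    show "f x \<in> borel_measurable N" using measurable_compose[OF _ f, of "\<lambda>y. (x, y)" N] x by simp
    show "AE y in N. norm (f x y) \<le> norm (g x y)"
      using bd[OF x] by (intro AE_I2) (metis abs_ge_self order_trans real_norm_def)
  qed
  show int: "integrable (M \<Otimes>\<^sub>M N) (\<lambda>(x, y). f x y)"
  proof (rule P.Fubini_integrable[OF f])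
    show "integrable M (\<lambda>x. \<integral>y. norm (case (x, y) of (x, y) \<Rightarrow> f x y) \<partial>N)"
    proof (rule Bochner_Integration.integrable_bound[OF G])
      have "(\<lambda>x. \<integral>y. norm (f x y) \<partial>N) \<in> borel_measurable M"
        by (rule N.borel_measurable_lebesgue_integral) (use f in \<open>simp add: case_prod_beta'\<close>)
      then show "(\<lambda>x. \<integral>y. norm (case (x, y) of (x, y) \<Rightarrow> f x y) \<partial>N) \<in> borel_measurable M" by simp
      have "norm (\<integral>y. norm (f x y) \<partial>N) \<le> norm (G x)" if x: "x \<in> space M" for x
      proof -
        have "(\<integral>y. norm (f x y) \<partial>N) \<le> (\<integral>y. g x y \<partial>N)"
          using fx[OF x] g[OF x] bd[OF x] by (intro Bochner_Integration.integral_mono) (auto simp: has_bochner_integral_iff)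
        also have "\<dots> = G x" using g[OF x] by (simp add: has_bochner_integral_iff)
        finally show ?thesis by simp
      qed
      then show "AE x in M. norm (\<integral>y. norm (case (x, y) of (x, y) \<Rightarrow> f x y) \<partial>N) \<le> norm (G x)"
        by (intro AE_I2) simp
    qed
    show "AE x in M. integrable N (\<lambda>y. case (x, y) of (x, y) \<Rightarrow> f x y)" using fx by (intro AE_I2) simp
  qed
  show "(\<integral>x. (\<integral>y. f x y \<partial>N) \<partial>M) = (\<integral>y. (\<integral>x. f x y \<partial>M) \<partial>N)"
    by (rule P.Fubini_integral[OF int, symmetric])
  show "integrable M (\<lambda>x. \<integral>y. f x y \<partial>N)" using P.integrable_fst'[OF int] by simp
  show "integrable N (\<lambda>y. \<integral>x. f x y \<partial>M)" by (rule P.integrable_snd[OF int])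
qed

lemma integrable_exp_abs_rate:
  assumes r: "r > 0"
  shows "integrable lborel (\<lambda>s::real. exp (- r * \<bar>s\<bar>))"
proof -
  have "integrable lborel (\<lambda>s. exp (- \<bar>0 + r * s\<bar>))"
    by (rule lborel_integrable_real_affine[OF integrable_exp_abs]) (use r in simp)
  then show ?thesis using r by (simp add: abs_mult)
qed

lemma sf_lborel: "sigma_finite_measure (lborel :: real measure)"
  by (rule lborel.sigma_finite_measure_axioms)

lemma continuous_measurable2:
  fixes f :: "real \<Rightarrow> real \<Rightarrow> complex"
  assumes "continuous_on UNIV (\<lambda>p. f (fst p) (snd p))"
  shows "(\<lambda>(x, y). f x y) \<in> borel_measurable (lborel \<Otimes>\<^sub>M lborel)"
proof -
  have "sets (lborel \<Otimes>\<^sub>M lborel) = sets (borel :: (real \<times> real) measure)"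
    by (simp only: sets_pair_measure_cong[OF sets_lborel sets_lborel] borel_prod)
  then show ?thesis using borel_measurable_continuous_onI[OF assms]
    unfolding case_prod_beta' measurable_cong_sets[OF _ refl] by (simp cong: measurable_cong_sets)
qed

lemma cub_add: "cub a (y + s) w = cub a y w * exp (- (of_real s * w))"
  unfolding cub_def exp_add[symmetric] by (simp add: algebra_simps)

lemma heat_continuous: "t > 0 \<Longrightarrow> continuous_on S (heat t)"
proof -
  assume t: "t > 0"
  have "continuous_on S (\<lambda>y. exp (- y\<^sup>2 / (4 * t)) / sqrt (4 * pi * t))"
    using t by (intro continuous_intros) auto
  then show ?thesis using t by (simp add: heat_eq cong: continuous_on_cong)
qed

text \<open>Under the contour integral the heat kernel acts on the exponential exp(- w x) and
  multiplies it by exp(t w^2). This raises the coefficient of w^2 by \<open>t\<close>, so the heat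
  flow moves within the family \<open>af\<close>.\<close>

lemma af_heat:
  assumes t: "t > 0"
  shows "has_bochner_integral lborel (\<lambda>x. af (- a) (x + s) * of_real (heat t (x - y))) (af (- (a + t)) (y + s))"
proof -
  define c where "c = \<bar>a\<bar> + t + 1"
  have c: "c > - a" "c > - (a + t)" using t by (auto simp: c_def)
  define f where "f q x = cub (- a) (x + s) (Complex c q) * of_real (heat t (x - y))" for q x
  define k where "k = exp (c ^ 3 / 3 + a * c\<^sup>2 - s * c)"
  have nf: "norm (f q x) = k * exp (- (c + a) * q\<^sup>2) * (heat t (x - y) * exp (- c * x))" for q x
    unfolding f_def norm_mult norm_cub_vertical k_def
    by (simp add: heat_nonneg algebra_simps flip: exp_add)
  have inner: "has_bochner_integral lborel (f q) (cub (- (a + t)) (y + s) (Complex c q))" for q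
  proof -
    let ?w = "Complex c q"
    have 1: "f q x = cub (- a) s ?w * (of_real (heat t (x - y)) * exp ((- ?w) * of_real x))" for x
      unfolding f_def by (subst add.commute, subst cub_add) (simp add: mult_ac)
    have 2: "cub (- a) s ?w * exp (of_real t * (- ?w)\<^sup>2 + (- ?w) * of_real y) = cub (- (a + t)) (y + s) ?w"
      unfolding cub_def exp_add[symmetric] by (simp add: algebra_simps)
    show ?thesis unfolding 1 2[symmetric] by (rule has_bochner_integral_mult_right) (rule heat_laplace[OF t])
  qed
  have meas: "(\<lambda>(q, x). f q x) \<in> borel_measurable (lborel \<Otimes>\<^sub>M lborel)"
  proof (rule continuous_measurable2)
    have "continuous_on UNIV (\<lambda>p :: real \<times> real. heat t (snd p - y))"
      by (rule continuous_on_compose2[OF heat_continuous[OF t, of UNIV]]) (auto intro!: continuous_intros)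
    moreover have "continuous_on UNIV (\<lambda>p :: real \<times> real. cub (- a) (snd p + s) (of_real c + \<i> * of_real (fst p)))"
      unfolding cub_def by (intro continuous_intros) auto
    ultimately show "continuous_on UNIV (\<lambda>p. f (fst p) (snd p))"
      unfolding f_def Complex_eq by (intro continuous_on_mult continuous_on_of_real)
  qed
  note F = fubini_dominated[OF sf_lborel sf_lborel meas,
      where g = "\<lambda>q x. k * exp (- (c + a) * q\<^sup>2) * (heat t (x - y) * exp (- c * x))" and
        G = "\<lambda>q. k * exp (- (c + a) * q\<^sup>2) * exp (t * (- c)\<^sup>2 + (- c) * y)"]
  have g: "has_bochner_integral lborel (\<lambda>x. k * exp (- (c + a) * q\<^sup>2) * (heat t (x - y) * exp (- c * x)))
      (k * exp (- (c + a) * q\<^sup>2) * exp (t * (- c)\<^sup>2 + (- c) * y))" for q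
    by (rule has_bochner_integral_mult_right) (rule heat_laplace_real[OF t])
  have G: "integrable lborel (\<lambda>q. k * exp (- (c + a) * q\<^sup>2) * exp (t * (- c)\<^sup>2 + (- c) * y))"
    using integrable_gauss[of "c + a"] c by simp
  have F': "(\<integral>q. (\<integral>x. f q x \<partial>lborel) \<partial>lborel) = (\<integral>x. (\<integral>q. f q x \<partial>lborel) \<partial>lborel)"
      "integrable lborel (\<lambda>x. \<integral>q. f q x \<partial>lborel)"
    using F(2)[OF g _ G] F(4)[OF g _ G] nf by auto
  have x: "(\<integral>q. f q x \<partial>lborel) = 2 * pi * (af (- a) (x + s) * of_real (heat t (x - y)))" for x
    unfolding f_def af_vline[OF c(1)] vline_def by simp
  have q: "(\<integral>x. f q x \<partial>lborel) = cub (- (a + t)) (y + s) (Complex c q)" for q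
    using inner by (rule has_bochner_integral_integral_eq)
  have "(\<integral>x. 2 * pi * (af (- a) (x + s) * of_real (heat t (x - y))) \<partial>lborel) = 2 * pi * af (- (a + t)) (y + s)"
    using F'(1) unfolding x q af_vline[OF c(2)] vline_def by simp
  moreover have "integrable lborel (\<lambda>x. of_real (2 * pi) * (af (- a) (x + s) * of_real (heat t (x - y))))"
    using F'(2) unfolding x by simp
  hence "integrable lborel (\<lambda>x. af (- a) (x + s) * of_real (heat t (x - y)))"
    using integrable_mult_right[of "1 / (2 * pi)" lborel "\<lambda>x. of_real (2 * pi) * (af (- a) (x + s) * of_real (heat t (x - y)))"]
    by (simp add: mult.assoc[symmetric])
  ultimately show ?thesis unfolding has_bochner_integral_iff by simp
qed

text \<open>Rates c > a and d > - b may have a sum of either sign exactly because a < b. One choice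
  bounds the product by an increasing exponential in \<open>s\<close>, another by a decreasing one,
  and together they decay at both ends.\<close>

lemma af_mult_integrable:
  assumes ab: "a < b"
  shows "integrable lborel (\<lambda>s. af a (x + s) * af (- b) (y + s))"
proof -
  define t where "t = b - a"
  have t: "t > 0" using ab by (simp add: t_def)
  have bd: "\<exists>C. \<forall>s. norm (af a (x + s) * af (- b) (y + s)) \<le> C * exp (r * s)" if r: "r < t" for r
  proof -
    define c d where "c = a + (t - r) / 2" and "d = - b + (t - r) / 2"
    have c: "c > a" and d: "d > - b" and cd: "c + d = - r" using r by (auto simp: c_def d_def t_def)
    have "norm (af a (x + s) * af (- b) (y + s)) \<le>
        (af_const a c * af_const (- b) d * exp (- c * x - d * y)) * exp (r * s)" for s
    proof -
      have "norm (af a (x + s) * af (- b) (y + s)) \<le>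
          (af_const a c * exp (- c * (x + s))) * (af_const (- b) d * exp (- d * (y + s)))"
        unfolding norm_mult using norm_af_le[OF c] norm_af_le[OF d] af_const_nonneg by (intro mult_mono) auto
      also have "\<dots> = af_const a c * af_const (- b) d * (exp (- c * (x + s)) * exp (- d * (y + s)))"
        by (simp only: mult_ac)
      also have "exp (- c * (x + s)) * exp (- d * (y + s)) = exp (- c * x - d * y) * exp (r * s)"
      proof -
        have "- c * (x + s) + - d * (y + s) = - c * x - d * y + (- (c + d)) * s" by (simp add: algebra_simps)
        then show ?thesis unfolding cd exp_add[symmetric] by simp
      qed
      also have "af_const a c * af_const (- b) d * (exp (- c * x - d * y) * exp (r * s)) =
          (af_const a c * af_const (- b) d * exp (- c * x - d * y)) * exp (r * s)"
        by (simp only: mult.assoc)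
      finally show ?thesis .
    qed
    then show ?thesis by blast
  qed
  obtain C1 where C1: "\<And>s. norm (af a (x + s) * af (- b) (y + s)) \<le> C1 * exp (t / 2 * s)"
    using bd[of "t / 2"] t by auto
  obtain C2 where C2: "\<And>s. norm (af a (x + s) * af (- b) (y + s)) \<le> C2 * exp (- (t / 2) * s)"
    using bd[of "- (t / 2)"] t by auto
  have nb: "norm (af a (x + s) * af (- b) (y + s)) \<le> norm ((\<bar>C1\<bar> + \<bar>C2\<bar>) * exp (- (t / 2) * \<bar>s\<bar>))" for s
  proof (cases "s \<ge> 0")
    case True
    have "norm (af a (x + s) * af (- b) (y + s)) \<le> C2 * exp (- (t / 2) * s)" by (rule C2)
    also have "\<dots> \<le> (\<bar>C1\<bar> + \<bar>C2\<bar>) * exp (- (t / 2) * s)" by (intro mult_right_mono) auto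
    finally show ?thesis using True by simp
  next
    case False
    have "norm (af a (x + s) * af (- b) (y + s)) \<le> C1 * exp (t / 2 * s)" by (rule C1)
    also have "\<dots> \<le> (\<bar>C1\<bar> + \<bar>C2\<bar>) * exp (t / 2 * s)" by (intro mult_right_mono) auto
    finally show ?thesis using False by simp
  qed
  have I: "integrable lborel (\<lambda>s. (\<bar>C1\<bar> + \<bar>C2\<bar>) * exp (- (t / 2) * \<bar>s\<bar>))"
    by (intro integrable_mult_right integrable_exp_abs_rate) (use t in simp)
  have m: "(\<lambda>s. af a (x + s) * af (- b) (y + s)) \<in> borel_measurable lborel" by measurable
  show ?thesis by (rule Bochner_Integration.integrable_bound[OF I m]) (rule AE_I2, rule nb)
qed

text \<open>
  The integral in \<open>af_product_integral\<close> is regularized by \<open>exp (- \<delta>\<^sup>2 s\<^sup>2 / 2)\<close>; after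
  Fubini this smooths one contour integrand with a Gaussian of width \<open>\<delta>\<close>.
\<close>

lemma gauss_fourier:
  fixes x :: real
  assumes d: "d > 0"
  shows "has_bochner_integral lborel (\<lambda>s. of_real (exp (- d\<^sup>2 * s\<^sup>2 / 2)) * exp (- (\<i> * of_real x * of_real s)))
    (of_real (sqrt (2 * pi) / d * exp (- x\<^sup>2 / (2 * d\<^sup>2))))"
proof -
  define t where "t = 1 / (2 * d\<^sup>2)"
  have t: "t > 0" using d by (simp add: t_def)
  have "sqrt (4 * pi * t) = sqrt (2 * pi) / d"
    using d by (simp add: t_def real_sqrt_divide real_sqrt_mult)
  hence 1: "exp (- d\<^sup>2 * s\<^sup>2 / 2) = sqrt (2 * pi) / d * heat t s" for s
    using t d by (simp add: heat_eq t_def)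
  have "has_bochner_integral lborel (\<lambda>s. of_real (sqrt (2 * pi) / d) * (of_real (heat t s) * exp ((- \<i> * of_real x) * of_real s)))
      (of_real (sqrt (2 * pi) / d) * exp (of_real t * (- \<i> * of_real x)\<^sup>2))"
    by (rule has_bochner_integral_mult_right) (rule heat_laplace_0[OF t])
  moreover have "exp (of_real t * (- \<i> * of_real x)\<^sup>2) = complex_of_real (exp (- x\<^sup>2 / (2 * d\<^sup>2)))"
    by (simp add: t_def power_mult_distrib flip: exp_of_real)
  ultimately show ?thesis unfolding 1 by (simp add: mult.assoc)
qed

lemma gauss_smoothing:
  fixes \<Psi> :: "real \<Rightarrow> complex"
  assumes d: "d > 0" and cont: "continuous_on UNIV \<Psi>" and int: "integrable lborel \<Psi>"
  shows "(\<integral>s. of_real (exp (- d\<^sup>2 * s\<^sup>2 / 2)) * exp (- (\<i> * of_real p * of_real s)) * ((\<integral>q. \<Psi> q * exp (- (\<i> * of_real q * of_real s)) \<partial>lborel) / (2 * pi)) \<partial>lborel) =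
    (\<integral>r. \<Psi> (- p + d * r) * of_real (std_normal_density r) \<partial>lborel)"
proof -
  define f where "f q s = \<Psi> q * (of_real (exp (- d\<^sup>2 * s\<^sup>2 / 2)) * exp (- (\<i> * of_real (p + q) * of_real s)))" for q s :: real
  have nf: "norm (f q s) = norm (\<Psi> q) * exp (- (d\<^sup>2 / 2) * s\<^sup>2)" for q s
    by (simp add: f_def norm_mult norm_exp_eq_Re)
  have meas: "(\<lambda>(q, s). f q s) \<in> borel_measurable (lborel \<Otimes>\<^sub>M lborel)"
  proof (rule continuous_measurable2)
    have "continuous_on UNIV (\<lambda>p :: real \<times> real. \<Psi> (fst p))"
      by (rule continuous_on_compose2[OF cont]) (auto intro!: continuous_intros)
    then show "continuous_on UNIV (\<lambda>p. f (fst p) (snd p))"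
      unfolding f_def by (intro continuous_on_mult) (auto intro!: continuous_intros)
  qed
  have G: "has_bochner_integral lborel (\<lambda>s. norm (\<Psi> q) * exp (- (d\<^sup>2 / 2) * s\<^sup>2)) (norm (\<Psi> q) * (\<integral>s. exp (- (d\<^sup>2 / 2) * s\<^sup>2) \<partial>lborel))" for q
    using d by (intro has_bochner_integral_mult_right has_bochner_integral_integrable integrable_gauss) auto
  note F = fubini_dominated[OF sf_lborel sf_lborel meas G]
  have swap: "(\<integral>q. (\<integral>s. f q s \<partial>lborel) \<partial>lborel) = (\<integral>s. (\<integral>q. f q s \<partial>lborel) \<partial>lborel)"
  proof (rule F(2))
    show "norm (f q s) \<le> norm (\<Psi> q) * exp (- (d\<^sup>2 / 2) * s\<^sup>2)" for q s by (simp only: nf order_refl)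
    show "integrable lborel (\<lambda>q. norm (\<Psi> q) * (\<integral>s. exp (- (d\<^sup>2 / 2) * s\<^sup>2) \<partial>lborel))"
      by (intro Bochner_Integration.integrable_mult_left integrable_norm int)
  qed
  have "(\<integral>s. of_real (exp (- d\<^sup>2 * s\<^sup>2 / 2)) * exp (- (\<i> * of_real p * of_real s)) * ((\<integral>q. \<Psi> q * exp (- (\<i> * of_real q * of_real s)) \<partial>lborel) / (2 * pi)) \<partial>lborel) =
      (\<integral>s. (\<integral>q. f q s \<partial>lborel) / (2 * pi) \<partial>lborel)"
  proof (rule Bochner_Integration.integral_cong[OF refl])
    fix s :: real
    let ?k = "of_real (exp (- d\<^sup>2 * s\<^sup>2 / 2)) * exp (- (\<i> * of_real p * of_real s)) :: complex"
    have "f q s = ?k * (\<Psi> q * exp (- (\<i> * of_real q * of_real s)))" for q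
    proof -
      have "exp (- (\<i> * of_real (p + q) * of_real s)) = exp (- (\<i> * of_real p * of_real s)) * exp (- (\<i> * of_real q * of_real s))"
        unfolding exp_add[symmetric] by (rule arg_cong[where f = exp]) (simp add: algebra_simps)
      then show ?thesis unfolding f_def by (simp only: mult_ac)
    qed
    hence "(\<integral>q. f q s \<partial>lborel) = ?k * (\<integral>q. \<Psi> q * exp (- (\<i> * of_real q * of_real s)) \<partial>lborel)" by simp
    then show "?k * ((\<integral>q. \<Psi> q * exp (- (\<i> * of_real q * of_real s)) \<partial>lborel) / (2 * pi)) = (\<integral>q. f q s \<partial>lborel) / (2 * pi)" by simp
  qed
  also have "\<dots> = (\<integral>q. (\<integral>s. f q s \<partial>lborel) \<partial>lborel) / (2 * pi)" using swap by simp
  also have "(\<lambda>q. \<integral>s. f q s \<partial>lborel) = (\<lambda>q. \<Psi> q * of_real (sqrt (2 * pi) / d * exp (- (p + q)\<^sup>2 / (2 * d\<^sup>2))))"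
    unfolding f_def integral_mult_right_zero has_bochner_integral_integral_eq[OF gauss_fourier[OF d]] ..
  also have "(\<integral>q. \<Psi> q * of_real (sqrt (2 * pi) / d * exp (- (p + q)\<^sup>2 / (2 * d\<^sup>2))) \<partial>lborel) =
      d *\<^sub>R (\<integral>r. \<Psi> (- p + d * r) * of_real (sqrt (2 * pi) / d * exp (- (p + (- p + d * r))\<^sup>2 / (2 * d\<^sup>2))) \<partial>lborel)"
    using d by (subst lborel_integral_real_affine[where c = d and t = "- p"]) simp_all
  also have "(\<lambda>r. \<Psi> (- p + d * r) * of_real (sqrt (2 * pi) / d * exp (- (p + (- p + d * r))\<^sup>2 / (2 * d\<^sup>2)))) =
      (\<lambda>r. of_real (2 * pi / d) * (\<Psi> (- p + d * r) * of_real (std_normal_density r)))"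
  proof (rule ext)
    fix r
    have e: "- (p + (- p + d * r))\<^sup>2 / (2 * d\<^sup>2) = - r\<^sup>2 / 2" using d by (simp add: power_mult_distrib)
    have "sqrt (2 * pi) = 2 * pi / sqrt (2 * pi)" by (subst nonzero_eq_divide_eq) simp_all
    hence "sqrt (2 * pi) / d * exp (- r\<^sup>2 / 2) = 2 * pi / d * std_normal_density r"
      unfolding std_normal_density_def by (metis (no_types, lifting) divide_divide_eq_left mult.commute mult_1 times_divide_eq_left times_divide_eq_right)
    then show "\<Psi> (- p + d * r) * of_real (sqrt (2 * pi) / d * exp (- (p + (- p + d * r))\<^sup>2 / (2 * d\<^sup>2))) =
        of_real (2 * pi / d) * (\<Psi> (- p + d * r) * of_real (std_normal_density r))"
      unfolding e by (simp only: of_real_mult mult_ac)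
  qed
  also have "d *\<^sub>R (\<integral>r. of_real (2 * pi / d) * (\<Psi> (- p + d * r) * of_real (std_normal_density r)) \<partial>lborel) / complex_of_real (2 * pi) =
      (\<integral>r. \<Psi> (- p + d * r) * of_real (std_normal_density r) \<partial>lborel)"
    using d by (simp add: scaleR_conv_of_real)
  finally show ?thesis .
qed

text \<open>A Parseval identity. The two functions are written on the lines of real part
  \<open>c\<close> and \<open>- c\<close>, with \<open>c\<close> between \<open>a\<close> and
  \<open>b\<close>, so that their exponentials in \<open>s\<close> cancel up to phases. Formally the
  integral of the phases over \<open>s\<close> sets the second contour variable to the negative of
  the first; then the cubes cancel and \<open>heat_contour\<close> remains. The Gaussian
  regularization replaces the formal delta function.\<close>

lemma af_product_integral:
  assumes ab: "a < b"
  shows "(\<integral>s. af a (x + s) * af (- b) (y + s) \<partial>lborel) = of_real (heat (b - a) (x - y))"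
proof -
  define c where "c = (a + b) / 2"
  have c: "c > a" "- c > - b" using ab by (auto simp: c_def)
  define \<Phi> where "\<Phi> p = cub a x (Complex c p)" for p
  define \<Psi> where "\<Psi> q = cub (- b) y (Complex (- c) q)" for q
  have cont\<Psi>: "continuous_on UNIV \<Psi>" and cont\<Phi>: "continuous_on UNIV \<Phi>"
    unfolding \<Phi>_def \<Psi>_def Complex_eq cub_def by (intro continuous_intros; simp)+
  have int\<Psi>: "integrable lborel \<Psi>" and int\<Phi>: "integrable lborel \<Phi>"
    unfolding \<Phi>_def \<Psi>_def using cub_integrable c by blast+
  define B where "B = exp ((- c) ^ 3 / 3 + b * (- c)\<^sup>2 - y * (- c))"
  have B: "norm (\<Psi> q) \<le> B" for q
    unfolding \<Psi>_def norm_cub_vertical B_def using c by (simp add: mult_le_cancel_left1 mult_nonpos_nonneg)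
  define Bt where "Bt s = (\<integral>q. \<Psi> q * exp (- (\<i> * of_real q * of_real s)) \<partial>lborel) / (2 * pi)" for s
  have af1: "af a (x + s) = exp (- (of_real c * of_real s)) * (\<integral>p. \<Phi> p * exp (- (\<i> * of_real p * of_real s)) \<partial>lborel) / (2 * pi)" for s
  proof -
    have "cub a (x + s) (Complex c p) = exp (- (of_real c * of_real s)) * (\<Phi> p * exp (- (\<i> * of_real p * of_real s)))" for p
      unfolding cub_add \<Phi>_def mult.left_commute[of _ "cub a x (Complex c p)"] exp_add[symmetric]
      by (rule arg_cong2[where f = "(*)"]) (simp_all add: Complex_eq algebra_simps)
    then show ?thesis unfolding af_vline[OF c(1)] vline_def by simp
  qed
  have af2: "af (- b) (y + s) = exp (of_real c * of_real s) * Bt s" for s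
  proof -
    have "cub (- b) (y + s) (Complex (- c) q) = exp (of_real c * of_real s) * (\<Psi> q * exp (- (\<i> * of_real q * of_real s)))" for q
      unfolding cub_add \<Psi>_def mult.left_commute[of _ "cub (- b) y (Complex (- c) q)"] exp_add[symmetric]
      by (rule arg_cong2[where f = "(*)"]) (simp_all add: Complex_eq algebra_simps)
    then show ?thesis unfolding af_vline[OF c(2)] vline_def Bt_def by simp
  qed
  define H where "H s = af a (x + s) * af (- b) (y + s)" for s
  have H: "H s = (\<integral>p. \<Phi> p * (exp (- (\<i> * of_real p * of_real s)) * Bt s) \<partial>lborel) / (2 * pi)" for s
  proof -
    have "H s = (exp (- (of_real c * of_real s)) * exp (of_real c * of_real s)) * ((\<integral>p. \<Phi> p * exp (- (\<i> * of_real p * of_real s)) \<partial>lborel) * Bt s) / (2 * pi)"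
      unfolding H_def af1 af2 by simp
    also have "exp (- (of_real c * of_real s)) * exp (of_real c * of_real s) = (1 :: complex)" by (simp flip: exp_add)
    also have "(\<integral>p. \<Phi> p * exp (- (\<i> * of_real p * of_real s)) \<partial>lborel) * Bt s = (\<integral>p. \<Phi> p * exp (- (\<i> * of_real p * of_real s)) * Bt s \<partial>lborel)"
      by simp
    finally show ?thesis by (simp add: mult.assoc)
  qed
  have intH: "integrable lborel H" unfolding H_def by (rule af_mult_integrable[OF ab])
  have Bt_bd: "norm (Bt s) \<le> (\<integral>q. norm (\<Psi> q) \<partial>lborel) / (2 * pi)" for s
  proof -
    have "norm (\<integral>q. \<Psi> q * exp (- (\<i> * of_real q * of_real s)) \<partial>lborel) \<le> (\<integral>q. norm (\<Psi> q * exp (- (\<i> * of_real q * of_real s))) \<partial>lborel)"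
      by (rule Bochner_Integration.integral_norm_bound)
    also have "\<dots> = (\<integral>q. norm (\<Psi> q) \<partial>lborel)" by (simp add: norm_mult norm_exp_eq_Re)
    finally show ?thesis by (simp add: Bt_def norm_divide divide_right_mono)
  qed
  have Bt_m: "Bt \<in> borel_measurable borel"
  proof -
    have "Bt = (\<lambda>s. exp (- (of_real c * of_real s)) * af (- b) (y + s))"
      unfolding af2 by (intro ext) (simp add: mult.assoc[symmetric] flip: exp_add)
    then show ?thesis by simp
  qed
  define J where "J d p = (\<integral>r. \<Psi> (- p + d * r) * of_real (std_normal_density r) \<partial>lborel)" for d p :: real
  have reg: "(\<integral>s. of_real (exp (- d\<^sup>2 * s\<^sup>2 / 2)) * H s \<partial>lborel) = (\<integral>p. \<Phi> p * J d p \<partial>lborel) / (2 * pi)"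
    if d: "d > 0" for d
  proof -
    define f where "f p s = \<Phi> p * (of_real (exp (- d\<^sup>2 * s\<^sup>2 / 2)) * exp (- (\<i> * of_real p * of_real s)) * Bt s)" for p s :: real
    define B0 where "B0 = (\<integral>q. norm (\<Psi> q) \<partial>lborel) / (2 * pi)"
    have nf: "norm (f p s) \<le> (norm (\<Phi> p) * B0) * exp (- (d\<^sup>2 / 2) * s\<^sup>2)" for p s
    proof -
      have "norm (f p s) = norm (\<Phi> p) * exp (- (d\<^sup>2 / 2) * s\<^sup>2) * norm (Bt s)"
        by (simp add: f_def norm_mult norm_exp_eq_Re)
      also have "\<dots> \<le> norm (\<Phi> p) * exp (- (d\<^sup>2 / 2) * s\<^sup>2) * B0"
        using Bt_bd unfolding B0_def by (intro mult_left_mono) auto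
      finally show ?thesis by (simp add: mult_ac)
    qed
    have meas: "(\<lambda>(p, s). f p s) \<in> borel_measurable (lborel \<Otimes>\<^sub>M lborel)"
    proof -
      have "(\<lambda>(p, s). \<Phi> p * (of_real (exp (- d\<^sup>2 * s\<^sup>2 / 2)) * exp (- (\<i> * of_real p * of_real s)))) \<in> borel_measurable (lborel \<Otimes>\<^sub>M lborel)"
      proof (rule continuous_measurable2)
        have "continuous_on UNIV (\<lambda>p :: real \<times> real. \<Phi> (fst p))"
          by (rule continuous_on_compose2[OF cont\<Phi>]) (auto intro!: continuous_intros)
        then show "continuous_on UNIV (\<lambda>p. \<Phi> (fst p) * (of_real (exp (- d\<^sup>2 * (snd p)\<^sup>2 / 2)) * exp (- (\<i> * of_real (fst p) * of_real (snd p)))))"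
          by (intro continuous_on_mult) (auto intro!: continuous_intros)
      qed
      moreover have "(\<lambda>ps. Bt (snd ps)) \<in> borel_measurable (lborel \<Otimes>\<^sub>M lborel)"
        using Bt_m by (intro measurable_compose[OF measurable_snd]) simp
      ultimately have "(\<lambda>ps. (case ps of (p, s) \<Rightarrow> \<Phi> p * (of_real (exp (- d\<^sup>2 * s\<^sup>2 / 2)) * exp (- (\<i> * of_real p * of_real s)))) * Bt (snd ps)) \<in> borel_measurable (lborel \<Otimes>\<^sub>M lborel)"
        by (rule borel_measurable_times)
      then show ?thesis unfolding f_def case_prod_beta' by (simp only: mult.assoc)
    qed
    have G: "has_bochner_integral lborel (\<lambda>s. (norm (\<Phi> p) * B0) * exp (- (d\<^sup>2 / 2) * s\<^sup>2)) ((norm (\<Phi> p) * B0) * (\<integral>s. exp (- (d\<^sup>2 / 2) * s\<^sup>2) \<partial>lborel))" for p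
      using d by (intro has_bochner_integral_mult_right has_bochner_integral_integrable integrable_gauss) auto
    have swap: "(\<integral>p. (\<integral>s. f p s \<partial>lborel) \<partial>lborel) = (\<integral>s. (\<integral>p. f p s \<partial>lborel) \<partial>lborel)"
      by (rule fubini_dominated(2)[OF sf_lborel sf_lborel meas G nf]) (use int\<Phi> in simp)
    have "of_real (exp (- d\<^sup>2 * s\<^sup>2 / 2)) * H s = (\<integral>p. f p s \<partial>lborel) / (2 * pi)" for s
    proof -
      have "f p s = of_real (exp (- d\<^sup>2 * s\<^sup>2 / 2)) * (\<Phi> p * (exp (- (\<i> * of_real p * of_real s)) * Bt s))" for p
        by (simp add: f_def mult_ac)
      hence "(\<integral>p. f p s \<partial>lborel) = of_real (exp (- d\<^sup>2 * s\<^sup>2 / 2)) * (\<integral>p. \<Phi> p * (exp (- (\<i> * of_real p * of_real s)) * Bt s) \<partial>lborel)" by simp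
      then show ?thesis unfolding H by simp
    qed
    hence "(\<integral>s. of_real (exp (- d\<^sup>2 * s\<^sup>2 / 2)) * H s \<partial>lborel) = (\<integral>s. (\<integral>p. f p s \<partial>lborel) \<partial>lborel) / (2 * pi)" by simp
    also have "\<dots> = (\<integral>p. (\<integral>s. f p s \<partial>lborel) \<partial>lborel) / (2 * pi)" by (simp only: swap)
    also have "(\<lambda>p. \<integral>s. f p s \<partial>lborel) = (\<lambda>p. \<Phi> p * J d p)"
      unfolding f_def J_def gauss_smoothing[OF d cont\<Psi> int\<Psi>, folded Bt_def, symmetric] by simp
    finally show ?thesis .
  qed
  define d where "d n = 1 / (real n + 1)" for n
  have dpos: "d n > 0" for n by (simp add: d_def)
  have d0: "d \<longlonglongrightarrow> 0" unfolding d_def by real_asymp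
  have lim1: "(\<lambda>n. \<integral>s. of_real (exp (- (d n)\<^sup>2 * s\<^sup>2 / 2)) * H s \<partial>lborel) \<longlonglongrightarrow> integral\<^sup>L lborel H"
  proof (rule integral_dominated_convergence[where w = "\<lambda>s. norm (H s)"])
    show "AE s in lborel. (\<lambda>n. of_real (exp (- (d n)\<^sup>2 * s\<^sup>2 / 2)) * H s) \<longlonglongrightarrow> H s"
    proof (rule AE_I2)
      fix s
      have "(\<lambda>n. of_real (exp (- (d n)\<^sup>2 * s\<^sup>2 / 2)) * H s) \<longlonglongrightarrow> of_real (exp (- 0\<^sup>2 * s\<^sup>2 / 2)) * H s"
        by (intro tendsto_intros d0) auto
      then show "(\<lambda>n. of_real (exp (- (d n)\<^sup>2 * s\<^sup>2 / 2)) * H s) \<longlonglongrightarrow> H s" by simp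
    qed
    show "AE s in lborel. norm (of_real (exp (- (d n)\<^sup>2 * s\<^sup>2 / 2)) * H s) \<le> norm (H s)" for n
      by (rule AE_I2, simp only: norm_mult norm_of_real abs_exp_cancel, rule mult_left_le_one_le) simp_all
  qed (use intH in auto)
  have Jlim: "(\<lambda>n. J (d n) p) \<longlonglongrightarrow> \<Psi> (- p)" for p
  proof -
    have "(\<lambda>n. \<integral>r. \<Psi> (- p + d n * r) * of_real (std_normal_density r) \<partial>lborel) \<longlonglongrightarrow> (\<integral>r. \<Psi> (- p) * of_real (std_normal_density r) \<partial>lborel)"
    proof (rule integral_dominated_convergence[where w = "\<lambda>r. B * std_normal_density r"])
      show "AE r in lborel. (\<lambda>n. \<Psi> (- p + d n * r) * of_real (std_normal_density r)) \<longlonglongrightarrow> \<Psi> (- p) * of_real (std_normal_density r)"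
      proof (rule AE_I2)
        fix r
        have "(\<lambda>n. - p + d n * r) \<longlonglongrightarrow> - p + 0 * r" by (intro tendsto_intros d0)
        hence "(\<lambda>n. \<Psi> (- p + d n * r)) \<longlonglongrightarrow> \<Psi> (- p + 0 * r)"
          by (rule continuous_on_tendsto_compose[OF cont\<Psi>]) auto
        then show "(\<lambda>n. \<Psi> (- p + d n * r) * of_real (std_normal_density r)) \<longlonglongrightarrow> \<Psi> (- p) * of_real (std_normal_density r)"
          by (intro tendsto_intros) simp
      qed
      show "AE r in lborel. norm (\<Psi> (- p + d n * r) * of_real (std_normal_density r)) \<le> B * std_normal_density r" for n
        using B by (intro AE_I2) (simp add: norm_mult mult_right_mono)
      have [measurable]: "\<Psi> \<in> borel_measurable borel" using cont\<Psi> by (rule borel_measurable_continuous_onI)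
      show "(\<lambda>r. \<Psi> (- p + d n * r) * of_real (std_normal_density r)) \<in> borel_measurable lborel" for n by measurable
      show "(\<lambda>r. \<Psi> (- p) * of_real (std_normal_density r)) \<in> borel_measurable lborel" by measurable
    qed simp
    moreover have "(\<integral>r. \<Psi> (- p) * complex_of_real (std_normal_density r) \<partial>lborel) = \<Psi> (- p)"
      by (subst integral_mult_right_zero, subst integral_complex_of_real) simp
    ultimately show ?thesis unfolding J_def by simp
  qed
  have JB: "norm (J d p) \<le> B" for d p
  proof -
    have B0: "0 \<le> B" by (simp add: B_def)
    have "norm (J d p) \<le> (\<integral>r. norm (\<Psi> (- p + d * r) * of_real (std_normal_density r)) \<partial>lborel)"
      unfolding J_def by (rule Bochner_Integration.integral_norm_bound)
    also have "\<dots> \<le> (\<integral>r. B * std_normal_density r \<partial>lborel)"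
      using B B0 by (intro Bochner_Integration.integral_mono') (auto simp: norm_mult intro!: mult_right_mono)
    also have "\<dots> = B" by simp
    finally show ?thesis .
  qed
  have Jm: "J d \<in> borel_measurable borel" for d
    unfolding J_def
  proof (rule lborel.borel_measurable_lebesgue_integral)
    have [measurable]: "\<Psi> \<in> borel_measurable borel" using cont\<Psi> by (rule borel_measurable_continuous_onI)
    show "(\<lambda>(p, r). \<Psi> (- p + d * r) * of_real (std_normal_density r)) \<in> borel_measurable (borel \<Otimes>\<^sub>M lborel)" by measurable
  qed
  have lim2: "(\<lambda>n. \<integral>p. \<Phi> p * J (d n) p \<partial>lborel) \<longlonglongrightarrow> (\<integral>p. \<Phi> p * \<Psi> (- p) \<partial>lborel)"
  proof (rule integral_dominated_convergence[where w = "\<lambda>p. norm (\<Phi> p) * B"])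
    have [measurable]: "\<Psi> \<in> borel_measurable borel" using cont\<Psi> by (rule borel_measurable_continuous_onI)
    have [measurable]: "\<Phi> \<in> borel_measurable borel" using cont\<Phi> by (rule borel_measurable_continuous_onI)
    note Jm[measurable]
    show "(\<lambda>p. \<Phi> p * J (d n) p) \<in> borel_measurable lborel" for n by measurable
    show "(\<lambda>p. \<Phi> p * \<Psi> (- p)) \<in> borel_measurable lborel" by measurable
    show "integrable lborel (\<lambda>p. norm (\<Phi> p) * B)" using int\<Phi> by simp
    show "AE p in lborel. (\<lambda>n. \<Phi> p * J (d n) p) \<longlonglongrightarrow> \<Phi> p * \<Psi> (- p)"
      by (intro AE_I2 tendsto_intros Jlim)
    show "AE p in lborel. norm (\<Phi> p * J (d n) p) \<le> norm (\<Phi> p) * B" for n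
      using JB by (intro AE_I2) (simp add: norm_mult mult_left_mono)
  qed
  have "(\<lambda>n. (\<integral>p. \<Phi> p * J (d n) p \<partial>lborel) / (2 * pi)) \<longlonglongrightarrow> (\<integral>p. \<Phi> p * \<Psi> (- p) \<partial>lborel) / (2 * pi)"
    by (intro tendsto_intros lim2) simp
  hence "(\<lambda>n. \<integral>s. of_real (exp (- (d n)\<^sup>2 * s\<^sup>2 / 2)) * H s \<partial>lborel) \<longlonglongrightarrow> (\<integral>p. \<Phi> p * \<Psi> (- p) \<partial>lborel) / (2 * pi)"
    by (simp only: reg[OF dpos])
  hence "integral\<^sup>L lborel H = (\<integral>p. \<Phi> p * \<Psi> (- p) \<partial>lborel) / (2 * pi)"
    using lim1 LIMSEQ_unique by blast
  also have "(\<lambda>p. \<Phi> p * \<Psi> (- p)) = (\<lambda>p. exp (of_real (b - a) * (Complex c p)\<^sup>2 + of_real (y - x) * Complex c p))"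
  proof (rule ext)
    fix p
    have "Complex (- c) (- p) = - Complex c p" by (simp add: complex_eq_iff)
    then show "\<Phi> p * \<Psi> (- p) = exp (of_real (b - a) * (Complex c p)\<^sup>2 + of_real (y - x) * Complex c p)"
      unfolding \<Phi>_def \<Psi>_def cub_def exp_add[symmetric] by (simp add: algebra_simps)
  qed
  also have "(\<integral>p. exp (of_real (b - a) * (Complex c p)\<^sup>2 + of_real (y - x) * Complex c p) \<partial>lborel) = of_real (2 * pi * heat (b - a) (y - x))"
    by (rule has_bochner_integral_integral_eq[OF heat_contour]) (use ab in simp)
  finally have "integral\<^sup>L lborel H = of_real (heat (b - a) (y - x))" by simp
  also have "heat (b - a) (y - x) = heat (b - a) (x - y)" using heat_minus[of "b - a" "x - y"] by simp
  finally show ?thesis unfolding H_def .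
qed

section \<open>Cutting the heat flow at the thresholds\<close>

definition push :: "real \<Rightarrow> real \<Rightarrow> (real \<Rightarrow> complex) \<Rightarrow> real \<Rightarrow> complex" where
  "push t b f y = (\<integral>x. indicator {..b} x * (f x * of_real (heat t (x - y))) \<partial>lborel)"

definition tail :: "real \<Rightarrow> real \<Rightarrow> (real \<Rightarrow> complex) \<Rightarrow> real \<Rightarrow> complex" where
  "tail t b f y = (\<integral>x. indicator {b<..} x * (f x * of_real (heat t (x - y))) \<partial>lborel)"

lemma norm_heat_mult_le:
  assumes "norm (f x) \<le> C * exp (p * x)"
  shows "norm (f x * complex_of_real (heat t (x - y))) \<le> C * (heat t (x - y) * exp (p * x))"
proof -
  have "norm (f x * complex_of_real (heat t (x - y))) = norm (f x) * heat t (x - y)"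
    by (simp add: norm_mult heat_nonneg)
  also have "\<dots> \<le> C * exp (p * x) * heat t (x - y)"
    by (intro mult_right_mono assms heat_nonneg)
  finally show ?thesis by (simp only: mult_ac)
qed

lemma heat_mult_integrable:
  assumes t: "t > 0" and f: "f \<in> borel_measurable borel" and b: "\<And>x. norm (f x) \<le> C * exp (p * x)"
  shows "integrable lborel (\<lambda>x. f x * complex_of_real (heat t (x - y)))"
proof (rule Bochner_Integration.integrable_bound)
  show "integrable lborel (\<lambda>x. C * (heat t (x - y) * exp (p * x)))"
    using heat_laplace_real[OF t] by (intro integrable_mult_right) (auto simp: has_bochner_integral_iff)
  show "(\<lambda>x. f x * complex_of_real (heat t (x - y))) \<in> borel_measurable lborel" using f by measurable
  show "AE x in lborel. norm (f x * complex_of_real (heat t (x - y))) \<le> norm (C * (heat t (x - y) * exp (p * x)))"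
    by (rule AE_I2, rule order_trans[OF norm_heat_mult_le[OF b]]) simp
qed

lemma integrable_indicator_times:
  fixes f :: "'a \<Rightarrow> complex"
  assumes "A \<in> sets M" "integrable M f"
  shows "integrable M (\<lambda>x. indicator A x * f x)"
proof -
  have "(\<lambda>x. indicator A x * f x) = (\<lambda>x. indicator A x *\<^sub>R f x)" by (auto simp: indicator_def)
  then show ?thesis using integrable_mult_indicator[OF assms] by simp
qed

lemma norm_heat_integral_le:
  assumes t: "t > 0" and f: "f \<in> borel_measurable borel" and b: "\<And>x. norm (f x) \<le> C * exp (p * x)"
    and A: "A \<in> sets borel"
  shows "norm (\<integral>x. indicator A x * (f x * complex_of_real (heat t (x - y))) \<partial>lborel) \<le> C * exp (t * p\<^sup>2 + p * y)"
proof -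
  have "norm (\<integral>x. indicator A x * (f x * complex_of_real (heat t (x - y))) \<partial>lborel) \<le> (\<integral>x. C * (heat t (x - y) * exp (p * x)) \<partial>lborel)"
  proof (rule order_trans[OF Bochner_Integration.integral_norm_bound Bochner_Integration.integral_mono])
    show "integrable lborel (\<lambda>x. norm (indicator A x * (f x * complex_of_real (heat t (x - y)))))"
      using A by (intro integrable_norm integrable_indicator_times heat_mult_integrable[OF t f b]) simp
    show "integrable lborel (\<lambda>x. C * (heat t (x - y) * exp (p * x)))"
      using heat_laplace_real[OF t] by (intro integrable_mult_right) (auto simp: has_bochner_integral_iff)
    fix x
    have "norm (indicator A x * (f x * complex_of_real (heat t (x - y)))) \<le> norm (f x * complex_of_real (heat t (x - y)))"
      by (simp add: indicator_def)
    also have "\<dots> \<le> C * (heat t (x - y) * exp (p * x))" by (rule norm_heat_mult_le[OF b])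
    finally show "norm (indicator A x * (f x * complex_of_real (heat t (x - y)))) \<le> C * (heat t (x - y) * exp (p * x))" .
  qed
  also have "\<dots> = C * exp (t * p\<^sup>2 + p * y)"
    using has_bochner_integral_integral_eq[OF heat_laplace_real[OF t, of y p]] by simp
  finally show ?thesis .
qed

lemma push_tail:
  assumes t: "t > 0" and f: "f \<in> borel_measurable borel" and b: "\<And>x. norm (f x) \<le> C * exp (p * x)"
  shows "(\<integral>x. f x * complex_of_real (heat t (x - y)) \<partial>lborel) = push t c f y + tail t c f y"
proof -
  note I = heat_mult_integrable[OF t f b, of y]
  have 1: "integrable lborel (\<lambda>x. indicator A x * (f x * complex_of_real (heat t (x - y))))" if "A \<in> sets borel" for A
    using that by (intro integrable_indicator_times I) simp
  have "push t c f y + tail t c f y = (\<integral>x. indicator {..c} x * (f x * complex_of_real (heat t (x - y))) +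
      indicator {c<..} x * (f x * complex_of_real (heat t (x - y))) \<partial>lborel)"
    unfolding push_def tail_def by (intro Bochner_Integration.integral_add[symmetric] 1) auto
  also have "\<dots> = (\<integral>x. f x * complex_of_real (heat t (x - y)) \<partial>lborel)"
    by (intro Bochner_Integration.integral_cong) (auto simp: indicator_def)
  finally show ?thesis ..
qed

lemma push_bound:
  assumes t: "t > 0" and f: "f \<in> borel_measurable borel" and b: "\<And>x. norm (f x) \<le> C * exp (p * x)"
  shows "norm (push t c f y) \<le> C * exp (t * p\<^sup>2) * exp (p * y)"
  using norm_heat_integral_le[OF t f b, of "{..c}" y] by (simp add: push_def exp_add mult.assoc)

lemma push_measurable2:
  assumes sN: "(\<lambda>(s, x). f s x) \<in> borel_measurable (N \<Otimes>\<^sub>M borel)"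
  shows "(\<lambda>(s, y). push t b (f s) y) \<in> borel_measurable (N \<Otimes>\<^sub>M borel)"
proof -
  have "(\<lambda>q. (fst (fst q), snd q)) \<in> measurable ((N \<Otimes>\<^sub>M borel) \<Otimes>\<^sub>M lborel) (N \<Otimes>\<^sub>M borel)"
    by measurable
  from measurable_compose[OF this sN]
  have [measurable]: "(\<lambda>q. f (fst (fst q)) (snd q)) \<in> borel_measurable ((N \<Otimes>\<^sub>M (borel :: real measure)) \<Otimes>\<^sub>M lborel)" by simp
  have "(\<lambda>p. \<integral>x. indicator {..b} x * (f (fst p) x * complex_of_real (heat t (x - snd p))) \<partial>lborel) \<in> borel_measurable (N \<Otimes>\<^sub>M borel)"
    by (rule lborel.borel_measurable_lebesgue_integral) (simp add: case_prod_beta')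
  then show ?thesis by (simp add: push_def case_prod_beta')
qed

lemma push_measurable:
  assumes f: "f \<in> borel_measurable borel"
  shows "push t b f \<in> borel_measurable borel"
proof -
  have "(\<lambda>(s, x). f x) \<in> borel_measurable (count_space {()} \<Otimes>\<^sub>M borel)"
    using f by measurable
  from push_measurable2[OF this, of t b] have "(\<lambda>p. push t b f (snd p)) \<in> borel_measurable (count_space {()} \<Otimes>\<^sub>M borel)"
    by (simp add: case_prod_beta')
  from measurable_compose[OF _ this, of "\<lambda>y. ((), y)" borel] show ?thesis by simp
qed

text \<open>Index 0 stands for level 1. Step \<open>n\<close> leaves level \<open>n + 1\<close>,
  where only the part at or below its threshold is kept, and arrives at level \<open>n + 2\<close>,
  whose threshold has not yet acted.\<close>

primrec chain :: "(nat \<Rightarrow> real) \<Rightarrow> (nat \<Rightarrow> real) \<Rightarrow> (real \<Rightarrow> complex) \<Rightarrow> nat \<Rightarrow> real \<Rightarrow> complex" where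
  "chain \<alpha> \<beta> f 0 = f"
| "chain \<alpha> \<beta> f (Suc n) = push (\<alpha> (n + 2) - \<alpha> (n + 1)) (\<beta> (n + 1)) (chain \<alpha> \<beta> f n)"

lemma chain_measurable2:
  assumes "(\<lambda>(s, x). f s x) \<in> borel_measurable (N \<Otimes>\<^sub>M borel)"
  shows "(\<lambda>(s, y). chain \<alpha> \<beta> (f s) n y) \<in> borel_measurable (N \<Otimes>\<^sub>M borel)"
  by (induction n) (simp_all add: assms push_measurable2)

lemma chain_measurable: "f \<in> borel_measurable borel \<Longrightarrow> chain \<alpha> \<beta> f n \<in> borel_measurable borel"
  by (induction n) (simp_all add: push_measurable)

lemma increasing_step:
  fixes \<alpha> :: "nat \<Rightarrow> real"
  assumes "strict_mono_on {1..m} \<alpha>" "1 \<le> i" "i < j" "j \<le> m"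
  shows "0 < \<alpha> j - \<alpha> i"
  using assms by (auto simp: strict_mono_on_def)

text \<open>An exponential with rate \<open>p\<close> is an eigenfunction of the heat flow with
  factor exp(t p^2), and cutting can only decrease the bound. The times of the single steps add up
  to \<open>\<alpha> (n + 1) - \<alpha> 1\<close>.\<close>

lemma chain_bound:
  assumes \<alpha>: "strict_mono_on {1..m} \<alpha>" and f: "f \<in> borel_measurable borel" and b: "\<And>x. norm (f x) \<le> C * exp (p * x)"
    and n: "n < m"
  shows "norm (chain \<alpha> \<beta> f n y) \<le> C * exp ((\<alpha> (n + 1) - \<alpha> 1) * p\<^sup>2) * exp (p * y)"
  using n
proof (induction n arbitrary: y)
  case 0
  then show ?case using b by simp
next
  case (Suc n)
  have t: "0 < \<alpha> (n + 2) - \<alpha> (n + 1)" using Suc.prems by (intro increasing_step[OF \<alpha>]) auto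
  have "norm (chain \<alpha> \<beta> f (Suc n) y) \<le> C * exp ((\<alpha> (n + 1) - \<alpha> 1) * p\<^sup>2) * exp ((\<alpha> (n + 2) - \<alpha> (n + 1)) * p\<^sup>2) * exp (p * y)"
    unfolding chain.simps using Suc.IH Suc.prems by (intro push_bound[OF t] chain_measurable f) auto
  also have "C * exp ((\<alpha> (n + 1) - \<alpha> 1) * p\<^sup>2) * exp ((\<alpha> (n + 2) - \<alpha> (n + 1)) * p\<^sup>2) =
      C * exp ((\<alpha> (Suc n + 1) - \<alpha> 1) * p\<^sup>2)"
    by (simp add: mult.assoc algebra_simps flip: exp_add)
  finally show ?case .
qed

text \<open>In \<open>tail\<close> the cut precedes the heat flow, so a further heat step only
  lengthens the time, by the semigroup law.\<close>

lemma tail_heat: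
  assumes s: "s > 0" and t: "t > 0" and f: "f \<in> borel_measurable borel" and b: "\<And>x. norm (f x) \<le> C * exp (p * x)"
  shows "(\<integral>x. tail s c f x * of_real (heat t (x - y)) \<partial>lborel) = tail (s + t) c f y"
    and "integrable lborel (\<lambda>x. tail s c f x * of_real (heat t (x - y)))"
proof -
  define F where "F z x = indicator {c<..} z * f z * complex_of_real (heat s (z - x) * heat t (x - y))" for z x
  have m: "(\<lambda>(z, x). F z x) \<in> borel_measurable (lborel \<Otimes>\<^sub>M lborel)"
    unfolding F_def using f by measurable
  have C: "0 \<le> C" using order_trans[OF norm_ge_zero b[of 0]] by simp
  have g: "has_bochner_integral lborel (\<lambda>x. (C * exp (p * z)) * (heat s (z - x) * heat t (x - y))) ((C * exp (p * z)) * heat (s + t) (z - y))" for z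
    by (rule has_bochner_integral_mult_right) (rule heat_conv[OF s t])
  have n: "norm (F z x) \<le> (C * exp (p * z)) * (heat s (z - x) * heat t (x - y))" for z x
  proof -
    have "norm (F z x) = indicator {c<..} z * norm (f z) * (heat s (z - x) * heat t (x - y))"
      by (simp add: F_def norm_mult heat_nonneg indicator_def)
    also have "\<dots> \<le> (C * exp (p * z)) * (heat s (z - x) * heat t (x - y))"
      using b[of z] C by (intro mult_right_mono) (auto simp: indicator_def heat_nonneg)
    finally show ?thesis .
  qed
  have G: "integrable lborel (\<lambda>z. (C * exp (p * z)) * heat (s + t) (z - y))"
  proof -
    have "(\<lambda>z. (C * exp (p * z)) * heat (s + t) (z - y)) = (\<lambda>z. C * (heat (s + t) (z - y) * exp (p * z)))" by (simp only: mult_ac)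
    then show ?thesis using heat_laplace_real[of "s + t" y p] s t by (simp add: has_bochner_integral_iff)
  qed
  note F = fubini_dominated[OF sf_lborel sf_lborel m g n G]
  have x: "(\<integral>z. F z x \<partial>lborel) = tail s c f x * of_real (heat t (x - y))" for x
  proof -
    have "F z x = indicator {c<..} z * (f z * of_real (heat s (z - x))) * of_real (heat t (x - y))" for z
      by (simp add: F_def)
    then show ?thesis by (simp add: tail_def)
  qed
  have z: "(\<integral>x. F z x \<partial>lborel) = indicator {c<..} z * (f z * of_real (heat (s + t) (z - y)))" for z
  proof -
    have "(\<integral>x. complex_of_real (heat s (z - x) * heat t (x - y)) \<partial>lborel) = of_real (heat (s + t) (z - y))"
      using has_bochner_integral_integral_eq[OF heat_conv[OF s t, of z y]] by (simp only: integral_complex_of_real)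
    then show ?thesis unfolding F_def by (simp only: integral_mult_right_zero mult.assoc)
  qed
  show "(\<integral>x. tail s c f x * of_real (heat t (x - y)) \<partial>lborel) = tail (s + t) c f y"
    using F(2) unfolding x z tail_def[of "s + t"] by simp
  show "integrable lborel (\<lambda>x. tail s c f x * of_real (heat t (x - y)))"
    using F(4) unfolding x .
qed

lemma af_measurable_shift: "(\<lambda>x. af a (x + s)) \<in> borel_measurable borel"
  by measurable

lemma af_exp_bound: "c > a \<Longrightarrow> norm (af a (x + s)) \<le> (af_const a c * exp (- c * s)) * exp (- c * x)"
  using norm_af_le[of a c "x + s"] by (simp add: algebra_simps exp_add exp_diff exp_minus divide_inverse)

text \<open>
  At each level the function is split at the threshold. The part below goes on to the next term of the
  chain, the part above is carried to the last level by the heat semigroup.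
\<close>

lemma af_chain:
  assumes \<alpha>: "strict_mono_on {1..m} \<alpha>" and n: "n < m"
  shows "af (- \<alpha> (n + 1)) (y + s) = chain \<alpha> \<beta> (\<lambda>x. af (- \<alpha> 1) (x + s)) n y +
    (\<Sum>j<n. tail (\<alpha> (n + 1) - \<alpha> (j + 1)) (\<beta> (j + 1)) (chain \<alpha> \<beta> (\<lambda>x. af (- \<alpha> 1) (x + s)) j) y)"
  using n
proof (induction n arbitrary: y)
  case 0
  show ?case by simp
next
  case (Suc n)
  let ?f = "\<lambda>x. af (- \<alpha> 1) (x + s)" and ?t = "\<alpha> (n + 2) - \<alpha> (n + 1)"
  define c where "c = - \<alpha> 1 + 1"
  have c: "c > - \<alpha> 1" by (simp add: c_def)
  have cb: "norm (chain \<alpha> \<beta> ?f j x) \<le> (af_const (- \<alpha> 1) c * exp (- c * s)) * exp ((\<alpha> (j + 1) - \<alpha> 1) * (- c)\<^sup>2) * exp (- c * x)" if "j < m" for j x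
    by (rule chain_bound[OF \<alpha> af_measurable_shift af_exp_bound[OF c] that])
  have t: "0 < ?t" using Suc.prems by (intro increasing_step[OF \<alpha>]) auto
  have cm: "chain \<alpha> \<beta> ?f j \<in> borel_measurable borel" for j by (rule chain_measurable[OF af_measurable_shift])
  have tl: "(\<integral>x. tail (\<alpha> (n + 1) - \<alpha> (j + 1)) (\<beta> (j + 1)) (chain \<alpha> \<beta> ?f j) x * of_real (heat ?t (x - y)) \<partial>lborel) =
      tail (\<alpha> (n + 2) - \<alpha> (j + 1)) (\<beta> (j + 1)) (chain \<alpha> \<beta> ?f j) y"
    "integrable lborel (\<lambda>x. tail (\<alpha> (n + 1) - \<alpha> (j + 1)) (\<beta> (j + 1)) (chain \<alpha> \<beta> ?f j) x * of_real (heat ?t (x - y)))" if j: "j < n" for j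
  proof -
    have sj: "0 < \<alpha> (n + 1) - \<alpha> (j + 1)" using j Suc.prems by (intro increasing_step[OF \<alpha>]) auto
    have "j < m" using j Suc.prems by simp
    note T = tail_heat[OF sj t cm cb[OF this], of "\<beta> (j + 1)" y]
    have e: "\<alpha> (n + 1) - \<alpha> (j + 1) + ?t = \<alpha> (n + 2) - \<alpha> (j + 1)" by simp
    show "(\<integral>x. tail (\<alpha> (n + 1) - \<alpha> (j + 1)) (\<beta> (j + 1)) (chain \<alpha> \<beta> ?f j) x * of_real (heat ?t (x - y)) \<partial>lborel) =
      tail (\<alpha> (n + 2) - \<alpha> (j + 1)) (\<beta> (j + 1)) (chain \<alpha> \<beta> ?f j) y" using T(1) unfolding e .
    show "integrable lborel (\<lambda>x. tail (\<alpha> (n + 1) - \<alpha> (j + 1)) (\<beta> (j + 1)) (chain \<alpha> \<beta> ?f j) x * of_real (heat ?t (x - y)))" by (rule T(2))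
  qed
  have nm: "n < m" using Suc.prems by simp
  have I0: "integrable lborel (\<lambda>x. chain \<alpha> \<beta> ?f n x * of_real (heat ?t (x - y)))"
    by (rule heat_mult_integrable[OF t cm cb[OF nm]])
  have "af (- \<alpha> (n + 2)) (y + s) = (\<integral>x. af (- \<alpha> (n + 1)) (x + s) * of_real (heat ?t (x - y)) \<partial>lborel)"
    using has_bochner_integral_integral_eq[OF af_heat[OF t, of "\<alpha> (n + 1)" s y]] by simp
  also have "\<dots> = (\<integral>x. chain \<alpha> \<beta> ?f n x * of_real (heat ?t (x - y)) +
      (\<Sum>j<n. tail (\<alpha> (n + 1) - \<alpha> (j + 1)) (\<beta> (j + 1)) (chain \<alpha> \<beta> ?f j) x * of_real (heat ?t (x - y))) \<partial>lborel)"
    unfolding Suc.IH[OF nm] by (simp only: distrib_right sum_distrib_right)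
  also have "\<dots> = (\<integral>x. chain \<alpha> \<beta> ?f n x * of_real (heat ?t (x - y)) \<partial>lborel) +
      (\<Sum>j<n. tail (\<alpha> (n + 2) - \<alpha> (j + 1)) (\<beta> (j + 1)) (chain \<alpha> \<beta> ?f j) y)"
    by (subst Bochner_Integration.integral_add[OF I0], rule Bochner_Integration.integrable_sum, rule tl(2), simp,
      subst Bochner_Integration.integral_sum, rule tl(2), simp, rule arg_cong2[where f = "(+)", OF refl], rule sum.cong[OF refl], rule tl(1), simp)
  also have "(\<integral>x. chain \<alpha> \<beta> ?f n x * of_real (heat ?t (x - y)) \<partial>lborel) =
      chain \<alpha> \<beta> ?f (Suc n) y + tail ?t (\<beta> (n + 1)) (chain \<alpha> \<beta> ?f n) y"
    unfolding chain.simps by (rule push_tail[OF t cm cb[OF nm]])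
  finally show ?case by simp
qed

section \<open>The extended Airy kernel\<close>

text \<open>The prefactors of \<open>af a\<close> and \<open>af (- b)\<close> multiply to exp(- s (a
  - b)), up to factors that depend on one endpoint each. For a < b the integral over negative
  \<open>s\<close> is the full integral, a heat kernel, minus the one over positive
  \<open>s\<close>; this brings both cases of the definition to the same half line.\<close>

lemma K_Ai_ext_af:
  defines "x' \<equiv> \<lambda>a x :: real. x - a\<^sup>2" and "g \<equiv> \<lambda>a x :: real. exp (a * (x - a\<^sup>2) + 2 * a ^ 3 / 3)"
  shows "K_Ai_ext a x b y = of_real (g a x / g b y) *
    ((\<integral>s. indicator {0..} s * (af a (x' a x + s) * af (- b) (x' b y + s)) \<partial>lborel) -
      (if a < b then of_real (heat (b - a) (x' a x - x' b y)) else 0))"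
proof -
  define H where "H s = af a (x' a x + s) * af (- b) (x' b y + s)" for s
  define A where "A s = complex_of_real (exp (- s * (a - b))) * Ai (of_real x + of_real s) * Ai (of_real y + of_real s)" for s
  have A: "A s = of_real (g a x / g b y) * H s" for s
  proof -
    have "g a x / g b y * (exp (- (a * (x' a x + s) + 2 * a ^ 3 / 3)) * exp (- (- b * (x' b y + s) + 2 * (- b) ^ 3 / 3))) = exp (- s * (a - b))"
      unfolding g_def x'_def exp_diff[symmetric] exp_add[symmetric] by (simp add: algebra_simps)
    hence "complex_of_real (exp (- s * (a - b))) = of_real (g a x / g b y) * (of_real (exp (- (a * (x' a x + s) + 2 * a ^ 3 / 3))) * of_real (exp (- (- b * (x' b y + s) + 2 * (- b) ^ 3 / 3))))"
      by (simp only: of_real_mult[symmetric])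
    moreover have "x' a x + s + a\<^sup>2 = x + s" "x' b y + s + (- b)\<^sup>2 = y + s" by (simp_all add: x'_def)
    ultimately show ?thesis unfolding A_def H_def af_def by (simp only: of_real_add[symmetric] mult_ac)
  qed
  have I0: "(\<integral>s. indicator {0::real..} s *\<^sub>R A s \<partial>lborel) = of_real (g a x / g b y) * (\<integral>s. indicator {0..} s * H s \<partial>lborel)"
  proof -
    have "(\<lambda>s. indicator {0::real..} s *\<^sub>R A s) = (\<lambda>s. of_real (g a x / g b y) * (indicator {0..} s * H s))"
      unfolding A by (auto simp: indicator_def)
    then show ?thesis by (simp only: integral_mult_right_zero)
  qed
  show ?thesis
  proof (cases "a < b")
    case False
    have "K_Ai_ext a x b y = (\<integral>s. indicator {0::real..} s *\<^sub>R A s \<partial>lborel)"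
      using False by (simp add: K_Ai_ext_def set_lebesgue_integral_def A_def)
    then show ?thesis unfolding I0 H_def using False by simp
  next
    case True
    have int: "integrable lborel H" unfolding H_def by (rule af_mult_integrable[OF True])
    have 1: "integrable lborel (\<lambda>s. indicator {..0} s * H s)" "integrable lborel (\<lambda>s. indicator {0..} s * H s)"
      by (intro integrable_indicator_times int; simp)+
    have "of_real (heat (b - a) (x' a x - x' b y)) = integral\<^sup>L lborel H"
      unfolding H_def by (rule af_product_integral[OF True, symmetric])
    also have "\<dots> = (\<integral>s. indicator {..0} s * H s + indicator {0..} s * H s \<partial>lborel)"
    proof (rule Bochner_Integration.integral_cong_AE)
      show "AE s in lborel. H s = indicator {..0} s * H s + indicator {0..} s * H s"
        using AE_lborel_singleton[of 0] by eventually_elim (auto simp: indicator_def)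
    qed (use int 1 in \<open>auto intro: borel_measurable_integrable\<close>)
    also have "\<dots> = (\<integral>s. indicator {..0} s * H s \<partial>lborel) + (\<integral>s. indicator {0..} s * H s \<partial>lborel)"
      by (rule Bochner_Integration.integral_add[OF 1])
    finally have 2: "- (\<integral>s. indicator {..0} s * H s \<partial>lborel) = (\<integral>s. indicator {0..} s * H s \<partial>lborel) - of_real (heat (b - a) (x' a x - x' b y))"
      by simp
    have "K_Ai_ext a x b y = - (\<integral>s. indicator {..0::real} s *\<^sub>R A s \<partial>lborel)"
      using True by (simp add: K_Ai_ext_def set_lebesgue_integral_def A_def)
    also have "(\<lambda>s. indicator {..0::real} s *\<^sub>R A s) = (\<lambda>s. of_real (g a x / g b y) * (indicator {..0} s * H s))"
      unfolding A by (auto simp: indicator_def)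
    also have "- (\<integral>s. of_real (g a x / g b y) * (indicator {..0} s * H s) \<partial>lborel) = of_real (g a x / g b y) * (- (\<integral>s. indicator {..0} s * H s \<partial>lborel))"
      by (simp only: integral_mult_right_zero mult_minus_right)
    finally show ?thesis unfolding 2 unfolding H_def using True by simp
  qed
qed

lemma fterm_cong:
  assumes "\<And>x y. x \<in> space M \<Longrightarrow> y \<in> space M \<Longrightarrow> K x y = K' x y"
  shows "fterm M K k = fterm M K' k"
  unfolding fterm_def
proof (intro arg_cong[where f = "\<lambda>x. 1 / fact k * x"] Bochner_Integration.integral_cong refl dt_cong)
  fix x i j assume "x \<in> space (\<Pi>\<^sub>M i\<in>{..<k}. M)" "i < k" "j < k"
  then show "K (x i) (x j) = K' (x i) (x j)" by (intro assms) (auto simp: space_PiM PiE_def Pi_def)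
qed

section \<open>Kernels that factor through another measure space\<close>

lemma factor_integrable:
  fixes R :: "'a \<Rightarrow> 'b \<Rightarrow> complex" and E :: "'b \<Rightarrow> 'a \<Rightarrow> complex"
  assumes Rm: "(\<lambda>(x, s). R x s) \<in> borel_measurable (M \<Otimes>\<^sub>M N)"
    and Em: "(\<lambda>(s, x). E s x) \<in> borel_measurable (N \<Otimes>\<^sub>M M)"
    and Rb: "\<And>x s. x \<in> space M \<Longrightarrow> s \<in> space N \<Longrightarrow> norm (R x s) \<le> w x * r s"
    and Eb: "\<And>s x. s \<in> space N \<Longrightarrow> x \<in> space M \<Longrightarrow> norm (E s x) \<le> C"
    and r: "integrable N r" and x: "x \<in> space M" and y: "y \<in> space M"
  shows "integrable N (\<lambda>s. R x s * E s y)" "norm (\<integral>s. R x s * E s y \<partial>N) \<le> w x * (C * integral\<^sup>L N r)"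
proof -
  have b: "norm (R x s * E s y) \<le> w x * (C * r s)" if s: "s \<in> space N" for s
  proof -
    have "norm (R x s * E s y) \<le> (w x * r s) * C" unfolding norm_mult
      using order_trans[OF norm_ge_zero Rb[OF x s]] by (intro mult_mono Rb Eb x y s) auto
    then show ?thesis by (simp only: mult_ac)
  qed
  have g: "integrable N (\<lambda>s. w x * (C * r s))" using r by simp
  show I: "integrable N (\<lambda>s. R x s * E s y)"
  proof (rule Bochner_Integration.integrable_bound[OF g])
    show "(\<lambda>s. R x s * E s y) \<in> borel_measurable N"
      by (rule borel_measurable_times[OF kernel_sections(1)[OF Rm x] kernel_sections(2)[OF Em y]])
    show "AE s in N. norm (R x s * E s y) \<le> norm (w x * (C * r s))"
      by (rule AE_I2, rule order_trans[OF b]) auto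
  qed
  have "norm (\<integral>s. R x s * E s y \<partial>N) \<le> (\<integral>s. norm (R x s * E s y) \<partial>N)" by (rule Bochner_Integration.integral_norm_bound)
  also have "\<dots> \<le> (\<integral>s. w x * (C * r s) \<partial>N)"
    by (rule Bochner_Integration.integral_mono[OF integrable_norm[OF I] g b])
  finally show "norm (\<integral>s. R x s * E s y \<partial>N) \<le> w x * (C * integral\<^sup>L N r)" by simp
qed

lemma dominated_factor:
  fixes R :: "'a \<Rightarrow> 'b \<Rightarrow> complex" and E :: "'b \<Rightarrow> 'a \<Rightarrow> complex"
  assumes sfN: "sigma_finite_measure N"
    and Rm: "(\<lambda>(x, s). R x s) \<in> borel_measurable (M \<Otimes>\<^sub>M N)"
    and Em: "(\<lambda>(s, x). E s x) \<in> borel_measurable (N \<Otimes>\<^sub>M M)"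
    and Rb: "\<And>x s. x \<in> space M \<Longrightarrow> s \<in> space N \<Longrightarrow> norm (R x s) \<le> w x * r s"
    and Eb: "\<And>s x. s \<in> space N \<Longrightarrow> x \<in> space M \<Longrightarrow> norm (E s x) \<le> C"
    and w: "integrable M w" "\<And>x. x \<in> space M \<Longrightarrow> 0 \<le> w x"
    and r: "integrable N r" "\<And>s. s \<in> space N \<Longrightarrow> 0 \<le> r s" and C: "0 \<le> C"
  shows "dominated M (\<lambda>x. w x * (C * integral\<^sup>L N r)) (\<lambda>x y. \<integral>s. R x s * E s y \<partial>N)"
  unfolding dominated_def
proof (intro conjI ballI)
  interpret N: sigma_finite_measure N by fact
  show "integrable M (\<lambda>x. w x * (C * integral\<^sup>L N r))" using w(1) by simp
  show "0 \<le> w x * (C * integral\<^sup>L N r)" if "x \<in> space M" for x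
    by (intro mult_nonneg_nonneg w(2)[OF that] C Bochner_Integration.integral_nonneg r(2))
  show "norm (\<integral>s. R x s * E s y \<partial>N) \<le> w x * (C * integral\<^sup>L N r)" if "x \<in> space M" "y \<in> space M" for x y
    by (rule factor_integrable(2)[OF Rm Em Rb Eb r(1) that])
  have [measurable]: "(\<lambda>p. R (fst (fst p)) (snd p)) \<in> borel_measurable ((M \<Otimes>\<^sub>M M) \<Otimes>\<^sub>M N)"
    using measurable_compose[OF _ Rm, of "\<lambda>p. (fst (fst p), snd p)" "(M \<Otimes>\<^sub>M M) \<Otimes>\<^sub>M N"] by simp
  have [measurable]: "(\<lambda>p. E (snd p) (snd (fst p))) \<in> borel_measurable ((M \<Otimes>\<^sub>M M) \<Otimes>\<^sub>M N)"
    using measurable_compose[OF _ Em, of "\<lambda>p. (snd p, snd (fst p))" "(M \<Otimes>\<^sub>M M) \<Otimes>\<^sub>M N"] by simp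
  have "(\<lambda>q. \<integral>s. R (fst q) s * E s (snd q) \<partial>N) \<in> borel_measurable (M \<Otimes>\<^sub>M M)"
    by (rule N.borel_measurable_lebesgue_integral) (simp add: case_prod_beta')
  then show "(\<lambda>(x, y). \<integral>s. R x s * E s y \<partial>N) \<in> borel_measurable (M \<Otimes>\<^sub>M M)" by (simp add: case_prod_beta')
qed

lemma fst_levels_measurable: "fst \<in> measurable (levels m) (count_space {1..m})"
  unfolding levels_def by (rule measurable_fst)

lemma snd_levels_measurable: "snd \<in> measurable (levels m) borel"
  using measurable_snd[of "count_space {1..m}" "lborel :: real measure"] unfolding levels_def by simp

lemma levels_pair_measurable:
  assumes "\<And>i. i \<in> {1..m} \<Longrightarrow> (\<lambda>(x, s). f (i, x) s) \<in> measurable (borel \<Otimes>\<^sub>M N) L"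
  shows "(\<lambda>(p, s). f p s) \<in> measurable (levels m \<Otimes>\<^sub>M N) L"
proof -
  have "(\<lambda>q. (case (snd (fst q), snd q) of (x, s) \<Rightarrow> f (fst (fst q), x) s)) \<in> measurable (levels m \<Otimes>\<^sub>M N) L"
  proof (rule measurable_compose_countable'[where g = "\<lambda>q. fst (fst q)" and I = "{1..m}" and f = "\<lambda>i q. case (snd (fst q), snd q) of (x, s) \<Rightarrow> f (i, x) s"])
    fix i assume i: "i \<in> {1..m}"
    have "(\<lambda>q. (snd (fst q), snd q)) \<in> measurable (levels m \<Otimes>\<^sub>M N) (borel \<Otimes>\<^sub>M N)"
      by (intro measurable_Pair measurable_compose[OF measurable_fst snd_levels_measurable] measurable_snd)
    from measurable_compose[OF this assms[OF i]]
    show "(\<lambda>q. case (snd (fst q), snd q) of (x, s) \<Rightarrow> f (i, x) s) \<in> measurable (levels m \<Otimes>\<^sub>M N) L" .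
  qed (rule measurable_compose[OF measurable_fst fst_levels_measurable], simp)
  then show ?thesis by (simp add: case_prod_beta')
qed

lemma levels_pair_measurable':
  assumes "\<And>i. i \<in> {1..m} \<Longrightarrow> (\<lambda>(s, x). f s (i, x)) \<in> measurable (N \<Otimes>\<^sub>M borel) L"
  shows "(\<lambda>(s, p). f s p) \<in> measurable (N \<Otimes>\<^sub>M levels m) L"
proof -
  have "(\<lambda>(p, s). f s p) \<in> measurable (levels m \<Otimes>\<^sub>M N) L"
  proof (rule levels_pair_measurable)
    fix i assume "i \<in> {1..m}"
    from measurable_compose[OF measurable_pair_swap' assms[OF this]]
    show "(\<lambda>(x, s). f s (i, x)) \<in> measurable (borel \<Otimes>\<^sub>M N) L" by (simp add: case_prod_beta')
  qed
  from measurable_compose[OF measurable_pair_swap' this] show ?thesis by (simp add: case_prod_beta')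
qed

lemma levels_levels_measurable:
  assumes "\<And>i j. i \<in> {1..m} \<Longrightarrow> j \<in> {1..m} \<Longrightarrow> (\<lambda>(x, y). f (i, x) (j, y)) \<in> measurable (borel \<Otimes>\<^sub>M borel) L"
  shows "(\<lambda>(p, q). f p q) \<in> measurable (levels m \<Otimes>\<^sub>M levels m) L"
  by (intro levels_pair_measurable levels_pair_measurable' assms)

lemma integrable_exp_tail:
  assumes d: "d > 0"
  shows "integrable lborel (\<lambda>x::real. indicator {b..} x * exp (- d * x))" "integrable lborel (\<lambda>x::real. indicator {b<..} x * exp (- d * x))"
proof -
  have I: "integrable lborel (\<lambda>x::real. exp (2 * d * \<bar>b\<bar>) * exp (- d * \<bar>x\<bar>))"
    by (intro integrable_mult_right integrable_exp_abs_rate d)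
  have "exp (- d * x) \<le> exp (2 * d * \<bar>b\<bar>) * exp (- d * \<bar>x\<bar>)" if "b \<le> x" for x
  proof -
    have "\<bar>x\<bar> - x \<le> 2 * \<bar>b\<bar>" using that by linarith
    hence "d * (\<bar>x\<bar> - x) \<le> d * (2 * \<bar>b\<bar>)" using d by (intro mult_left_mono) auto
    then show ?thesis by (simp add: algebra_simps flip: exp_add)
  qed
  hence b: "norm (indicator A x * exp (- d * x)) \<le> norm (exp (2 * d * \<bar>b\<bar>) * exp (- d * \<bar>x\<bar>))" if "A \<subseteq> {b..}" for x and A :: "real set"
    using that by (auto simp: indicator_def abs_mult)
  show "integrable lborel (\<lambda>x::real. indicator {b..} x * exp (- d * x))"
    by (rule Bochner_Integration.integrable_bound[OF I], measurable, rule AE_I2, rule b) auto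
  show "integrable lborel (\<lambda>x::real. indicator {b<..} x * exp (- d * x))"
    by (rule Bochner_Integration.integrable_bound[OF I], measurable, rule AE_I2, rule b) auto
qed

text \<open>Completing the square. The tilted heat kernel is bounded uniformly in its argument, as
  domination by the first variable requires.\<close>

lemma heat_exp_le:
  assumes t: "t > 0"
  shows "heat t x * exp (a * x) \<le> exp (t * a\<^sup>2) / sqrt (4 * pi * t)"
proof -
  have "t * a\<^sup>2 - (- x\<^sup>2 / (4 * t) + a * x) = (x - 2 * t * a)\<^sup>2 / (4 * t)"
    using t by (simp add: power2_eq_square field_simps)
  also have "\<dots> \<ge> 0" using t by simp
  finally have "exp (- x\<^sup>2 / (4 * t) + a * x) \<le> exp (t * a\<^sup>2)" by simp
  hence "exp (- x\<^sup>2 / (4 * t)) * exp (a * x) / sqrt (4 * pi * t) \<le> exp (t * a\<^sup>2) / sqrt (4 * pi * t)"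
    unfolding exp_add using t by (intro divide_right_mono) simp_all
  then show ?thesis unfolding heat_eq[OF t] by simp
qed

context
  fixes m :: nat and \<alpha> \<beta> :: "nat \<Rightarrow> real"
  assumes \<alpha>: "strict_mono_on {1..m} \<alpha>"
begin

text \<open>A single position to the right of every \<open>\<alpha> i\<close> and every
  \<open>- \<alpha> i\<close>, hence a contour position that is admissible in
  \<open>norm_af_le\<close> for all Airy functions that occur.\<close>

definition rate :: real where "rate = 1 + (\<Sum>i=1..m. \<bar>\<alpha> i\<bar>)"

text \<open>The \<open>i - 1\<close> steps lead from level 1 to level \<open>i\<close>. By
  \<open>af_chain\<close> this is the part of the function \<open>af (- \<alpha> i)\<close> at
  \<open>x + s\<close> that has passed below all earlier thresholds.\<close>

definition airy_chain :: "nat \<Rightarrow> real \<Rightarrow> real \<Rightarrow> complex" where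
  "airy_chain i s = chain \<alpha> \<beta> (\<lambda>x. af (- \<alpha> 1) (x + s)) (i - 1)"

text \<open>
  In the coordinate \<open>x - (\<alpha> i)\<^sup>2\<close>, and up to a conjugation that makes all kernels integrable, the Airy
  kernel is \<open>N - C - C N\<close> with \<open>N = lev_up\<close> strictly triangular and \<open>C\<close> the product of \<open>lev_out\<close> and \<open>lev_in\<close>.
\<close>

definition lev_out :: "nat \<times> real \<Rightarrow> real \<Rightarrow> complex" where
  "lev_out p s = indicator {\<beta> (fst p)<..} (snd p) * indicator {0..} s * (of_real (exp (\<alpha> (fst p) * snd p)) * af (\<alpha> (fst p)) (snd p + s))"

definition lev_in :: "real \<Rightarrow> nat \<times> real \<Rightarrow> complex" where
  "lev_in s p = indicator {\<beta> (fst p)<..} (snd p) * indicator {0..} s * (of_real (exp (- \<alpha> (fst p) * snd p)) * airy_chain (fst p) s (snd p))"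

definition lev_up :: "nat \<times> real \<Rightarrow> nat \<times> real \<Rightarrow> complex" where
  "lev_up p q = (if fst p < fst q \<and> fst q \<le> m
     then indicator {\<beta> (fst p)<..} (snd p) * indicator {\<beta> (fst q)<..} (snd q) *
       of_real (exp (\<alpha> (fst p) * snd p - \<alpha> (fst q) * snd q) * heat (\<alpha> (fst q) - \<alpha> (fst p)) (snd p - snd q)) else 0)"

definition out_weight :: "nat \<times> real \<Rightarrow> real" where
  "out_weight p = indicator {\<beta> (fst p)<..} (snd p) * (af_const (\<alpha> (fst p)) rate * exp (- (rate - \<alpha> (fst p)) * snd p))"

definition up_weight :: "nat \<times> real \<Rightarrow> real" where
  "up_weight p = indicator {\<beta> (fst p)<..} (snd p) * (\<Sum>j\<in>{fst p<..m}. exp (- (\<alpha> j - \<alpha> (fst p)) * snd p) *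
     (exp ((\<alpha> j - \<alpha> (fst p)) * (\<alpha> j)\<^sup>2) / sqrt (4 * pi * (\<alpha> j - \<alpha> (fst p)))))"

definition half_weight :: "real \<Rightarrow> real" where "half_weight s = indicator {0..} s * exp (- rate * s)"

text \<open>The bound for \<open>lev_in\<close> is largest at \<open>x = \<beta> i\<close> and
  \<open>s = 0\<close>; its values there are summed over the levels.\<close>

definition in_bound :: real where
  "in_bound = (\<Sum>i=1..m. af_const (- \<alpha> 1) rate * exp ((\<alpha> i - \<alpha> 1) * rate\<^sup>2) * exp (- (\<alpha> i + rate) * \<beta> i))"

lemma rate_gt: "i \<in> {1..m} \<Longrightarrow> \<alpha> i < rate" "i \<in> {1..m} \<Longrightarrow> - \<alpha> i < rate" "0 < rate"
proof -
  have "\<bar>\<alpha> i\<bar> < rate" if "i \<in> {1..m}" for i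
    using member_le_sum[OF that, of "\<lambda>i. \<bar>\<alpha> i\<bar>"] by (simp add: rate_def)
  then show "i \<in> {1..m} \<Longrightarrow> \<alpha> i < rate" "i \<in> {1..m} \<Longrightarrow> - \<alpha> i < rate" by (fastforce simp: abs_less_iff)+
  show "0 < rate" unfolding rate_def by (intro add_pos_nonneg sum_nonneg) auto
qed

lemma airy_chain_measurable2: "(\<lambda>(s, x). airy_chain i s x) \<in> borel_measurable (borel \<Otimes>\<^sub>M borel)"
  unfolding airy_chain_def by (rule chain_measurable2) measurable

lemma airy_chain_bound:
  assumes i: "i \<in> {1..m}"
  shows "norm (airy_chain i s x) \<le> af_const (- \<alpha> 1) rate * exp (- rate * s) * exp ((\<alpha> i - \<alpha> 1) * rate\<^sup>2) * exp (- rate * x)"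
proof -
  have "1 \<in> {1..m}" using i by auto
  from chain_bound[OF \<alpha> af_measurable_shift af_exp_bound[OF rate_gt(2)[OF this]], of "i - 1"]
  have "i - 1 < m \<Longrightarrow> norm (airy_chain i s x) \<le> (af_const (- \<alpha> 1) rate * exp (- rate * s)) * exp ((\<alpha> (i - 1 + 1) - \<alpha> 1) * (- rate)\<^sup>2) * exp (- rate * x)"
    unfolding airy_chain_def .
  then show ?thesis using i by (simp del: One_nat_def) (auto simp del: One_nat_def)
qed

lemma lev_out_measurable: "(\<lambda>(p, s). lev_out p s) \<in> borel_measurable (levels m \<Otimes>\<^sub>M lborel)"
  by (rule levels_pair_measurable) (unfold lev_out_def fst_conv snd_conv, measurable)

lemma lev_in_measurable: "(\<lambda>(s, p). lev_in s p) \<in> borel_measurable (lborel \<Otimes>\<^sub>M levels m)"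
proof (rule levels_pair_measurable')
  fix i
  have [measurable]: "(\<lambda>p. airy_chain i (fst p) (snd p)) \<in> borel_measurable (lborel \<Otimes>\<^sub>M borel)"
    using measurable_compose[OF _ airy_chain_measurable2, of "\<lambda>p. (fst p, snd p)" "lborel \<Otimes>\<^sub>M borel"] by simp
  show "(\<lambda>(s, x). lev_in s (i, x)) \<in> borel_measurable (lborel \<Otimes>\<^sub>M borel)"
    unfolding lev_in_def fst_conv snd_conv case_prod_beta' by measurable
qed

lemma lev_up_measurable: "(\<lambda>(p, q). lev_up p q) \<in> borel_measurable (levels m \<Otimes>\<^sub>M levels m)"
  by (rule levels_levels_measurable) (unfold lev_up_def fst_conv snd_conv, measurable)

lemma norm_lev_out: "p \<in> space (levels m) \<Longrightarrow> norm (lev_out p s) \<le> out_weight p * half_weight s"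
proof -
  assume "p \<in> space (levels m)"
  then obtain i x where p: "p = (i, x)" and i: "i \<in> {1..m}" by (auto simp: space_levels)
  have "exp (\<alpha> i * x) * norm (af (\<alpha> i) (x + s)) \<le> exp (\<alpha> i * x) * (af_const (\<alpha> i) rate * exp (- rate * (x + s)))"
    by (intro mult_left_mono norm_af_le rate_gt(1)[OF i]) simp
  also have "\<dots> = (af_const (\<alpha> i) rate * exp (- (rate - \<alpha> i) * x)) * exp (- rate * s)"
    by (simp add: algebra_simps flip: exp_add)
  finally show ?thesis by (simp add: p lev_out_def out_weight_def half_weight_def norm_mult indicator_def)
qed

lemma in_bound_nonneg: "0 \<le> in_bound"
  unfolding in_bound_def by (intro sum_nonneg mult_nonneg_nonneg af_const_nonneg) simp_all

lemma norm_lev_in: "p \<in> space (levels m) \<Longrightarrow> norm (lev_in s p) \<le> in_bound"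
proof -
  assume "p \<in> space (levels m)"
  then obtain i x where p: "p = (i, x)" and i: "i \<in> {1..m}" by (auto simp: space_levels)
  let ?K = "\<lambda>i. af_const (- \<alpha> 1) rate * exp ((\<alpha> i - \<alpha> 1) * rate\<^sup>2)"
  have Kle: "?K i * exp (- (\<alpha> i + rate) * \<beta> i) \<le> in_bound"
    unfolding in_bound_def by (rule member_le_sum[OF i]) (auto intro!: mult_nonneg_nonneg af_const_nonneg)
  show ?thesis
  proof (cases "\<beta> i < x \<and> 0 \<le> s")
    case True
    have "exp (- \<alpha> i * x) * norm (airy_chain i s x) \<le> exp (- \<alpha> i * x) * (af_const (- \<alpha> 1) rate * exp (- rate * s) * exp ((\<alpha> i - \<alpha> 1) * rate\<^sup>2) * exp (- rate * x))"
      by (intro mult_left_mono airy_chain_bound i) simp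
    also have "\<dots> = ?K i * exp (- (\<alpha> i + rate) * x - rate * s)"
      by (simp add: algebra_simps flip: exp_add)
    also have "\<dots> \<le> ?K i * exp (- (\<alpha> i + rate) * \<beta> i)"
    proof (intro mult_left_mono mult_nonneg_nonneg af_const_nonneg)
      have "(\<alpha> i + rate) * \<beta> i \<le> (\<alpha> i + rate) * x" "0 \<le> rate * s"
        using True rate_gt(2)[OF i] rate_gt(3) by (auto intro!: mult_left_mono)
      hence "- (\<alpha> i + rate) * x - rate * s \<le> - (\<alpha> i + rate) * \<beta> i" unfolding mult_minus_left by linarith
      then show "exp (- (\<alpha> i + rate) * x - rate * s) \<le> exp (- (\<alpha> i + rate) * \<beta> i)" by simp
    qed simp
    also note Kle
    finally show ?thesis using True by (simp add: p lev_in_def norm_mult)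
  next
    case False
    then show ?thesis using in_bound_nonneg by (auto simp: p lev_in_def)
  qed
qed

lemma out_weight_nonneg: "0 \<le> out_weight p"
  unfolding out_weight_def by (intro mult_nonneg_nonneg af_const_nonneg) simp_all

lemma out_weight_integrable: "integrable (levels m) out_weight"
proof (rule integrable_levels)
  show "out_weight \<in> borel_measurable (levels m)"
    by (rule levels_measurable) (unfold out_weight_def fst_conv snd_conv, measurable)
  fix i assume i: "i \<in> {1..m}"
  have "integrable lborel (\<lambda>x. af_const (\<alpha> i) rate * (indicator {\<beta> i<..} x * exp (- (rate - \<alpha> i) * x)))"
    using rate_gt(1)[OF i] by (intro integrable_mult_right integrable_exp_tail) simp
  then show "integrable lborel (\<lambda>x. out_weight (i, x))" by (simp add: out_weight_def mult_ac)
qed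

lemma half_weight_nonneg: "0 \<le> half_weight s" by (simp add: half_weight_def)

lemma half_weight_integrable: "integrable lborel half_weight"
  unfolding half_weight_def by (intro integrable_exp_tail rate_gt)

lemma dominated_lev_up: "dominated (levels m) up_weight lev_up"
  unfolding dominated_def
proof (intro conjI ballI)
  show "(\<lambda>(x, y). lev_up x y) \<in> borel_measurable (levels m \<Otimes>\<^sub>M levels m)" by (rule lev_up_measurable)
  show nn: "0 \<le> up_weight p" if "p \<in> space (levels m)" for p
  proof -
    have "0 \<le> \<alpha> j - \<alpha> (fst p)" if "j \<in> {fst p<..m}" for j
      using that \<open>p \<in> _\<close> increasing_step[OF \<alpha>, of "fst p" j] by (auto simp: space_levels)
    then show ?thesis unfolding up_weight_def by (intro mult_nonneg_nonneg sum_nonneg divide_nonneg_nonneg) auto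
  qed
  show "integrable (levels m) up_weight"
  proof (rule integrable_levels)
    show "up_weight \<in> borel_measurable (levels m)"
      by (rule levels_measurable) (unfold up_weight_def fst_conv snd_conv, measurable)
    fix i assume i: "i \<in> {1..m}"
    have "integrable lborel (\<lambda>x. \<Sum>j\<in>{i<..m}. (exp ((\<alpha> j - \<alpha> i) * (\<alpha> j)\<^sup>2) / sqrt (4 * pi * (\<alpha> j - \<alpha> i))) * (indicator {\<beta> i<..} x * exp (- (\<alpha> j - \<alpha> i) * x)))"
      by (rule Bochner_Integration.integrable_sum, rule integrable_mult_right, rule integrable_exp_tail)
        (rule increasing_step[OF \<alpha>], use i in auto)
    then show "integrable lborel (\<lambda>x. up_weight (i, x))"
      unfolding up_weight_def fst_conv snd_conv sum_distrib_left by (simp only: mult_ac)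
  qed
  show "norm (lev_up p q) \<le> up_weight p" if pq: "p \<in> space (levels m)" "q \<in> space (levels m)" for p q
  proof -
    obtain i x j y where p: "p = (i, x)" and q: "q = (j, y)" and i: "i \<in> {1..m}" and j: "j \<in> {1..m}"
      using pq by (auto simp: space_levels)
    show ?thesis
    proof (cases "i < j \<and> \<beta> i < x \<and> \<beta> j < y")
      case True
      define t where "t = \<alpha> j - \<alpha> i"
      have t: "t > 0" unfolding t_def using True i j by (intro increasing_step[OF \<alpha>]) auto
      \<comment> \<open>Writing \<alpha>_i x - \<alpha>_j y as - t x + \<alpha>_j (x - y) separates
        a decay in \<open>x\<close>, present because \<alpha>_j > \<alpha>_i, from a tilt of the
        heat kernel that \<open>heat_exp_le\<close> controls.\<close>
      have "exp (\<alpha> i * x - \<alpha> j * y) * heat t (x - y) = exp (- t * x) * (heat t (x - y) * exp (\<alpha> j * (x - y)))"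
        by (simp add: t_def algebra_simps flip: exp_add)
      also have "\<dots> \<le> exp (- t * x) * (exp (t * (\<alpha> j)\<^sup>2) / sqrt (4 * pi * t))"
        by (intro mult_left_mono heat_exp_le t) simp
      also have "\<dots> \<le> (\<Sum>j\<in>{i<..m}. exp (- (\<alpha> j - \<alpha> i) * x) * (exp ((\<alpha> j - \<alpha> i) * (\<alpha> j)\<^sup>2) / sqrt (4 * pi * (\<alpha> j - \<alpha> i))))"
        unfolding t_def
      proof (rule member_le_sum)
        fix l assume "l \<in> {i<..m} - {j}"
        then have "0 \<le> \<alpha> l - \<alpha> i" using increasing_step[OF \<alpha>, of i l] i by auto
        then show "0 \<le> exp (- (\<alpha> l - \<alpha> i) * x) * (exp ((\<alpha> l - \<alpha> i) * (\<alpha> l)\<^sup>2) / sqrt (4 * pi * (\<alpha> l - \<alpha> i)))" by simp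
      qed (use True j in auto)
      finally show ?thesis using True j by (simp add: p q lev_up_def up_weight_def norm_mult heat_nonneg t_def)
    next
      case False
      then have "lev_up p q = 0" by (auto simp: p q lev_up_def)
      then show ?thesis using nn[OF pq(1)] by simp
    qed
  qed
qed

text \<open>The contribution of level \<open>l\<close> to the integral is the tail cut off at
  \<open>l\<close> and carried by the heat flow to the level of \<open>q\<close>; the tilts at level
  \<open>l\<close> cancel. By \<open>af_chain\<close> these tails complete the chain to the uncut
  Airy function, so multiplication by I + N turns \<open>lev_in\<close> into the plain Airy
  factor.\<close>

lemma lev_in_step:
  assumes q: "q \<in> space (levels m)"
  shows "lev_in s q + (\<integral>z. lev_in s z * lev_up z q \<partial>levels m) =
    indicator {\<beta> (fst q)<..} (snd q) * indicator {0..} s * (of_real (exp (- \<alpha> (fst q) * snd q)) * af (- \<alpha> (fst q)) (snd q + s))"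
proof -
  obtain j y where q_eq: "q = (j, y)" and j: "j \<in> {1..m}" using q by (auto simp: space_levels)
  obtain n where n: "j = n + 1" using j by (cases j) auto
  define \<kappa> where "\<kappa> = indicator {\<beta> j<..} y * indicator {0..} s * complex_of_real (exp (- \<alpha> j * y))"
  have D: "norm (lev_up z q) \<le> up_weight z" if "z \<in> space (levels m)" for z
    using dominated_lev_up that q by (simp add: dominated_def)
  have I: "integrable (levels m) (\<lambda>z. lev_in s z * lev_up z q)"
  proof (rule Bochner_Integration.integrable_bound)
    show "integrable (levels m) (\<lambda>z. in_bound * up_weight z)"
      using dominated_lev_up by (simp add: dominated_def)
    show "(\<lambda>z. lev_in s z * lev_up z q) \<in> borel_measurable (levels m)"
      by (intro borel_measurable_times kernel_sections(1)[OF lev_in_measurable] kernel_sections(2)[OF lev_up_measurable q]) simp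
    have "norm (lev_in s z * lev_up z q) \<le> norm (in_bound * up_weight z)" if z: "z \<in> space (levels m)" for z
      unfolding norm_mult using in_bound_nonneg norm_lev_in[OF z] order_trans[OF D[OF z] abs_ge_self]
      by (intro mult_mono) auto
    then show "AE z in levels m. norm (lev_in s z * lev_up z q) \<le> norm (in_bound * up_weight z)"
      by (intro AE_I2)
  qed
  define g where "g l = tail (\<alpha> j - \<alpha> l) (\<beta> l) (airy_chain l s) y" for l
  have "(\<integral>x. lev_in s (l, x) * lev_up (l, x) q \<partial>lborel) = (if l < j then \<kappa> * g l else 0)" for l
  proof (cases "l < j")
    case True
    have "(\<lambda>x. lev_in s (l, x) * lev_up (l, x) q) = (\<lambda>x. \<kappa> * (indicator {\<beta> l<..} x * (airy_chain l s x * of_real (heat (\<alpha> j - \<alpha> l) (x - y)))))"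
    proof (rule ext)
      fix x
      have "exp (- \<alpha> l * x) * exp (\<alpha> l * x - \<alpha> j * y) = exp (- \<alpha> j * y)" by (simp flip: exp_add)
      hence e: "complex_of_real (exp (- \<alpha> l * x)) * of_real (exp (\<alpha> l * x - \<alpha> j * y)) = of_real (exp (- \<alpha> j * y))"
        by (simp only: of_real_mult[symmetric])
      have "lev_in s (l, x) * lev_up (l, x) q = indicator {\<beta> j<..} y * indicator {0..} s *
          (complex_of_real (exp (- \<alpha> l * x)) * of_real (exp (\<alpha> l * x - \<alpha> j * y))) *
          (indicator {\<beta> l<..} x * (airy_chain l s x * of_real (heat (\<alpha> j - \<alpha> l) (x - y))))"
        using True j by (simp add: lev_in_def lev_up_def q_eq indicator_def)
      then show "lev_in s (l, x) * lev_up (l, x) q = \<kappa> * (indicator {\<beta> l<..} x * (airy_chain l s x * of_real (heat (\<alpha> j - \<alpha> l) (x - y))))"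
        unfolding e \<kappa>_def .
    qed
    then show ?thesis using True by (simp only: integral_mult_right_zero g_def tail_def if_True)
  next
    case False
    then show ?thesis by (simp add: lev_up_def q_eq)
  qed
  hence "(\<integral>z. lev_in s z * lev_up z q \<partial>levels m) = (\<Sum>l=1..m. if l < j then \<kappa> * g l else 0)"
    unfolding integral_levels(1)[OF I] by simp
  also have "\<dots> = (\<Sum>l\<in>{1..<j}. \<kappa> * g l)"
    using j by (intro sum.mono_neutral_cong_right) auto
  also have "\<dots> = (\<Sum>l<n. \<kappa> * g (l + 1))"
    by (rule sum.reindex_bij_witness[where i = "\<lambda>l. l + 1" and j = "\<lambda>l. l - 1"]) (auto simp: n)
  also have "\<dots> = \<kappa> * (\<Sum>l<n. g (l + 1))" by (simp only: sum_distrib_left)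
  finally have 1: "(\<integral>z. lev_in s z * lev_up z q \<partial>levels m) = \<kappa> * (\<Sum>l<n. g (l + 1))" .
  have "n < m" using j n by simp
  from af_chain[OF \<alpha> this, of y s \<beta>]
  have 2: "af (- \<alpha> j) (y + s) = airy_chain j s y + (\<Sum>l<n. g (l + 1))"
    by (simp add: g_def airy_chain_def n)
  have 3: "lev_in s q = \<kappa> * airy_chain j s y" by (simp add: lev_in_def q_eq \<kappa>_def)
  show ?thesis unfolding 1 3 distrib_left[symmetric] 2[symmetric] by (simp add: \<kappa>_def q_eq)
qed

definition lev_kernel :: "nat \<times> real \<Rightarrow> nat \<times> real \<Rightarrow> complex" where
  "lev_kernel p q = (\<integral>s. lev_out p s * lev_in s q \<partial>lborel)"

text \<open>The kernel at which the Airy side and the contour side meet. It is the product of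
  \<open>lev_in\<close> and \<open>lev_out\<close> in reversed order, with a minus sign; the
  exponential tilts of the two factors have cancelled.\<close>

definition half_line_kernel :: "real \<Rightarrow> real \<Rightarrow> complex" where
  "half_line_kernel s s' = - (indicator {0..} s * indicator {0..} s' *
     (\<Sum>i=1..m. \<integral>x. indicator {\<beta> i<..} x * (airy_chain i s x * af (\<alpha> i) (x + s')) \<partial>lborel))"

lemmas lev_facts = lev_out_measurable lev_in_measurable norm_lev_out norm_lev_in

lemma dominated_lev_kernel: "dominated (levels m) (\<lambda>x. out_weight x * (in_bound * integral\<^sup>L lborel (half_weight))) lev_kernel"
  unfolding lev_kernel_def
  by (rule dominated_factor[OF sf_lborel lev_facts out_weight_integrable out_weight_nonneg half_weight_integrable half_weight_nonneg in_bound_nonneg])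

lemma integral_lev_kernel_up:
  assumes p: "p \<in> space (levels m)" and q: "q \<in> space (levels m)"
  shows "(\<integral>s. lev_out p s * (\<integral>z. lev_in s z * lev_up z q \<partial>levels m) \<partial>lborel) = kmult (levels m) lev_kernel lev_up p q"
    and "integrable lborel (\<lambda>s. lev_out p s * (\<integral>z. lev_in s z * lev_up z q \<partial>levels m))"
proof -
  define f where "f z s = lev_out p s * lev_in s z * lev_up z q" for z s
  note N = dominated_lev_up
  have m: "(\<lambda>(z, s). f z s) \<in> borel_measurable (levels m \<Otimes>\<^sub>M lborel)"
  proof -
    have 1: "(\<lambda>v. lev_out p (snd v)) \<in> borel_measurable (levels m \<Otimes>\<^sub>M lborel)"
      by (rule measurable_compose[OF measurable_snd kernel_sections(1)[OF lev_facts(1) p]])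
    have 2: "(\<lambda>v. lev_up (fst v) q) \<in> borel_measurable (levels m \<Otimes>\<^sub>M lborel)"
      by (rule measurable_compose[OF measurable_fst kernel_sections(2)[OF lev_up_measurable q]])
    have 3: "(\<lambda>v. lev_in (snd v) (fst v)) \<in> borel_measurable (levels m \<Otimes>\<^sub>M lborel)"
      using measurable_compose[OF measurable_pair_swap' lev_facts(2)] by (simp add: case_prod_beta')
    show ?thesis unfolding f_def case_prod_beta' by (intro borel_measurable_times 1 2 3)
  qed
  have g: "has_bochner_integral lborel (\<lambda>s. (out_weight p * in_bound * up_weight z) * half_weight s)
      ((out_weight p * in_bound * up_weight z) * integral\<^sup>L lborel (half_weight))" for z
    by (intro has_bochner_integral_mult_right has_bochner_integral_integrable half_weight_integrable)
  have b: "norm (f z s) \<le> (out_weight p * in_bound * up_weight z) * half_weight s" if z: "z \<in> space (levels m)" for z s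
  proof -
    have "norm (f z s) \<le> (out_weight p * half_weight s) * in_bound * up_weight z"
      unfolding f_def norm_mult
      using N z q by (intro mult_mono lev_facts(3,4) p mult_nonneg_nonneg out_weight_nonneg half_weight_nonneg in_bound_nonneg)
        (auto simp: dominated_def)
    then show ?thesis by (simp only: mult_ac)
  qed
  have G: "integrable (levels m) (\<lambda>z. (out_weight p * in_bound * up_weight z) * integral\<^sup>L lborel (half_weight))"
    using N by (simp add: dominated_def)
  note F = fubini_dominated[OF sigma_finite_levels sf_lborel m g b G]
  have 1: "(\<integral>z. f z s \<partial>levels m) = lev_out p s * (\<integral>z. lev_in s z * lev_up z q \<partial>levels m)" for s
    unfolding f_def by (simp only: mult.assoc integral_mult_right_zero)
  have 2: "(\<integral>s. f z s \<partial>lborel) = lev_kernel p z * lev_up z q" for z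
    unfolding f_def lev_kernel_def by (simp only: integral_mult_left_zero)
  show "(\<integral>s. lev_out p s * (\<integral>z. lev_in s z * lev_up z q \<partial>levels m) \<partial>lborel) = kmult (levels m) lev_kernel lev_up p q"
    using F(2) unfolding 1 2 kmult_def by simp
  show "integrable lborel (\<lambda>s. lev_out p s * (\<integral>z. lev_in s z * lev_up z q \<partial>levels m))"
    using F(4) unfolding 1 .
qed

text \<open>By associativity C + C N is \<open>lev_out\<close> composed with the factor that
  \<open>lev_in_step\<close> has computed. This is the part of the extended kernel without heat
  kernels.\<close>

lemma lev_kernel_up:
  assumes p: "p \<in> space (levels m)" and q: "q \<in> space (levels m)"
  shows "lev_kernel p q + kmult (levels m) lev_kernel lev_up p q =
    indicator {\<beta> (fst p)<..} (snd p) * indicator {\<beta> (fst q)<..} (snd q) * of_real (exp (\<alpha> (fst p) * snd p) * exp (- \<alpha> (fst q) * snd q)) *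
    (\<integral>s. indicator {0..} s * (af (\<alpha> (fst p)) (snd p + s) * af (- \<alpha> (fst q)) (snd q + s)) \<partial>lborel)"
proof -
  have I: "integrable lborel (\<lambda>s. lev_out p s * lev_in s q)"
    by (rule factor_integrable(1)[OF lev_facts half_weight_integrable p q])
  have "lev_kernel p q + kmult (levels m) lev_kernel lev_up p q = (\<integral>s. lev_out p s * lev_in s q + lev_out p s * (\<integral>z. lev_in s z * lev_up z q \<partial>levels m) \<partial>lborel)"
    unfolding integral_lev_kernel_up(1)[OF p q, symmetric] lev_kernel_def
    by (rule Bochner_Integration.integral_add[OF I integral_lev_kernel_up(2)[OF p q], symmetric])
  also have "(\<lambda>s. lev_out p s * lev_in s q + lev_out p s * (\<integral>z. lev_in s z * lev_up z q \<partial>levels m)) =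
      (\<lambda>s. (indicator {\<beta> (fst p)<..} (snd p) * indicator {\<beta> (fst q)<..} (snd q) * of_real (exp (\<alpha> (fst p) * snd p) * exp (- \<alpha> (fst q) * snd q))) *
        (indicator {0..} s * (af (\<alpha> (fst p)) (snd p + s) * af (- \<alpha> (fst q)) (snd q + s))))"
    unfolding distrib_left[symmetric] lev_in_step[OF q] lev_out_def by (auto simp: indicator_def)
  finally show ?thesis by (simp only: integral_mult_right_zero)
qed

text \<open>The kernel of (I - C)(I + N) - I, in the shape to which
  \<open>fredholm_strictly_triangular\<close> applies.\<close>

definition conj_kernel :: "nat \<times> real \<Rightarrow> nat \<times> real \<Rightarrow> complex" where
  "conj_kernel p q = - lev_kernel p q + (lev_up p q + kmult (levels m) (\<lambda>x y. - lev_kernel x y) lev_up p q)"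

text \<open>The constant part of the inverse prefactor of \<open>af\<close>. The part that depends
  on the position stays inside the kernel as a tilt, for integrability.\<close>

definition conj_factor :: "nat \<times> real \<Rightarrow> real" where "conj_factor p = exp (2 * \<alpha> (fst p) ^ 3 / 3)"

text \<open>Shifting level \<open>i\<close> by the square of \<open>\<alpha> i\<close> turns the
  threshold in \<open>chi\<close> into \<open>\<beta> i\<close> and centres the Airy functions as in
  \<open>af\<close>. The shift preserves \<open>levels m\<close>, and the quotient of constants is a
  conjugation, so neither affects the Fredholm terms.\<close>

lemma airy_kernel_conj:
  assumes p: "p \<in> space (levels m)" and q: "q \<in> space (levels m)"
  defines "S \<equiv> \<lambda>p. (fst p, snd p + - (\<alpha> (fst p))\<^sup>2)"
  shows "level_kernel (\<lambda>_. 1) (\<lambda>i x j y. - (sqrt (chi \<alpha> \<beta> i x) * K_Ai_ext (\<alpha> i) x (\<alpha> j) y * sqrt (chi \<alpha> \<beta> j y))) p q =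
    of_real (conj_factor (S p)) * conj_kernel (S p) (S q) / of_real (conj_factor (S q))"
proof -
  obtain i x j y where pq: "p = (i, x)" "q = (j, y)" and i: "i \<in> {1..m}" and j: "j \<in> {1..m}"
    using p q by (auto simp: space_levels)
  define x' y' where "x' = x - (\<alpha> i)\<^sup>2" and "y' = y - (\<alpha> j)\<^sup>2"
  have S: "S p = (i, x')" "S q = (j, y')" by (simp_all add: S_def pq x'_def y'_def)
  have sp: "(i, x') \<in> space (levels m)" "(j, y') \<in> space (levels m)" using i j by (simp_all add: space_levels)
  define J where "J = (\<integral>s. indicator {0..} s * (af (\<alpha> i) (x' + s) * af (- \<alpha> j) (y' + s)) \<partial>lborel)"
  define H where "H = (if i < j then complex_of_real (heat (\<alpha> j - \<alpha> i) (x' - y')) else 0)"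
  define ij where "ij = indicator {\<beta> i<..} x' * (indicator {\<beta> j<..} y' :: complex)"
  have lt: "\<alpha> i < \<alpha> j \<longleftrightarrow> i < j" using strict_mono_on_less[OF \<alpha> i j] .
  have ch: "complex_of_real (sqrt (chi \<alpha> \<beta> i x)) = indicator {\<beta> i<..} x'" "complex_of_real (sqrt (chi \<alpha> \<beta> j y)) = indicator {\<beta> j<..} y'"
    by (auto simp: chi_def x'_def y'_def)
  let ?g = "\<lambda>i x'. exp (\<alpha> i * x' + 2 * \<alpha> i ^ 3 / 3)"
  have L: "level_kernel (\<lambda>_. 1) (\<lambda>i x j y. - (sqrt (chi \<alpha> \<beta> i x) * K_Ai_ext (\<alpha> i) x (\<alpha> j) y * sqrt (chi \<alpha> \<beta> j y))) p q =
      - (ij * of_real (?g i x' / ?g j y') * (J - H))"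
    unfolding level_kernel_def pq fst_conv snd_conv ch K_Ai_ext_af lt J_def H_def x'_def[symmetric] y'_def[symmetric] ij_def by simp
  have nk: "kmult (levels m) (\<lambda>x y. - lev_kernel x y) lev_up p q = - kmult (levels m) lev_kernel lev_up p q" for p q
    unfolding kmult_def by simp
  have up: "lev_up (i, x') (j, y') = ij * of_real (exp (\<alpha> i * x') * exp (- \<alpha> j * y')) * H"
    using j by (simp add: lev_up_def H_def ij_def exp_diff exp_minus divide_inverse)
  have "conj_kernel (i, x') (j, y') = lev_up (i, x') (j, y') - (lev_kernel (i, x') (j, y') + kmult (levels m) lev_kernel lev_up (i, x') (j, y'))"
    unfolding conj_kernel_def nk by simp
  also have "\<dots> = - (ij * of_real (exp (\<alpha> i * x') * exp (- \<alpha> j * y')) * (J - H))"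
    unfolding lev_kernel_up[OF sp] up fst_conv snd_conv ij_def J_def by (simp add: algebra_simps)
  finally have R: "conj_kernel (S p) (S q) = - (ij * of_real (exp (\<alpha> i * x') * exp (- \<alpha> j * y')) * (J - H))" unfolding S .
  have "?g i x' / ?g j y' = conj_factor (S p) * (exp (\<alpha> i * x') * exp (- \<alpha> j * y')) / conj_factor (S q)"
    unfolding S conj_factor_def fst_conv exp_add by (simp add: exp_minus field_simps)
  hence "complex_of_real (?g i x' / ?g j y') = of_real (conj_factor (S p)) * of_real (exp (\<alpha> i * x') * exp (- \<alpha> j * y')) / of_real (conj_factor (S q))"
    by (simp only: of_real_mult of_real_divide)
  then show ?thesis unfolding L R by simp
qed

lemma dominated_conj_kernel: "\<exists>w. dominated (levels m) w (\<lambda>p q. of_real (conj_factor p) * conj_kernel p q / of_real (conj_factor q))"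
proof -
  have C: "dominated (levels m) (\<lambda>x. out_weight x * (in_bound * integral\<^sup>L lborel (half_weight))) (\<lambda>x y. - lev_kernel x y)"
    using dominated_lev_kernel unfolding dominated_def case_prod_beta' by (simp del: borel_measurable_uminus_eq add: borel_measurable_uminus)
  note N = dominated_lev_up
  from dominated_add[OF C dominated_add[OF N dominated_kmult[OF sigma_finite_levels C N]]]
  obtain w where w: "dominated (levels m) w conj_kernel" unfolding conj_kernel_def[abs_def] by blast
  define B where "B = (\<Sum>i=1..m. 1 / exp (2 * \<alpha> i ^ 3 / 3))"
  have [measurable]: "conj_factor \<in> borel_measurable (levels m)"
    by (rule levels_measurable) (simp add: conj_factor_def)
  have B: "1 / conj_factor q \<le> B" if "q \<in> space (levels m)" for q
    using that unfolding B_def conj_factor_def by (intro member_le_sum) (auto simp: space_levels)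
  have "dominated (levels m) (\<lambda>p. conj_factor p * w p * B) (\<lambda>p q. of_real (conj_factor p) * conj_kernel p q / of_real (conj_factor q))"
    unfolding dominated_def
  proof (intro conjI ballI)
    have wi: "integrable (levels m) w" using w by (simp add: dominated_def)
    define B' where "B' = (\<Sum>i=1..m. exp (2 * \<alpha> i ^ 3 / 3))"
    have B': "conj_factor q \<le> B'" if "q \<in> space (levels m)" for q
      using that unfolding B'_def conj_factor_def by (intro member_le_sum) (auto simp: space_levels)
    have le: "norm (conj_factor q * w q) \<le> norm (B' * w q)" if "q \<in> space (levels m)" for q
    proof -
      have "0 \<le> conj_factor q" by (simp add: conj_factor_def)
      then show ?thesis unfolding norm_mult using B'[OF that] by (intro mult_right_mono) simp_all
    qed
    have "integrable (levels m) (\<lambda>p. conj_factor p * w p)"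
    proof (rule Bochner_Integration.integrable_bound)
      show "integrable (levels m) (\<lambda>p. B' * w p)" using wi by simp
      show "(\<lambda>p. conj_factor p * w p) \<in> borel_measurable (levels m)"
        by (rule borel_measurable_times[OF _ borel_measurable_integrable[OF wi]]) measurable
      show "AE q in levels m. norm (conj_factor q * w q) \<le> norm (B' * w q)" by (rule AE_I2) (rule le)
    qed
    then show "integrable (levels m) (\<lambda>p. conj_factor p * w p * B)" by simp
    have [measurable]: "(\<lambda>p. conj_kernel (fst p) (snd p)) \<in> borel_measurable (levels m \<Otimes>\<^sub>M levels m)"
      using w by (simp add: dominated_def case_prod_beta')
    show "(\<lambda>(p, q). complex_of_real (conj_factor p) * conj_kernel p q / complex_of_real (conj_factor q)) \<in> borel_measurable (levels m \<Otimes>\<^sub>M levels m)"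
      unfolding case_prod_beta' by measurable
    fix p assume p: "p \<in> space (levels m)"
    have wp: "0 \<le> w p" using w p by (simp add: dominated_def)
    have cp: "0 < conj_factor p" for p by (simp add: conj_factor_def)
    have B0: "0 \<le> B" unfolding B_def by (intro sum_nonneg) simp
    show "0 \<le> conj_factor p * w p * B" using wp cp[of p] B0 by simp
    fix q assume q: "q \<in> space (levels m)"
    have "norm (complex_of_real (conj_factor p) * conj_kernel p q / complex_of_real (conj_factor q)) =
        conj_factor p * norm (conj_kernel p q) * (1 / conj_factor q)"
      using cp[of p] cp[of q] by (simp add: norm_mult norm_divide)
    also have "\<dots> \<le> conj_factor p * w p * B"
      using w p q cp[of p] cp[of q] wp B[OF q] by (intro mult_mono mult_left_mono) (auto simp: dominated_def)
    finally show "norm (complex_of_real (conj_factor p) * conj_kernel p q / complex_of_real (conj_factor q)) \<le> conj_factor p * w p * B" .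
  qed
  then show ?thesis by blast
qed

lemma suminf_conj_kernel: "(\<Sum>k. fterm (levels m) conj_kernel k) = (\<Sum>k. fterm lborel half_line_kernel k)"
proof -
  let ?w = "\<lambda>x. out_weight x * (in_bound * integral\<^sup>L lborel (half_weight))"
  have C: "dominated (levels m) ?w (\<lambda>x y. - lev_kernel x y)"
    using dominated_lev_kernel unfolding dominated_def case_prod_beta' by (simp del: borel_measurable_uminus_eq add: borel_measurable_uminus)
  note N = dominated_lev_up
  have nn: "0 \<le> ?w x" "0 \<le> up_weight x" if "x \<in> space (levels m)" for x
    using C N that unfolding dominated_def by blast+
  have int: "integrable (levels m) (\<lambda>x. ?w x + up_weight x)"
    using C N unfolding dominated_def by (intro Bochner_Integration.integrable_add) blast+
  have C': "dominated (levels m) (\<lambda>x. ?w x + up_weight x) (\<lambda>x y. - lev_kernel x y)"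
    using nn(2) by (intro dominated_mono[OF C int]) simp
  have N': "dominated (levels m) (\<lambda>x. ?w x + up_weight x) lev_up"
    using nn(1) by (intro dominated_mono[OF N int]) simp
  \<comment> \<open>The level map has to be bounded by \<open>m\<close> at all pairs, also outside
    the space. On the support of \<open>lev_up\<close> both levels are at most \<open>m\<close>, and
    the minimum preserves their strict order.\<close>
  have ty: "(\<lambda>p. min m (fst p)) \<in> measurable (levels m) (count_space UNIV)"
    by (rule measurable_compose[OF fst_levels_measurable]) simp
  have "(\<Sum>k. fterm (levels m) conj_kernel k) = (\<Sum>k. fterm (levels m) (\<lambda>x y. - lev_kernel x y) k)"
    unfolding conj_kernel_def[abs_def]
  proof (rule fredholm_strictly_triangular[OF sigma_finite_levels C' N' ty, of m])
    show "min m (fst x) < min m (fst y)" if "lev_up x y \<noteq> 0" for x y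
    proof -
      have "fst x < fst y \<and> fst y \<le> m" using that unfolding lev_up_def by meson
      then show ?thesis by simp
    qed
  qed simp
  also have "(\<lambda>k. fterm (levels m) (\<lambda>x y. - lev_kernel x y) k) = fterm lborel half_line_kernel"
  proof (rule ext)
    fix k
    have 1: "(\<lambda>x y. - lev_kernel x y) = (\<lambda>x y. \<integral>s. lev_out x s * (- lev_in s y) \<partial>lborel)"
      unfolding lev_kernel_def by simp
    have Em: "(\<lambda>(s, x). - lev_in s x) \<in> borel_measurable (lborel \<Otimes>\<^sub>M levels m)"
      using borel_measurable_uminus[OF lev_facts(2)] by (simp add: case_prod_beta')
    have Eb: "norm (- lev_in s x) \<le> in_bound" if "x \<in> space (levels m)" for s x using lev_facts(4)[OF that] by simp
    have "fterm (levels m) (\<lambda>x y. - lev_kernel x y) k = fterm lborel (\<lambda>s s'. \<integral>x. - lev_in s x * lev_out x s' \<partial>levels m) k"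
      unfolding 1
      by (rule fterm_commute[where R = lev_out and E = "\<lambda>s x. - lev_in s x", OF sigma_finite_levels sf_lborel lev_facts(1) Em lev_facts(3) Eb out_weight_integrable out_weight_nonneg half_weight_integrable half_weight_nonneg])
    also have "(\<lambda>s s'. \<integral>x. - lev_in s x * lev_out x s' \<partial>levels m) = half_line_kernel"
    proof (intro ext)
      fix s s'
      have I: "integrable (levels m) (\<lambda>x. - lev_in s x * lev_out x s')"
      proof (rule Bochner_Integration.integrable_bound)
        show "integrable (levels m) (\<lambda>x. in_bound * half_weight s' * out_weight x)" using out_weight_integrable by simp
        show "(\<lambda>x. - lev_in s x * lev_out x s') \<in> borel_measurable (levels m)"
          using kernel_sections(1)[OF Em, of s] kernel_sections(2)[OF lev_facts(1), of s'] by (intro borel_measurable_times) auto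
        have "norm (- lev_in s x * lev_out x s') \<le> norm (in_bound * half_weight s' * out_weight x)" if x: "x \<in> space (levels m)" for x
        proof -
          have "norm (- lev_in s x * lev_out x s') \<le> in_bound * (out_weight x * half_weight s')"
            unfolding norm_mult by (intro mult_mono Eb lev_facts(3) x in_bound_nonneg) simp
          also have "\<dots> = in_bound * half_weight s' * out_weight x" by (simp only: mult_ac)
          also have "\<dots> \<le> norm (in_bound * half_weight s' * out_weight x)" by simp
          finally show ?thesis .
        qed
        then show "AE x in levels m. norm (- lev_in s x * lev_out x s') \<le> norm (in_bound * half_weight s' * out_weight x)"
          by (intro AE_I2)
      qed
      have eq: "(\<lambda>x. - lev_in s (i, x) * lev_out (i, x) s') = (\<lambda>x. - (indicator {0..} s * indicator {0..} s') *
          (indicator {\<beta> i<..} x * (airy_chain i s x * af (\<alpha> i) (x + s'))))" for i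
      proof (rule ext)
        fix x
        have "exp (- \<alpha> i * x) * exp (\<alpha> i * x) = 1" by (simp flip: exp_add)
        hence e: "complex_of_real (exp (- \<alpha> i * x)) * of_real (exp (\<alpha> i * x)) = 1" by (simp only: of_real_mult[symmetric] of_real_1)
        have "- lev_in s (i, x) * lev_out (i, x) s' = - (indicator {0..} s * indicator {0..} s') * (complex_of_real (exp (- \<alpha> i * x)) * of_real (exp (\<alpha> i * x))) *
          (indicator {\<beta> i<..} x * (airy_chain i s x * af (\<alpha> i) (x + s')))"
          by (simp add: lev_in_def lev_out_def indicator_def)
        then show "- lev_in s (i, x) * lev_out (i, x) s' = - (indicator {0..} s * indicator {0..} s') *
          (indicator {\<beta> i<..} x * (airy_chain i s x * af (\<alpha> i) (x + s')))" unfolding e by simp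
      qed
      show "(\<integral>x. - lev_in s x * lev_out x s' \<partial>levels m) = half_line_kernel s s'"
        unfolding integral_levels(1)[OF I] half_line_kernel_def eq integral_mult_right_zero sum_distrib_left[symmetric] by (rule mult_minus_left)
    qed
    finally show "fterm (levels m) (\<lambda>x y. - lev_kernel x y) k = fterm lborel half_line_kernel k" .
  qed
  finally show ?thesis .
qed

lemma airy_fredholm_det:
  "fredholm_det m (\<lambda>_. 1) (\<lambda>i x j y. - (sqrt (chi \<alpha> \<beta> i x) * K_Ai_ext (\<alpha> i) x (\<alpha> j) y * sqrt (chi \<alpha> \<beta> j y))) =
    (\<Sum>k. fterm lborel half_line_kernel k)"
proof -
  define S where "S p = (fst p, snd p + - (\<alpha> (fst p))\<^sup>2)" for p :: "nat \<times> real"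
  define F where "F = level_kernel (\<lambda>_. 1) (\<lambda>i x j y. - (sqrt (chi \<alpha> \<beta> i x) * K_Ai_ext (\<alpha> i) x (\<alpha> j) y * sqrt (chi \<alpha> \<beta> j y)))"
  define G where "G p q = of_real (conj_factor p) * conj_kernel p q / of_real (conj_factor q)" for p q
  have S: "S \<in> measurable (levels m) (levels m)" "distr (levels m) (levels m) S = levels m"
    using levels_shift[where m = m and a = "\<lambda>i. - (\<alpha> i)\<^sup>2"] unfolding S_def[abs_def] case_prod_beta' by auto
  have FG: "F p q = G (S p) (S q)" if "p \<in> space (levels m)" "q \<in> space (levels m)" for p q
    using airy_kernel_conj[OF that] unfolding F_def G_def S_def .
  obtain w where w: "dominated (levels m) w G" using dominated_conj_kernel unfolding G_def[abs_def] by blast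
  have D: "dominated (levels m) (\<lambda>p. w (S p)) F"
    unfolding dominated_def
  proof (intro conjI ballI)
    have "integrable (distr (levels m) (levels m) S) w" unfolding S(2) using w by (simp add: dominated_def)
    then show "integrable (levels m) (\<lambda>p. w (S p))" by (rule integrable_distr[OF S(1)])
    have "(\<lambda>v. G (S (fst v)) (S (snd v))) \<in> borel_measurable (levels m \<Otimes>\<^sub>M levels m)"
    proof -
      have "(\<lambda>v. (S (fst v), S (snd v))) \<in> measurable (levels m \<Otimes>\<^sub>M levels m) (levels m \<Otimes>\<^sub>M levels m)"
        by (intro measurable_Pair measurable_compose[OF measurable_fst S(1)] measurable_compose[OF measurable_snd S(1)])
      from measurable_compose[OF this, of "\<lambda>(p, q). G p q"] w show ?thesis by (simp add: dominated_def)
    qed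
    then show "(\<lambda>(x, y). F x y) \<in> borel_measurable (levels m \<Otimes>\<^sub>M levels m)"
      by (rule measurable_cong[THEN iffD1, rotated]) (auto simp: FG space_pair_measure)
    have Ss: "S p \<in> space (levels m)" if "p \<in> space (levels m)" for p using measurable_space[OF S(1) that] .
    show "0 \<le> w (S x)" if "x \<in> space (levels m)" for x using w Ss[OF that] by (simp add: dominated_def)
    show "norm (F x y) \<le> w (S x)" if "x \<in> space (levels m)" "y \<in> space (levels m)" for x y
      using w Ss[OF that(1)] Ss[OF that(2)] by (simp add: FG[OF that] dominated_def)
  qed
  have "fredholm_term m (\<lambda>_. 1) (\<lambda>i x j y. - (sqrt (chi \<alpha> \<beta> i x) * K_Ai_ext (\<alpha> i) x (\<alpha> j) y * sqrt (chi \<alpha> \<beta> j y))) k = fterm (levels m) conj_kernel k" for k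
  proof -
    have "fredholm_term m (\<lambda>_. 1) (\<lambda>i x j y. - (sqrt (chi \<alpha> \<beta> i x) * K_Ai_ext (\<alpha> i) x (\<alpha> j) y * sqrt (chi \<alpha> \<beta> j y))) k = fterm (levels m) F k"
      unfolding F_def by (rule fredholm_term_levels(1)[OF D[unfolded F_def]])
    also have "\<dots> = fterm (levels m) (\<lambda>p q. G (S p) (S q)) k" by (rule fterm_cong) (rule FG)
    also have "\<dots> = fterm (levels m) G k"
      using w by (intro fterm_distr[OF sigma_finite_levels S]) (simp add: dominated_def)
    also have "\<dots> = fterm (levels m) conj_kernel k"
      unfolding G_def by (rule fterm_conjugate) (simp add: conj_factor_def)
    finally show ?thesis .
  qed
  note eq = this
  show ?thesis unfolding fredholm_det_def eq by (rule suminf_conj_kernel)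
qed

end

section \<open>Laplace transforms and the contour kernel\<close>

lemma exp_half_line_right:
  fixes a :: complex
  assumes a: "Re a < 0"
  shows "has_bochner_integral lborel (\<lambda>x. indicator {b<..} x * exp (a * of_real x)) (- exp (a * of_real b) / a)"
proof -
  define d where "d = - Re a"
  have d: "d > 0" using a by (simp add: d_def)
  have a0: "a \<noteq> 0" using a by auto
  have I: "integrable lborel (\<lambda>x. indicator {b<..} x * exp (a * of_real x))"
  proof (rule Bochner_Integration.integrable_bound)
    show "integrable lborel (\<lambda>x. indicator {b<..} x * exp (- d * x))" by (rule integrable_exp_tail(2)[OF d])
    show "AE x in lborel. norm (indicator {b<..} x * exp (a * complex_of_real x)) \<le> norm (indicator {b<..} x * exp (- d * x))"
      by (rule AE_I2) (simp add: norm_mult indicator_def d_def)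
  qed measurable
  have S: "set_integrable lborel (einterval (ereal b) \<infinity>) (\<lambda>x. exp (a * of_real x))"
    unfolding set_integrable_def einterval_eq
    by (rule Bochner_Integration.integrable_cong[OF refl, THEN iffD1, OF _ I]) (simp add: indicator_def)
  define F where "F x = exp (a * of_real x) / a" for x :: real
  have "((\<lambda>x. norm (F x)) \<longlongrightarrow> 0) at_top"
  proof -
    have "((\<lambda>x. exp (- d * x) / norm a) \<longlongrightarrow> 0) at_top" using d a0 by real_asymp
    then show ?thesis by (simp add: F_def norm_divide d_def)
  qed
  hence F0: "(F \<longlongrightarrow> 0) at_top" by (rule tendsto_norm_zero_cancel)
  have Fb: "(F \<longlongrightarrow> F b) (at_right b)"
    unfolding F_def using a0 by (intro tendsto_intros) auto
  have "(LBINT x=ereal b..\<infinity>. exp (a * of_real x)) = 0 - F b"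
  proof (rule interval_integral_FTC_integrable[OF _ _ _ S, where F = F])
    show "(F has_vector_derivative exp (a * complex_of_real x)) (at x)" for x
    proof -
      have "((\<lambda>w. exp (a * w) / a) has_field_derivative exp (a * of_real x)) (at (of_real x))"
        using a0 by (auto intro!: derivative_eq_intros)
      from has_vector_derivative_real_field[OF this] show ?thesis unfolding F_def[abs_def] .
    qed
    show "((F \<circ> real_of_ereal) \<longlongrightarrow> F b) (at_right (ereal b))" using Fb by (simp add: ereal_tendsto_simps1)
    show "((F \<circ> real_of_ereal) \<longlongrightarrow> 0) (at_left \<infinity>)" using F0 by (simp add: ereal_tendsto_simps1)
  qed (auto intro!: continuous_intros)
  also have "(LBINT x=ereal b..\<infinity>. exp (a * of_real x)) = (\<integral>x. indicator {b<..} x * exp (a * of_real x) \<partial>lborel)"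
    unfolding interval_lebesgue_integral_def set_lebesgue_integral_def einterval_eq
    by (auto intro!: Bochner_Integration.integral_cong simp: indicator_def)
  finally show ?thesis using I by (simp add: has_bochner_integral_iff F_def)
qed

lemma exp_half_line_left:
  fixes a :: complex
  assumes a: "0 < Re a"
  shows "has_bochner_integral lborel (\<lambda>x. indicator {..b} x * exp (a * of_real x)) (exp (a * of_real b) / a)"
proof -
  have "has_bochner_integral lborel (\<lambda>x. indicator {-b<..} (0 + (- 1) * x) * exp (- a * of_real (0 + (- 1) * x))) (exp (a * of_real b) / a)"
    using lborel_has_bochner_integral_real_affine_iff[of "- 1" "\<lambda>x. indicator {-b<..} x * exp (- a * of_real x)" _ 0]
      exp_half_line_right[of "- a" "- b"] a by simp
  then show ?thesis
  proof (rule has_bochner_integralI_AE)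
    show "AE x in lborel. indicator {- b<..} (0 + - 1 * x) * exp (- a * complex_of_real (0 + - 1 * x)) = indicator {..b} x * exp (a * complex_of_real x)"
      using AE_lborel_singleton[of b] by eventually_elim (auto simp: indicator_def)
  qed measurable
qed

lemma norm_exp_minus_one_le:
  fixes w :: complex
  shows "norm (exp w - 1) \<le> exp (norm w) * norm w"
proof -
  have "norm (exp w - exp 0) \<le> exp (norm w) * norm (w - 0)"
  proof (rule field_differentiable_bound[where S = "cball 0 (norm w)" and f' = exp])
    fix z :: complex assume "z \<in> cball 0 (norm w)"
    then show "norm (exp z) \<le> exp (norm w)" using complex_Re_le_cmod[of z] by (simp add: norm_exp_eq_Re)
  qed (auto intro: DERIV_exp has_field_derivative_at_within)
  then show ?thesis by simp
qed

section \<open>Laplace transforms on the left half plane\<close>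

definition laplace :: "(real \<Rightarrow> complex) \<Rightarrow> complex \<Rightarrow> complex" where
  "laplace \<phi> x = (\<integral>r. exp (x * of_real r) * \<phi> r \<partial>lborel)"

definition decays :: "(real \<Rightarrow> complex) \<Rightarrow> bool" where
  "decays \<phi> \<longleftrightarrow> \<phi> \<in> borel_measurable borel \<and> (\<forall>c<0. integrable lborel (\<lambda>r. exp (c * r) * norm (\<phi> r)))"

lemma decays_integrable:
  assumes \<phi>: "decays \<phi>" and x: "Re x < 0"
  shows "integrable lborel (\<lambda>r. exp (x * of_real r) * \<phi> r)"
proof (rule Bochner_Integration.integrable_bound)
  have [measurable]: "\<phi> \<in> borel_measurable borel" using \<phi> by (simp add: decays_def)
  show "integrable lborel (\<lambda>r. exp (Re x * r) * norm (\<phi> r))" using \<phi> x by (simp add: decays_def)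
  show "(\<lambda>r. exp (x * of_real r) * \<phi> r) \<in> borel_measurable lborel" by measurable
  show "AE r in lborel. norm (exp (x * complex_of_real r) * \<phi> r) \<le> norm (exp (Re x * r) * norm (\<phi> r))"
    by (rule AE_I2) (simp add: norm_mult)
qed

text \<open>Difference quotients converge under the integral by dominated convergence. One \<delta>
  in the rates pays for the increment and one for the factor \<open>r\<close>; since \<delta> is a
  quarter of - Re x, both rates Re x + 2 \<delta> and Re x - 2 \<delta> stay negative. Two rates are
  used because the function may live on both half lines.\<close>

lemma laplace_holomorphic:
  assumes \<phi>: "decays \<phi>"
  shows "laplace \<phi> holomorphic_on {x. Re x < 0}"
proof -
  have m [measurable]: "\<phi> \<in> borel_measurable borel" using \<phi> by (simp add: decays_def)
  have "(laplace \<phi> has_field_derivative laplace (\<lambda>r. of_real r * \<phi> r) x) (at x)" if x: "Re x < 0" for x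
    unfolding DERIV_def tendsto_at_iff_sequentially
  proof (intro allI impI)
    fix X :: "nat \<Rightarrow> complex" assume X: "\<forall>i. X i \<in> UNIV - {0}" "X \<longlonglongrightarrow> 0"
    define \<delta> where "\<delta> = - Re x / 4"
    have \<delta>: "\<delta> > 0" using x by (simp add: \<delta>_def)
    obtain N where N: "\<And>n. n \<ge> N \<Longrightarrow> norm (X n) < min \<delta> (- Re x)"
      using LIMSEQ_D[OF X(2), of "min \<delta> (- Re x)"] \<delta> x by auto
    define f where "f n r = (exp ((x + X (n + N)) * of_real r) - exp (x * of_real r)) / X (n + N) * \<phi> r" for n r
    define w where "w r = (1 / \<delta>) * (exp ((Re x + 2 * \<delta>) * r) * norm (\<phi> r) + exp ((Re x - 2 * \<delta>) * r) * norm (\<phi> r))" for r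
    have w: "integrable lborel w"
    proof -
      have "integrable lborel (\<lambda>r. exp (c * r) * norm (\<phi> r))" if "c < 0" for c using \<phi> that by (simp add: decays_def)
      moreover have "Re x + 2 * \<delta> < 0" "Re x - 2 * \<delta> < 0" using x by (simp_all add: \<delta>_def)
      ultimately show ?thesis unfolding w_def by (intro integrable_mult_right Bochner_Integration.integrable_add)
    qed
    have bd: "norm (f n r) \<le> w r" for n r
    proof -
      define h where "h = X (n + N)"
      have h: "norm h \<le> \<delta>" "h \<noteq> 0" using N[of "n + N"] X(1) by (auto simp: h_def)
      have "norm (exp ((x + h) * of_real r) - exp (x * of_real r)) = exp (Re x * r) * norm (exp (h * of_real r) - 1)"
      proof -
        have "exp ((x + h) * of_real r) - exp (x * of_real r) = exp (x * of_real r) * (exp (h * of_real r) - 1)"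
          by (simp add: ring_distribs exp_add)
        then show ?thesis by (simp add: norm_mult)
      qed
      also have "\<dots> \<le> exp (Re x * r) * (exp (norm (h * of_real r)) * norm (h * of_real r))"
        by (intro mult_left_mono norm_exp_minus_one_le) simp
      also have "\<dots> \<le> exp (Re x * r) * (exp (\<delta> * \<bar>r\<bar>) * (norm h * \<bar>r\<bar>))"
        using h by (intro mult_left_mono mult_mono) (auto simp: norm_mult intro!: mult_right_mono)
      also have "\<dots> \<le> exp (Re x * r) * (exp (\<delta> * \<bar>r\<bar>) * (norm h * (exp (\<delta> * \<bar>r\<bar>) / \<delta>)))"
      proof (intro mult_left_mono)
        have "\<delta> * \<bar>r\<bar> \<le> exp (\<delta> * \<bar>r\<bar>)" using exp_ge_add_one_self[of "\<delta> * \<bar>r\<bar>"] by linarith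
        then show "\<bar>r\<bar> \<le> exp (\<delta> * \<bar>r\<bar>) / \<delta>" using \<delta> by (simp add: field_simps)
      qed auto
      also have "\<dots> = norm h * ((1 / \<delta>) * (exp (Re x * r) * exp (2 * \<delta> * \<bar>r\<bar>)))"
        by (simp add: mult_ac exp_double[symmetric] power2_eq_square) (simp flip: exp_add)
      also have "\<dots> \<le> norm h * ((1 / \<delta>) * (exp ((Re x + 2 * \<delta>) * r) + exp ((Re x - 2 * \<delta>) * r)))"
        using \<delta> by (intro mult_left_mono) (cases "r \<ge> 0"; simp add: algebra_simps flip: exp_add)+
      finally have "norm (exp ((x + h) * of_real r) - exp (x * of_real r)) / norm h \<le> (1 / \<delta>) * (exp ((Re x + 2 * \<delta>) * r) + exp ((Re x - 2 * \<delta>) * r))"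
        using h by (simp add: divide_le_eq mult.commute)
      hence "norm (exp ((x + h) * of_real r) - exp (x * of_real r)) / norm h * norm (\<phi> r) \<le> (1 / \<delta>) * (exp ((Re x + 2 * \<delta>) * r) + exp ((Re x - 2 * \<delta>) * r)) * norm (\<phi> r)"
        by (rule mult_right_mono) simp
      then show ?thesis unfolding f_def w_def h_def[symmetric] norm_mult norm_divide by (simp only: mult.assoc distrib_right)
    qed
    have lim: "(\<lambda>n. f n r) \<longlonglongrightarrow> exp (x * of_real r) * (of_real r * \<phi> r)" for r
    proof -
      have "((\<lambda>w. exp (w * of_real r)) has_field_derivative of_real r * exp (x * of_real r)) (at x)"
        by (auto intro!: derivative_eq_intros)
      hence "((\<lambda>h. (exp ((x + h) * of_real r) - exp (x * of_real r)) / h) \<longlongrightarrow> of_real r * exp (x * of_real r)) (at 0)"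
        by (simp only: DERIV_def)
      hence "(\<lambda>n. (exp ((x + X n) * of_real r) - exp (x * of_real r)) / X n) \<longlonglongrightarrow> of_real r * exp (x * of_real r)"
        using X unfolding tendsto_at_iff_sequentially comp_def by blast
      from tendsto_mult_right[OF LIMSEQ_ignore_initial_segment[OF this, of N], of "\<phi> r"]
      show ?thesis unfolding f_def by (simp only: mult_ac)
    qed
    have "(\<lambda>n. integral\<^sup>L lborel (f n)) \<longlonglongrightarrow> (\<integral>r. exp (x * of_real r) * (of_real r * \<phi> r) \<partial>lborel)"
    proof (rule integral_dominated_convergence[where w = w])
      show "f n \<in> borel_measurable lborel" for n unfolding f_def by measurable
      show "AE r in lborel. (\<lambda>n. f n r) \<longlonglongrightarrow> exp (x * of_real r) * (of_real r * \<phi> r)" by (rule AE_I2) (rule lim)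
      show "AE r in lborel. norm (f n r) \<le> w r" for n by (rule AE_I2) (rule bd)
    qed (use w in measurable)
    moreover have "integral\<^sup>L lborel (f n) = (laplace \<phi> (x + X (n + N)) - laplace \<phi> x) / X (n + N)" for n
    proof -
      have "Re (x + X (n + N)) < 0" using N[of "n + N"] complex_Re_le_cmod[of "X (n + N)"] by simp
      note I = decays_integrable[OF \<phi> this] decays_integrable[OF \<phi> x]
      have "f n = (\<lambda>r. (exp ((x + X (n + N)) * of_real r) * \<phi> r - exp (x * of_real r) * \<phi> r) / X (n + N))"
        unfolding f_def by (simp add: left_diff_distrib)
      then show ?thesis unfolding laplace_def using I by simp
    qed
    ultimately have "(\<lambda>n. (laplace \<phi> (x + X (n + N)) - laplace \<phi> x) / X (n + N)) \<longlonglongrightarrow> laplace (\<lambda>r. of_real r * \<phi> r) x"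
      by (simp add: laplace_def)
    then have "(\<lambda>n. (laplace \<phi> (x + X n) - laplace \<phi> x) / X n) \<longlonglongrightarrow> laplace (\<lambda>r. of_real r * \<phi> r) x"
      by (rule LIMSEQ_offset[of _ N])
    then show "((\<lambda>h. (laplace \<phi> (x + h) - laplace \<phi> x) / h) \<circ> X) \<longlonglongrightarrow> laplace (\<lambda>r. of_real r * \<phi> r) x"
      by (simp add: comp_def)
  qed
  then show ?thesis by (intro holomorphic_onI) (auto simp: field_differentiable_def intro: has_field_derivative_at_within)
qed

text \<open>The adjoint of \<open>push\<close>: the heat flow comes first and the cut-off last. On
  Laplace transforms it is one of the \<open>u\<close>-integrals.\<close>

definition pull :: "real \<Rightarrow> real \<Rightarrow> (real \<Rightarrow> complex) \<Rightarrow> real \<Rightarrow> complex" where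
  "pull t b \<phi> r = indicator {..b} r * (\<integral>x. of_real (heat t (r - x)) * \<phi> x \<partial>lborel)"

lemma pull_duality:
  assumes t: "t > 0" and \<phi>: "decays \<phi>" and f: "f \<in> borel_measurable borel"
    and b: "\<And>x. norm (f x) \<le> C * exp (p * x)" and p: "p < 0"
  shows "integrable lborel (\<lambda>r. f r * pull t b \<phi> r)"
    and "(\<integral>r. f r * pull t b \<phi> r \<partial>lborel) = (\<integral>x. push t b f x * \<phi> x \<partial>lborel)"
    and "integrable lborel (\<lambda>x. push t b f x * \<phi> x)"
proof -
  have m [measurable]: "\<phi> \<in> borel_measurable borel" using \<phi> by (simp add: decays_def)
  define F where "F x r = indicator {..b} r * (f r * of_real (heat t (r - x))) * \<phi> x" for x r
  have C: "0 \<le> C" using order_trans[OF norm_ge_zero b[of 0]] by simp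
  have mF: "(\<lambda>(x, r). F x r) \<in> borel_measurable (lborel \<Otimes>\<^sub>M lborel)"
    unfolding F_def using f by measurable
  have g: "has_bochner_integral lborel (\<lambda>r. (norm (\<phi> x) * C) * (heat t (r - x) * exp (p * r))) ((norm (\<phi> x) * C) * exp (t * p\<^sup>2 + p * x))" for x
    by (rule has_bochner_integral_mult_right) (rule heat_laplace_real[OF t])
  have n: "norm (F x r) \<le> (norm (\<phi> x) * C) * (heat t (r - x) * exp (p * r))" for x r
  proof -
    have "norm (F x r) = indicator {..b} r * norm (f r) * heat t (r - x) * norm (\<phi> x)"
      by (simp add: F_def norm_mult heat_nonneg indicator_def)
    also have "\<dots> \<le> 1 * (C * exp (p * r)) * heat t (r - x) * norm (\<phi> x)"
      using b[of r] by (intro mult_right_mono mult_mono) (auto simp: indicator_def heat_nonneg)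
    finally show ?thesis by (simp only: mult_ac mult_1)
  qed
  have G: "integrable lborel (\<lambda>x. (norm (\<phi> x) * C) * exp (t * p\<^sup>2 + p * x))"
  proof -
    have "(\<lambda>x. (norm (\<phi> x) * C) * exp (t * p\<^sup>2 + p * x)) = (\<lambda>x. (C * exp (t * p\<^sup>2)) * (exp (p * x) * norm (\<phi> x)))"
      by (simp only: exp_add mult_ac)
    then show ?thesis using \<phi> p by (simp add: decays_def)
  qed
  note R = fubini_dominated[OF sf_lborel sf_lborel mF g n G]
  have 1: "(\<integral>r. F x r \<partial>lborel) = push t b f x * \<phi> x" for x
    unfolding F_def push_def by (simp only: integral_mult_left_zero)
  have 2: "(\<integral>x. F x r \<partial>lborel) = f r * pull t b \<phi> r" for r
  proof -
    have "F x r = (f r * indicator {..b} r) * (of_real (heat t (r - x)) * \<phi> x)" for x by (simp add: F_def)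
    then show ?thesis by (simp add: pull_def)
  qed
  show "integrable lborel (\<lambda>r. f r * pull t b \<phi> r)" using R(4) unfolding 2 .
  show "(\<integral>r. f r * pull t b \<phi> r \<partial>lborel) = (\<integral>x. push t b f x * \<phi> x \<partial>lborel)"
    using R(2) unfolding 1 2 by simp
  show "integrable lborel (\<lambda>x. push t b f x * \<phi> x)" using R(3) unfolding 1 .
qed

lemma decays_pull:
  assumes t: "t > 0" and \<phi>: "decays \<phi>"
  shows "decays (pull t b \<phi>)"
  unfolding decays_def
proof (intro conjI allI impI)
  have [measurable]: "\<phi> \<in> borel_measurable borel" using \<phi> by (simp add: decays_def)
  have "(\<lambda>r. \<integral>x. of_real (heat t (r - x)) * \<phi> x \<partial>lborel) \<in> borel_measurable borel"
    by (rule lborel.borel_measurable_lebesgue_integral) measurable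
  then show "pull t b \<phi> \<in> borel_measurable borel" unfolding pull_def by measurable
  fix c :: real assume "c < 0"
  from pull_duality(1)[OF t \<phi>, of "\<lambda>r. of_real (exp (c * r))" 1 c b, THEN integrable_norm] this
  show "integrable lborel (\<lambda>r. exp (c * r) * norm (pull t b \<phi> r))" by (simp add: norm_mult)
qed

text \<open>The heat kernel is replaced by its contour integral on the line of real part
  \<open>c\<close>. As this line is to the left of \<open>x\<close>, the integral over r \<le> b
  converges and produces the pole 1 / (x - w).\<close>

lemma push_exp:
  assumes t: "t > 0" and c: "c < Re x"
  shows "push t b (\<lambda>r. exp (x * of_real r)) y =
    vline c (\<lambda>w. exp (of_real t * w\<^sup>2) * exp (of_real b * (x - w)) / (x - w) * exp (w * of_real y))"
proof -
  define K where "K q = exp (of_real t * (Complex c q)\<^sup>2 + of_real y * Complex c q)" for q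
  define F where "F q r = K q * (indicator {..b} r * exp ((x - Complex c q) * of_real r))" for q r
  have Kc: "continuous_on UNIV K" unfolding K_def Complex_eq by (intro continuous_intros)
  have mF: "(\<lambda>(q, r). F q r) \<in> borel_measurable (lborel \<Otimes>\<^sub>M lborel)"
  proof -
    have "(\<lambda>(q, r). K q * exp ((x - Complex c q) * of_real r)) \<in> borel_measurable (lborel \<Otimes>\<^sub>M lborel)"
    proof (rule continuous_measurable2)
      have "continuous_on UNIV (\<lambda>p :: real \<times> real. K (fst p))"
        by (rule continuous_on_compose2[OF Kc]) (auto intro!: continuous_intros)
      then show "continuous_on UNIV (\<lambda>p. K (fst p) * exp ((x - Complex c (fst p)) * of_real (snd p)))"
        unfolding Complex_eq by (intro continuous_on_mult) (auto intro!: continuous_intros)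
    qed
    then have [measurable]: "(\<lambda>p. K (fst p) * exp ((x - Complex c (fst p)) * of_real (snd p))) \<in> borel_measurable (lborel \<Otimes>\<^sub>M lborel)"
      by (simp add: case_prod_beta')
    have "(\<lambda>p. indicator {..b} (snd p) * (K (fst p) * exp ((x - Complex c (fst p)) * of_real (snd p)))) \<in> borel_measurable (lborel \<Otimes>\<^sub>M lborel)"
      by measurable
    then show ?thesis unfolding F_def case_prod_beta' by (simp only: mult.left_commute)
  qed
  have ind: "has_bochner_integral lborel (\<lambda>r. indicator {..b} r * exp ((Re x - c) * r)) (exp ((Re x - c) * b) / (Re x - c))"
  proof -
    have "has_bochner_integral lborel (\<lambda>r. indicator {..b} r * exp (complex_of_real (Re x - c) * of_real r)) (exp (of_real (Re x - c) * of_real b) / of_real (Re x - c))"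
      using c by (intro exp_half_line_left) simp
    also have "(\<lambda>r. indicator {..b} r * exp (complex_of_real (Re x - c) * of_real r)) = (\<lambda>r. complex_of_real (indicator {..b} r * exp ((Re x - c) * r)))"
      by (auto simp: indicator_def exp_of_real[symmetric])
    also have "exp (of_real (Re x - c) * of_real b) / of_real (Re x - c) = complex_of_real (exp ((Re x - c) * b) / (Re x - c))"
      by (simp add: exp_of_real[symmetric])
    finally show ?thesis by (simp only: has_bochner_integral_iff complex_of_real_integrable_eq integral_complex_of_real of_real_eq_iff)
  qed
  have g: "has_bochner_integral lborel (\<lambda>r. norm (K q) * (indicator {..b} r * exp ((Re x - c) * r))) (norm (K q) * (exp ((Re x - c) * b) / (Re x - c)))" for q
    by (rule has_bochner_integral_mult_right[OF ind])
  have n: "norm (F q r) \<le> norm (K q) * (indicator {..b} r * exp ((Re x - c) * r))" for q r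
    by (simp add: F_def norm_mult indicator_def)
  have KI: "integrable lborel K" unfolding K_def using heat_contour[OF t, of c y] by (simp add: has_bochner_integral_iff)
  have G: "integrable lborel (\<lambda>q. norm (K q) * (exp ((Re x - c) * b) / (Re x - c)))" using KI by simp
  note R = fubini_dominated(2)[OF sf_lborel sf_lborel mF g n G]
  have 1: "(\<integral>r. F q r \<partial>lborel) = exp (of_real t * (Complex c q)\<^sup>2) * exp (of_real b * (x - Complex c q)) / (x - Complex c q) * exp (Complex c q * of_real y)" for q
  proof -
    have "(\<integral>r. F q r \<partial>lborel) = K q * (exp ((x - Complex c q) * of_real b) / (x - Complex c q))"
      unfolding F_def using has_bochner_integral_integral_eq[OF exp_half_line_left[of "x - Complex c q" b]] c by simp
    then show ?thesis unfolding K_def exp_add by (simp add: mult_ac)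
  qed
  have 2: "(\<integral>q. F q r \<partial>lborel) = of_real (2 * pi) * (indicator {..b} r * (exp (x * of_real r) * of_real (heat t (r - y))))" for r
  proof -
    have "F q r = (indicator {..b} r * exp (x * of_real r)) * exp (of_real t * (Complex c q)\<^sup>2 + of_real (y - r) * Complex c q)" for q
      unfolding F_def K_def by (simp add: algebra_simps flip: exp_add)
    then have "(\<integral>q. F q r \<partial>lborel) = (indicator {..b} r * exp (x * of_real r)) * of_real (2 * pi * heat t (y - r))"
      using has_bochner_integral_integral_eq[OF heat_contour[OF t, of c "y - r"]] by simp
    then show ?thesis using heat_minus[of t "r - y"] by simp
  qed
  show ?thesis using R unfolding 1 2 push_def vline_def by simp
qed

text \<open>Duality moves the operator from \<phi> to the exponential exp(x r), where
  \<open>push_exp\<close> gives a contour integral; integrating \<phi> against the remaining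
  exponential exp(w y) gives its transform at \<open>w\<close>.\<close>

lemma laplace_pull:
  assumes t: "t > 0" and \<phi>: "decays \<phi>" and x: "Re x < 0" and c: "c < Re x"
  shows "laplace (pull t b \<phi>) x =
    vline c (\<lambda>w. exp (of_real t * w\<^sup>2) * exp (of_real b * (x - w)) / (x - w) * laplace \<phi> w)"
proof -
  have m [measurable]: "\<phi> \<in> borel_measurable borel" using \<phi> by (simp add: decays_def)
  define K where "K q = exp (of_real t * (Complex c q)\<^sup>2) * exp (of_real b * (x - Complex c q)) / (x - Complex c q)" for q
  define F where "F y q = K q * exp (Complex c q * of_real y) * \<phi> y" for y q
  have nz: "x - Complex c q \<noteq> 0" for q using c by (auto simp: complex_eq_iff)
  have Kc: "continuous_on UNIV K" using nz unfolding K_def Complex_eq by (intro continuous_intros) auto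
  have mF: "(\<lambda>(y, q). F y q) \<in> borel_measurable (lborel \<Otimes>\<^sub>M lborel)"
  proof -
    have "(\<lambda>(y, q). K q * exp (Complex c q * of_real y)) \<in> borel_measurable (lborel \<Otimes>\<^sub>M lborel)"
    proof (rule continuous_measurable2)
      have "continuous_on UNIV (\<lambda>p :: real \<times> real. K (snd p))"
        by (rule continuous_on_compose2[OF Kc]) (auto intro!: continuous_intros)
      then show "continuous_on UNIV (\<lambda>p. K (snd p) * exp (Complex c (snd p) * of_real (fst p)))"
        unfolding Complex_eq by (intro continuous_on_mult) (auto intro!: continuous_intros)
    qed
    then have [measurable]: "(\<lambda>p. K (snd p) * exp (Complex c (snd p) * of_real (fst p))) \<in> borel_measurable (lborel \<Otimes>\<^sub>M lborel)"
      by (simp add: case_prod_beta')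
    show ?thesis unfolding F_def case_prod_beta' by measurable
  qed
  define B where "B = exp (t * c\<^sup>2) * exp (b * (Re x - c)) / (Re x - c)"
  have B: "norm (K q) \<le> B * exp (- t * q\<^sup>2)" for q
  proof -
    have 1: "norm (exp (complex_of_real t * (Complex c q)\<^sup>2)) = exp (t * c\<^sup>2) * exp (- t * q\<^sup>2)"
      by (simp add: norm_exp_eq_Re power2_eq_square algebra_simps flip: exp_add)
    have 2: "norm (exp (complex_of_real b * (x - Complex c q))) = exp (b * (Re x - c))" by (simp add: norm_exp_eq_Re)
    have 3: "Re x - c \<le> norm (x - Complex c q)" using complex_Re_le_cmod[of "x - Complex c q"] by simp
    have "norm (K q) = exp (t * c\<^sup>2) * exp (- t * q\<^sup>2) * exp (b * (Re x - c)) / norm (x - Complex c q)"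
      unfolding K_def norm_divide norm_mult 1 2 ..
    also have "\<dots> \<le> exp (t * c\<^sup>2) * exp (- t * q\<^sup>2) * exp (b * (Re x - c)) / (Re x - c)"
      using c 3 by (intro divide_left_mono mult_pos_pos) auto
    finally show ?thesis by (simp add: B_def mult_ac)
  qed
  have g: "has_bochner_integral lborel (\<lambda>q. (exp (c * y) * norm (\<phi> y) * B) * exp (- t * q\<^sup>2)) ((exp (c * y) * norm (\<phi> y) * B) * (\<integral>q. exp (- t * q\<^sup>2) \<partial>lborel))" for y
    by (intro has_bochner_integral_mult_right has_bochner_integral_integrable integrable_gauss t)
  have n: "norm (F y q) \<le> (exp (c * y) * norm (\<phi> y) * B) * exp (- t * q\<^sup>2)" for y q
  proof -
    have "norm (F y q) = norm (K q) * (exp (c * y) * norm (\<phi> y))" by (simp add: F_def norm_mult norm_exp_eq_Re)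
    also have "\<dots> \<le> (B * exp (- t * q\<^sup>2)) * (exp (c * y) * norm (\<phi> y))" by (intro mult_right_mono B) simp
    finally show ?thesis by (simp only: mult_ac)
  qed
  have G: "integrable lborel (\<lambda>y. (exp (c * y) * norm (\<phi> y) * B) * (\<integral>q. exp (- t * q\<^sup>2) \<partial>lborel))"
    using \<phi> c x by (simp add: decays_def)
  note R = fubini_dominated(2)[OF sf_lborel sf_lborel mF g n G]
  have 1: "(\<integral>q. F y q \<partial>lborel) = of_real (2 * pi) * (push t b (\<lambda>r. exp (x * of_real r)) y * \<phi> y)" for y
  proof -
    have "(\<integral>q. F y q \<partial>lborel) = (\<integral>q. K q * exp (Complex c q * of_real y) \<partial>lborel) * \<phi> y" unfolding F_def by (simp only: integral_mult_left_zero)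
    then show ?thesis unfolding push_exp[OF t c] vline_def K_def by simp
  qed
  have 2: "(\<integral>y. F y q \<partial>lborel) = K q * laplace \<phi> (Complex c q)" for q
    unfolding F_def laplace_def by (simp only: mult.assoc integral_mult_right_zero)
  have "laplace (pull t b \<phi>) x = (\<integral>y. push t b (\<lambda>r. exp (x * of_real r)) y * \<phi> y \<partial>lborel)"
    unfolding laplace_def using x by (intro pull_duality(2)[OF t \<phi>, where C = 1 and p = "Re x"]) (simp_all add: norm_exp_eq_Re)
  also have "\<dots> = (\<integral>q. K q * laplace \<phi> (Complex c q) \<partial>lborel) / of_real (2 * pi)"
    using R unfolding 1 2 by (simp add: nonzero_eq_divide_eq mult.commute)
  finally show ?thesis unfolding vline_def K_def by simp
qed

lemma quadratic_exponent_le: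
  fixes A B D y :: real
  assumes "A > 0"
  shows "exp (- A * y\<^sup>2 + B * y + D) \<le> exp ((B + 1)\<^sup>2 / (4 * A) + D) * exp (- y)"
proof -
  have "(B + 1)\<^sup>2 / (4 * A) - ((B + 1) * y - A * y\<^sup>2) = (B + 1 - 2 * A * y)\<^sup>2 / (4 * A)"
    using assms by (simp add: power2_eq_square field_simps)
  also have "\<dots> \<ge> 0" using assms by simp
  finally show ?thesis by (simp add: algebra_simps flip: exp_add)
qed

text \<open>
  Contours of slope below \<open>1\<close> lie in the sectors where \<open>exp (t w\<^sup>2)\<close> decays. For \<open>pull t b \<phi>\<close> the bound is read
  off a wedge of slope between \<open>\<kappa>\<close> and \<open>1\<close>, which stays away from the points to be bounded.
\<close>

definition tame :: "real \<Rightarrow> (real \<Rightarrow> complex) \<Rightarrow> bool" where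
  "tame b \<phi> \<longleftrightarrow> decays \<phi> \<and> (\<forall>\<kappa> M. 0 < \<kappa> \<longrightarrow> \<kappa> < 1 \<longrightarrow> 0 \<le> M \<longrightarrow>
     (\<exists>C. \<forall>x. Re x < 0 \<longrightarrow> - M - \<kappa> * \<bar>Im x\<bar> \<le> Re x \<longrightarrow> norm (exp (- (of_real b * x)) * laplace \<phi> x) \<le> C))"

text \<open>In the sector the exponent t (Re w)^2 - t (Im w)^2 is at most - t (1 - \<kappa>^2) (Im
  w)^2 up to linear terms. A negative quadratic absorbs these, including the factor exp((b' - b) w)
  caused by the change of threshold.\<close>

lemma tame_gauss_bound:
  assumes t: "t > 0" and \<phi>: "tame b' \<phi>" and \<kappa>: "0 < \<kappa>" "\<kappa> < 1" and M: "0 \<le> M"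
  obtains C where "0 \<le> C" "\<And>w. Re w < 0 \<Longrightarrow> - M - \<kappa> * \<bar>Im w\<bar> \<le> Re w \<Longrightarrow>
    norm (exp (of_real t * w\<^sup>2 - of_real b * w) * laplace \<phi> w) \<le> C * exp (- \<bar>Im w\<bar>)"
proof -
  obtain C where C: "\<And>x. Re x < 0 \<Longrightarrow> - M - \<kappa> * \<bar>Im x\<bar> \<le> Re x \<Longrightarrow> norm (exp (- (of_real b' * x)) * laplace \<phi> x) \<le> C"
    using \<phi> \<kappa> M unfolding tame_def by meson
  define A B D where "A = t * (1 - \<kappa>\<^sup>2)" and "B = 2 * t * M * \<kappa> + \<bar>b' - b\<bar> * \<kappa>" and "D = t * M\<^sup>2 + \<bar>b' - b\<bar> * M"
  have A: "A > 0" using t \<kappa> unfolding A_def by (simp add: power_less_one_iff abs_square_less_1)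
  define C' where "C' = exp ((B + 1)\<^sup>2 / (4 * A) + D) * \<bar>C\<bar>"
  show thesis
  proof (rule that)
    show "0 \<le> C'" by (simp add: C'_def)
    fix w assume w: "Re w < 0" "- M - \<kappa> * \<bar>Im w\<bar> \<le> Re w"
    define y where "y = \<bar>Im w\<bar>"
    have re: "\<bar>Re w\<bar> \<le> M + \<kappa> * y" using w by (simp add: y_def)
    have "t * (Re w)\<^sup>2 \<le> t * (M + \<kappa> * y)\<^sup>2" using t power_mono[OF re, of 2] by (intro mult_left_mono) auto
    moreover have "(b' - b) * Re w \<le> \<bar>b' - b\<bar> * (M + \<kappa> * y)"
    proof -
      have "(b' - b) * Re w \<le> \<bar>b' - b\<bar> * \<bar>Re w\<bar>" by (metis abs_ge_self abs_mult)
      also have "\<dots> \<le> \<bar>b' - b\<bar> * (M + \<kappa> * y)" by (intro mult_left_mono re) simp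
      finally show ?thesis .
    qed
    ultimately have "t * ((Re w)\<^sup>2 - y\<^sup>2) + (b' - b) * Re w \<le> - A * y\<^sup>2 + B * y + D"
      by (simp add: A_def B_def D_def power2_eq_square algebra_simps)
    hence e: "exp (t * ((Re w)\<^sup>2 - y\<^sup>2) + (b' - b) * Re w) \<le> exp ((B + 1)\<^sup>2 / (4 * A) + D) * exp (- y)"
      using quadratic_exponent_le[OF A, of y B D] by (meson exp_le_cancel_iff order_trans)
    have "exp (of_real t * w\<^sup>2 - of_real b * w) = exp (of_real t * w\<^sup>2 + of_real (b' - b) * w) * exp (- (of_real b' * w))"
      unfolding exp_add[symmetric] by (rule arg_cong[where f = exp]) (simp add: algebra_simps)
    hence "norm (exp (of_real t * w\<^sup>2 - of_real b * w) * laplace \<phi> w) =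
        norm (exp (of_real t * w\<^sup>2 + of_real (b' - b) * w)) * norm (exp (- (of_real b' * w)) * laplace \<phi> w)"
      by (simp only: norm_mult mult.assoc)
    also have "norm (exp (of_real t * w\<^sup>2 + of_real (b' - b) * w)) = exp (t * ((Re w)\<^sup>2 - y\<^sup>2) + (b' - b) * Re w)"
      by (simp add: norm_exp_eq_Re y_def power2_eq_square)
    also have "exp (t * ((Re w)\<^sup>2 - y\<^sup>2) + (b' - b) * Re w) * norm (exp (- (of_real b' * w)) * laplace \<phi> w) \<le>
        (exp ((B + 1)\<^sup>2 / (4 * A) + D) * exp (- y)) * \<bar>C\<bar>"
      using order_trans[OF C[OF w] abs_ge_self] by (intro mult_mono e) auto
    finally show "norm (exp (of_real t * w\<^sup>2 - of_real b * w) * laplace \<phi> w) \<le> C' * exp (- \<bar>Im w\<bar>)"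
      by (simp add: C'_def y_def mult_ac)
  qed
qed

lemma line_integral_pull:
  assumes t: "t > 0" and \<phi>: "tame b' \<phi>" and \<gamma>: "unbounded_contour \<theta> \<gamma>"
    and \<theta>: "0 < sin \<theta>" "\<bar>cos \<theta>\<bar> < sin \<theta>" "cos \<theta> < 0"
    and neg: "\<And>s. Re (\<gamma> s) < 0" and z: "z \<in> right_side \<gamma>" "Re z < 0"
  shows "line_integral \<gamma> (\<lambda>w. exp (of_real t * w\<^sup>2 - of_real b * w) * laplace \<phi> w / (z - w)) =
    2 * pi * \<i> * (exp (- (of_real b * z)) * laplace (pull t b \<phi>) z)"
proof -
  have dec: "decays \<phi>" using \<phi> by (simp add: tame_def)
  define r where "r = \<bar>cos \<theta>\<bar> / sin \<theta>"
  have r: "0 \<le> r" "r < 1" and cos_r: "\<bar>cos \<theta>\<bar> = r * sin \<theta>"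
    unfolding r_def using \<theta> by (simp_all only: pos_divide_less_eq divide_nonneg_pos abs_ge_zero mult_1) simp
  \<comment> \<open>A slope strictly between the slope \<open>r\<close> of the contour and 1: the
    tails of the contour end up in this sector, and the Gaussian still decays there.\<close>
  define \<kappa> where "\<kappa> = (r + 1) / 2"
  have \<kappa>: "0 < \<kappa>" "\<kappa> < 1" "r < \<kappa>" unfolding \<kappa>_def using r by simp_all
  have \<kappa>': "\<bar>cos \<theta>\<bar> < \<kappa> * sin \<theta>" unfolding cos_r using \<kappa>(3) \<theta>(1) by simp
  obtain C where C: "\<And>w. Re w < 0 \<Longrightarrow> - 0 - \<kappa> * \<bar>Im w\<bar> \<le> Re w \<Longrightarrow>
      norm (exp (of_real t * w\<^sup>2 - of_real b * w) * laplace \<phi> w) \<le> C * exp (- \<bar>Im w\<bar>)"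
    using tame_gauss_bound[OF t \<phi> \<kappa>(1,2) order_refl] by blast
  define c where "c = Re z - 1"
  have c: "c < Re z" "c < 0" using z by (simp_all add: c_def)
  have 1: "line_integral \<gamma> (\<lambda>w. exp (of_real t * w\<^sup>2 - of_real b * w) * laplace \<phi> w / (z - w)) =
      2 * pi * \<i> * vline c (\<lambda>w. exp (of_real t * w\<^sup>2 - of_real b * w) * laplace \<phi> w / (z - w))"
  proof (rule line_integral_pole[OF _ \<gamma> \<theta>(1) \<kappa>' \<theta>(3) neg z c(1)])
    show "(\<lambda>w. exp (of_real t * w\<^sup>2 - of_real b * w) * laplace \<phi> w) holomorphic_on {w. Re w < 0}"
      by (intro holomorphic_intros laplace_holomorphic dec)
    fix w assume "0 \<le> \<bar>Im w\<bar>" "\<bar>Re w\<bar> \<le> \<kappa> * \<bar>Im w\<bar>" "Re w \<le> c"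
    then show "norm (exp (of_real t * w\<^sup>2 - of_real b * w) * laplace \<phi> w) \<le> C * exp (- \<bar>Im w\<bar>)"
      using c by (intro C) auto
  qed
  have 2: "(\<lambda>w. exp (of_real t * w\<^sup>2 - of_real b * w) * laplace \<phi> w / (z - w)) =
      (\<lambda>w. exp (- (of_real b * z)) * (exp (of_real t * w\<^sup>2) * exp (of_real b * (z - w)) / (z - w) * laplace \<phi> w))"
  proof (rule ext)
    fix w
    have "exp (of_real t * w\<^sup>2 - of_real b * w) = exp (- (of_real b * z)) * (exp (of_real t * w\<^sup>2) * exp (of_real b * (z - w)))"
      unfolding exp_add[symmetric] by (rule arg_cong[where f = exp]) (simp add: algebra_simps)
    then show "exp (of_real t * w\<^sup>2 - of_real b * w) * laplace \<phi> w / (z - w) =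
      exp (- (of_real b * z)) * (exp (of_real t * w\<^sup>2) * exp (of_real b * (z - w)) / (z - w) * laplace \<phi> w)" by simp
  qed
  have 3: "vline c (\<lambda>w. exp (- (of_real b * z)) * (exp (of_real t * w\<^sup>2) * exp (of_real b * (z - w)) / (z - w) * laplace \<phi> w)) =
      exp (- (of_real b * z)) * laplace (pull t b \<phi>) z"
    unfolding laplace_pull[OF t dec z(2) c(1)] unfolding vline_def by (simp only: integral_mult_right_zero times_divide_eq_right)
  show ?thesis unfolding 1 unfolding 2 3 ..
qed

lemma wedge_Re_Im: "Re (wedge (of_real c) \<theta> t) = c + \<bar>t\<bar> * cos \<theta>" "Im (wedge (of_real c) \<theta> t) = t * sin \<theta>"
  by (auto simp: wedge_def sgn_real_def)

lemma norm_line_integral_wedge: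
  assumes b: "\<And>t. norm (f (wedge c \<theta> t)) \<le> G t" and G: "integrable lborel G"
  shows "norm (line_integral (wedge c \<theta>) f) \<le> integral\<^sup>L lborel G"
proof -
  define h where "h t = (if t = 0 then 0 else f (wedge c \<theta> t) * vector_derivative (wedge c \<theta>) (at t))" for t
  have "norm (vector_derivative (wedge c \<theta>) (at t)) = 1" if "t \<noteq> 0" for t
    using that vector_derivative_at[OF wedge_vector_derivative(1)] vector_derivative_at[OF wedge_vector_derivative(2)]
    by (cases "t > 0") auto
  hence h: "norm (h t) \<le> G t" for t
    using b[of t] order_trans[OF norm_ge_zero b[of t]] by (cases "t = 0") (simp_all add: h_def norm_mult)
  have "line_integral (wedge c \<theta>) f = integral UNIV h"
    unfolding line_integral_def by (rule integral_spike[of "{0}"]) (auto simp: h_def)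
  also have "norm \<dots> \<le> integral UNIV G"
  proof (cases "h integrable_on UNIV")
    case True
    then show ?thesis using integrable_on_lborel[OF G] h by (intro integral_norm_bound_integral) auto
  next
    \<comment> \<open>The gauge integral of a function that is not integrable is 0 by convention, so
      the bound holds as soon as the right side is nonnegative.\<close>
    case False
    have "0 \<le> integral UNIV G"
      using order_trans[OF norm_ge_zero h] by (intro Henstock_Kurzweil_Integration.integral_nonneg integrable_on_lborel[OF G]) auto
    then show ?thesis using False by (simp add: not_integrable_integral)
  qed
  also have "integral UNIV G = integral\<^sup>L lborel G" by (rule integral_lborel[OF G])
  finally show ?thesis .
qed

lemma tame_pull:
  assumes t: "t > 0" and \<phi>: "tame b' \<phi>"
  shows "tame b (pull t b \<phi>)"
  unfolding tame_def
proof (intro conjI allI impI)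
  show "decays (pull t b \<phi>)" using \<phi> by (intro decays_pull[OF t]) (simp add: tame_def)
  fix \<kappa> M :: real assume \<kappa>: "0 < \<kappa>" "\<kappa> < 1" and M: "0 \<le> M"
  define l where "l = (1 + \<kappa>) / 2"
  have l: "0 < l" "l < 1" "\<kappa> < l" using \<kappa> by (simp_all add: l_def)
  define \<theta> where "\<theta> = pi / 2 + arctan l"
  have sc: "sin \<theta> = cos (arctan l)" "cos \<theta> = - sin (arctan l)" by (simp_all add: \<theta>_def sin_add cos_add)
  have cpos: "cos (arctan l) > 0" by (simp add: cos_arctan add_pos_nonneg)
  have cs: "cos \<theta> = - l * sin \<theta>" unfolding sc using cpos tan_arctan[of l] by (simp add: tan_def field_simps)
  have s0: "0 < sin \<theta>" unfolding sc by (rule cpos)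
  have \<theta>: "0 < sin \<theta>" "\<bar>cos \<theta>\<bar> < sin \<theta>" "cos \<theta> < 0" unfolding cs using s0 l by (auto simp: abs_mult)
  define \<gamma> where "\<gamma> = wedge (of_real (- (M + 1))) \<theta>"
  have Re\<gamma>: "Re (\<gamma> s) = - (M + 1) - l * \<bar>Im (\<gamma> s)\<bar>" for s
    unfolding \<gamma>_def wedge_Re_Im cs using s0 by (simp add: abs_mult)
  have Im\<gamma>: "Im (\<gamma> s) = s * sin \<theta>" for s unfolding \<gamma>_def by (rule wedge_Re_Im)
  have neg: "Re (\<gamma> s) < 0" for s unfolding Re\<gamma> using M l by (smt (verit) mult_nonneg_nonneg abs_ge_zero)
  obtain C where C: "0 \<le> C" "\<And>w. Re w < 0 \<Longrightarrow> - (M + 1) - l * \<bar>Im w\<bar> \<le> Re w \<Longrightarrow>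
      norm (exp (of_real t * w\<^sup>2 - of_real b * w) * laplace \<phi> w) \<le> C * exp (- \<bar>Im w\<bar>)"
    using tame_gauss_bound[OF t \<phi> l(1,2), of "M + 1"] M by auto
  define G where "G s = 2 * C * exp (- sin \<theta> * \<bar>s\<bar>)" for s
  have G: "integrable lborel G" unfolding G_def by (intro integrable_mult_right integrable_exp_abs_rate s0)
  have "norm (exp (- (of_real b * x)) * laplace (pull t b \<phi>) x) \<le> integral\<^sup>L lborel G / (2 * pi)"
    if x: "Re x < 0" "- M - \<kappa> * \<bar>Im x\<bar> \<le> Re x" for x
  proof -
    \<comment> \<open>The wedge \<gamma> starts one unit to the left of the region of admissible
      \<open>x\<close>, and its slope \<open>l\<close>, midway between \<kappa> and 1, is the
      steeper one in this sense. Two points at distance below 1/2 would contradict both bounds on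
      the real part.\<close>
    have far: "1 / 2 \<le> norm (x - \<gamma> s)" for s
    proof (rule ccontr)
      assume "\<not> ?thesis"
      hence lt: "norm (x - \<gamma> s) < 1 / 2" by simp
      have "\<bar>Re x - Re (\<gamma> s)\<bar> < 1 / 2" "\<bar>Im x - Im (\<gamma> s)\<bar> < 1 / 2"
        using abs_Re_le_cmod[of "x - \<gamma> s"] abs_Im_le_cmod[of "x - \<gamma> s"] lt by simp_all
      hence im: "\<bar>Im x\<bar> \<le> \<bar>Im (\<gamma> s)\<bar> + 1 / 2" and re: "Re x < Re (\<gamma> s) + 1 / 2" by linarith+
      have "\<kappa> * \<bar>Im x\<bar> \<le> \<kappa> * (\<bar>Im (\<gamma> s)\<bar> + 1 / 2)" using im \<kappa> by (intro mult_left_mono) auto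
      moreover have "\<kappa> * \<bar>Im (\<gamma> s)\<bar> \<le> l * \<bar>Im (\<gamma> s)\<bar>" using l by (intro mult_right_mono) auto
      ultimately show False using re x(2) \<kappa> unfolding Re\<gamma> by (simp add: distrib_left)
    qed
    \<comment> \<open>The segment from 0 to \<open>x\<close> avoids the wedge: at each of its points
      the real part is at least - M - \<kappa> |Im|, while on the wedge it is - (M + 1) - l
      |Im|.\<close>
    have "x \<in> right_side \<gamma>"
      unfolding right_side_def mem_Collect_eq connected_component_def
    proof (intro exI[of _ "closed_segment 0 x"] conjI)
      show "closed_segment 0 x \<subseteq> - range \<gamma>"
      proof
        fix w assume "w \<in> closed_segment 0 x"
        then obtain r where r: "0 \<le> r" "r \<le> 1" and w: "w = r *\<^sub>R x" by (auto simp: in_segment)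
        show "w \<in> - range \<gamma>"
        proof
          assume "w \<in> range \<gamma>"
          then obtain s where s: "w = \<gamma> s" by blast
          have "r * Re x = - (M + 1) - l * \<bar>r * Im x\<bar>" using Re\<gamma>[of s] unfolding s[symmetric] w by simp
          moreover have "r * (- M - \<kappa> * \<bar>Im x\<bar>) \<le> r * Re x" by (intro mult_left_mono x(2) r)
          moreover have "r * M \<le> M" using r M by (simp add: mult_left_le_one_le)
          moreover have "\<kappa> * \<bar>r * Im x\<bar> \<le> l * \<bar>r * Im x\<bar>" using l by (intro mult_right_mono) auto
          moreover have "r * (- M - \<kappa> * \<bar>Im x\<bar>) = - (r * M) - \<kappa> * \<bar>r * Im x\<bar>" using r by (simp add: abs_mult algebra_simps)
          ultimately show False by linarith
        qed
      qed
    qed auto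
    hence "2 * pi * \<i> * (exp (- (of_real b * x)) * laplace (pull t b \<phi>) x) =
        line_integral \<gamma> (\<lambda>w. exp (of_real t * w\<^sup>2 - of_real b * w) * laplace \<phi> w / (x - w))"
      using line_integral_pull[OF t \<phi> wedge_unbounded_contour[of \<theta> "of_real (- (M + 1))", folded \<gamma>_def] \<theta> neg _ x(1)] by simp
    moreover have "norm (line_integral \<gamma> (\<lambda>w. exp (of_real t * w\<^sup>2 - of_real b * w) * laplace \<phi> w / (x - w))) \<le> integral\<^sup>L lborel G"
      unfolding \<gamma>_def
    proof (rule norm_line_integral_wedge[OF _ G], fold \<gamma>_def)
      fix s
      have "norm (exp (of_real t * (\<gamma> s)\<^sup>2 - of_real b * \<gamma> s) * laplace \<phi> (\<gamma> s)) \<le> C * exp (- \<bar>Im (\<gamma> s)\<bar>)"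
        using Re\<gamma>[of s] by (intro C(2) neg) simp
      hence "norm (exp (of_real t * (\<gamma> s)\<^sup>2 - of_real b * \<gamma> s) * laplace \<phi> (\<gamma> s)) / norm (x - \<gamma> s) \<le> C * exp (- \<bar>Im (\<gamma> s)\<bar>) / (1 / 2)"
        using far[of s] C(1) by (intro frac_le) auto
      also have "\<dots> = G s" using s0 by (simp add: G_def Im\<gamma> abs_mult mult_ac)
      finally show "norm (exp (of_real t * (\<gamma> s)\<^sup>2 - of_real b * \<gamma> s) * laplace \<phi> (\<gamma> s) / (x - \<gamma> s)) \<le> G s"
        by (simp only: norm_divide)
    qed
    ultimately have "norm (2 * pi * \<i> * (exp (- (of_real b * x)) * laplace (pull t b \<phi>) x)) \<le> integral\<^sup>L lborel G" by (simp only:)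
    hence "2 * pi * norm (exp (- (of_real b * x)) * laplace (pull t b \<phi>) x) \<le> integral\<^sup>L lborel G"
      by (simp add: norm_mult)
    then show ?thesis by (simp add: pos_le_divide_eq mult.commute)
  qed
  then show "\<exists>C. \<forall>x. Re x < 0 \<longrightarrow> - M - \<kappa> * \<bar>Im x\<bar> \<le> Re x \<longrightarrow> norm (exp (- (of_real b * x)) * laplace (pull t b \<phi>) x) \<le> C"
    by blast
qed

text \<open>The function whose Laplace transform has the pole 1 / (v - u_i), up to exponential
  factors. All pulls start from it.\<close>

definition cut_exp :: "real \<Rightarrow> complex \<Rightarrow> real \<Rightarrow> complex" where
  "cut_exp b v r = indicator {b<..} r * exp (- v * of_real r)"

lemma laplace_cut_exp:
  assumes "Re x < Re v"
  shows "laplace (cut_exp b v) x = exp ((x - v) * of_real b) / (v - x)"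
proof -
  have "(\<lambda>r. exp (x * of_real r) * cut_exp b v r) = (\<lambda>r. indicator {b<..} r * exp ((x - v) * of_real r))"
    by (auto simp: cut_exp_def indicator_def algebra_simps simp flip: exp_add)
  moreover have "(\<integral>r. indicator {b<..} r * exp ((x - v) * of_real r) \<partial>lborel) = - exp ((x - v) * of_real b) / (x - v)"
    using assms by (intro has_bochner_integral_integral_eq[OF exp_half_line_right]) simp
  ultimately show ?thesis unfolding laplace_def
    by (metis minus_diff_eq minus_divide_divide minus_minus)
qed

lemma tame_cut_exp:
  assumes v: "Re v > 0"
  shows "tame b (cut_exp b v)"
  unfolding tame_def
proof (intro conjI allI impI)
  show "decays (cut_exp b v)"
    unfolding decays_def
  proof (intro conjI allI impI)
    show "cut_exp b v \<in> borel_measurable borel" unfolding cut_exp_def by measurable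
    fix c :: real assume c: "c < 0"
    have "(\<lambda>r. exp (c * r) * norm (cut_exp b v r)) = (\<lambda>r. indicator {b<..} r * exp (- (Re v - c) * r))"
      by (auto simp: cut_exp_def indicator_def norm_mult algebra_simps simp flip: exp_add)
    then show "integrable lborel (\<lambda>r. exp (c * r) * norm (cut_exp b v r))"
      using integrable_exp_tail(2)[of "Re v - c" b] c v by simp
  qed
  fix \<kappa> M :: real
  have "norm (exp (- (of_real b * x)) * laplace (cut_exp b v) x) \<le> exp (- Re v * b) / Re v" if x: "Re x < 0" for x
  proof -
    have "exp (- (of_real b * x)) * laplace (cut_exp b v) x = exp (- v * of_real b) / (v - x)"
      using x v by (subst laplace_cut_exp) (simp_all add: algebra_simps flip: exp_add)
    moreover have "Re v \<le> norm (v - x)" using complex_Re_le_cmod[of "v - x"] x by simp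
    moreover have "v \<noteq> x" using v x by auto
    ultimately show ?thesis using v by (simp add: norm_divide) (intro divide_left_mono mult_pos_pos; simp)
  qed
  then show "\<exists>C. \<forall>x. Re x < 0 \<longrightarrow> - M - \<kappa> * \<bar>Im x\<bar> \<le> Re x \<longrightarrow> norm (exp (- (of_real b * x)) * laplace (cut_exp b v) x) \<le> C"
    by blast
qed

lemma line_integral_cong: "(\<And>t. f (\<gamma> t) = g (\<gamma> t)) \<Longrightarrow> line_integral \<gamma> f = line_integral \<gamma> g"
  by (simp add: line_integral_def)

lemma line_integral_cmult: "line_integral \<gamma> (\<lambda>w. c * f w) = c * line_integral \<gamma> f"
  unfolding line_integral_def by (simp only: mult.assoc integral_mult_right)

text \<open>The \<open>u\<close>-integrals, taken innermost first, produce the Laplace transforms of these functions.\<close>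

primrec pulled :: "(nat \<Rightarrow> real) \<Rightarrow> (nat \<Rightarrow> real) \<Rightarrow> nat \<Rightarrow> complex \<Rightarrow> nat \<Rightarrow> real \<Rightarrow> complex" where
  "pulled \<alpha> \<beta> i v 0 = cut_exp (\<beta> i) v"
| "pulled \<alpha> \<beta> i v (Suc k) = pull (\<alpha> (i - k) - \<alpha> (i - Suc k)) (\<beta> (i - Suc k)) (pulled \<alpha> \<beta> i v k)"

text \<open>After \<open>k\<close> pulls the function belongs to level \<open>i - k\<close>, and the
  exponential factor in its bound is set by the threshold of that level.\<close>

lemma tame_pulled:
  assumes \<alpha>: "strict_mono_on {1..m} \<alpha>" and i: "i \<in> {1..m}" and v: "Re v > 0"
  shows "k < i \<Longrightarrow> tame (\<beta> (i - k)) (pulled \<alpha> \<beta> i v k)"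
proof (induction k)
  case 0
  then show ?case using tame_cut_exp[OF v] by simp
next
  case (Suc k)
  have "0 < \<alpha> (i - k) - \<alpha> (i - Suc k)" using Suc.prems i by (intro increasing_step[OF \<alpha>]) auto
  then show ?case using Suc by (simp add: tame_pull)
qed

text \<open>Each use of duality takes the outermost \<open>pull\<close> off the right factor and
  adds a \<open>push\<close> to the left one. After \<open>n\<close> uses the exponential has been
  carried from level 1 to level \<open>n + 1\<close>; for n = i - 1 only \<open>cut_exp\<close> is
  left on the right.\<close>

lemma laplace_pulled:
  assumes \<alpha>: "strict_mono_on {1..m} \<alpha>" and i: "i \<in> {1..m}" and v: "Re v > 0" and z: "Re z < 0"
  shows "n < i \<Longrightarrow> laplace (pulled \<alpha> \<beta> i v (i - 1)) z =
    (\<integral>x. chain \<alpha> \<beta> (\<lambda>x. exp (z * of_real x)) n x * pulled \<alpha> \<beta> i v (i - 1 - n) x \<partial>lborel)"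
proof (induction n)
  case 0
  then show ?case by (simp add: laplace_def)
next
  case (Suc n)
  define k where "k = i - 1 - Suc n"
  have k: "i - 1 - n = Suc k" "i - Suc k = n + 1" "i - k = n + 2" "k < i" using Suc.prems by (auto simp: k_def)
  let ?f = "\<lambda>x. exp (z * complex_of_real x)"
  have fm: "?f \<in> borel_measurable borel" by measurable
  have fb: "norm (?f x) \<le> 1 * exp (Re z * x)" for x by (simp add: norm_exp_eq_Re)
  have "n < m" using Suc.prems i by simp
  note cb = chain_bound[OF \<alpha> fm fb this]
  have t: "0 < \<alpha> (n + 2) - \<alpha> (n + 1)" using Suc.prems i by (intro increasing_step[OF \<alpha>]) auto
  have d: "decays (pulled \<alpha> \<beta> i v k)" using tame_pulled[OF \<alpha> i v k(4)] by (simp add: tame_def)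
  have "laplace (pulled \<alpha> \<beta> i v (i - 1)) z = (\<integral>x. chain \<alpha> \<beta> ?f n x * pulled \<alpha> \<beta> i v (Suc k) x \<partial>lborel)"
    using Suc unfolding k(1) by simp
  also have "\<dots> = (\<integral>x. chain \<alpha> \<beta> ?f (Suc n) x * pulled \<alpha> \<beta> i v k x \<partial>lborel)"
    unfolding pulled.simps chain.simps k(2,3) by (rule pull_duality(2)[OF t d chain_measurable[OF fm] cb z])
  finally show ?case by (simp add: k_def)
qed

section \<open>The contour integrals in the kernel\<close>

definition iterate_integrand ::
  "(nat \<Rightarrow> real) \<Rightarrow> (nat \<Rightarrow> real) \<Rightarrow> nat \<Rightarrow> complex \<Rightarrow> complex \<Rightarrow> complex \<Rightarrow> (nat \<Rightarrow> complex) \<Rightarrow> complex" where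
  "iterate_integrand \<alpha> \<beta> i z v u us = f_fun \<alpha> \<beta> 1 z / f_fun \<alpha> \<beta> i v *
     ((\<Prod>l\<in>{2..i}. F_fun \<alpha> \<beta> l (us l)) /
      ((z - us 2) * (\<Prod>l\<in>{2..i - 1}. us l - us (l + 1)) * (us i - v) * (v - u)))"

text \<open>The neighbour on the left in the chain z, u_2, ..., u_i of the denominators; it is the
  pole of the integral over u_l.\<close>

definition prev_point :: "complex \<Rightarrow> (nat \<Rightarrow> complex) \<Rightarrow> nat \<Rightarrow> complex" where
  "prev_point z us l = (if l = 2 then z else us (l - 1))"

lemma prev_point_prod:
  assumes "2 \<le> i"
  shows "(z - us 2) * (\<Prod>l\<in>{2..i - 1}. us l - us (l + 1)) = (\<Prod>l\<in>{2..i}. prev_point z us l - us l)"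
proof -
  have "{2..i} = insert 2 {3..i}" using assms by auto
  hence "(\<Prod>l\<in>{2..i}. prev_point z us l - us l) = (z - us 2) * (\<Prod>l\<in>{3..i}. prev_point z us l - us l)"
    by (simp add: prev_point_def)
  also have "(\<Prod>l\<in>{3..i}. prev_point z us l - us l) = (\<Prod>l\<in>{2..i - 1}. us l - us (l + 1))"
    by (rule prod.reindex_bij_witness[where i = "\<lambda>l. l + 1" and j = "\<lambda>l. l - 1"]) (auto simp: prev_point_def)
  finally show ?thesis ..
qed

lemma F_fun_exp:
  assumes "2 \<le> l"
  shows "F_fun \<alpha> \<beta> l w * exp (- (of_real (\<beta> l) * w)) = exp (of_real (\<alpha> l - \<alpha> (l - 1)) * w\<^sup>2 - of_real (\<beta> (l - 1)) * w)"
  using assms unfolding F_fun_def f_fun_def exp_diff[symmetric] by (simp add: algebra_simps flip: exp_add exp_diff)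

lemma pole_sign:
  fixes c :: complex
  shows "- c / (v - u) * (1 / (v - x)) = c / ((x - v) * (v - u))"
proof -
  have "c / ((x - v) * (v - u)) = c / (v - u) * (1 / (x - v))" by simp
  moreover have "1 / (x - v) = - (1 / (v - x))" by (metis minus_diff_eq minus_divide_right)
  ultimately show ?thesis by simp
qed

text \<open>The innermost \<open>k\<close> variables, those of index above \<open>i - k\<close>, are
  integrated out. Each integral is an instance of \<open>line_integral_pull\<close> with its pole at
  the preceding variable, which lies to the right of the contour because the contours are ordered.
  The factor exp(- \<beta>_l w) left by the previous integral combines with F_l to the Gaussian
  whose threshold is \<beta>_{l-1}, so the same form returns one level lower.\<close>

lemma iterated_integral_u:
  assumes \<alpha>: "strict_mono_on {1..m} \<alpha>" and i: "i \<in> {2..m}" and v: "Re v > 0" and z: "Re z < 0"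
    and U: "u_contours i z U"
  shows "k < i \<Longrightarrow> (\<And>r. r \<in> {2..<i + 1 - k} \<Longrightarrow> us r \<in> range (U r)) \<Longrightarrow>
    iterated_integral U [i + 1 - k..<i + 1] (iterate_integrand \<alpha> \<beta> i z v u) us =
    (\<Prod>r\<in>{2..<i + 1 - k}. F_fun \<alpha> \<beta> r (us r) / (prev_point z us r - us r)) *
    (- (f_fun \<alpha> \<beta> 1 z / f_fun \<alpha> \<beta> i v * exp (of_real (\<beta> i) * v) / (v - u)) *
      (exp (- (of_real (\<beta> (i - k)) * prev_point z us (i + 1 - k))) * laplace (pulled \<alpha> \<beta> i v k) (prev_point z us (i + 1 - k))))"
proof (induction k arbitrary: us)
  case 0
  define x where "x = us i"
  have "x \<in> range (U i)" using 0 i by (auto simp: x_def)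
  hence x: "Re x < 0" using U i by (auto simp: u_contours_def)
  have "exp (of_real (\<beta> i) * v) * (exp (- (of_real (\<beta> i) * x)) * laplace (cut_exp (\<beta> i) v) x) = 1 / (v - x)"
  proof -
    have "exp (of_real (\<beta> i) * v) * (exp (- (of_real (\<beta> i) * x)) * exp ((x - v) * of_real (\<beta> i))) = 1"
      unfolding exp_add[symmetric] by (simp add: algebra_simps)
    then show ?thesis using x v by (subst laplace_cut_exp) (simp_all add: mult.assoc)
  qed
  hence 1: "- (f_fun \<alpha> \<beta> 1 z / f_fun \<alpha> \<beta> i v * exp (of_real (\<beta> i) * v) / (v - u)) * (exp (- (of_real (\<beta> i) * x)) * laplace (cut_exp (\<beta> i) v) x) =
      f_fun \<alpha> \<beta> 1 z / f_fun \<alpha> \<beta> i v / ((x - v) * (v - u))"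
  proof -
    assume a: "exp (of_real (\<beta> i) * v) * (exp (- (of_real (\<beta> i) * x)) * laplace (cut_exp (\<beta> i) v) x) = 1 / (v - x)"
    have "- (f_fun \<alpha> \<beta> 1 z / f_fun \<alpha> \<beta> i v * exp (of_real (\<beta> i) * v) / (v - u)) * (exp (- (of_real (\<beta> i) * x)) * laplace (cut_exp (\<beta> i) v) x) =
      - (f_fun \<alpha> \<beta> 1 z / f_fun \<alpha> \<beta> i v) / (v - u) * (exp (of_real (\<beta> i) * v) * (exp (- (of_real (\<beta> i) * x)) * laplace (cut_exp (\<beta> i) v) x))"
      by simp
    also have "\<dots> = f_fun \<alpha> \<beta> 1 z / f_fun \<alpha> \<beta> i v / ((x - v) * (v - u))"
      unfolding a by (rule pole_sign)
    finally show ?thesis .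
  qed
  have p: "prev_point z us (i + 1) = x" using i by (simp add: prev_point_def x_def)
  have s: "{2..<i + 1} = {2..i}" by auto
  have "iterate_integrand \<alpha> \<beta> i z v u us = (\<Prod>r\<in>{2..i}. F_fun \<alpha> \<beta> r (us r)) / (\<Prod>l\<in>{2..i}. prev_point z us l - us l) *
      (f_fun \<alpha> \<beta> 1 z / f_fun \<alpha> \<beta> i v / ((x - v) * (v - u)))"
  proof -
    have "iterate_integrand \<alpha> \<beta> i z v u us = f_fun \<alpha> \<beta> 1 z / f_fun \<alpha> \<beta> i v *
        ((\<Prod>r\<in>{2..i}. F_fun \<alpha> \<beta> r (us r)) / ((\<Prod>l\<in>{2..i}. prev_point z us l - us l) * (x - v) * (v - u)))"
      unfolding iterate_integrand_def x_def using prev_point_prod[of i z us] i by (simp only: atLeastAtMost_iff)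
    then show ?thesis by (simp add: mult_ac)
  qed
  then show ?case using p s 1 by (simp add: prod_dividef)
next
  case (Suc k)
  define l where "l = i - k"
  have l: "2 \<le> l" "l \<le> i" "i + 1 - Suc k = l" "i + 1 - k = Suc l" "i - Suc k = l - 1" using Suc.prems(1) i by (auto simp: l_def)
  define p where "p = prev_point z us l"
  define t where "t = \<alpha> l - \<alpha> (l - 1)"
  define A where "A = - (f_fun \<alpha> \<beta> 1 z / f_fun \<alpha> \<beta> i v * exp (of_real (\<beta> i) * v) / (v - u))"
  define P where "P = (\<Prod>r\<in>{2..<l}. F_fun \<alpha> \<beta> r (us r) / (prev_point z us r - us r))"
  have t: "0 < t" unfolding t_def using l i by (intro increasing_step[OF \<alpha>]) auto
  have tm: "tame (\<beta> l) (pulled \<alpha> \<beta> i v k)" unfolding l_def using Suc.prems(1) i by (intro tame_pulled[OF \<alpha> _ v]) auto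
  have Ul: "unbounded_contour (2 * pi / 3) (U l)" "\<And>t. Re (U l t) < 0" "z \<in> right_side (U l)"
    using U l by (auto simp: u_contours_def)
  have p1: "p \<in> right_side (U l) \<and> Re p < 0"
  proof (cases "l = 2")
    case True
    then show ?thesis using Ul z by (simp add: p_def prev_point_def)
  next
    case False
    have "p = us (l - 1)" using False by (simp add: p_def prev_point_def)
    moreover have "us (l - 1) \<in> range (U (l - 1))" using Suc.prems(2)[of "l - 1"] l False by auto
    moreover have "range (U (l - 1)) \<subseteq> right_side (U l) \<and> (\<forall>t. Re (U (l - 1) t) < 0)"
    proof -
      have "l - 1 \<in> {2..i}" "l \<in> {2..i}" "l - 1 < l" using l(1,2) False by auto
      then show ?thesis using U unfolding u_contours_def by blast
    qed
    ultimately show ?thesis by (metis rangeE subsetD)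
  qed
  have IH: "iterated_integral U [Suc l..<i + 1] (iterate_integrand \<alpha> \<beta> i z v u) (us(l := w)) =
      (P * A) * (exp (of_real t * w\<^sup>2 - of_real (\<beta> (l - 1)) * w) * laplace (pulled \<alpha> \<beta> i v k) w / (p - w))"
    if w: "w \<in> range (U l)" for w
  proof -
    have "k < i" using Suc.prems(1) by simp
    note E = Suc.IH[OF this, of "us(l := w)", folded A_def, folded l_def, unfolded l(4)]
    have *: "(us(l := w)) r \<in> range (U r)" if "r \<in> {2..<Suc l}" for r
      using that w Suc.prems(2)[of r] l by (cases "r = l") auto
    have pp: "prev_point z (us(l := w)) (Suc l) = w" using l by (simp add: prev_point_def)
    have "{2..<Suc l} = insert l {2..<l}" using l by auto
    hence "(\<Prod>r\<in>{2..<Suc l}. F_fun \<alpha> \<beta> r ((us(l := w)) r) / (prev_point z (us(l := w)) r - (us(l := w)) r)) =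
        F_fun \<alpha> \<beta> l w / (prev_point z (us(l := w)) l - w) *
        (\<Prod>r\<in>{2..<l}. F_fun \<alpha> \<beta> r ((us(l := w)) r) / (prev_point z (us(l := w)) r - (us(l := w)) r))" by simp
    also have "(\<Prod>r\<in>{2..<l}. F_fun \<alpha> \<beta> r ((us(l := w)) r) / (prev_point z (us(l := w)) r - (us(l := w)) r)) = P"
      unfolding P_def by (rule prod.cong) (auto simp: prev_point_def)
    also have "prev_point z (us(l := w)) l = p" using l by (auto simp: prev_point_def p_def)
    finally have pr: "(\<Prod>r\<in>{2..<Suc l}. F_fun \<alpha> \<beta> r ((us(l := w)) r) / (prev_point z (us(l := w)) r - (us(l := w)) r)) = F_fun \<alpha> \<beta> l w / (p - w) * P" .
    have "F_fun \<alpha> \<beta> l w / (p - w) * P * (A * (exp (- (of_real (\<beta> l) * w)) * laplace (pulled \<alpha> \<beta> i v k) w)) =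
        (P * A) * ((F_fun \<alpha> \<beta> l w * exp (- (of_real (\<beta> l) * w))) * laplace (pulled \<alpha> \<beta> i v k) w / (p - w))"
      by simp
    then show ?thesis using E[OF *] unfolding pr pp F_fun_exp[OF l(1)] t_def by (simp only:)
  qed
  have "[l..<i + 1] = l # [Suc l..<i + 1]" using l by (simp add: upt_conv_Cons)
  hence "iterated_integral U [l..<i + 1] (iterate_integrand \<alpha> \<beta> i z v u) us =
      line_integral (U l) (\<lambda>w. iterated_integral U [Suc l..<i + 1] (iterate_integrand \<alpha> \<beta> i z v u) (us(l := w))) / (2 * pi * \<i>)"
    by simp
  also have "line_integral (U l) (\<lambda>w. iterated_integral U [Suc l..<i + 1] (iterate_integrand \<alpha> \<beta> i z v u) (us(l := w))) =
      line_integral (U l) (\<lambda>w. (P * A) * (exp (of_real t * w\<^sup>2 - of_real (\<beta> (l - 1)) * w) * laplace (pulled \<alpha> \<beta> i v k) w / (p - w)))"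
    by (rule line_integral_cong, rule IH) simp
  also have "\<dots> = (P * A) * (2 * pi * \<i> * (exp (- (of_real (\<beta> (l - 1)) * p)) * laplace (pull t (\<beta> (l - 1)) (pulled \<alpha> \<beta> i v k)) p))"
    unfolding line_integral_cmult
  proof (subst line_integral_pull[OF t tm Ul(1) _ _ _ Ul(2)])
    show "0 < sin (2 * pi / 3)" "cos (2 * pi / 3) < 0" by (simp_all add: sin_120 cos_120)
    have "(1 :: real) < sqrt 3" by simp
    then show "\<bar>cos (2 * pi / 3)\<bar> < sin (2 * pi / 3)" by (simp add: sin_120 cos_120)
  qed (use p1 in auto)
  also have "pull t (\<beta> (l - 1)) (pulled \<alpha> \<beta> i v k) = pulled \<alpha> \<beta> i v (Suc k)"
    by (simp add: t_def l_def)
  finally have 1: "iterated_integral U [l..<i + 1] (iterate_integrand \<alpha> \<beta> i z v u) us =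
      P * A * (2 * pi * \<i> * (exp (- (of_real (\<beta> (l - 1)) * p)) * laplace (pulled \<alpha> \<beta> i v (Suc k)) p)) / (2 * pi * \<i>)" .
  have "P * A * (complex_of_real (2 * pi) * \<i> * X) / (2 * pi * \<i>) = P * (A * X)" for X
  proof -
    have "P * A * (complex_of_real (2 * pi) * \<i> * X) = complex_of_real (2 * pi) * \<i> * (P * (A * X))" by (simp only: mult_ac)
    then show ?thesis by (simp only:) (rule nonzero_mult_div_cancel_left, simp)
  qed
  with 1 have "iterated_integral U [l..<i + 1] (iterate_integrand \<alpha> \<beta> i z v u) us =
      P * (A * (exp (- (of_real (\<beta> (l - 1)) * p)) * laplace (pulled \<alpha> \<beta> i v (Suc k)) p))" by (simp only:)
  then show ?case unfolding l(3,5) A_def P_def p_def .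
qed

definition v_integrand :: "(nat \<Rightarrow> real) \<Rightarrow> (nat \<Rightarrow> real) \<Rightarrow> nat \<Rightarrow> complex \<Rightarrow> complex \<Rightarrow> complex \<Rightarrow> complex" where
  "v_integrand \<alpha> \<beta> i z u v = cub (\<alpha> i) 0 v / (v - u) *
     (\<integral>x. chain \<alpha> \<beta> (\<lambda>x. exp (z * of_real x)) (i - 1) x * cut_exp (\<beta> i) v x \<partial>lborel)"

text \<open>What is left of f_1(z) once the factor exp(- \<beta>_1 z), which the
  \<open>u\<close>-integrals leave behind, has removed its linear term.\<close>

definition z_factor :: "(nat \<Rightarrow> real) \<Rightarrow> complex \<Rightarrow> complex" where
  "z_factor \<alpha> z = exp (- (z ^ 3 / 3) + of_real (\<alpha> 1) * z\<^sup>2)"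

lemma kernel_K_v_integral:
  assumes \<alpha>: "strict_mono_on {1..m} \<alpha>" and i: "i \<in> {1..m}" and z: "Re z < 0"
    and V: "v_contour (V i z j u)" and U: "u_contours i z (U i z j u)"
  shows "kernel_K \<alpha> \<beta> V U i z j u = - z_factor \<alpha> z * (line_integral (V i z j u) (v_integrand \<alpha> \<beta> i z u) / (2 * pi * \<i>))"
proof -
  have fz: "f_fun \<alpha> \<beta> 1 z * exp (- (of_real (\<beta> 1) * z)) = z_factor \<alpha> z"
    unfolding f_fun_def z_factor_def exp_add[symmetric] by (rule arg_cong[where f = exp]) simp
  have fv: "1 / f_fun \<alpha> \<beta> i v * exp (of_real (\<beta> i) * v) = cub (\<alpha> i) 0 v" for v
  proof -
    have "1 / f_fun \<alpha> \<beta> i v = exp (- (- (1 / 3) * v ^ 3 + \<alpha> i * v\<^sup>2 + \<beta> i * v))"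
      by (simp only: f_fun_def exp_minus inverse_eq_divide)
    then show ?thesis unfolding cub_def by (simp only: exp_add[symmetric]) (rule arg_cong[where f = exp], simp)
  qed
  have val: "- (f_fun \<alpha> \<beta> 1 z / f_fun \<alpha> \<beta> i v * exp (of_real (\<beta> i) * v) / (v - u)) * (exp (- (of_real (\<beta> 1) * z)) * laplace (pulled \<alpha> \<beta> i v (i - 1)) z) =
      - z_factor \<alpha> z * v_integrand \<alpha> \<beta> i z u v" if v: "Re v > 0" for v
  proof -
    have "laplace (pulled \<alpha> \<beta> i v (i - 1)) z = (\<integral>x. chain \<alpha> \<beta> (\<lambda>x. exp (z * of_real x)) (i - 1) x * cut_exp (\<beta> i) v x \<partial>lborel)"
      using laplace_pulled[OF \<alpha> i v z, of "i - 1"] i by simp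
    then show ?thesis unfolding v_integrand_def fz[symmetric] fv[symmetric] by simp
  qed
  have vpos: "Re v > 0" if "v \<in> range (V i z j u)" for v using V that by (auto simp: v_contour_def)
  have "kernel_K \<alpha> \<beta> V U i z j u = line_integral (V i z j u) (\<lambda>v. - z_factor \<alpha> z * v_integrand \<alpha> \<beta> i z u v) / (2 * pi * \<i>)"
  proof (cases "i = 1")
    case True
    have "f_fun \<alpha> \<beta> 1 z / f_fun \<alpha> \<beta> 1 v * (1 / ((z - v) * (v - u))) = - z_factor \<alpha> z * v_integrand \<alpha> \<beta> i z u v"
      if v: "Re v > 0" for v
    proof -
      have "exp (of_real (\<beta> 1) * v) * (exp (- (of_real (\<beta> 1) * z)) * exp ((z - v) * of_real (\<beta> 1))) = 1"
        unfolding exp_add[symmetric] by (simp add: algebra_simps)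
      hence e: "exp (of_real (\<beta> 1) * v) * (exp (- (of_real (\<beta> 1) * z)) * laplace (cut_exp (\<beta> 1) v) z) = 1 / (v - z)"
        using z v by (subst laplace_cut_exp) (simp_all add: mult.assoc)
      have "- z_factor \<alpha> z * v_integrand \<alpha> \<beta> i z u v = - (f_fun \<alpha> \<beta> 1 z / f_fun \<alpha> \<beta> 1 v) / (v - u) *
          (exp (of_real (\<beta> 1) * v) * (exp (- (of_real (\<beta> 1) * z)) * laplace (cut_exp (\<beta> 1) v) z))"
        unfolding val[OF v, symmetric] using True by simp
      then show ?thesis unfolding e pole_sign by simp
    qed
    then have "line_integral (V i z j u) (\<lambda>v. f_fun \<alpha> \<beta> 1 z / f_fun \<alpha> \<beta> 1 v * (1 / ((z - v) * (v - u)))) =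
        line_integral (V i z j u) (\<lambda>v. - z_factor \<alpha> z * v_integrand \<alpha> \<beta> i z u v)"
      using vpos by (intro line_integral_cong) simp
    then show ?thesis unfolding kernel_K_def using True by (simp only: simp_thms if_True)
  next
    case False
    hence i2: "i \<in> {2..m}" using i by auto
    have "iterated_integral (U i z j u) [2..<i + 1] (iterate_integrand \<alpha> \<beta> i z v u) (\<lambda>_. 0) = - z_factor \<alpha> z * v_integrand \<alpha> \<beta> i z u v"
      if v: "Re v > 0" for v
    proof -
      have e: "i + 1 - (i - 1) = 2" "i - (i - 1) = 1" "i - 1 < i" using i2 by auto
      from iterated_integral_u[OF \<alpha> i2 v z U, of "i - 1" "\<lambda>_. 0" \<beta> u, unfolded e]
      show ?thesis unfolding val[OF v, symmetric] using i2 by (simp add: prev_point_def)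
    qed
    then have "line_integral (V i z j u) (\<lambda>v. iterated_integral (U i z j u) [2..<i + 1] (iterate_integrand \<alpha> \<beta> i z v u) (\<lambda>_. 0)) =
        line_integral (V i z j u) (\<lambda>v. - z_factor \<alpha> z * v_integrand \<alpha> \<beta> i z u v)"
      using vpos by (intro line_integral_cong) simp
    then show ?thesis unfolding kernel_K_def iterate_integrand_def[abs_def] if_not_P[OF False] by (simp only:)
  qed
  then show ?thesis unfolding line_integral_cmult by simp
qed

text \<open>At pi/5 the cosines of the triple and the double angle are opposite, which makes x =
  cos(pi/5) a root of 4 x^2 = 2 x + 1. The claim squared says x^2 < 9/13, and by this equation that
  is the same as x < 23/26.\<close>

lemma cos_pi_fifth_less: "\<bar>cos (pi / 5)\<bar> < 3 / 2 * sin (pi / 5)"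
proof -
  define x where "x = cos (pi / 5)"
  have x0: "x > 0" unfolding x_def by (rule cos_gt_zero) auto
  have s0: "sin (pi / 5) > 0" by (rule sin_gt_zero) auto
  have "cos (3 * (pi / 5)) = cos (pi - 2 * (pi / 5))" by (rule arg_cong[where f = cos]) simp
  also have "\<dots> = - cos (2 * (pi / 5))" unfolding cos_diff cos_pi sin_pi by simp
  finally have "4 * x ^ 3 - 3 * x = - (2 * x\<^sup>2 - 1)"
    unfolding cos_treble_cos cos_double_cos x_def .
  hence "(x + 1) * (4 * x\<^sup>2 - 2 * x - 1) = 0" by (simp add: power3_eq_cube power2_eq_square algebra_simps)
  hence q: "4 * x\<^sup>2 = 2 * x + 1" using x0 by simp
  have "x < 23 / 26"
  proof (rule ccontr)
    assume "\<not> x < 23 / 26"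
    hence "(2 * x) * (20 / 26) \<le> (2 * x) * (2 * x - 1)" by (intro mult_left_mono) auto
    moreover have "(2 * x) * (2 * x - 1) = 1" using q by (simp add: power2_eq_square algebra_simps)
    ultimately show False using \<open>\<not> x < 23 / 26\<close> by linarith
  qed
  hence "x\<^sup>2 < 9 / 13" using q by linarith
  moreover have "(sin (pi / 5))\<^sup>2 = 1 - x\<^sup>2" unfolding x_def by (simp add: sin_squared_eq)
  ultimately have "x\<^sup>2 < 9 / 4 * (sin (pi / 5))\<^sup>2" by linarith
  also have "9 / 4 * r\<^sup>2 = (3 / 2 * r)\<^sup>2" for r :: real by (simp add: power2_eq_square)
  finally have "x < 3 / 2 * sin (pi / 5)" by (rule power2_less_imp_less) (use s0 in simp)
  then show ?thesis using x0 by (simp add: x_def)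
qed

lemma v_line_integral:
  fixes e :: "real \<Rightarrow> complex"
  assumes e: "e \<in> borel_measurable borel" and bd: "\<And>x. norm (e x) \<le> C * exp (p * x)" and p: "p < 0"
    and u: "Re u < 0" and V: "v_contour \<gamma>"
  shows "line_integral \<gamma> (\<lambda>v. cub a 0 v / (v - u) * (\<integral>x. e x * cut_exp b v x \<partial>lborel)) / (2 * pi * \<i>) =
    (\<integral>s. (\<integral>x. indicator {b<..} x * (e x * af a (x + s)) \<partial>lborel) * (indicator {0..} s * exp (of_real s * u)) \<partial>lborel)"
proof -
  define c where "c = 26 * \<bar>a\<bar> + 1"
  have c: "c > 0" "26 * \<bar>a\<bar> \<le> c" "c > a" by (auto simp: c_def)
  have C: "0 \<le> C" using order_trans[OF norm_ge_zero bd[of 0]] by simp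
  define \<phi> where "\<phi> x = indicator {b<..} x * e x" for x
  define \<Phi> where "\<Phi> v = (\<integral>x. e x * cut_exp b v x \<partial>lborel)" for v
  have \<Phi>_eq: "\<Phi> v = laplace \<phi> (- v)" for v
    unfolding \<Phi>_def laplace_def \<phi>_def cut_exp_def by (intro Bochner_Integration.integral_cong refl) simp
  have \<phi>m [measurable]: "\<phi> \<in> borel_measurable borel" unfolding \<phi>_def using e by measurable
  have \<phi>b: "norm (\<phi> x) \<le> C * (indicator {b<..} x * exp (p * x))" for x using bd[of x] by (simp add: \<phi>_def indicator_def)
  have tail: "has_bochner_integral lborel (\<lambda>x. indicator {b<..} x * exp (- r * x)) (exp (- r * b) / r)" if r: "r > 0" for r :: real
  proof -
    have "has_bochner_integral lborel (\<lambda>x. indicator {b<..} x * exp (complex_of_real (- r) * of_real x)) (- exp (of_real (- r) * of_real b) / of_real (- r))"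
      using r by (intro exp_half_line_right) simp
    also have "(\<lambda>x. indicator {b<..} x * exp (complex_of_real (- r) * of_real x)) = (\<lambda>x. complex_of_real (indicator {b<..} x * exp (- r * x)))"
      by (auto simp: indicator_def simp flip: exp_of_real)
    also have "- exp (of_real (- r) * of_real b) / of_real (- r) = complex_of_real (exp (- r * b) / r)"
      by (simp flip: exp_of_real)
    finally show ?thesis by (simp only: has_bochner_integral_iff complex_of_real_integrable_eq integral_complex_of_real of_real_eq_iff)
  qed
  have eb: "norm (exp (w * of_real x) * \<phi> x) \<le> C * (indicator {b<..} x * exp (- (- Re w - p) * x))" for w x
  proof -
    have "norm (exp (w * of_real x) * \<phi> x) \<le> exp (Re w * x) * (C * (indicator {b<..} x * exp (p * x)))"
      unfolding norm_mult using \<phi>b[of x] by (intro mult_mono) auto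
    also have "\<dots> = C * (indicator {b<..} x * exp (- (- Re w - p) * x))"
      by (simp add: algebra_simps indicator_def flip: exp_add)
    finally show ?thesis .
  qed
  have dec: "decays \<phi>"
    unfolding decays_def
  proof (intro conjI allI impI \<phi>m)
    fix k :: real assume k: "k < 0"
    show "integrable lborel (\<lambda>x. exp (k * x) * norm (\<phi> x))"
    proof (rule Bochner_Integration.integrable_bound)
      show "integrable lborel (\<lambda>x. C * (indicator {b<..} x * exp (- (- k - p) * x)))"
        using k p by (intro integrable_mult_right integrable_exp_tail) simp
      have "norm (exp (k * x) * norm (\<phi> x)) \<le> norm (C * (indicator {b<..} x * exp (- (- k - p) * x)))" for x
        using order_trans[OF eb[of "of_real k" x] abs_ge_self] by (simp add: norm_mult)
      then show "AE x in lborel. norm (exp (k * x) * norm (\<phi> x)) \<le> norm (C * (indicator {b<..} x * exp (- (- k - p) * x)))" by simp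
    qed measurable
  qed
  define C' where "C' = C * exp (p * b) / (- p)"
  have \<Phi>b: "norm (\<Phi> v) \<le> C' * exp (- b * Re v)" if v: "Re v > 0" for v
  proof -
    have r: "Re v - p > 0" using v p by simp
    have "norm (\<Phi> v) \<le> (\<integral>x. norm (exp (- v * of_real x) * \<phi> x) \<partial>lborel)"
      unfolding \<Phi>_eq laplace_def by (rule Bochner_Integration.integral_norm_bound)
    also have "\<dots> \<le> (\<integral>x. C * (indicator {b<..} x * exp (- (Re v - p) * x)) \<partial>lborel)"
    proof (rule Bochner_Integration.integral_mono)
      show "integrable lborel (\<lambda>x. norm (exp (- v * of_real x) * \<phi> x))" using v by (intro integrable_norm decays_integrable dec) simp
      show "integrable lborel (\<lambda>x. C * (indicator {b<..} x * exp (- (Re v - p) * x)))" by (intro integrable_mult_right integrable_exp_tail r)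
      show "norm (exp (- v * of_real x) * \<phi> x) \<le> C * (indicator {b<..} x * exp (- (Re v - p) * x))" for x using eb[of "- v" x] by simp
    qed
    also have "\<dots> = C * (exp (- (Re v - p) * b) / (Re v - p))" using has_bochner_integral_integral_eq[OF tail[OF r]] by simp
    also have "\<dots> \<le> C * (exp (- (Re v - p) * b) / (- p))" using C p v by (intro mult_left_mono divide_left_mono mult_pos_pos) auto
    also have "exp (- (Re v - p) * b) = exp (p * b) * exp (- b * Re v)" by (simp add: algebra_simps flip: exp_add)
    finally show ?thesis by (simp add: C'_def)
  qed
  have C'0: "0 \<le> C'" unfolding C'_def using C p by (intro divide_nonneg_pos) auto
  define f where "f v = cub a 0 v / (v - u) * \<Phi> v" for v
  have vu: "c \<le> norm (v - u)" if "c \<le> Re v" for v using complex_Re_le_cmod[of "v - u"] u that by simp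
  have shift: "line_integral \<gamma> f = 2 * pi * \<i> * vline c f"
  proof (rule line_integral_shift[where D = "{v. 0 < Re v}" and \<sigma> = 1 and \<kappa> = "3 / 2" and \<theta> = "pi / 5"])
    show "open {v. 0 < Re v}" "convex {v. 0 < Re v}" by (simp_all add: open_halfspace_Re_gt convex_halfspace_Re_gt)
    have "(laplace \<phi> \<circ> uminus) holomorphic_on {v. 0 < Re v}"
      by (rule holomorphic_on_compose_gen[OF _ laplace_holomorphic[OF dec]]) (auto intro!: holomorphic_intros)
    then show "f holomorphic_on {v. 0 < Re v}"
      unfolding f_def \<Phi>_eq comp_def using u by (intro holomorphic_intros) auto
    show "unbounded_contour (pi / 5) \<gamma>" "\<And>t. \<gamma> t \<in> {v. 0 < Re v}" using V by (auto simp: v_contour_def)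
    show "0 < sin (pi / 5)" by (rule sin_gt_zero) auto
    show "\<bar>cos (pi / 5)\<bar> < 3 / 2 * sin (pi / 5)" by (rule cos_pi_fifth_less)
    show "0 < 1 * cos (pi / 5)" using cos_gt_zero[of "pi / 5"] by simp
    show "Complex c q \<in> {v. 0 < Re v}" for q using c by simp
    fix w assume w: "16 / c + 16 * \<bar>b\<bar> + 1 \<le> \<bar>Im w\<bar>" "\<bar>Re w\<bar> \<le> 3 / 2 * \<bar>Im w\<bar>" "0 \<le> 1 * (Re w - c)"
    hence re: "c \<le> Re w" "0 < Re w" using c by auto
    \<comment> \<open>The factor exp(- b Re w) in the bound for \<Phi> is taken into the cubic
      exponential as its linear coefficient, so that the sector bound applies with y = b.\<close>
    have "cub a b w = cub a 0 w * exp (- (of_real b * w))" using cub_add[of a 0 b w] by simp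
    hence "norm (cub a 0 w) * exp (- b * Re w) = norm (cub a b w)" by (simp add: norm_mult)
    also have "\<dots> \<le> exp (- \<bar>Im w\<bar>)" by (rule cub_sector_bound[OF c(1,2) re(1) w(2,1)])
    finally have cb: "norm (cub a 0 w) * exp (- b * Re w) \<le> exp (- \<bar>Im w\<bar>)" .
    have "norm (f w) = norm (cub a 0 w) * norm (\<Phi> w) / norm (w - u)" by (simp add: f_def norm_mult norm_divide)
    also have "\<dots> \<le> norm (cub a 0 w) * (C' * exp (- b * Re w)) / c"
      using vu[OF re(1)] c(1) by (intro frac_le mult_left_mono \<Phi>b re mult_nonneg_nonneg C'0) auto
    also have "\<dots> = C' / c * (norm (cub a 0 w) * exp (- b * Re w))" by simp
    also have "\<dots> \<le> C' / c * exp (- \<bar>Im w\<bar>)" using C'0 c by (intro mult_left_mono cb) auto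
    finally show "w \<in> {v. 0 < Re v} \<and> norm (f w) \<le> C' / c * exp (- \<bar>Im w\<bar>)" using re by simp
  qed
  define G where "G q = cub a 0 (Complex c q) * \<Phi> (Complex c q)" for q
  have pairc: "(\<lambda>(x, q). h x q) \<in> borel_measurable (lborel \<Otimes>\<^sub>M lborel) \<Longrightarrow> (\<lambda>y. h (fst y) (snd y)) \<in> borel_measurable (lborel \<Otimes>\<^sub>M lborel)"
    for h :: "real \<Rightarrow> real \<Rightarrow> complex" by (simp add: case_prod_beta')
  have cubm: "(\<lambda>y. cub a (fst y) (Complex c (snd y))) \<in> borel_measurable (lborel \<Otimes>\<^sub>M lborel)"
    by (rule pairc, rule continuous_measurable2) (unfold cub_def Complex_eq, intro continuous_intros; simp)
  have cubm': "(\<lambda>y. cub a (fst y + s) (Complex c (snd y))) \<in> borel_measurable (lborel \<Otimes>\<^sub>M lborel)" for s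
    by (rule pairc, rule continuous_measurable2) (unfold cub_def Complex_eq, intro continuous_intros; simp)
  \<comment> \<open>Exchanges the contour integral behind \<open>af\<close> with the integral over
    \<open>x\<close>. After this only a plain exponential in \<open>s\<close> stands under the
    contour integral, ready to be integrated over the half line to give 1 / (v - u).\<close>
  have J: "(\<integral>x. \<phi> x * af a (x + s) \<partial>lborel) = (\<integral>q. G q * exp (- (of_real s * Complex c q)) \<partial>lborel) / (2 * pi)" for s
  proof -
    define F where "F x q = \<phi> x * cub a (x + s) (Complex c q)" for x q
    define k where "k = exp (c ^ 3 / 3 - a * c\<^sup>2 - s * c)"
    have nc: "norm (cub a (x + s) (Complex c q)) = (exp (- c * x) * k) * exp (- (c - a) * q\<^sup>2)" for x q
      unfolding norm_cub_vertical k_def by (simp add: algebra_simps flip: exp_add)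
    have mF: "(\<lambda>(x, q). F x q) \<in> borel_measurable (lborel \<Otimes>\<^sub>M lborel)"
      unfolding F_def case_prod_beta' by (rule borel_measurable_times[OF _ cubm']) measurable
    have g: "has_bochner_integral lborel (\<lambda>q. (norm (\<phi> x) * (exp (- c * x) * k)) * exp (- (c - a) * q\<^sup>2))
        ((norm (\<phi> x) * (exp (- c * x) * k)) * (\<integral>q. exp (- (c - a) * q\<^sup>2) \<partial>lborel))" for x
      using c by (intro has_bochner_integral_mult_right has_bochner_integral_integrable integrable_gauss) simp
    have n: "norm (F x q) \<le> (norm (\<phi> x) * (exp (- c * x) * k)) * exp (- (c - a) * q\<^sup>2)" for x q
      by (simp only: F_def norm_mult nc mult.assoc order_refl)
    have Gi: "integrable lborel (\<lambda>x. (norm (\<phi> x) * (exp (- c * x) * k)) * (\<integral>q. exp (- (c - a) * q\<^sup>2) \<partial>lborel))"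
    proof -
      have "integrable lborel (\<lambda>x. exp (- c * x) * norm (\<phi> x))"
        using dec spec[of "\<lambda>k. k < 0 \<longrightarrow> integrable lborel (\<lambda>x. exp (k * x) * norm (\<phi> x))" "- c"] c(1) unfolding decays_def by simp
      then have "integrable lborel (\<lambda>x. (exp (- c * x) * norm (\<phi> x)) * (k * (\<integral>q. exp (- (c - a) * q\<^sup>2) \<partial>lborel)))" by (rule integrable_mult_left)
      then show ?thesis by (simp only: mult_ac)
    qed
    note R = fubini_dominated(2)[OF sf_lborel sf_lborel mF g n Gi]
    have 1: "(\<integral>q. F x q \<partial>lborel) = of_real (2 * pi) * (\<phi> x * af a (x + s))" for x
      unfolding F_def af_vline[OF c(3)] vline_def by simp
    have 2: "(\<integral>x. F x q \<partial>lborel) = G q * exp (- (of_real s * Complex c q))" for q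
    proof -
      have "cub a (x + s) w = cub a 0 w * exp (- (of_real s * w)) * exp (- w * of_real x)" for x w
        unfolding cub_def exp_add[symmetric] by (rule arg_cong[where f = exp]) (simp add: algebra_simps)
      then have "F x q = (cub a 0 (Complex c q) * exp (- (of_real s * Complex c q))) * (exp (- Complex c q * of_real x) * \<phi> x)" for x
        unfolding F_def by (simp only: mult_ac)
      then show ?thesis unfolding G_def \<Phi>_eq laplace_def by simp
    qed
    show ?thesis using R unfolding 1 2 integral_mult_right_zero by (simp add: nonzero_eq_divide_eq mult.commute)
  qed
  define K where "K = C' * exp (- b * c) * exp (c ^ 3 / 3 - a * c\<^sup>2)"
  have Gb: "norm (G q) \<le> K * exp (- (c - a) * q\<^sup>2)" for q
  proof -
    have "norm (G q) \<le> (exp (c ^ 3 / 3 - a * c\<^sup>2 - 0 * c) * exp (- (c - a) * q\<^sup>2)) * (C' * exp (- b * c))"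
      unfolding G_def norm_mult norm_cub_vertical using \<Phi>b[of "Complex c q"] c by (intro mult_left_mono) auto
    then show ?thesis by (simp add: K_def mult_ac)
  qed
  have Gm: "G \<in> borel_measurable borel"
  proof -
    have "continuous_on {v. 0 < Re v} \<Phi>"
    proof (rule holomorphic_on_imp_continuous_on)
      have "(laplace \<phi> \<circ> uminus) holomorphic_on {v. 0 < Re v}"
        by (rule holomorphic_on_compose_gen[OF _ laplace_holomorphic[OF dec]]) (auto intro!: holomorphic_intros)
      then show "\<Phi> holomorphic_on {v. 0 < Re v}" unfolding \<Phi>_eq[abs_def] comp_def .
    qed
    then have "continuous_on UNIV (\<lambda>q. \<Phi> (Complex c q))"
      by (rule continuous_on_compose2) (use c in \<open>auto simp: Complex_eq intro!: continuous_intros\<close>)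
    moreover have "continuous_on UNIV (\<lambda>q. cub a 0 (Complex c q))" unfolding cub_def Complex_eq by (intro continuous_intros) simp
    ultimately show ?thesis unfolding G_def by (intro borel_measurable_continuous_onI continuous_on_mult)
  qed
  define H where "H s q = (indicator {0..} s * exp (of_real s * u)) * (G q * exp (- (of_real s * Complex c q)))" for s q
  have mH: "(\<lambda>(s, q). H s q) \<in> borel_measurable (lborel \<Otimes>\<^sub>M lborel)"
  proof -
    have m1: "(\<lambda>y. exp (- (of_real (fst y) * Complex c (snd y)))) \<in> borel_measurable (lborel \<Otimes>\<^sub>M lborel)"
      by (rule pairc, rule continuous_measurable2) (unfold Complex_eq, intro continuous_intros)
    have m2: "(\<lambda>y. G (snd y)) \<in> borel_measurable (lborel \<Otimes>\<^sub>M lborel)"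
      by (rule measurable_compose[OF measurable_snd]) (use Gm in simp)
    have m0: "(\<lambda>y. indicator {0..} (fst y) * exp (complex_of_real (fst y) * u)) \<in> borel_measurable (lborel \<Otimes>\<^sub>M lborel)" by measurable
    show ?thesis unfolding H_def case_prod_beta' by (rule borel_measurable_times[OF m0 borel_measurable_times[OF m2 m1]])
  qed
  have gH: "has_bochner_integral lborel (\<lambda>q. (indicator {0..} s * exp (- (c - Re u) * s) * K) * exp (- (c - a) * q\<^sup>2))
      ((indicator {0..} s * exp (- (c - Re u) * s) * K) * (\<integral>q. exp (- (c - a) * q\<^sup>2) \<partial>lborel))" for s
    using c by (intro has_bochner_integral_mult_right has_bochner_integral_integrable integrable_gauss) simp
  have nH: "norm (H s q) \<le> (indicator {0..} s * exp (- (c - Re u) * s) * K) * exp (- (c - a) * q\<^sup>2)" for s q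
  proof -
    have "norm (H s q) = indicator {0..} s * exp (- (c - Re u) * s) * norm (G q)"
      by (simp add: H_def norm_mult indicator_def algebra_simps flip: exp_add)
    also have "\<dots> \<le> indicator {0..} s * exp (- (c - Re u) * s) * (K * exp (- (c - a) * q\<^sup>2))" by (intro mult_left_mono Gb) simp
    finally show ?thesis by (simp only: mult.assoc)
  qed
  have GH: "integrable lborel (\<lambda>s. (indicator {0..} s * exp (- (c - Re u) * s) * K) * (\<integral>q. exp (- (c - a) * q\<^sup>2) \<partial>lborel))"
    using u c by (intro integrable_mult_left integrable_exp_tail) simp
  note R = fubini_dominated(2)[OF sf_lborel sf_lborel mH gH nH GH]
  have 1: "(\<integral>q. H s q \<partial>lborel) = of_real (2 * pi) * ((\<integral>x. \<phi> x * af a (x + s) \<partial>lborel) * (indicator {0..} s * exp (of_real s * u)))" for s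
    unfolding J unfolding H_def by simp
  have 2: "(\<integral>s. H s q \<partial>lborel) = f (Complex c q)" for q
  proof -
    define w where "w = u - Complex c q"
    have w: "Re w < 0" using u c by (simp add: w_def)
    have "AE s in lborel. H s q = G q * (indicator {0<..} s * exp (w * of_real s))"
      using AE_lborel_singleton[of 0]
    proof eventually_elim
      fix s :: real assume "s \<noteq> 0"
      have "exp (of_real s * u) * exp (- (of_real s * Complex c q)) = exp (w * of_real s)"
        unfolding w_def exp_add[symmetric] by (rule arg_cong[where f = exp]) (simp add: algebra_simps)
      hence "H s q = G q * (indicator {0..} s * exp (w * of_real s))" unfolding H_def by (simp add: mult_ac)
      then show "H s q = G q * (indicator {0<..} s * exp (w * of_real s))" using \<open>s \<noteq> 0\<close> by (simp add: indicator_def)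
    qed
    then have "(\<integral>s. H s q \<partial>lborel) = (\<integral>s. G q * (indicator {0<..} s * exp (w * of_real s)) \<partial>lborel)"
      by (intro Bochner_Integration.integral_cong_AE) (unfold H_def, measurable)
    also have "\<dots> = G q * (- exp (w * of_real 0) / w)"
      using has_bochner_integral_integral_eq[OF exp_half_line_right[OF w, of 0]] by simp
    also have "- exp (w * of_real 0) / w = 1 / (Complex c q - u)" unfolding w_def by simp (metis minus_diff_eq minus_divide_right)
    finally show ?thesis by (simp add: f_def G_def)
  qed
  have "line_integral \<gamma> f / (2 * pi * \<i>) = (\<integral>q. f (Complex c q) \<partial>lborel) / (2 * pi)"
    unfolding shift vline_def by simp
  also have "\<dots> = (\<integral>s. (\<integral>x. \<phi> x * af a (x + s) \<partial>lborel) * (indicator {0..} s * exp (of_real s * u)) \<partial>lborel)"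
    using R unfolding 1 2 integral_mult_right_zero by (simp add: nonzero_divide_eq_eq mult.commute)
  finally show ?thesis unfolding f_def \<Phi>_def \<phi>_def mult.assoc .
qed

text \<open>The left factor of \<open>kernel_K\<close> through the half line, as a function of
  \<open>z\<close> and the half-line variable \<open>s\<close>; the right factor is exp(s
  u).\<close>

definition resolvent :: "(nat \<Rightarrow> real) \<Rightarrow> (nat \<Rightarrow> real) \<Rightarrow> nat \<Rightarrow> complex \<Rightarrow> real \<Rightarrow> complex" where
  "resolvent \<alpha> \<beta> i z s = - z_factor \<alpha> z *
     (\<integral>x. indicator {\<beta> i<..} x * (chain \<alpha> \<beta> (\<lambda>x. exp (z * of_real x)) (i - 1) x * af (\<alpha> i) (x + s)) \<partial>lborel)"

lemma kernel_K_resolvent: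
  assumes \<alpha>: "strict_mono_on {1..m} \<alpha>" and i: "i \<in> {1..m}" and z: "Re z < 0" and u: "Re u < 0"
    and V: "v_contour (V i z j u)" and U: "u_contours i z (U i z j u)"
  shows "kernel_K \<alpha> \<beta> V U i z j u = (\<integral>s. resolvent \<alpha> \<beta> i z s * (indicator {0..} s * exp (of_real s * u)) \<partial>lborel)"
proof -
  let ?e = "chain \<alpha> \<beta> (\<lambda>x. exp (z * complex_of_real x)) (i - 1)"
  have fm: "(\<lambda>x. exp (z * complex_of_real x)) \<in> borel_measurable borel" by measurable
  have fb: "norm (exp (z * complex_of_real x)) \<le> 1 * exp (Re z * x)" for x by simp
  have "i - 1 < m" using i by auto
  note cb = chain_bound[OF \<alpha> fm fb this]
  show ?thesis
    unfolding kernel_K_v_integral[where V = V and U = U and i = i and z = z and j = j and u = u, OF \<alpha> i z V U] v_integrand_def[abs_def]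
      v_line_integral[OF chain_measurable[OF fm] cb z u V] resolvent_def mult.assoc integral_mult_right_zero ..
qed

section \<open>The Fredholm determinant on the contour\<close>

lemma Gamma_L_Re_Im: "Re (Gamma_L t) = - 1 - \<bar>t\<bar> / 2" "Im (Gamma_L t) = t * (sqrt 3 / 2)"
  using wedge_Re_Im[of "- 1" "2 * pi / 3" t] by (simp_all add: Gamma_L_def cos_120 sin_120)

lemma Gamma_L_Re_le: "Re (Gamma_L t) \<le> - 1" by (simp add: Gamma_L_Re_Im)

lemma Gamma_L_continuous: "continuous_on S Gamma_L"
  unfolding Gamma_L_def by (rule wedge_continuous)

lemma Gamma_L_measurable [measurable]: "Gamma_L \<in> borel_measurable borel"
  by (rule borel_measurable_continuous_onI) (rule Gamma_L_continuous)

lemma Gamma_L_density_eq: "Gamma_L_density t =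
    (if t = 0 then Gamma_L_density 0 else if t > 0 then cis (2 * pi / 3) / (2 * pi * \<i>) else - cis (- (2 * pi / 3)) / (2 * pi * \<i>))"
  using vector_derivative_at[OF wedge_vector_derivative(1)] vector_derivative_at[OF wedge_vector_derivative(2)]
  unfolding Gamma_L_density_def Gamma_L_def by auto

lemma Gamma_L_density_measurable [measurable]: "Gamma_L_density \<in> borel_measurable borel"
proof -
  have "(\<lambda>t::real. if t = 0 then Gamma_L_density 0 else if t > 0 then cis (2 * pi / 3) / (2 * pi * \<i>) else - cis (- (2 * pi / 3)) / (2 * pi * \<i>)) \<in> borel_measurable borel"
    by measurable
  then show ?thesis unfolding Gamma_L_density_eq[abs_def, symmetric] .
qed

text \<open>At the corner t = 0 the value of \<open>vector_derivative\<close> is unspecified. It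
  enters the constant because domination is required at every point, not only almost
  everywhere.\<close>

definition density_bound :: real where "density_bound = norm (Gamma_L_density 0) + 1"

lemma norm_Gamma_L_density: "norm (Gamma_L_density t) \<le> density_bound" and density_bound_nonneg: "0 \<le> density_bound"
proof -
  have "1 / (2 * pi) \<le> 1" using pi_gt3 by simp
  then show "norm (Gamma_L_density t) \<le> density_bound"
    by (subst Gamma_L_density_eq) (auto simp: density_bound_def norm_divide norm_mult add_increasing)
  show "0 \<le> density_bound" by (simp add: density_bound_def)
qed

lemma cubic_exponent_le:
  fixes a2 a1 a0 \<tau> :: real
  assumes "3 * (\<bar>a2\<bar> + \<bar>a1\<bar> + 1) \<le> \<tau>"
  shows "- (\<tau> ^ 3) / 3 + a2 * \<tau>\<^sup>2 + a1 * \<tau> + a0 \<le> a0 - \<tau>"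
proof -
  define b2 b1 where "b2 = \<bar>a2\<bar>" and "b1 = \<bar>a1\<bar>"
  have b: "0 \<le> b2" "0 \<le> b1" "a2 \<le> b2" "a1 \<le> b1" by (simp_all add: b2_def b1_def)
  have as: "3 * (b2 + b1 + 1) \<le> \<tau>" using assms by (simp only: b2_def b1_def)
  have \<tau>: "1 \<le> \<tau>" using as b by (simp add: distrib_left)
  have "(b2 + b1 + 1) * \<tau>\<^sup>2 \<le> \<tau> / 3 * \<tau>\<^sup>2" using as by (intro mult_right_mono) auto
  also have "\<dots> = \<tau> ^ 3 / 3" by (simp add: power3_eq_cube power2_eq_square)
  finally have 1: "b2 * \<tau>\<^sup>2 + (b1 + 1) * \<tau>\<^sup>2 \<le> \<tau> ^ 3 / 3" by (simp add: algebra_simps)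
  have 2: "a2 * \<tau>\<^sup>2 \<le> b2 * \<tau>\<^sup>2" using b by (intro mult_right_mono) auto
  have "\<tau> \<le> \<tau>\<^sup>2" using \<tau> by (simp add: power2_eq_square)
  hence 3: "(b1 + 1) * \<tau> \<le> (b1 + 1) * \<tau>\<^sup>2" using b by (intro mult_left_mono) auto
  have 4: "a1 * \<tau> \<le> b1 * \<tau>" using b \<tau> by (intro mult_right_mono) auto
  have 5: "(b1 + 1) * \<tau> = b1 * \<tau> + \<tau>" by (simp add: distrib_right)
  have "- (\<tau> ^ 3) / 3 = - (\<tau> ^ 3 / 3)" by simp
  then show ?thesis using 1 2 3 4 5 by linarith
qed

text \<open>In the directions of \<Gamma>_L the cube of z is asymptotically positive, so f_1 decays
  like exp(- |t|^3 / 3). This beats the growth exp(A (Re z)^2) that the heat steps of the chain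
  produce and the factor exp(B Re z) of the thresholds, for all real \<open>A\<close> and
  \<open>B\<close>.\<close>

definition ray_weight :: "(nat \<Rightarrow> real) \<Rightarrow> real \<Rightarrow> real \<Rightarrow> real \<Rightarrow> real" where
  "ray_weight \<alpha> A B t = norm (z_factor \<alpha> (Gamma_L t)) * exp (A * (Re (Gamma_L t))\<^sup>2 + B * Re (Gamma_L t))"

lemma ray_weight_integrable: "integrable lborel (ray_weight \<alpha> A B)"
proof -
  define a2 where "a2 = - 1 / 2 - \<alpha> 1 / 2 + A / 4"
  define a1 where "a1 = 1 / 2 + \<alpha> 1 + A - B / 2"
  define a0 where "a0 = 1 / 3 + \<alpha> 1 + A - B"
  have eq: "ray_weight \<alpha> A B t = exp (- (\<bar>t\<bar> ^ 3) / 3 + a2 * \<bar>t\<bar>\<^sup>2 + a1 * \<bar>t\<bar> + a0)" for t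
  proof -
    define x y where "x = Re (Gamma_L t)" and "y = Im (Gamma_L t)"
    have x: "x = - 1 - \<bar>t\<bar> / 2" and y: "y\<^sup>2 = 3 / 4 * \<bar>t\<bar>\<^sup>2"
      by (simp_all add: x_def y_def Gamma_L_Re_Im power_mult_distrib power_divide)
    have "Re (- (Gamma_L t ^ 3 / 3) + complex_of_real (\<alpha> 1) * (Gamma_L t)\<^sup>2) = - (x ^ 3 - 3 * x * y\<^sup>2) / 3 + \<alpha> 1 * (x\<^sup>2 - y\<^sup>2)"
      unfolding x_def y_def by (simp add: power3_eq_cube power2_eq_square field_simps)
    also have "\<dots> + (A * x\<^sup>2 + B * x) = - (\<bar>t\<bar> ^ 3) / 3 + a2 * \<bar>t\<bar>\<^sup>2 + a1 * \<bar>t\<bar> + a0"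
      unfolding y unfolding x a2_def a1_def a0_def power3_eq_cube power2_eq_square by (simp add: field_simps)
    finally show ?thesis unfolding ray_weight_def z_factor_def norm_exp_eq_Re exp_add[symmetric] x_def by simp
  qed
  have "integrable lborel (\<lambda>t. complex_of_real (ray_weight \<alpha> A B t))"
  proof (rule integrable_exp_decay)
    show "continuous_on UNIV (\<lambda>t. complex_of_real (ray_weight \<alpha> A B t))"
      unfolding eq by (intro continuous_intros) auto
    fix t :: real assume "3 * (\<bar>a2\<bar> + \<bar>a1\<bar> + 1) \<le> \<bar>t\<bar>"
    from cubic_exponent_le[OF this, of a0]
    have "exp (- (\<bar>t\<bar> ^ 3) / 3 + a2 * \<bar>t\<bar>\<^sup>2 + a1 * \<bar>t\<bar> + a0) \<le> exp (a0 + - \<bar>t\<bar>)"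
      by (simp only: exp_le_cancel_iff diff_conv_add_uminus)
    then show "norm (complex_of_real (ray_weight \<alpha> A B t)) \<le> exp a0 * exp (- \<bar>t\<bar>)"
      unfolding eq norm_of_real abs_exp_cancel exp_add[of a0] .
  qed
  then show ?thesis by (simp only: complex_of_real_integrable_eq)
qed

definition ray_density :: "(nat \<Rightarrow> real) \<Rightarrow> real \<Rightarrow> real \<Rightarrow> complex" where
  "ray_density \<alpha> s t = Gamma_L_density t * exp (of_real s * Gamma_L t) * z_factor \<alpha> (Gamma_L t)"

lemma z_factor_continuous: "continuous_on S (z_factor \<alpha>)"
  unfolding z_factor_def by (intro continuous_intros) auto

lemma z_factor_measurable [measurable]: "z_factor \<alpha> \<in> borel_measurable borel"
  by (rule borel_measurable_continuous_onI) (rule z_factor_continuous)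

lemma ray_density_measurable [measurable]: "ray_density \<alpha> s \<in> borel_measurable borel"
  unfolding ray_density_def by measurable

lemma norm_ray_density:
  "norm (ray_density \<alpha> s t) * exp (A * (Re (Gamma_L t))\<^sup>2 + B * Re (Gamma_L t)) \<le> density_bound * ray_weight \<alpha> A (B + s) t"
proof -
  have "norm (ray_density \<alpha> s t) * exp (A * (Re (Gamma_L t))\<^sup>2 + B * Re (Gamma_L t)) =
      norm (Gamma_L_density t) * (norm (z_factor \<alpha> (Gamma_L t)) * (exp (s * Re (Gamma_L t)) * exp (A * (Re (Gamma_L t))\<^sup>2 + B * Re (Gamma_L t))))"
    by (simp add: ray_density_def norm_mult mult_ac)
  also have "exp (s * Re (Gamma_L t)) * exp (A * (Re (Gamma_L t))\<^sup>2 + B * Re (Gamma_L t)) = exp (A * (Re (Gamma_L t))\<^sup>2 + (B + s) * Re (Gamma_L t))"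
    by (simp add: algebra_simps flip: exp_add)
  also have "norm (Gamma_L_density t) * (norm (z_factor \<alpha> (Gamma_L t)) * exp (A * (Re (Gamma_L t))\<^sup>2 + (B + s) * Re (Gamma_L t))) \<le>
      density_bound * ray_weight \<alpha> A (B + s) t"
    unfolding ray_weight_def by (intro mult_right_mono norm_Gamma_L_density) simp
  finally show ?thesis .
qed

lemma ray_density_integrable:
  "integrable lborel (\<lambda>t. norm (ray_density \<alpha> s t) * exp (A * (Re (Gamma_L t))\<^sup>2 + B * Re (Gamma_L t)))"
proof (rule Bochner_Integration.integrable_bound)
  show "integrable lborel (\<lambda>t. density_bound * ray_weight \<alpha> A (B + s) t)" by (intro integrable_mult_right ray_weight_integrable)
  show "AE t in lborel. norm (norm (ray_density \<alpha> s t) * exp (A * (Re (Gamma_L t))\<^sup>2 + B * Re (Gamma_L t))) \<le> norm (density_bound * ray_weight \<alpha> A (B + s) t)"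
    by (rule AE_I2) (use order_trans[OF norm_ray_density abs_ge_self] in simp)
qed measurable

lemma exp_chain_measurable2: "(\<lambda>(t, x). chain \<alpha> \<beta> (\<lambda>x. exp (Gamma_L t * of_real x)) n x) \<in> borel_measurable (lborel \<Otimes>\<^sub>M borel)"
  by (rule chain_measurable2) measurable

lemma norm_exp_chain:
  assumes \<alpha>: "strict_mono_on {1..m} \<alpha>" and n: "n < m"
  shows "norm (chain \<alpha> \<beta> (\<lambda>x. exp (z * of_real x)) n x) \<le> exp ((\<alpha> (n + 1) - \<alpha> 1) * (Re z)\<^sup>2) * exp (Re z * x)"
proof -
  have fm: "(\<lambda>x. exp (z * complex_of_real x)) \<in> borel_measurable borel" by measurable
  have fb: "norm (exp (z * complex_of_real x)) \<le> 1 * exp (Re z * x)" for x by simp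
  show ?thesis using chain_bound[OF \<alpha> fm fb n] by simp
qed

text \<open>The integral over \<Gamma>_L commutes with every \<open>push\<close>, by Fubini. It may
  therefore be carried out at level 1, where \<open>Gamma_L_integral\<close> turns the exponential
  exp(z x) into an Airy function; the chain on the contour side becomes the one on the Airy
  side.\<close>

lemma ray_chain:
  assumes \<alpha>: "strict_mono_on {1..m} \<alpha>"
  shows "n < m \<Longrightarrow> (\<integral>t. ray_density \<alpha> s t * chain \<alpha> \<beta> (\<lambda>x. exp (Gamma_L t * of_real x)) n y \<partial>lborel) = chain \<alpha> \<beta> (\<lambda>x. af (- \<alpha> 1) (x + s)) n y"
proof (induction n arbitrary: y)
  case 0
  define h where "h t = ray_density \<alpha> s t * exp (Gamma_L t * of_real y)" for t
  have e: "cub (- \<alpha> 1) (y + s) (- Gamma_L t) * vector_derivative Gamma_L (at t) = 2 * pi * \<i> * h t" for t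
  proof -
    have "cub (- \<alpha> 1) (y + s) (- Gamma_L t) = exp (of_real s * Gamma_L t) * z_factor \<alpha> (Gamma_L t) * exp (Gamma_L t * of_real y)"
      unfolding cub_def z_factor_def exp_add[symmetric] by (rule arg_cong[where f = exp]) (simp add: algebra_simps)
    then show ?thesis by (simp add: h_def ray_density_def Gamma_L_density_def)
  qed
  have "integrable lborel h"
  proof (rule Bochner_Integration.integrable_bound)
    show "integrable lborel (\<lambda>t. norm (ray_density \<alpha> s t) * exp (0 * (Re (Gamma_L t))\<^sup>2 + y * Re (Gamma_L t)))" by (rule ray_density_integrable)
    show "AE t in lborel. norm (h t) \<le> norm (norm (ray_density \<alpha> s t) * exp (0 * (Re (Gamma_L t))\<^sup>2 + y * Re (Gamma_L t)))"
      by (rule AE_I2) (simp add: h_def norm_mult mult.commute)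
  qed (unfold h_def, measurable)
  hence "integral UNIV (\<lambda>t. 2 * pi * \<i> * h t) = (\<integral>t. 2 * pi * \<i> * h t \<partial>lborel)"
    by (intro integral_lborel integrable_mult_right)
  also have "integral UNIV (\<lambda>t. 2 * pi * \<i> * h t) = line_integral Gamma_L (\<lambda>z. cub (- \<alpha> 1) (y + s) (- z))"
    unfolding line_integral_def e ..
  finally have "2 * pi * \<i> * af (- \<alpha> 1) (y + s) = 2 * pi * \<i> * integral\<^sup>L lborel h"
    unfolding Gamma_L_integral integral_mult_right_zero .
  then show ?case by (simp add: h_def[abs_def])
next
  case (Suc n)
  let ?c = "\<lambda>t. chain \<alpha> \<beta> (\<lambda>x. exp (Gamma_L t * complex_of_real x)) n"
  define \<tau> b A where "\<tau> = \<alpha> (n + 2) - \<alpha> (n + 1)" and "b = \<beta> (n + 1)" and "A = \<alpha> (n + 1) - \<alpha> 1"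
  have \<tau>: "0 < \<tau>" unfolding \<tau>_def using Suc.prems by (intro increasing_step[OF \<alpha>]) auto
  have nm: "n < m" using Suc.prems by simp
  define F where "F t x = ray_density \<alpha> s t * (indicator {..b} x * (?c t x * of_real (heat \<tau> (x - y))))" for t x
  have mF: "(\<lambda>(t, x). F t x) \<in> borel_measurable (lborel \<Otimes>\<^sub>M lborel)"
  proof -
    have "(\<lambda>q. (fst q, snd q)) \<in> measurable (lborel \<Otimes>\<^sub>M lborel) (lborel \<Otimes>\<^sub>M borel)" by measurable
    from measurable_compose[OF this exp_chain_measurable2[of \<alpha> \<beta> n]]
    have [measurable]: "(\<lambda>q. ?c (fst q) (snd q)) \<in> borel_measurable (lborel \<Otimes>\<^sub>M lborel)" by simp
    show ?thesis unfolding F_def case_prod_beta' by measurable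
  qed
  define W where "W t = norm (ray_density \<alpha> s t) * exp (A * (Re (Gamma_L t))\<^sup>2)" for t
  have g: "has_bochner_integral lborel (\<lambda>x. W t * (heat \<tau> (x - y) * exp (Re (Gamma_L t) * x))) (W t * exp (\<tau> * (Re (Gamma_L t))\<^sup>2 + Re (Gamma_L t) * y))" for t
    by (rule has_bochner_integral_mult_right) (rule heat_laplace_real[OF \<tau>])
  have nF: "norm (F t x) \<le> W t * (heat \<tau> (x - y) * exp (Re (Gamma_L t) * x))" for t x
  proof -
    have "norm (F t x) = norm (ray_density \<alpha> s t) * (indicator {..b} x * (norm (?c t x) * heat \<tau> (x - y)))"
      by (simp add: F_def norm_mult heat_nonneg indicator_def)
    also have "\<dots> \<le> norm (ray_density \<alpha> s t) * (1 * ((exp (A * (Re (Gamma_L t))\<^sup>2) * exp (Re (Gamma_L t) * x)) * heat \<tau> (x - y)))"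
      using norm_exp_chain[OF \<alpha> nm, of \<beta> "Gamma_L t" x] heat_nonneg[of \<tau> "x - y"]
      unfolding A_def[symmetric] by (intro mult_left_mono mult_mono) (auto simp: indicator_def intro!: mult_right_mono)
    finally show ?thesis by (simp add: W_def mult_ac)
  qed
  have G: "integrable lborel (\<lambda>t. W t * exp (\<tau> * (Re (Gamma_L t))\<^sup>2 + Re (Gamma_L t) * y))"
  proof -
    have "(\<lambda>t. W t * exp (\<tau> * (Re (Gamma_L t))\<^sup>2 + Re (Gamma_L t) * y)) =
        (\<lambda>t. norm (ray_density \<alpha> s t) * exp ((A + \<tau>) * (Re (Gamma_L t))\<^sup>2 + y * Re (Gamma_L t)))"
      unfolding W_def mult.assoc exp_add[symmetric] by (simp add: algebra_simps)
    then show ?thesis using ray_density_integrable[of \<alpha> s "A + \<tau>" y] by simp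
  qed
  note R = fubini_dominated(2)[OF sf_lborel sf_lborel mF g nF G]
  have 1: "(\<integral>x. F t x \<partial>lborel) = ray_density \<alpha> s t * chain \<alpha> \<beta> (\<lambda>x. exp (Gamma_L t * of_real x)) (Suc n) y" for t
    unfolding F_def chain.simps push_def \<tau>_def b_def by (simp only: integral_mult_right_zero)
  have 2: "(\<integral>t. F t x \<partial>lborel) = indicator {..b} x * (chain \<alpha> \<beta> (\<lambda>x. af (- \<alpha> 1) (x + s)) n x * of_real (heat \<tau> (x - y)))" for x
  proof -
    have "F t x = (indicator {..b} x * of_real (heat \<tau> (x - y))) * (ray_density \<alpha> s t * ?c t x)" for t
      by (simp add: F_def)
    then show ?thesis using Suc.IH[OF nm, of x] by simp
  qed
  show ?case using R unfolding 1 2 unfolding chain.simps push_def \<tau>_def b_def .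
qed

section \<open>Factoring the contour kernel through the half line\<close>

context
  fixes m :: nat and \<alpha> \<beta> :: "nat \<Rightarrow> real"
  assumes \<alpha>: "strict_mono_on {1..m} \<alpha>"
begin

definition resolvent_const :: "nat \<Rightarrow> real" where
  "resolvent_const i = exp (\<beta> i) * af_const (\<alpha> i) (rate m \<alpha>) * (\<integral>x. indicator {\<beta> i<..} x * exp (- (1 + rate m \<alpha>) * x) \<partial>lborel)"

lemma resolvent_const_nonneg: "0 \<le> resolvent_const i"
  unfolding resolvent_const_def by (intro mult_nonneg_nonneg af_const_nonneg Bochner_Integration.integral_nonneg) auto

lemma resolvent_tail_integrable: "integrable lborel (\<lambda>x. indicator {\<beta> i<..} x * exp (- (1 + rate m \<alpha>) * x))"
  using rate_gt(3)[OF \<alpha>] by (intro integrable_exp_tail) simp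

lemma norm_resolvent_integrand:
  assumes i: "i \<in> {1..m}" and z: "Re z \<le> - 1"
  shows "norm (indicator {\<beta> i<..} x * (chain \<alpha> \<beta> (\<lambda>x. exp (z * of_real x)) (i - 1) x * af (\<alpha> i) (x + s))) \<le>
    (exp ((\<alpha> i - \<alpha> 1) * (Re z)\<^sup>2 + \<beta> i * Re z) * (exp (\<beta> i) * af_const (\<alpha> i) (rate m \<alpha>) * exp (- rate m \<alpha> * s))) *
    (indicator {\<beta> i<..} x * exp (- (1 + rate m \<alpha>) * x))"
proof (cases "\<beta> i < x")
  case True
  define A p r K where "A = \<alpha> i - \<alpha> 1" and "p = Re z" and "r = rate m \<alpha>" and "K = af_const (\<alpha> i) (rate m \<alpha>)"
  have i1: "i - 1 < m" "i - 1 + 1 = i" using i by auto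
  have 1: "norm (chain \<alpha> \<beta> (\<lambda>x. exp (z * of_real x)) (i - 1) x) \<le> exp (A * p\<^sup>2) * exp (p * x)"
    using norm_exp_chain[OF \<alpha> i1(1), of \<beta> z x] unfolding i1(2) A_def p_def .
  have 2: "norm (af (\<alpha> i) (x + s)) \<le> K * exp (- r * (x + s))"
    unfolding K_def r_def by (rule norm_af_le) (rule rate_gt(1)[OF \<alpha> i])
  have K: "0 \<le> K" unfolding K_def by (rule af_const_nonneg)
  \<comment> \<open>As Re z \<le> - 1 and x exceeds \<beta>_i, one unit of the rate can be spent on
    decay in \<open>x\<close>, uniformly in \<open>z\<close>, while the factor exp(\<beta>_i Re z)
    is kept for the integral over \<Gamma>_L.\<close>
  have "0 \<le> (- 1 - p) * (x - \<beta> i)" using True z by (intro mult_nonneg_nonneg) (simp_all add: p_def)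
  hence "p * x \<le> \<beta> i * p + (\<beta> i - x)" by (simp add: algebra_simps)
  hence 3: "exp (p * x) \<le> exp (\<beta> i * p + (\<beta> i - x))" by simp
  have "norm (chain \<alpha> \<beta> (\<lambda>x. exp (z * of_real x)) (i - 1) x) * norm (af (\<alpha> i) (x + s)) \<le>
      (exp (A * p\<^sup>2) * exp (\<beta> i * p + (\<beta> i - x))) * (K * exp (- r * (x + s)))"
    using order_trans[OF 1 mult_left_mono[OF 3]] by (intro mult_mono 2) auto
  also have "\<dots> = K * (exp (A * p\<^sup>2) * exp (\<beta> i * p + (\<beta> i - x)) * exp (- r * (x + s)))" by (simp only: mult_ac)
  also have "exp (A * p\<^sup>2) * exp (\<beta> i * p + (\<beta> i - x)) * exp (- r * (x + s)) =
      exp (A * p\<^sup>2 + \<beta> i * p) * exp (\<beta> i) * exp (- r * s) * exp (- (1 + r) * x)"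
    unfolding exp_add[symmetric] by (rule arg_cong[where f = exp]) (simp add: algebra_simps)
  also have "K * \<dots> = (exp (A * p\<^sup>2 + \<beta> i * p) * (exp (\<beta> i) * K * exp (- r * s))) * exp (- (1 + r) * x)" by (simp only: mult_ac)
  finally show ?thesis using True unfolding A_def p_def r_def K_def norm_mult by simp
next
  case False
  then show ?thesis by simp
qed

lemma resolvent_integrand_measurable:
  "(\<lambda>(t, x). indicator {\<beta> i<..} x * (chain \<alpha> \<beta> (\<lambda>x. exp (Gamma_L t * of_real x)) (i - 1) x * af (\<alpha> i) (x + s))) \<in> borel_measurable (lborel \<Otimes>\<^sub>M lborel)"
proof -
  have "(\<lambda>q. (fst q, snd q)) \<in> measurable (lborel \<Otimes>\<^sub>M lborel) (lborel \<Otimes>\<^sub>M borel)" by measurable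
  from measurable_compose[OF this exp_chain_measurable2[of \<alpha> \<beta> "i - 1"]]
  have [measurable]: "(\<lambda>q. chain \<alpha> \<beta> (\<lambda>x. exp (Gamma_L (fst q) * complex_of_real x)) (i - 1) (snd q)) \<in> borel_measurable (lborel \<Otimes>\<^sub>M lborel)" by simp
  show ?thesis unfolding case_prod_beta' by measurable
qed

lemma norm_resolvent:
  assumes i: "i \<in> {1..m}"
  shows "norm (resolvent \<alpha> \<beta> i (Gamma_L t) s) \<le> ray_weight \<alpha> (\<alpha> i - \<alpha> 1) (\<beta> i) t * resolvent_const i * exp (- rate m \<alpha> * s)"
proof -
  define z where "z = Gamma_L t"
  have z: "Re z \<le> - 1" unfolding z_def by (rule Gamma_L_Re_le)
  define W where "W = exp ((\<alpha> i - \<alpha> 1) * (Re z)\<^sup>2 + \<beta> i * Re z) * (exp (\<beta> i) * af_const (\<alpha> i) (rate m \<alpha>) * exp (- rate m \<alpha> * s))"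
  let ?f = "\<lambda>x. indicator {\<beta> i<..} x * (chain \<alpha> \<beta> (\<lambda>x. exp (z * of_real x)) (i - 1) x * af (\<alpha> i) (x + s))"
  have I: "integrable lborel (\<lambda>x. W * (indicator {\<beta> i<..} x * exp (- (1 + rate m \<alpha>) * x)))"
    by (intro integrable_mult_right resolvent_tail_integrable)
  have "norm (\<integral>x. ?f x \<partial>lborel) \<le> (\<integral>x. norm (?f x) \<partial>lborel)" by (rule Bochner_Integration.integral_norm_bound)
  also have "\<dots> \<le> (\<integral>x. W * (indicator {\<beta> i<..} x * exp (- (1 + rate m \<alpha>) * x)) \<partial>lborel)"
  proof (rule Bochner_Integration.integral_mono'[OF I])
    show "norm (?f x) \<le> W * (indicator {\<beta> i<..} x * exp (- (1 + rate m \<alpha>) * x))" for x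
      unfolding W_def by (rule norm_resolvent_integrand[OF i z])
    then show "0 \<le> W * (indicator {\<beta> i<..} x * exp (- (1 + rate m \<alpha>) * x))" for x
      by (rule order_trans[OF norm_ge_zero])
  qed
  also have "\<dots> = exp ((\<alpha> i - \<alpha> 1) * (Re z)\<^sup>2 + \<beta> i * Re z) * (resolvent_const i * exp (- rate m \<alpha> * s))"
    unfolding integral_mult_right_zero W_def resolvent_const_def by (simp only: mult_ac)
  finally have "norm (z_factor \<alpha> z) * norm (\<integral>x. ?f x \<partial>lborel) \<le> norm (z_factor \<alpha> z) * (exp ((\<alpha> i - \<alpha> 1) * (Re z)\<^sup>2 + \<beta> i * Re z) * (resolvent_const i * exp (- rate m \<alpha> * s)))"
    by (rule mult_left_mono) simp
  then show ?thesis unfolding resolvent_def ray_weight_def z_def norm_mult norm_minus_cancel by (simp only: mult.assoc)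
qed

lemma resolvent_integral:
  assumes i: "i \<in> {1..m}"
  shows "(\<integral>t. exp (of_real s * Gamma_L t) * Gamma_L_density t * resolvent \<alpha> \<beta> i (Gamma_L t) s' \<partial>lborel) =
    - (\<integral>x. indicator {\<beta> i<..} x * (airy_chain \<alpha> \<beta> i s x * af (\<alpha> i) (x + s')) \<partial>lborel)"
proof -
  define f where "f t x = indicator {\<beta> i<..} x * (chain \<alpha> \<beta> (\<lambda>x. exp (Gamma_L t * of_real x)) (i - 1) x * af (\<alpha> i) (x + s'))" for t x
  define F where "F t x = ray_density \<alpha> s t * f t x" for t x
  define K where "K = exp (\<beta> i) * af_const (\<alpha> i) (rate m \<alpha>) * exp (- rate m \<alpha> * s')"
  define W where "W t = norm (ray_density \<alpha> s t) * exp ((\<alpha> i - \<alpha> 1) * (Re (Gamma_L t))\<^sup>2 + \<beta> i * Re (Gamma_L t))" for t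
  have mf: "(\<lambda>q. f (fst q) (snd q)) \<in> borel_measurable (lborel \<Otimes>\<^sub>M lborel)"
    using resolvent_integrand_measurable[of i s'] by (simp add: f_def case_prod_beta')
  have mF: "(\<lambda>(t, x). F t x) \<in> borel_measurable (lborel \<Otimes>\<^sub>M lborel)"
    unfolding F_def case_prod_beta' by (rule borel_measurable_times[OF _ mf]) measurable
  have g: "has_bochner_integral lborel (\<lambda>x. (W t * K) * (indicator {\<beta> i<..} x * exp (- (1 + rate m \<alpha>) * x)))
      ((W t * K) * (\<integral>x. indicator {\<beta> i<..} x * exp (- (1 + rate m \<alpha>) * x) \<partial>lborel))" for t
    by (intro has_bochner_integral_mult_right has_bochner_integral_integrable resolvent_tail_integrable)
  have nF: "norm (F t x) \<le> (W t * K) * (indicator {\<beta> i<..} x * exp (- (1 + rate m \<alpha>) * x))" for t x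
  proof -
    have "norm (F t x) \<le> norm (ray_density \<alpha> s t) * ((exp ((\<alpha> i - \<alpha> 1) * (Re (Gamma_L t))\<^sup>2 + \<beta> i * Re (Gamma_L t)) * K) *
        (indicator {\<beta> i<..} x * exp (- (1 + rate m \<alpha>) * x)))"
      unfolding F_def norm_mult[of "ray_density \<alpha> s t"] f_def K_def by (rule mult_left_mono[OF norm_resolvent_integrand[OF i Gamma_L_Re_le]]) simp
    then show ?thesis unfolding W_def by (simp only: mult.assoc)
  qed
  have G: "integrable lborel (\<lambda>t. (W t * K) * (\<integral>x. indicator {\<beta> i<..} x * exp (- (1 + rate m \<alpha>) * x) \<partial>lborel))"
    unfolding W_def by (intro integrable_mult_left ray_density_integrable)
  note R = fubini_dominated(2)[OF sf_lborel sf_lborel mF g nF G]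
  have 1: "(\<integral>x. F t x \<partial>lborel) = - (exp (of_real s * Gamma_L t) * Gamma_L_density t * resolvent \<alpha> \<beta> i (Gamma_L t) s')" for t
    unfolding F_def integral_mult_right_zero unfolding f_def resolvent_def ray_density_def by (simp add: mult_ac)
  have 2: "(\<integral>t. F t x \<partial>lborel) = indicator {\<beta> i<..} x * (airy_chain \<alpha> \<beta> i s x * af (\<alpha> i) (x + s'))" for x
  proof -
    have "F t x = (indicator {\<beta> i<..} x * af (\<alpha> i) (x + s')) * (ray_density \<alpha> s t * chain \<alpha> \<beta> (\<lambda>x. exp (Gamma_L t * of_real x)) (i - 1) x)" for t
      by (simp add: F_def f_def)
    moreover have "i - 1 < m" using i by auto
    ultimately show ?thesis unfolding airy_chain_def[OF \<alpha>] using ray_chain[OF \<alpha>, of "i - 1" s \<beta> x] by simp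
  qed
  show ?thesis using R unfolding 1 2 Bochner_Integration.integral_minus by (rule minus_equation_iff[THEN iffD1, symmetric])
qed

definition ray_out :: "nat \<times> real \<Rightarrow> real \<Rightarrow> complex" where
  "ray_out p s = indicator {0..} s * resolvent \<alpha> \<beta> (fst p) (Gamma_L (snd p)) s"

text \<open>The density is attached to this factor because \<open>level_kernel\<close> puts it into
  the second argument.\<close>

definition ray_in :: "real \<Rightarrow> nat \<times> real \<Rightarrow> complex" where
  "ray_in s p = indicator {0..} s * (exp (of_real s * Gamma_L (snd p)) * Gamma_L_density (snd p))"

definition ray_out_weight :: "nat \<times> real \<Rightarrow> real" where
  "ray_out_weight p = ray_weight \<alpha> (\<alpha> (fst p) - \<alpha> 1) (\<beta> (fst p)) (snd p) * resolvent_const (fst p)"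

lemma ray_out_measurable: "(\<lambda>(p, s). ray_out p s) \<in> borel_measurable (levels m \<Otimes>\<^sub>M lborel)"
proof (rule levels_pair_measurable)
  fix i
  have "(\<lambda>q. (fst (fst q), snd q)) \<in> measurable ((borel \<Otimes>\<^sub>M lborel) \<Otimes>\<^sub>M lborel) (lborel \<Otimes>\<^sub>M borel)" by measurable
  from measurable_compose[OF this exp_chain_measurable2[of \<alpha> \<beta> "i - 1"]]
  have [measurable]: "(\<lambda>q. chain \<alpha> \<beta> (\<lambda>x. exp (Gamma_L (fst (fst q)) * complex_of_real x)) (i - 1) (snd q)) \<in> borel_measurable ((borel \<Otimes>\<^sub>M lborel) \<Otimes>\<^sub>M lborel)" by simp
  have [measurable]: "(\<lambda>p. \<integral>x. indicator {\<beta> i<..} x * (chain \<alpha> \<beta> (\<lambda>x. exp (Gamma_L (fst p) * of_real x)) (i - 1) x * af (\<alpha> i) (x + snd p)) \<partial>lborel) \<in> borel_measurable (borel \<Otimes>\<^sub>M lborel)"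
    by (rule lborel.borel_measurable_lebesgue_integral) (unfold case_prod_beta', measurable)
  show "(\<lambda>(t, s). ray_out (i, t) s) \<in> borel_measurable (borel \<Otimes>\<^sub>M lborel)"
    unfolding ray_out_def fst_conv snd_conv case_prod_beta' resolvent_def by measurable
qed

lemma ray_in_measurable: "(\<lambda>(s, p). ray_in s p) \<in> borel_measurable (lborel \<Otimes>\<^sub>M levels m)"
  by (rule levels_pair_measurable') (unfold ray_in_def fst_conv snd_conv, measurable)

lemma norm_ray_out: "p \<in> space (levels m) \<Longrightarrow> norm (ray_out p s) \<le> ray_out_weight p * half_weight m \<alpha> s"
proof -
  assume "p \<in> space (levels m)"
  then have i: "fst p \<in> {1..m}" by (auto simp: space_levels)
  show ?thesis
    using norm_resolvent[OF i, of "snd p" s] by (cases "0 \<le> s") (simp_all add: ray_out_def ray_out_weight_def half_weight_def[OF \<alpha>])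
qed

lemma norm_ray_in: "norm (ray_in s p) \<le> density_bound"
proof (cases "0 \<le> s")
  case True
  have "s * Re (Gamma_L (snd p)) \<le> 0" using True Gamma_L_Re_le[of "snd p"] by (intro mult_nonneg_nonpos) auto
  hence "exp (s * Re (Gamma_L (snd p))) \<le> 1" by simp
  then have "exp (s * Re (Gamma_L (snd p))) * norm (Gamma_L_density (snd p)) \<le> 1 * density_bound"
    by (intro mult_mono norm_Gamma_L_density) auto
  then show ?thesis using True by (simp add: ray_in_def norm_mult)
next
  case False
  then show ?thesis using density_bound_nonneg by (simp add: ray_in_def)
qed

lemma ray_out_weight_nonneg: "0 \<le> ray_out_weight p"
  unfolding ray_out_weight_def ray_weight_def by (intro mult_nonneg_nonneg resolvent_const_nonneg) auto

lemma ray_weight_measurable [measurable]: "ray_weight \<alpha> a b \<in> borel_measurable borel"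
  using borel_measurable_integrable[OF ray_weight_integrable] by simp

lemma ray_out_weight_integrable: "integrable (levels m) ray_out_weight"
proof (rule integrable_levels)
  show "ray_out_weight \<in> borel_measurable (levels m)"
    by (rule levels_measurable) (unfold ray_out_weight_def fst_conv snd_conv, measurable)
  show "integrable lborel (\<lambda>x. ray_out_weight (i, x))" for i
    unfolding ray_out_weight_def fst_conv snd_conv by (intro integrable_mult_left ray_weight_integrable)
qed

lemma suminf_ray_kernel: "fterm (levels m) (\<lambda>p q. \<integral>s. ray_out p s * ray_in s q \<partial>lborel) k = fterm lborel (half_line_kernel m \<alpha> \<beta>) k"
proof -
  have "fterm (levels m) (\<lambda>p q. \<integral>s. ray_out p s * ray_in s q \<partial>lborel) k = fterm lborel (\<lambda>s s'. \<integral>x. ray_in s x * ray_out x s' \<partial>levels m) k"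
    by (rule fterm_commute[where R = ray_out and E = ray_in, OF sigma_finite_levels sf_lborel ray_out_measurable ray_in_measurable norm_ray_out norm_ray_in
        ray_out_weight_integrable ray_out_weight_nonneg half_weight_integrable[OF \<alpha>] half_weight_nonneg[OF \<alpha>]])
  also have "(\<lambda>s s'. \<integral>x. ray_in s x * ray_out x s' \<partial>levels m) = half_line_kernel m \<alpha> \<beta>"
  proof (intro ext)
    fix s s' :: real
    have I: "integrable (levels m) (\<lambda>x. ray_in s x * ray_out x s')"
    proof (rule Bochner_Integration.integrable_bound)
      show "integrable (levels m) (\<lambda>x. density_bound * half_weight m \<alpha> s' * ray_out_weight x)"
        by (intro integrable_mult_right ray_out_weight_integrable)
      show "(\<lambda>x. ray_in s x * ray_out x s') \<in> borel_measurable (levels m)"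
        by (rule borel_measurable_times[OF kernel_sections(1)[OF ray_in_measurable] kernel_sections(2)[OF ray_out_measurable]]) simp_all
      have "norm (ray_in s x * ray_out x s') \<le> norm (density_bound * half_weight m \<alpha> s' * ray_out_weight x)" if x: "x \<in> space (levels m)" for x
      proof -
        have "norm (ray_in s x * ray_out x s') \<le> density_bound * (ray_out_weight x * half_weight m \<alpha> s')"
          unfolding norm_mult by (rule mult_mono[OF norm_ray_in norm_ray_out[OF x] density_bound_nonneg norm_ge_zero])
        also have "\<dots> = density_bound * half_weight m \<alpha> s' * ray_out_weight x" by (simp only: mult_ac)
        also have "\<dots> \<le> norm (density_bound * half_weight m \<alpha> s' * ray_out_weight x)" by simp
        finally show ?thesis .
      qed
      then show "AE x in levels m. norm (ray_in s x * ray_out x s') \<le> norm (density_bound * half_weight m \<alpha> s' * ray_out_weight x)"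
        by (rule AE_I2)
    qed
    have eq: "(\<integral>t. ray_in s (i, t) * ray_out (i, t) s' \<partial>lborel) =
        - (indicator {0..} s * indicator {0..} s') * (\<integral>x. indicator {\<beta> i<..} x * (airy_chain \<alpha> \<beta> i s x * af (\<alpha> i) (x + s')) \<partial>lborel)" if i: "i \<in> {1..m}" for i
    proof -
      have "(\<lambda>t. ray_in s (i, t) * ray_out (i, t) s') = (\<lambda>t. (indicator {0..} s * indicator {0..} s') *
          (exp (of_real s * Gamma_L t) * Gamma_L_density t * resolvent \<alpha> \<beta> i (Gamma_L t) s'))"
        unfolding ray_in_def ray_out_def fst_conv snd_conv by (simp only: mult_ac)
      then show ?thesis by (simp only: integral_mult_right_zero resolvent_integral[OF i] mult_minus_left mult_minus_right)
    qed
    show "(\<integral>x. ray_in s x * ray_out x s' \<partial>levels m) = half_line_kernel m \<alpha> \<beta> s s'"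
      unfolding integral_levels(1)[OF I] half_line_kernel_def[OF \<alpha>] sum_distrib_left sum_negf[symmetric]
      by (rule sum.cong[OF refl]) (simp only: eq mult_minus_left)
  qed
  finally show ?thesis .
qed

text \<open>The contours may change from entry to entry in an arbitrary, even nonmeasurable way.
  Each entry nevertheless equals a factored kernel in which no contour occurs, and measurability and
  domination are taken from there.\<close>

lemma kernel_K_fredholm:
  assumes VU: "\<And>i z j u. i \<in> {1..m} \<Longrightarrow> j \<in> {1..m} \<Longrightarrow> z \<in> range Gamma_L \<Longrightarrow> u \<in> range Gamma_L \<Longrightarrow>
           v_contour (V i z j u) \<and> u_contours i z (U i z j u)"
  defines "K \<equiv> \<lambda>i s j t. kernel_K \<alpha> \<beta> V U i (Gamma_L s) j (Gamma_L t)"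
  shows "fredholm_abs_convergent m Gamma_L_density K"
    and "fredholm_det m Gamma_L_density K = (\<Sum>k. fterm lborel (half_line_kernel m \<alpha> \<beta>) k)"
proof -
  let ?L = "\<lambda>p q. \<integral>s. ray_out p s * ray_in s q \<partial>lborel"
  have eq: "level_kernel Gamma_L_density K p q = ?L p q" if p: "p \<in> space (levels m)" and q: "q \<in> space (levels m)" for p q
  proof -
    obtain i x j y where pq: "p = (i, x)" "q = (j, y)" and ij: "i \<in> {1..m}" "j \<in> {1..m}"
      using p q by (auto simp: space_levels)
    have neg: "Re (Gamma_L t) < 0" for t using Gamma_L_Re_le[of t] by simp
    have c: "v_contour (V i (Gamma_L x) j (Gamma_L y))" "u_contours i (Gamma_L x) (U i (Gamma_L x) j (Gamma_L y))"
      using VU[OF ij, of "Gamma_L x" "Gamma_L y"] by auto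
    have "(\<lambda>s. ray_out p s * ray_in s q) = (\<lambda>s. (resolvent \<alpha> \<beta> i (Gamma_L x) s * (indicator {0..} s * exp (of_real s * Gamma_L y))) * Gamma_L_density y)"
      unfolding ray_out_def ray_in_def pq fst_conv snd_conv by (auto simp: indicator_def)
    then have "?L p q = (\<integral>s. resolvent \<alpha> \<beta> i (Gamma_L x) s * (indicator {0..} s * exp (of_real s * Gamma_L y)) \<partial>lborel) * Gamma_L_density y"
      by (simp only: integral_mult_left_zero)
    then show ?thesis
      unfolding level_kernel_def K_def pq fst_conv snd_conv
        kernel_K_resolvent[where V = V and U = U and i = i and j = j and z = "Gamma_L x" and u = "Gamma_L y", OF \<alpha> ij(1) neg neg c] by simp
  qed
  define w where "w p = ray_out_weight p * (density_bound * integral\<^sup>L lborel (half_weight m \<alpha>))" for p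
  have D: "dominated (levels m) w ?L"
    unfolding w_def
    by (rule dominated_factor[where R = ray_out and E = ray_in, OF sf_lborel ray_out_measurable ray_in_measurable norm_ray_out norm_ray_in
        ray_out_weight_integrable ray_out_weight_nonneg half_weight_integrable[OF \<alpha>] half_weight_nonneg[OF \<alpha>] density_bound_nonneg])
  have D': "dominated (levels m) w (level_kernel Gamma_L_density K)"
    unfolding dominated_def
  proof (intro conjI ballI)
    show "integrable (levels m) w" "\<And>x. x \<in> space (levels m) \<Longrightarrow> 0 \<le> w x" using D unfolding dominated_def by blast+
    have "(\<lambda>(x, y). ?L x y) \<in> borel_measurable (levels m \<Otimes>\<^sub>M levels m)" using D unfolding dominated_def by blast
    then show "(\<lambda>(x, y). level_kernel Gamma_L_density K x y) \<in> borel_measurable (levels m \<Otimes>\<^sub>M levels m)"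
      by (rule measurable_cong[THEN iffD1, rotated]) (auto simp: eq space_pair_measure)
    show "norm (level_kernel Gamma_L_density K x y) \<le> w x" if "x \<in> space (levels m)" "y \<in> space (levels m)" for x y
      unfolding eq[OF that] using D that unfolding dominated_def by blast
  qed
  have ft: "fredholm_term m Gamma_L_density K k = fterm lborel (half_line_kernel m \<alpha> \<beta>) k" for k
    unfolding fredholm_term_levels(1)[OF D'] suminf_ray_kernel[symmetric] by (rule fterm_cong) (rule eq)
  have "summable (\<lambda>k. norm (fredholm_term m Gamma_L_density K k))"
    unfolding fredholm_term_levels(1)[OF D'] by (rule fterm_summable[OF sigma_finite_levels D'])
  then show "fredholm_abs_convergent m Gamma_L_density K"
    unfolding fredholm_abs_convergent_def using fredholm_term_levels(2)[OF D'] by blast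
  show "fredholm_det m Gamma_L_density K = (\<Sum>k. fterm lborel (half_line_kernel m \<alpha> \<beta>) k)"
    unfolding fredholm_det_def ft ..
qed

end

theorem proposition2p1:
  fixes M :: "'a measure" and A :: "real \<Rightarrow> 'a \<Rightarrow> real"
    and m :: nat and \<alpha> \<beta> :: "nat \<Rightarrow> real"
    and V :: "nat \<Rightarrow> complex \<Rightarrow> nat \<Rightarrow> complex \<Rightarrow> real \<Rightarrow> complex"
    and U :: "nat \<Rightarrow> complex \<Rightarrow> nat \<Rightarrow> complex \<Rightarrow> nat \<Rightarrow> real \<Rightarrow> complex"
  assumes "parabolic_airy_process M A"
    and "m \<ge> 1"
    and "strict_mono_on {1..m} \<alpha>"
    and "\<And>i z j u. i \<in> {1..m} \<Longrightarrow> j \<in> {1..m} \<Longrightarrow> z \<in> range Gamma_L \<Longrightarrow> u \<in> range Gamma_L \<Longrightarrow>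
           v_contour (V i z j u) \<and> u_contours i z (U i z j u)"
  shows "fredholm_abs_convergent m Gamma_L_density (\<lambda>i s j t. kernel_K \<alpha> \<beta> V U i (Gamma_L s) j (Gamma_L t)) \<and>
         complex_of_real (measure M (\<Inter>i\<in>{1..m}. {\<omega> \<in> space M. A (\<alpha> i) \<omega> \<le> \<beta> i})) =
           fredholm_det m Gamma_L_density (\<lambda>i s j t. kernel_K \<alpha> \<beta> V U i (Gamma_L s) j (Gamma_L t))"
proof
  show "fredholm_abs_convergent m Gamma_L_density (\<lambda>i s j t. kernel_K \<alpha> \<beta> V U i (Gamma_L s) j (Gamma_L t))"
    by (rule kernel_K_fredholm(1)[OF assms(3,4)])
  have "complex_of_real (measure M (\<Inter>i\<in>{1..m}. {\<omega> \<in> space M. A (\<alpha> i) \<omega> \<le> \<beta> i})) =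
      fredholm_det m (\<lambda>_. 1) (\<lambda>i x j y. - (sqrt (chi \<alpha> \<beta> i x) * K_Ai_ext (\<alpha> i) x (\<alpha> j) y * sqrt (chi \<alpha> \<beta> j y)))"
    using assms(1-3) unfolding parabolic_airy_process_def by blast
  also have "\<dots> = fredholm_det m Gamma_L_density (\<lambda>i s j t. kernel_K \<alpha> \<beta> V U i (Gamma_L s) j (Gamma_L t))"
    unfolding airy_fredholm_det[OF assms(3)] by (rule kernel_K_fredholm(2)[OF assms(3,4), symmetric])
  finally show "complex_of_real (measure M (\<Inter>i\<in>{1..m}. {\<omega> \<in> space M. A (\<alpha> i) \<omega> \<le> \<beta> i})) =
      fredholm_det m Gamma_L_density (\<lambda>i s j t. kernel_K \<alpha> \<beta> V U i (Gamma_L s) j (Gamma_L t))" .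
qed

end
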